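(* Let $\bar t>0$ and let $u(t)=a(t)\,\varphi_1(t)\wedge\dots\wedge\varphi_N(t)\in\mathcal M$, $t\in[0,\bar t]$, be as in the hypotheses of the Hartree–Fock theorem (orthonormal orbitals $\varphi_\ell\in C^1([0,\bar t];L^2(\Lambda))\cap C([0,\bar t];H^2_{\vec A}(\Lambda))$, $a\in C^1$, gauge condition $\langle\varphi_i(t),\dot\varphi_j(t)\rangle=0$, and the Dirac–Frenkel condition $\langle v,\mathrm i\hbar\dot u(t)-H_Nu(t)\rangle=0$ for all $v\in T_{u(t)}\mathcal M$), with $a(0)=1$, so that $u(0)=\varphi_1(0)\wedge\dots\wedge\varphi_N(0)\in\bigwedge^NH^2_{\vec A}(\Lambda)$. Let $\Psi(t)=\mathrm e^{-\mathrm iH_Nt/\hbar}u(0)$ be the solution of $\mathrm i\hbar\dot\Psi(t)=H_N\Psi(t)$ with $\Psi(0)=u(0)$. Then for all $t\in[0,\bar t]$, $$\|\Psi(t)-u(t)\|_{\mathcal H_N}\le\frac1\hbar\sqrt{N(N-1)}\,\|V\|_{L^\infty(\Lambda\times\Lambda)}\,t.$$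
   Context: Setting: $\Lambda=[-L_1/2,L_1/2]\times[-L_2/2,L_2/2]$, $b=qB/(\hbar c)>0$, flux quantization $bL_1L_2=2\pi M$ with $M$ a positive integer. $H_1=\frac{1}{2m_0}\big[-\hbar^2\partial_{x_1}^2+(-\mathrm i\hbar\partial_{x_2}-\tfrac{qB}{c}x_1)^2\big]$ on $L^2(\Lambda)$ with magnetic-periodic boundary conditions $\varphi(-L_1/2,x_2)=\mathrm e^{-\mathrm i2\pi Mx_2/L_2}\varphi(L_1/2,x_2)$, $\varphi(x_1,-L_2/2)=\varphi(x_1,L_2/2)$, self-adjoint on $H^2_{\vec A}(\Lambda)=\{\psi\in L^2(\Lambda):H_1\psi\in L^2(\Lambda)\}$. $\mathcal H_N=\bigwedge^NL^2(\Lambda)$ (antisymmetric functions in $L^2(\Lambda^N)$), with wedge product $\psi_1\wedge\dots\wedge\psi_N=\frac{1}{\sqrt{N!}}\det[\psi_i(\vec x_j)]$. $H_N=\sum_{i=1}^NH_1^{(i)}+\sum_{1\le i<j\le N}V(\vec x_i;\vec x_j)$, with $H_1^{(i)}$ acting on the $i$-th variable and $V\in L^\infty(\Lambda\times\Lambda)$ real-valued with $V(\vec x;\vec y)=V(\vec y;\vec x)$; $H_N$ is self-adjoint on $\bigwedge^NH^2_{\vec A}(\Lambda)$. $\mathcal M=\{a\,\varphi_1\wedge\dots\wedge\varphi_N:a\in\mathbb C,\ \varphi_i\in L^2(\Lambda),\ \langle\varphi_i,\varphi_j\rangle=\delta_{ij}\}$ is the manifold of Slater determinants, and $T_u\mathcal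 M$ its tangent space at $u$, consisting of all vectors $\dot a\,\varphi_1\wedge\dots\wedge\varphi_N+a\sum_j\varphi_1\wedge\dots\wedge\dot\varphi_j\wedge\dots\wedge\varphi_N$ with $\dot a\in\mathbb C$, $\dot\varphi_j\in L^2(\Lambda)$. *)

theory Defs
  imports "HOL-Analysis.Analysis"
begin

definition box_Lambda :: "real \<Rightarrow> real \<Rightarrow> (real \<times> real) set" where
  "box_Lambda L1 L2 = {-L1/2..L1/2} \<times> {-L2/2..L2/2}"

definition box_LambdaN :: "real \<Rightarrow> real \<Rightarrow> ((real \<times> real)^'n) set" where
  "box_LambdaN L1 L2 = {X. \<forall>j. X $ j \<in> box_Lambda L1 L2}"

definition L2on :: "'a::euclidean_space set \<Rightarrow> ('a \<Rightarrow> complex) \<Rightarrow> bool" where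
  "L2on S f \<longleftrightarrow> set_borel_measurable lebesgue S f \<and>
      set_integrable lebesgue S (\<lambda>x. (norm (f x))^2)"

definition inner_on :: "'a::euclidean_space set \<Rightarrow> ('a \<Rightarrow> complex) \<Rightarrow> ('a \<Rightarrow> complex) \<Rightarrow> complex" where
  "inner_on S f g = (LINT x:S|lebesgue. cnj (f x) * g x)"

definition norm_on :: "'a::euclidean_space set \<Rightarrow> ('a \<Rightarrow> complex) \<Rightarrow> real" where
  "norm_on S f = sqrt (LINT x:S|lebesgue. (norm (f x))^2)"

definition has_L2_derivative ::
  "'a::euclidean_space set \<Rightarrow> (real \<Rightarrow> 'a \<Rightarrow> complex) \<Rightarrow> ('a \<Rightarrow> complex) \<Rightarrow> real \<Rightarrow> real set \<Rightarrow> bool" where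
  "has_L2_derivative S f f' t T \<longleftrightarrow> L2on S f' \<and>
     ((\<lambda>s. norm_on S (\<lambda>x. (f s x - f t x) / complex_of_real (s - t) - f' x)) \<longlongrightarrow> 0) (at t within T)"

definition L2_continuous_on ::
  "'a::euclidean_space set \<Rightarrow> (real \<Rightarrow> 'a \<Rightarrow> complex) \<Rightarrow> real set \<Rightarrow> bool" where
  "L2_continuous_on S f T \<longleftrightarrow> (\<forall>t\<in>T. L2on S (f t) \<and>
     ((\<lambda>s. norm_on S (\<lambda>x. f s x - f t x)) \<longlongrightarrow> 0) (at t within T))"

definition L2_C1_on ::
  "'a::euclidean_space set \<Rightarrow> (real \<Rightarrow> 'a \<Rightarrow> complex) \<Rightarrow> (real \<Rightarrow> 'a \<Rightarrow> complex) \<Rightarrow> real set \<Rightarrow> bool" where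
  "L2_C1_on S f f' T \<longleftrightarrow> L2_continuous_on S f T \<and> L2_continuous_on S f' T \<and>
     (\<forall>t\<in>T. has_L2_derivative S f (f' t) t T)"

definition ddir :: "'a::real_normed_vector \<Rightarrow> ('a \<Rightarrow> complex) \<Rightarrow> 'a \<Rightarrow> complex" where
  "ddir e f x = vector_derivative (\<lambda>s. f (x + s *\<^sub>R e)) (at 0)"

fun iter_ddir :: "'a::real_normed_vector list \<Rightarrow> ('a \<Rightarrow> complex) \<Rightarrow> 'a \<Rightarrow> complex" where
  "iter_ddir [] f = f"
| "iter_ddir (e # es) f = ddir e (iter_ddir es f)"

definition test_fun :: "('a::euclidean_space \<Rightarrow> complex) \<Rightarrow> bool" where
  "test_fun f \<longleftrightarrow> compact (closure {x. f x \<noteq> 0}) \<and>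
     (\<forall>es \<in> lists Basis. continuous_on UNIV (iter_ddir es f) \<and>
        (\<forall>e\<in>Basis. \<forall>x. ((\<lambda>s. iter_ddir es f (x + s *\<^sub>R e)) has_vector_derivative
                          iter_ddir (e # es) f x) (at 0)))"

text \<open>One-particle wave functions on Lambda are represented by their magnetic-periodic
  extensions to R^2:  phi(x1+L1,x2) = exp(i 2 pi M x2/L2) phi(x1,x2),  phi(x1,x2+L2) = phi(x1,x2).\<close>
definition mag_per :: "real \<Rightarrow> real \<Rightarrow> nat \<Rightarrow> (real \<times> real \<Rightarrow> complex) \<Rightarrow> bool" where
  "mag_per L1 L2 M \<phi> \<longleftrightarrow> (\<forall>x1 x2.
      \<phi> (x1 + L1, x2) = exp (\<i> * complex_of_real (2 * pi * real M * x2 / L2)) * \<phi> (x1, x2) \<and>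
      \<phi> (x1, x2 + L2) = \<phi> (x1, x2))"

definition mag_perN :: "real \<Rightarrow> real \<Rightarrow> nat \<Rightarrow> ((real \<times> real)^'n \<Rightarrow> complex) \<Rightarrow> bool" where
  "mag_perN L1 L2 M \<Psi> \<longleftrightarrow> (\<forall>j X.
      \<Psi> (X + axis j (L1, 0)) = exp (\<i> * complex_of_real (2 * pi * real M * snd (X $ j) / L2)) * \<Psi> X \<and>
      \<Psi> (X + axis j (0, L2)) = \<Psi> X)"

text \<open>Classical action on test functions: H_1 f = (1/2m0) [ p1(p1 f) + pi2(pi2 f) ] with
  p1 = -i hbar d/dx1, pi2 = -i hbar d/dx2 - (qB/c) x1 and qB/c = hbar b.\<close>
definition p1_op :: "real \<Rightarrow> (real \<times> real \<Rightarrow> complex) \<Rightarrow> real \<times> real \<Rightarrow> complex" where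
  "p1_op hbar f x = - \<i> * complex_of_real hbar * ddir (1, 0) f x"

definition pi2_op :: "real \<Rightarrow> real \<Rightarrow> (real \<times> real \<Rightarrow> complex) \<Rightarrow> real \<times> real \<Rightarrow> complex" where
  "pi2_op hbar b f x = - \<i> * complex_of_real hbar * ddir (0, 1) f x
                       - complex_of_real (hbar * b * fst x) * f x"

definition H1_cl :: "real \<Rightarrow> real \<Rightarrow> real \<Rightarrow> (real \<times> real \<Rightarrow> complex) \<Rightarrow> real \<times> real \<Rightarrow> complex" where
  "H1_cl hbar m0 b f x = (p1_op hbar (p1_op hbar f) x + pi2_op hbar b (pi2_op hbar b f) x)
                          / complex_of_real (2 * m0)"

definition weak_H1 :: "real \<Rightarrow> real \<Rightarrow> real \<Rightarrow> (real \<times> real \<Rightarrow> complex) \<Rightarrow> (real \<times> real \<Rightarrow> complex) \<Rightarrow> bool" where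
  "weak_H1 hbar m0 b \<psi> g \<longleftrightarrow> (\<forall>f. test_fun f \<longrightarrow>
      integral\<^sup>L lebesgue (\<lambda>x. cnj (H1_cl hbar m0 b f x) * \<psi> x) =
      integral\<^sup>L lebesgue (\<lambda>x. cnj (f x) * g x))"

definition in_H2A :: "real \<Rightarrow> real \<Rightarrow> nat \<Rightarrow> real \<Rightarrow> real \<Rightarrow> real \<Rightarrow> (real \<times> real \<Rightarrow> complex) \<Rightarrow> bool" where
  "in_H2A L1 L2 M hbar m0 b \<psi> \<longleftrightarrow> L2on (box_Lambda L1 L2) \<psi> \<and> mag_per L1 L2 M \<psi> \<and>
     (\<exists>g. L2on (box_Lambda L1 L2) g \<and> mag_per L1 L2 M g \<and> weak_H1 hbar m0 b \<psi> g)"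

definition H1 :: "real \<Rightarrow> real \<Rightarrow> nat \<Rightarrow> real \<Rightarrow> real \<Rightarrow> real \<Rightarrow> (real \<times> real \<Rightarrow> complex) \<Rightarrow> real \<times> real \<Rightarrow> complex" where
  "H1 L1 L2 M hbar m0 b \<psi> = (SOME g. L2on (box_Lambda L1 L2) g \<and> mag_per L1 L2 M g \<and> weak_H1 hbar m0 b \<psi> g)"

definition p1_opN :: "real \<Rightarrow> 'n \<Rightarrow> ((real \<times> real)^'n \<Rightarrow> complex) \<Rightarrow> (real \<times> real)^'n \<Rightarrow> complex" where
  "p1_opN hbar j f X = - \<i> * complex_of_real hbar * ddir (axis j (1, 0)) f X"

definition pi2_opN :: "real \<Rightarrow> real \<Rightarrow> 'n \<Rightarrow> ((real \<times> real)^'n \<Rightarrow> complex) \<Rightarrow> (real \<times> real)^'n \<Rightarrow> complex" where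
  "pi2_opN hbar b j f X = - \<i> * complex_of_real hbar * ddir (axis j (0, 1)) f X
                          - complex_of_real (hbar * b * fst (X $ j)) * f X"

definition kin_cl :: "real \<Rightarrow> real \<Rightarrow> real \<Rightarrow> ((real \<times> real)^'n::finite \<Rightarrow> complex) \<Rightarrow> (real \<times> real)^'n \<Rightarrow> complex" where
  "kin_cl hbar m0 b f X = (\<Sum>j\<in>UNIV.
      (p1_opN hbar j (p1_opN hbar j f) X + pi2_opN hbar b j (pi2_opN hbar b j f) X)
      / complex_of_real (2 * m0))"

definition weak_kin :: "real \<Rightarrow> real \<Rightarrow> real \<Rightarrow> ((real \<times> real)^'n::finite \<Rightarrow> complex) \<Rightarrow> ((real \<times> real)^'n \<Rightarrow> complex) \<Rightarrow> bool" where
  "weak_kin hbar m0 b \<Psi> G \<longleftrightarrow> (\<forall>f. test_fun f \<longrightarrow>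
      integral\<^sup>L lebesgue (\<lambda>X. cnj (kin_cl hbar m0 b f X) * \<Psi> X) =
      integral\<^sup>L lebesgue (\<lambda>X. cnj (f X) * G X))"

text \<open>Domain of H_N: wedge^N H^2_A(Lambda) = {Psi in L2(Lambda^N) : sum_i H_1^(i) Psi in L2(Lambda^N)}.\<close>
definition in_domHN :: "real \<Rightarrow> real \<Rightarrow> nat \<Rightarrow> real \<Rightarrow> real \<Rightarrow> real \<Rightarrow> ((real \<times> real)^'n::finite \<Rightarrow> complex) \<Rightarrow> bool" where
  "in_domHN L1 L2 M hbar m0 b \<Psi> \<longleftrightarrow> L2on (box_LambdaN L1 L2) \<Psi> \<and> mag_perN L1 L2 M \<Psi> \<and>
     (\<exists>G. L2on (box_LambdaN L1 L2) G \<and> mag_perN L1 L2 M G \<and> weak_kin hbar m0 b \<Psi> G)"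

definition pair_pot :: "(real \<times> real \<Rightarrow> real \<times> real \<Rightarrow> real) \<Rightarrow> (real \<times> real)^'n::{finite,linorder} \<Rightarrow> real" where
  "pair_pot V X = (\<Sum>(i, j) \<in> {(i::'n, j). i < j}. V (X $ i) (X $ j))"

definition HN :: "real \<Rightarrow> real \<Rightarrow> nat \<Rightarrow> real \<Rightarrow> real \<Rightarrow> real \<Rightarrow> (real \<times> real \<Rightarrow> real \<times> real \<Rightarrow> real)
     \<Rightarrow> ((real \<times> real)^('n::{finite,linorder}) \<Rightarrow> complex) \<Rightarrow> (real \<times> real)^('n::{finite,linorder}) \<Rightarrow> complex" where
  "HN L1 L2 M hbar m0 b V \<Psi> X =
     (SOME G. L2on (box_LambdaN L1 L2) G \<and> mag_perN L1 L2 M G \<and> weak_kin hbar m0 b \<Psi> G) X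
     + complex_of_real (pair_pot V X) * \<Psi> X"

definition wedge :: "('n::finite \<Rightarrow> real \<times> real \<Rightarrow> complex) \<Rightarrow> (real \<times> real)^'n \<Rightarrow> complex" where
  "wedge \<psi> X = det (\<chi> i j. \<psi> i (X $ j)) / complex_of_real (sqrt (fact CARD('n)))"

definition tangent_vec :: "complex \<Rightarrow> ('n::finite \<Rightarrow> real \<times> real \<Rightarrow> complex) \<Rightarrow> complex
     \<Rightarrow> ('n \<Rightarrow> real \<times> real \<Rightarrow> complex) \<Rightarrow> (real \<times> real)^'n \<Rightarrow> complex" where
  "tangent_vec a \<phi> adot \<phi>dot X =
     adot * wedge \<phi> X + a * (\<Sum>j\<in>UNIV. wedge (\<phi>(j := \<phi>dot j)) X)"

definition Linf_norm_V :: "real \<Rightarrow> real \<Rightarrow> (real \<times> real \<Rightarrow> real \<times> real \<Rightarrow> real) \<Rightarrow> real" where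
  "Linf_norm_V L1 L2 V = Inf {C. 0 \<le> C \<and>
      (AE z in lebesgue. z \<in> box_Lambda L1 L2 \<times> box_Lambda L1 L2 \<longrightarrow> \<bar>V (fst z) (snd z)\<bar> \<le> C)}"

end

theory Submission
  imports Defs
begin

text \<open>
  Let \<open>D = \<Psi> - u\<close> and \<open>r = H\<^sub>N u - i \<hbar> u'\<close>. Then \<open>i \<hbar> D' = H\<^sub>N D + r\<close>, and as \<open>H\<^sub>N\<close> is symmetric,
  \<open>\<hbar> Re \<langle>D, D'\<rangle> = Im \<langle>D, r\<rangle>\<close>; hence \<open>\<parallel>D(t)\<parallel> \<le> sup \<parallel>r\<parallel> t / \<hbar>\<close>. The Dirac-Frenkel condition with
  \<open>v = u\<close> shows that \<open>\<parallel>u\<parallel> = 1\<close> is conserved.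

  Residual: the one-particle part of \<open>H\<^sub>N u\<close> is tangent at \<open>u\<close>, so \<open>r = W u - \<tau>\<close> with \<open>W = \<Sum> V(x\<^sub>i, x\<^sub>j)\<close>, \<open>\<tau>\<close> tangent and
  \<open>r\<close> orthogonal to the tangent space; thus \<open>\<parallel>r\<parallel>\<^sup>2 = \<langle>r, W u\<rangle>\<close>. In \<open>V(x\<^sub>i, x\<^sub>j) u\<close> project both
  particles \<open>i\<close> and \<open>j\<close> onto the complement of the occupied orbitals. The discarded part has \<open>N - 1\<close> occupied
  orbitals and is invisible to \<open>r\<close>; the remaining vectors are pairwise orthogonal, each of norm at most
  \<open>\<parallel>V\<parallel> \<parallel>u\<parallel>\<close>, so the norm of their sum is at most \<open>sqrt (N (N - 1) / 2) \<parallel>V\<parallel>\<close>.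

  Symmetry of the kinetic energy \<open>T\<close>, known only in the weak sense: test it on the kernel
  \<open>f\<^sub>X(Y) = exp (i \<theta>(Y, X)) \<rho>(Y - X)\<close>, with \<open>\<rho>\<close> a radial bump and \<open>\<theta>\<close> the phase of the magnetic translations.
  Then \<open>T f\<^sub>X = exp (i \<theta>(Y, X)) m(Y - X)\<close> with \<open>m\<close> real and even. Pairing the weak equation \<open>T \<Psi> = G\<close> with
  \<open>\<Psi>\<close> over a cell gives \<open>\<integral> m J\<^sub>\<Psi>\<^sub>\<Psi> = \<integral> \<rho> J\<^sub>\<Psi>\<^sub>G\<close>, where \<open>J\<^sub>A\<^sub>B(Z)\<close> is the correlation of \<open>A\<close> with the
  magnetic translate of \<open>B\<close> by \<open>Z\<close>. Since \<open>J\<^sub>\<Psi>\<^sub>\<Psi>(-Z)\<close> is the conjugate of \<open>J\<^sub>\<Psi>\<^sub>\<Psi>(Z)\<close>, the left-hand side is real;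
  shrinking \<open>\<rho>\<close> to a point yields \<open>Im \<langle>\<Psi>, G\<rangle> = 0\<close>.
\<close>

section \<open>Square-integrable functions over a measure\<close>

text \<open>\<open>H1\<close> and \<open>HN\<close> are given by a choice operator over weak
  solutions, so self-adjointness and regularity of the domain are not at hand, and all derivatives
  have to fall on one explicit kernel. Its phase is the integral of the vector potential along the
  segment joining the two points: with it the kinetic momenta at \<open>Y\<close> see only
  \<open>Y - X\<close>, and flux quantisation makes the shifted correlations periodic. The
  multiplier is real because the bump is invariant under rotations in each plane, which kills the
  angular momentum term. The same averaging argument, applied to the zero function, shows that a
  weak kinetic energy is unique almost everywhere; this identifies the chosen \<open>HN u\<close>
  with the Leibniz sum over the orbitals. Orbitals are Lebesgue measurable on a closed box, whereas
  Fubini on configuration space is used for Borel functions on a product, so functions are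
  constantly replaced by Borel versions. The projection argument yields the constant
  \<open>sqrt (N (N - 1) / 2)\<close>; the bound claimed is weaker by a factor
  \<open>sqrt 2\<close>.\<close>

definition sq_int :: "'a measure \<Rightarrow> ('a \<Rightarrow> complex) \<Rightarrow> bool" where
  "sq_int M f \<longleftrightarrow> f \<in> borel_measurable M \<and> integrable M (\<lambda>x. (norm (f x))\<^sup>2)"

definition ip :: "'a measure \<Rightarrow> ('a \<Rightarrow> complex) \<Rightarrow> ('a \<Rightarrow> complex) \<Rightarrow> complex" where
  "ip M f g = (\<integral>x. cnj (f x) * g x \<partial>M)"

definition nrm :: "'a measure \<Rightarrow> ('a \<Rightarrow> complex) \<Rightarrow> real" where
  "nrm M f = sqrt (\<integral>x. (norm (f x))\<^sup>2 \<partial>M)"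

lemma borel_measurable_cnj [measurable (raw)]:
  "f \<in> borel_measurable M \<Longrightarrow> (\<lambda>x. cnj (f x)) \<in> borel_measurable M"
  by (rule borel_measurable_continuous_on[OF continuous_on_cnj[OF continuous_on_id]])

lemma sq_int_measurable [measurable_dest]: "sq_int M f \<Longrightarrow> f \<in> borel_measurable M"
  by (simp add: sq_int_def)

lemma sq_int_integrable: "sq_int M f \<Longrightarrow> integrable M (\<lambda>x. (norm (f x))\<^sup>2)"
  by (simp add: sq_int_def)

lemma sq_int_bound:
  assumes "g \<in> borel_measurable M" "sq_int M f" "AE x in M. norm (g x) \<le> C * norm (f x)"
  shows "sq_int M g"
  unfolding sq_int_def
proof
  show "integrable M (\<lambda>x. (norm (g x))\<^sup>2)"
  proof (rule Bochner_Integration.integrable_bound)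
    show "integrable M (\<lambda>x. C\<^sup>2 * (norm (f x))\<^sup>2)" using sq_int_integrable[OF assms(2)] by simp
    show "AE x in M. norm ((norm (g x))\<^sup>2) \<le> norm (C\<^sup>2 * (norm (f x))\<^sup>2)"
      using assms(3)
    proof eventually_elim
      case (elim x)
      then have "(norm (g x))\<^sup>2 \<le> (C * norm (f x))\<^sup>2" by (intro power_mono) auto
      then show ?case by (simp add: power_mult_distrib)
    qed
  qed (use assms(1) in measurable)
qed (fact assms(1))

lemma sq_int_zero [simp]: "sq_int M (\<lambda>x. 0)"
  by (simp add: sq_int_def)

lemma sq_int_mult_bounded:
  assumes "b \<in> borel_measurable M" "sq_int M f" "AE x in M. norm (b x) \<le> C"
  shows "sq_int M (\<lambda>x. b x * f x)"
  by (rule sq_int_bound[OF _ assms(2), where C=C])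
     (use assms in \<open>auto simp: norm_mult intro: mult_right_mono elim!: eventually_mono\<close>)

lemma sq_int_cmult: "sq_int M f \<Longrightarrow> sq_int M (\<lambda>x. c * f x)"
  by (rule sq_int_mult_bounded[where C="norm c"]) auto

lemma sq_int_minus: "sq_int M f \<Longrightarrow> sq_int M (\<lambda>x. - f x)"
  by (simp add: sq_int_def)

lemma sq_int_divide: "sq_int M f \<Longrightarrow> sq_int M (\<lambda>x. f x / c)"
  using sq_int_cmult[of M f "inverse c"] by (simp add: field_simps)

lemma sq_int_cnj: "sq_int M f \<Longrightarrow> sq_int M (\<lambda>x. cnj (f x))"
  by (auto simp: sq_int_def)

lemma sq_int_add:
  assumes "sq_int M f" "sq_int M g" shows "sq_int M (\<lambda>x. f x + g x)"
  unfolding sq_int_def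
proof
  show "integrable M (\<lambda>x. (norm (f x + g x))\<^sup>2)"
  proof (rule Bochner_Integration.integrable_bound)
    show "integrable M (\<lambda>x. 2 * (norm (f x))\<^sup>2 + 2 * (norm (g x))\<^sup>2)"
      using assms by (auto simp: sq_int_def)
    show "AE x in M. norm ((norm (f x + g x))\<^sup>2) \<le> norm (2 * (norm (f x))\<^sup>2 + 2 * (norm (g x))\<^sup>2)"
    proof (rule AE_I2)
      fix x
      have "(norm (f x + g x))\<^sup>2 \<le> (norm (f x) + norm (g x))\<^sup>2"
        by (intro power_mono norm_triangle_ineq) auto
      also have "\<dots> \<le> 2 * (norm (f x))\<^sup>2 + 2 * (norm (g x))\<^sup>2"
        using zero_le_power2[of "norm (f x) - norm (g x)"] by (simp add: power2_eq_square algebra_simps)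
      finally show "norm ((norm (f x + g x))\<^sup>2) \<le> norm (2 * (norm (f x))\<^sup>2 + 2 * (norm (g x))\<^sup>2)" by simp
    qed
  qed (use assms in measurable)
qed (use assms in measurable)

lemma sq_int_diff: "sq_int M f \<Longrightarrow> sq_int M g \<Longrightarrow> sq_int M (\<lambda>x. f x - g x)"
  using sq_int_add[of M f "\<lambda>x. - g x"] sq_int_minus[of M g] by simp

lemma sq_int_sum: "(\<And>i. i \<in> I \<Longrightarrow> sq_int M (f i)) \<Longrightarrow> sq_int M (\<lambda>x. \<Sum>i\<in>I. f i x)"
  by (induction I rule: infinite_finite_induct) (auto intro!: sq_int_add)

lemma integrable_sq_int_mult:
  assumes "sq_int M f" "sq_int M g" shows "integrable M (\<lambda>x. f x * g x)"
proof (rule Bochner_Integration.integrable_bound)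
  show "integrable M (\<lambda>x. (norm (f x))\<^sup>2 + (norm (g x))\<^sup>2)" using assms by (auto simp: sq_int_def)
  show "AE x in M. norm (f x * g x) \<le> norm ((norm (f x))\<^sup>2 + (norm (g x))\<^sup>2)"
  proof (rule AE_I2)
    fix x
    have "norm (f x) * norm (g x) \<le> (norm (f x))\<^sup>2 + (norm (g x))\<^sup>2"
      using sum_squares_bound[of "norm (f x)" "norm (g x)"]
        mult_nonneg_nonneg[of "norm (f x)" "norm (g x)", OF norm_ge_zero norm_ge_zero] by linarith
    then show "norm (f x * g x) \<le> norm ((norm (f x))\<^sup>2 + (norm (g x))\<^sup>2)" by (simp add: norm_mult)
  qed
qed (use assms in measurable)

lemma integrable_ip: "sq_int M f \<Longrightarrow> sq_int M g \<Longrightarrow> integrable M (\<lambda>x. cnj (f x) * g x)"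
  by (intro integrable_sq_int_mult sq_int_cnj)

lemma ip_cong_AE:
  assumes "AE x in M. f x = f' x" "AE x in M. g x = g' x"
    and [measurable]: "f \<in> borel_measurable M" "f' \<in> borel_measurable M" "g \<in> borel_measurable M" "g' \<in> borel_measurable M"
  shows "ip M f g = ip M f' g'"
  unfolding ip_def by (rule integral_cong_AE, measurable) (use assms(1,2) in auto)

lemma ip_add_right: "sq_int M f \<Longrightarrow> sq_int M g \<Longrightarrow> sq_int M h \<Longrightarrow> ip M f (\<lambda>x. g x + h x) = ip M f g + ip M f h"
  unfolding ip_def distrib_left by (intro Bochner_Integration.integral_add integrable_ip)

lemma ip_diff_right: "sq_int M f \<Longrightarrow> sq_int M g \<Longrightarrow> sq_int M h \<Longrightarrow> ip M f (\<lambda>x. g x - h x) = ip M f g - ip M f h"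
  unfolding ip_def right_diff_distrib by (intro Bochner_Integration.integral_diff integrable_ip)

lemma ip_cmult_right: "ip M f (\<lambda>x. c * g x) = c * ip M f g"
proof -
  have "(\<lambda>x. cnj (f x) * (c * g x)) = (\<lambda>x. c * (cnj (f x) * g x))" by (auto simp: ac_simps)
  then show ?thesis unfolding ip_def by simp
qed

lemma cnj_ip: "cnj (ip M f g) = ip M g f"
  unfolding ip_def by (subst Bochner_Integration.integral_cnj[symmetric]) (simp add: mult.commute)

lemma ip_add_left: "sq_int M f \<Longrightarrow> sq_int M g \<Longrightarrow> sq_int M h \<Longrightarrow> ip M (\<lambda>x. g x + h x) f = ip M g f + ip M h f"
  using arg_cong[OF ip_add_right[of M f g h], of cnj] by (simp add: cnj_ip)

lemma ip_diff_left: "sq_int M f \<Longrightarrow> sq_int M g \<Longrightarrow> sq_int M h \<Longrightarrow> ip M (\<lambda>x. g x - h x) f = ip M g f - ip M h f"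
  using arg_cong[OF ip_diff_right[of M f g h], of cnj] by (simp add: cnj_ip)

lemma ip_cmult_left: "ip M (\<lambda>x. c * g x) f = cnj c * ip M g f"
  using arg_cong[OF ip_cmult_right[of M f c g], of cnj] by (simp add: cnj_ip)

lemma ip_zero_left [simp]: "ip M (\<lambda>x. 0) f = 0" and ip_zero_right [simp]: "ip M f (\<lambda>x. 0) = 0"
  by (simp_all add: ip_def)

lemma ip_sum_right:
  assumes "sq_int M f" "\<And>i. i \<in> I \<Longrightarrow> sq_int M (g i)"
  shows "ip M f (\<lambda>x. \<Sum>i\<in>I. g i x) = (\<Sum>i\<in>I. ip M f (g i))"
  using assms(2) by (induction I rule: infinite_finite_induct)
    (simp_all add: ip_add_right assms(1) sq_int_sum)

lemma ip_sum_left: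
  assumes "sq_int M f" "\<And>i. i \<in> I \<Longrightarrow> sq_int M (g i)"
  shows "ip M (\<lambda>x. \<Sum>i\<in>I. g i x) f = (\<Sum>i\<in>I. ip M (g i) f)"
  using assms(2) by (induction I rule: infinite_finite_induct)
    (simp_all add: ip_add_left assms(1) sq_int_sum)

lemma nrm_nonneg [simp]: "nrm M f \<ge> 0"
  by (simp add: nrm_def)

lemma nrm_sq: "(nrm M f)\<^sup>2 = (\<integral>x. (norm (f x))\<^sup>2 \<partial>M)"
  by (simp add: nrm_def)

lemma ip_self: "ip M f f = of_real ((nrm M f)\<^sup>2)"
proof -
  have "(\<lambda>x. cnj (f x) * f x) = (\<lambda>x. complex_of_real ((norm (f x))\<^sup>2))"
    by (rule ext, subst mult.commute, simp only: complex_norm_square)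
  then show ?thesis by (simp only: ip_def nrm_sq integral_complex_of_real)
qed

lemma nrm_cmult: "nrm M (\<lambda>x. c * f x) = norm c * nrm M f"
  by (simp add: nrm_def norm_mult power_mult_distrib real_sqrt_mult)

lemma nrm_minus_commute: "nrm M (\<lambda>x. f x - g x) = nrm M (\<lambda>x. g x - f x)"
  by (simp add: nrm_def norm_minus_commute)

lemma nn_integral_sq_int: "sq_int M f \<Longrightarrow> (\<integral>\<^sup>+x. ennreal ((norm (f x))\<^sup>2) \<partial>M) = ennreal ((nrm M f)\<^sup>2)"
  by (subst nn_integral_eq_integral) (auto simp: sq_int_def nrm_sq)

text \<open>Cauchy-Schwarz is taken from nonnegative integrals; integrability of the product then
  turns it into an inequality between real integrals.\<close>

lemma integral_norm_mult_le:
  assumes "sq_int M f" "sq_int M g"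
  shows "(\<integral>x. norm (f x) * norm (g x) \<partial>M) \<le> nrm M f * nrm M g"
proof -
  note [measurable] = sq_int_measurable[OF assms(1)] sq_int_measurable[OF assms(2)]
  have i: "integrable M (\<lambda>x. norm (f x) * norm (g x))"
    using integrable_norm[OF integrable_sq_int_mult[OF assms]] by (simp add: norm_mult)
  define I where "I = (\<integral>x. norm (f x) * norm (g x) \<partial>M)"
  have I0: "I \<ge> 0" unfolding I_def by (intro integral_nonneg_AE) auto
  have "(\<integral>\<^sup>+x. ennreal (norm (f x)) * ennreal (norm (g x)) \<partial>M)\<^sup>2 \<le>
     (\<integral>\<^sup>+x. (ennreal (norm (f x)))\<^sup>2 \<partial>M) * (\<integral>\<^sup>+x. (ennreal (norm (g x)))\<^sup>2 \<partial>M)"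
    by (rule Cauchy_Schwarz_nn_integral) measurable
  also have "(\<integral>\<^sup>+x. ennreal (norm (f x)) * ennreal (norm (g x)) \<partial>M) = ennreal I"
    unfolding I_def by (subst nn_integral_eq_integral[OF i, symmetric]) (auto simp: ennreal_mult')
  also have "(\<integral>\<^sup>+x. (ennreal (norm (f x)))\<^sup>2 \<partial>M) = ennreal ((nrm M f)\<^sup>2)"
    using nn_integral_sq_int[OF assms(1)] by (simp add: ennreal_power)
  also have "(\<integral>\<^sup>+x. (ennreal (norm (g x)))\<^sup>2 \<partial>M) = ennreal ((nrm M g)\<^sup>2)"
    using nn_integral_sq_int[OF assms(2)] by (simp add: ennreal_power)
  finally have "ennreal (I\<^sup>2) \<le> ennreal ((nrm M f * nrm M g)\<^sup>2)"
    using I0 by (simp add: ennreal_power power_mult_distrib ennreal_mult')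
  then have "I\<^sup>2 \<le> (nrm M f * nrm M g)\<^sup>2" by (subst (asm) ennreal_le_iff) auto
  then show ?thesis unfolding I_def[symmetric] by (rule power2_le_imp_le) simp
qed

lemma ip_Cauchy_Schwarz:
  assumes "sq_int M f" "sq_int M g" shows "norm (ip M f g) \<le> nrm M f * nrm M g"
proof -
  have "norm (ip M f g) \<le> (\<integral>x. norm (f x) * norm (g x) \<partial>M)"
    unfolding ip_def using integral_norm_bound[of M "\<lambda>x. cnj (f x) * g x"] by (simp add: norm_mult)
  with integral_norm_mult_le[OF assms] show ?thesis by linarith
qed

lemma nrm_add_sq:
  assumes "sq_int M f" "sq_int M g"
  shows "(nrm M (\<lambda>x. f x + g x))\<^sup>2 = (nrm M f)\<^sup>2 + 2 * Re (ip M f g) + (nrm M g)\<^sup>2"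
proof -
  have "complex_of_real ((nrm M (\<lambda>x. f x + g x))\<^sup>2) = ip M f f + ip M f g + (ip M g f + ip M g g)"
    unfolding ip_self[symmetric] by (simp add: assms ip_add_left ip_add_right sq_int_add)
  also have "ip M g f = cnj (ip M f g)" by (simp add: cnj_ip)
  finally have "Re (complex_of_real ((nrm M (\<lambda>x. f x + g x))\<^sup>2)) =
     Re (of_real ((nrm M f)\<^sup>2) + ip M f g + (cnj (ip M f g) + of_real ((nrm M g)\<^sup>2)))"
    unfolding ip_self by simp
  then show ?thesis by simp
qed

lemma nrm_triangle:
  assumes "sq_int M f" "sq_int M g"
  shows "nrm M (\<lambda>x. f x + g x) \<le> nrm M f + nrm M g"
proof (rule power2_le_imp_le)
  have "Re (ip M f g) \<le> nrm M f * nrm M g"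
    using ip_Cauchy_Schwarz[OF assms] complex_Re_le_cmod[of "ip M f g"] by linarith
  then show "(nrm M (\<lambda>x. f x + g x))\<^sup>2 \<le> (nrm M f + nrm M g)\<^sup>2"
    unfolding nrm_add_sq[OF assms] by (simp add: power2_sum)
qed simp

lemma nrm_triangle_sum:
  assumes "\<And>i. i \<in> I \<Longrightarrow> sq_int M (g i)"
  shows "nrm M (\<lambda>x. \<Sum>i\<in>I. g i x) \<le> (\<Sum>i\<in>I. nrm M (g i))"
  using assms
proof (induction I rule: infinite_finite_induct)
  case (insert i I)
  have "nrm M (\<lambda>x. \<Sum>i\<in>insert i I. g i x) = nrm M (\<lambda>x. g i x + (\<Sum>i\<in>I. g i x))" using insert by simp
  also have "\<dots> \<le> nrm M (g i) + nrm M (\<lambda>x. \<Sum>i\<in>I. g i x)"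
    by (rule nrm_triangle) (auto intro!: sq_int_sum insert)
  finally show ?case using insert by simp
qed (simp_all add: nrm_def)

lemma nrm_triangle_diff:
  assumes "sq_int M f" "sq_int M g"
  shows "nrm M f \<le> nrm M g + nrm M (\<lambda>x. f x - g x)"
  using nrm_triangle[OF assms(2) sq_int_diff[OF assms]] by simp

lemma nrm_mono_AE:
  assumes "f \<in> borel_measurable M" "sq_int M g" "C \<ge> 0" "AE x in M. norm (f x) \<le> C * norm (g x)"
  shows "nrm M f \<le> C * nrm M g"
proof -
  have "(\<integral>x. (norm (f x))\<^sup>2 \<partial>M) \<le> (\<integral>x. (norm (C * g x))\<^sup>2 \<partial>M)"
  proof (rule integral_mono_AE)
    show "AE x in M. (norm (f x))\<^sup>2 \<le> (norm (complex_of_real C * g x))\<^sup>2"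
      using assms(4) by eventually_elim (auto intro!: power_mono simp: norm_mult assms(3))
    show "integrable M (\<lambda>x. (norm (f x))\<^sup>2)"
      using sq_int_bound[OF assms(1,2,4)] by (simp add: sq_int_def)
    show "integrable M (\<lambda>x. (norm (complex_of_real C * g x))\<^sup>2)"
      using sq_int_cmult[OF assms(2)] by (simp add: sq_int_def)
  qed
  then have "nrm M f \<le> nrm M (\<lambda>x. C * g x)" by (simp add: nrm_def)
  then show ?thesis by (simp add: nrm_cmult assms(3))
qed

lemma nrm_eq_0_AE:
  assumes "sq_int M f" shows "nrm M f = 0 \<longleftrightarrow> (AE x in M. f x = 0)"
  unfolding nrm_def real_sqrt_eq_0_iff
  by (subst integral_nonneg_eq_0_iff_AE) (use assms in \<open>auto simp: sq_int_def\<close>)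

lemma nrm_sum_orthogonal:
  assumes "finite I" "\<And>i. i \<in> I \<Longrightarrow> sq_int M (g i)"
    and "\<And>i j. i \<in> I \<Longrightarrow> j \<in> I \<Longrightarrow> i \<noteq> j \<Longrightarrow> ip M (g i) (g j) = 0"
  shows "(nrm M (\<lambda>x. \<Sum>i\<in>I. g i x))\<^sup>2 = (\<Sum>i\<in>I. (nrm M (g i))\<^sup>2)"
  using assms
proof (induction I rule: finite_induct)
  case (insert i I)
  have "ip M (g i) (\<lambda>x. \<Sum>i\<in>I. g i x) = (\<Sum>j\<in>I. ip M (g i) (g j))"
    by (rule ip_sum_right) (auto intro: insert)
  also have "\<dots> = 0" by (rule sum.neutral) (use insert in auto)
  finally have "(nrm M (\<lambda>x. g i x + (\<Sum>i\<in>I. g i x)))\<^sup>2 = (nrm M (g i))\<^sup>2 + (nrm M (\<lambda>x. \<Sum>i\<in>I. g i x))\<^sup>2"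
    by (subst nrm_add_sq) (auto intro!: sq_int_sum insert)
  then show ?case using insert by simp
qed (simp add: nrm_def)

text \<open>Pythagoras for \<open>g = f + (g - f)\<close>. A projected vector can thus be compared
  with the original through one orthogonality relation, and the projection never has to be written
  as an operator.\<close>

lemma nrm_le_of_ip_zero:
  assumes "sq_int M f" "sq_int M g" "ip M f (\<lambda>x. g x - f x) = 0"
  shows "nrm M f \<le> nrm M g"
proof -
  have "(nrm M (\<lambda>x. f x + (g x - f x)))\<^sup>2 = (nrm M f)\<^sup>2 + (nrm M (\<lambda>x. g x - f x))\<^sup>2"
    by (subst nrm_add_sq) (use assms in \<open>auto intro!: sq_int_diff\<close>)
  then have "(nrm M f)\<^sup>2 \<le> (nrm M g)\<^sup>2" by simp
  then show ?thesis by (rule power2_le_imp_le) simp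
qed

section \<open>Slater determinants on a product space\<close>

abbreviation PiU :: "'a measure \<Rightarrow> ('n::finite \<Rightarrow> 'a) measure" where
  "PiU M \<equiv> PiM UNIV (\<lambda>_. M)"

lemma product_sigma_finite_const: "sigma_finite_measure M \<Longrightarrow> product_sigma_finite (\<lambda>_. M)"
  by (simp add: product_sigma_finite_def)

text \<open>A product measure with equal factors is determined by its values on rectangles, and
  relabelling the coordinates merely permutes the sides of a rectangle.\<close>

lemma distr_PiM_permute:
  fixes p :: "'n::finite \<Rightarrow> 'n"
  assumes M: "sigma_finite_measure M" and p: "bij p"
  shows "distr (PiU M) (PiU M) (\<lambda>X. X \<circ> p) = PiU M"
proof -
  interpret product_sigma_finite "\<lambda>_::'n. M" by (rule product_sigma_finite_const[OF M])
  have meas[measurable]: "(\<lambda>X. X \<circ> p) \<in> measurable (PiU M) (PiU M)"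
    unfolding comp_def by (rule measurable_abs_UNIV) measurable
  show ?thesis
  proof (rule PiM_eqI)
    fix A :: "'n \<Rightarrow> 'a set" assume A: "\<And>i. i \<in> UNIV \<Longrightarrow> A i \<in> sets M"
    have sub: "A i \<subseteq> space M" for i using A sets.sets_into_space by auto
    have "(\<lambda>X. X \<circ> p) -` Pi\<^sub>E UNIV A \<inter> space (PiU M) = Pi\<^sub>E UNIV (\<lambda>i. A (inv p i))"
    proof (intro set_eqI iffI)
      fix X assume "X \<in> (\<lambda>X. X \<circ> p) -` Pi\<^sub>E UNIV A \<inter> space (PiU M)"
      then have "X (p i) \<in> A i" for i by (auto simp: PiE_iff)
      from this[of "inv p _"] show "X \<in> Pi\<^sub>E UNIV (\<lambda>i. A (inv p i))"
        using p by (auto simp: PiE_iff bij_is_surj surj_f_inv_f)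
    next
      fix X assume "X \<in> Pi\<^sub>E UNIV (\<lambda>i. A (inv p i))"
      then have *: "X i \<in> A (inv p i)" for i by auto
      show "X \<in> (\<lambda>X. X \<circ> p) -` Pi\<^sub>E UNIV A \<inter> space (PiU M)"
        using *[of "p _"] * sub p by (auto simp: PiE_iff space_PiM bij_is_inj inv_f_f subset_eq)
    qed
    then have "emeasure (distr (PiU M) (PiU M) (\<lambda>X. X \<circ> p)) (Pi\<^sub>E UNIV A) = emeasure (PiU M) (Pi\<^sub>E UNIV (\<lambda>i. A (inv p i)))"
      using A by (subst emeasure_distr) (auto intro!: sets_PiM_I_finite)
    also have "\<dots> = (\<Prod>i\<in>UNIV. emeasure M (A (inv p i)))"
      using A by (subst emeasure_PiM) auto
    also have "\<dots> = (\<Prod>i\<in>UNIV. emeasure M (A i))"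
      by (rule prod.reindex_bij_betw) (use p bij_imp_bij_inv in auto)
    finally show "emeasure (distr (PiU M) (PiU M) (\<lambda>X. X \<circ> p)) (Pi\<^sub>E UNIV A) = (\<Prod>i\<in>UNIV. emeasure M (A i))" .
  qed simp_all
qed

text \<open>The exceptional set lies in a cylinder with one null side. The index set is kept general
  because the result is also applied with one coordinate removed.\<close>

lemma AE_PiM_coordinate:
  assumes M: "sigma_finite_measure M" and I: "finite I" "i \<in> I" and P: "AE x in M. P x"
  shows "AE X in PiM I (\<lambda>_. M). P (X i)"
proof -
  interpret product_sigma_finite "\<lambda>_. M" by (rule product_sigma_finite_const[OF M])
  from P obtain N where N: "{x\<in>space M. \<not> P x} \<subseteq> N" "N \<in> sets M" "emeasure M N = 0"
    by (rule AE_E)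
  let ?A = "\<lambda>j. if j = i then N else space M"
  have "emeasure (PiM I (\<lambda>_. M)) (Pi\<^sub>E I ?A) = (\<Prod>j\<in>I. emeasure M (?A j))"
    using I N by (intro emeasure_PiM) auto
  also have "\<dots> = 0" using I N by (intro prod_zero) (auto intro: bexI[of _ i])
  finally have 0: "emeasure (PiM I (\<lambda>_. M)) (Pi\<^sub>E I ?A) = 0" .
  show ?thesis
  proof (rule AE_I[OF _ 0])
    show "{X \<in> space (PiM I (\<lambda>_. M)). \<not> P (X i)} \<subseteq> Pi\<^sub>E I ?A"
      using N I by (auto simp: space_PiM PiE_iff subset_eq)
    show "Pi\<^sub>E I ?A \<in> sets (PiM I (\<lambda>_. M))"
      using I N by (intro sets_PiM_I_finite) auto
  qed
qed

text \<open>Orthogonality on configuration space is reduced to this: integrate first over the one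
  coordinate in which the inner integral is known to vanish. The other coordinates only have to be
  good almost everywhere.\<close>

lemma integral_PiM_coordinate_zero:
  fixes F :: "('n::finite \<Rightarrow> 'a) \<Rightarrow> complex"
  assumes M: "sigma_finite_measure M" and F: "integrable (PiU M) F"
    and 0: "AE X in PiM (UNIV - {j}) (\<lambda>_. M). (\<integral>y. F (X(j := y)) \<partial>M) = 0"
  shows "integral\<^sup>L (PiU M) F = 0"
proof -
  interpret product_sigma_finite "\<lambda>_::'n. M" by (rule product_sigma_finite_const[OF M])
  have UN: "insert j (UNIV - {j}) = (UNIV :: 'n set)" by auto
  have "integral\<^sup>L (PiU M) F = (\<integral>X. (\<integral>y. F (X(j := y)) \<partial>M) \<partial>PiM (UNIV - {j}) (\<lambda>_. M))"
    using product_integral_insert[of "UNIV - {j}" j F] F unfolding UN by simp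
  also have "\<dots> = 0"
    by (rule integral_eq_zero_AE) (rule 0)
  finally show ?thesis .
qed

definition tensor :: "('n::finite \<Rightarrow> 'a \<Rightarrow> complex) \<Rightarrow> ('n \<Rightarrow> 'a) \<Rightarrow> complex" where
  "tensor f X = (\<Prod>k\<in>UNIV. f k (X k))"

text \<open>The determinant without the factor \<open>1 / sqrt (N!)\<close>, with the permutation
  acting on the orbital labels. Configurations are functions, not vectors, so that product measures
  apply.\<close>

definition slater :: "('n::finite \<Rightarrow> 'a \<Rightarrow> complex) \<Rightarrow> ('n \<Rightarrow> 'a) \<Rightarrow> complex" where
  "slater f X = (\<Sum>p\<in>{p. p permutes UNIV}. of_int (sign p) * tensor (f \<circ> p) X)"

definition antisymmetric :: "(('n::finite \<Rightarrow> 'a) \<Rightarrow> complex) \<Rightarrow> bool" where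
  "antisymmetric r \<longleftrightarrow> (\<forall>p X. p permutes UNIV \<longrightarrow> r (X \<circ> p) = of_int (sign p) * r X)"

lemma tensor_comp_perm:
  assumes "p permutes UNIV" shows "tensor (f \<circ> p) (X \<circ> p) = tensor f X"
  unfolding tensor_def comp_def
  by (rule prod.reindex_bij_betw[of p UNIV UNIV "\<lambda>k. f k (X k)"]) (use assms permutes_imp_bij in blast)

lemma of_int_sign_square [simp]: "of_int (sign p) * of_int (sign p) = (1::complex)"
  by (metis of_int_1 of_int_mult sign_idempotent)

lemma slater_det: "slater f X = det (\<chi> i j. f i (X j))"
proof -
  have "det (\<chi> i j. f i (X j)) = det (transpose (\<chi> i j. f i (X j)))" by (simp add: det_transpose)
  also have "\<dots> = slater f X" by (simp add: det_def slater_def tensor_def transpose_def)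
  finally show ?thesis ..
qed

lemma antisymmetric_slater: "antisymmetric (slater f)"
  unfolding antisymmetric_def
proof (intro allI impI)
  fix p :: "'a \<Rightarrow> 'a" and X :: "'a \<Rightarrow> 'b" assume p: "p permutes UNIV"
  have perm: "permutation p" using p by (simp add: permutation_permutes) blast
  have "slater f (X \<circ> p) = (\<Sum>q\<in>{q. q permutes UNIV}. of_int (sign (q \<circ> p)) * tensor (f \<circ> (q \<circ> p)) (X \<circ> p))"
    unfolding slater_def by (rule sum_permutations_compose_right[OF p])
  also have "\<dots> = (\<Sum>q\<in>{q. q permutes UNIV}. of_int (sign p) * (of_int (sign q) * tensor (f \<circ> q) X))"
  proof (rule sum.cong[OF refl])
    fix q :: "'a \<Rightarrow> 'a" assume "q \<in> {q. q permutes UNIV}"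
    then have q: "permutation q" by (auto simp: permutation_permutes)
    have "tensor (f \<circ> (q \<circ> p)) (X \<circ> p) = tensor (f \<circ> q) X"
      using tensor_comp_perm[OF p, of "f \<circ> q" X] by (simp add: comp_assoc)
    then show "of_int (sign (q \<circ> p)) * tensor (f \<circ> (q \<circ> p)) (X \<circ> p) = of_int (sign p) * (of_int (sign q) * tensor (f \<circ> q) X)"
      by (simp add: sign_compose[OF q perm] mult.commute mult.left_commute)
  qed
  finally show "slater f (X \<circ> p) = of_int (sign p) * slater f X"
    by (simp add: slater_def sum_distrib_left)
qed

lemma sq_int_tensor:
  fixes f :: "'n::finite \<Rightarrow> 'a \<Rightarrow> complex"
  assumes M: "sigma_finite_measure M" and f: "\<And>k. sq_int M (f k)"
  shows "sq_int (PiU M) (tensor f)"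
proof -
  interpret product_sigma_finite "\<lambda>_::'n. M" by (rule product_sigma_finite_const[OF M])
  have "integrable (PiU M) (\<lambda>X. \<Prod>k\<in>UNIV. (norm (f k (X k)))\<^sup>2)"
    by (rule product_integrable_prod) (use f in \<open>auto simp: sq_int_def\<close>)
  moreover have "tensor f \<in> borel_measurable (PiU M)"
    unfolding tensor_def using sq_int_measurable[OF f] by measurable
  ultimately show ?thesis by (simp add: sq_int_def tensor_def prod_norm[symmetric] prod_power_distrib)
qed

lemma ip_tensor:
  fixes f :: "'n::finite \<Rightarrow> 'a \<Rightarrow> complex"
  assumes M: "sigma_finite_measure M" and f: "\<And>k. sq_int M (f k)" "\<And>k. sq_int M (g k)"
  shows "ip (PiU M) (tensor f) (tensor g) = (\<Prod>k\<in>UNIV. ip M (f k) (g k))"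
proof -
  interpret product_sigma_finite "\<lambda>_::'n. M" by (rule product_sigma_finite_const[OF M])
  show ?thesis
    unfolding ip_def tensor_def cnj_prod prod.distrib[symmetric]
    by (rule product_integral_prod) (auto intro: integrable_ip f)
qed

lemma nrm_tensor:
  fixes f :: "'n::finite \<Rightarrow> 'a \<Rightarrow> complex"
  assumes M: "sigma_finite_measure M" and f: "\<And>k. sq_int M (f k)"
  shows "nrm (PiU M) (tensor f) = (\<Prod>k\<in>UNIV. nrm M (f k))"
proof -
  have "complex_of_real ((nrm (PiU M) (tensor f))\<^sup>2) = complex_of_real (\<Prod>k\<in>UNIV. (nrm M (f k))\<^sup>2)"
    unfolding ip_self[symmetric] ip_tensor[OF M f f] by (simp add: ip_self)
  then have "(nrm (PiU M) (tensor f))\<^sup>2 = (\<Prod>k\<in>UNIV. nrm M (f k))\<^sup>2"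
    by (simp only: of_real_eq_iff prod_power_distrib)
  then show ?thesis by (rule power2_eq_imp_eq) (auto intro: prod_nonneg)
qed

lemma sq_int_slater:
  assumes M: "sigma_finite_measure M" and f: "\<And>k. sq_int M (f k)"
  shows "sq_int (PiU M) (slater f)"
  unfolding slater_def by (intro sq_int_sum sq_int_cmult sq_int_tensor[OF M]) (simp add: f)

text \<open>Undoing the permutation of the orbitals by a change of variables moves it onto
  \<open>r\<close>, which returns the same sign that stands in front of the term. All
  \<open>N!\<close> terms are therefore equal.\<close>

lemma ip_slater_antisymmetric:
  fixes f :: "'n::finite \<Rightarrow> 'a \<Rightarrow> complex"
  assumes M: "sigma_finite_measure M" and f: "\<And>k. sq_int M (f k)"
    and r: "sq_int (PiU M) r" "antisymmetric r"
  shows "ip (PiU M) (slater f) r = fact CARD('n) * ip (PiU M) (tensor f) r"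
proof -
  have one: "ip (PiU M) (tensor (f \<circ> p)) r = of_int (sign p) * ip (PiU M) (tensor f) r"
    if p: "p permutes UNIV" for p
  proof -
    have bp: "bij p" using p permutes_imp_bij by blast
    note [measurable] = sq_int_measurable[OF r(1)] sq_int_measurable[OF sq_int_tensor[OF M f]]
      sq_int_measurable[OF sq_int_tensor[OF M, of "f \<circ> p"]]
    have tm[measurable]: "tensor (f \<circ> p) \<in> borel_measurable (PiU M)"
      by (rule sq_int_measurable[OF sq_int_tensor[OF M]]) (simp add: f)
    have meas[measurable]: "(\<lambda>X. X \<circ> p) \<in> measurable (PiU M) (PiU M)"
      unfolding comp_def by (rule measurable_abs_UNIV) measurable
    have "ip (PiU M) (tensor (f \<circ> p)) r = (\<integral>X. cnj (tensor (f \<circ> p) X) * r X \<partial>distr (PiU M) (PiU M) (\<lambda>X. X \<circ> p))"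
      by (simp add: ip_def distr_PiM_permute[OF M bp])
    also have "\<dots> = (\<integral>X. cnj (tensor (f \<circ> p) (X \<circ> p)) * r (X \<circ> p) \<partial>PiU M)"
      by (rule integral_distr) measurable
    also have "\<dots> = (\<integral>X. of_int (sign p) * (cnj (tensor f X) * r X) \<partial>PiU M)"
      using r(2) p by (simp add: tensor_comp_perm antisymmetric_def mult.commute mult.left_commute)
    finally show ?thesis by (simp add: ip_def)
  qed
  have "ip (PiU M) (slater f) r = (\<Sum>p\<in>{p. p permutes UNIV}. ip (PiU M) (\<lambda>X. of_int (sign p) * tensor (f \<circ> p) X) r)"
    unfolding slater_def
    by (rule ip_sum_left[OF r(1)]) (intro sq_int_cmult sq_int_tensor[OF M], simp add: f)
  also have "\<dots> = (\<Sum>p\<in>{p. p permutes (UNIV::'n set)}. ip (PiU M) (tensor f) r)"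
  proof (rule sum.cong[OF refl])
    fix p :: "'n \<Rightarrow> 'n" assume "p \<in> {p. p permutes UNIV}"
    then have "ip (PiU M) (\<lambda>X. of_int (sign p) * tensor (f \<circ> p) X) r = of_int (sign p) * (of_int (sign p) * ip (PiU M) (tensor f) r)"
      by (simp add: ip_cmult_left one)
    then show "ip (PiU M) (\<lambda>X. of_int (sign p) * tensor (f \<circ> p) X) r = ip (PiU M) (tensor f) r"
      by (simp add: mult.assoc[symmetric])
  qed
  also have "\<dots> = fact CARD('n) * ip (PiU M) (tensor f) r"
    by (simp add: card_permutations[OF refl])
  finally show ?thesis .
qed

lemma slater_comp_perm:
  assumes p: "p permutes UNIV"
  shows "slater (f \<circ> p) X = of_int (sign p) * slater f X"
  using det_permute_rows[OF p, of "\<chi> i j. f i (X j)"] by (simp add: slater_det)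

lemma slater_eq_0:
  assumes "i \<noteq> j" "f i = f j" shows "slater f X = 0"
  unfolding slater_det by (rule det_identical_rows[OF assms(1)]) (simp add: row_def assms(2))

section \<open>Pair interactions and the tangent space\<close>

lemma sq_int_swap:
  assumes M: "sigma_finite_measure M" and g: "sq_int (M \<Otimes>\<^sub>M M) g"
  shows "sq_int (M \<Otimes>\<^sub>M M) (\<lambda>(x, y). g (y, x))"
proof -
  interpret pair_sigma_finite M M using M by (simp add: pair_sigma_finite_def)
  have "integrable (M \<Otimes>\<^sub>M M) (\<lambda>(x, y). (norm (g (y, x)))\<^sup>2)"
    using integrable_product_swap[OF sq_int_integrable[OF g]] .
  moreover note [measurable] = sq_int_measurable[OF g]
  have "(\<lambda>(x, y). g (y, x)) \<in> borel_measurable (M \<Otimes>\<^sub>M M)" by measurable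
  ultimately show ?thesis by (simp add: sq_int_def case_prod_unfold)
qed

lemma sq_int_pair:
  assumes M: "sigma_finite_measure M" and f: "sq_int M f" and g: "sq_int M g"
  shows "sq_int (M \<Otimes>\<^sub>M M) (\<lambda>(x, y). f x * g y)"
proof -
  interpret pair_sigma_finite M M using M by (simp add: pair_sigma_finite_def)
  note [measurable] = sq_int_measurable[OF f] sq_int_measurable[OF g]
  have "integrable (M \<Otimes>\<^sub>M M) (\<lambda>(x, y). (norm (f x * g y))\<^sup>2)"
  proof (rule Fubini_integrable)
    show "(\<lambda>(x, y). (norm (f x * g y))\<^sup>2) \<in> borel_measurable (M \<Otimes>\<^sub>M M)" by measurable
    show "AE x in M. integrable M (\<lambda>y. case (x, y) of (x, y) \<Rightarrow> (norm (f x * g y))\<^sup>2)"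
      using sq_int_integrable[OF g] by (auto simp: norm_mult power_mult_distrib)
    have "(\<lambda>x. \<integral>y. norm (case (x, y) of (x, y) \<Rightarrow> (norm (f x * g y))\<^sup>2) \<partial>M) = (\<lambda>x. (norm (f x))\<^sup>2 * (nrm M g)\<^sup>2)"
      by (simp add: norm_mult power_mult_distrib nrm_sq)
    then show "integrable M (\<lambda>x. \<integral>y. norm (case (x, y) of (x, y) \<Rightarrow> (norm (f x * g y))\<^sup>2) \<partial>M)"
      using sq_int_integrable[OF f] by simp
  qed
  moreover have "(\<lambda>(x, y). f x * g y) \<in> borel_measurable (M \<Otimes>\<^sub>M M)" by measurable
  ultimately show ?thesis by (simp add: sq_int_def case_prod_unfold)
qed

lemma AE_sq_int_slice:
  assumes M: "sigma_finite_measure M" and g: "sq_int (M \<Otimes>\<^sub>M M) g"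
  shows "AE x in M. sq_int M (\<lambda>y. g (x, y))"
proof -
  interpret pair_sigma_finite M M using M by (simp add: pair_sigma_finite_def)
  note [measurable] = sq_int_measurable[OF g]
  have "AE x in M. integrable M (\<lambda>y. (norm (g (x, y)))\<^sup>2)"
    by (rule AE_integrable_fst') (rule sq_int_integrable[OF g])
  then show ?thesis using AE_space
    by eventually_elim (simp add: sq_int_def)
qed

text \<open>Cauchy-Schwarz on each slice bounds the partial product by the norm of the slice, whose
  square is integrable by Fubini.\<close>

lemma sq_int_partial_ip:
  assumes M: "sigma_finite_measure M" and f: "sq_int M f" and g: "sq_int (M \<Otimes>\<^sub>M M) g"
  shows "sq_int M (\<lambda>x. ip M f (\<lambda>y. g (x, y)))"
proof -
  interpret pair_sigma_finite M M using M by (simp add: pair_sigma_finite_def)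
  note [measurable] = sq_int_measurable[OF g] sq_int_measurable[OF f]
  have meas[measurable]: "(\<lambda>x. ip M f (\<lambda>y. g (x, y))) \<in> borel_measurable M"
    unfolding ip_def by measurable
  have int: "integrable M (\<lambda>x. \<integral>y. (norm (g (x, y)))\<^sup>2 \<partial>M)"
    by (rule integrable_fst') (rule sq_int_integrable[OF g])
  have "integrable M (\<lambda>x. (norm (ip M f (\<lambda>y. g (x, y))))\<^sup>2)"
  proof (rule Bochner_Integration.integrable_bound)
    show "integrable M (\<lambda>x. (nrm M f)\<^sup>2 * (\<integral>y. (norm (g (x, y)))\<^sup>2 \<partial>M))" using int by simp
    show "AE x in M. norm ((norm (ip M f (\<lambda>y. g (x, y))))\<^sup>2) \<le> norm ((nrm M f)\<^sup>2 * (\<integral>y. (norm (g (x, y)))\<^sup>2 \<partial>M))"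
      using AE_sq_int_slice[OF M g]
    proof eventually_elim
      case (elim x)
      have "(norm (ip M f (\<lambda>y. g (x, y))))\<^sup>2 \<le> (nrm M f * nrm M (\<lambda>y. g (x, y)))\<^sup>2"
        by (intro power_mono ip_Cauchy_Schwarz f elim) simp
      also have "\<dots> = (nrm M f)\<^sup>2 * (\<integral>y. (norm (g (x, y)))\<^sup>2 \<partial>M)"
        by (simp add: power_mult_distrib nrm_sq[of M "\<lambda>y. g (x, y)"])
      finally show ?case by simp
    qed
  qed measurable
  then show ?thesis by (simp add: sq_int_def)
qed

text \<open>The double projection \<open>(1 - P) \<otimes> (1 - P)\<close> of \<open>g\<close>, where \<open>P\<close> projects onto the span
  of the orbitals, differs from \<open>g\<close> only by terms with one factor in that span.\<close>

lemma two_particle_split: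
  fixes \<phi> :: "'n::finite \<Rightarrow> 'a \<Rightarrow> complex"
  assumes M: "sigma_finite_measure M" and \<phi>: "\<And>c. sq_int M (\<phi> c)"
    and orth: "\<And>c d. ip M (\<phi> c) (\<phi> d) = (if c = d then 1 else 0)"
    and g: "sq_int (M \<Otimes>\<^sub>M M) g"
  shows "\<exists>\<alpha> \<beta>. (\<forall>c. sq_int M (\<alpha> c) \<and> sq_int M (\<beta> c)) \<and>
    (AE x in M. sq_int M (\<lambda>y. g (x, y) - (\<Sum>c\<in>UNIV. \<phi> c x * \<alpha> c y) - (\<Sum>c\<in>UNIV. \<beta> c x * \<phi> c y)) \<and>
       (\<forall>d. ip M (\<phi> d) (\<lambda>y. g (x, y) - (\<Sum>c\<in>UNIV. \<phi> c x * \<alpha> c y) - (\<Sum>c\<in>UNIV. \<beta> c x * \<phi> c y)) = 0)) \<and>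
    (AE y in M. sq_int M (\<lambda>x. g (x, y) - (\<Sum>c\<in>UNIV. \<phi> c x * \<alpha> c y) - (\<Sum>c\<in>UNIV. \<beta> c x * \<phi> c y)) \<and>
       (\<forall>d. ip M (\<phi> d) (\<lambda>x. g (x, y) - (\<Sum>c\<in>UNIV. \<phi> c x * \<alpha> c y) - (\<Sum>c\<in>UNIV. \<beta> c x * \<phi> c y)) = 0))"
proof -
  interpret pair_sigma_finite M M using M by (simp add: pair_sigma_finite_def)
  note [measurable] = sq_int_measurable[OF g] sq_int_measurable[OF \<phi>]
  \<comment> \<open>The component of \<open>g\<close> along the orbitals in the second variable;
    \<open>h1\<close> is what remains after removing it.\<close>
  define \<beta> where "\<beta> c x = ip M (\<phi> c) (\<lambda>y. g (x, y))" for c x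
  have \<beta>: "sq_int M (\<beta> c)" for c
    unfolding \<beta>_def by (rule sq_int_partial_ip[OF M \<phi> g])
  define h1 where "h1 = (\<lambda>(x, y). g (x, y) - (\<Sum>c\<in>UNIV. \<beta> c x * \<phi> c y))"
  have h1: "sq_int (M \<Otimes>\<^sub>M M) h1"
  proof -
    have "sq_int (M \<Otimes>\<^sub>M M) (\<lambda>z. g z - (\<Sum>c\<in>UNIV. (\<lambda>(x, y). \<beta> c x * \<phi> c y) z))"
      by (intro sq_int_diff sq_int_sum g sq_int_pair[OF M \<beta> \<phi>])
    then show ?thesis by (simp add: h1_def case_prod_unfold)
  qed
  note [measurable] = sq_int_measurable[OF h1]
  have h1x: "AE x in M. sq_int M (\<lambda>y. h1 (x, y)) \<and> (\<forall>d. ip M (\<phi> d) (\<lambda>y. h1 (x, y)) = 0)"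
    using AE_sq_int_slice[OF M g] AE_sq_int_slice[OF M h1]
  proof eventually_elim
    case (elim x)
    have "ip M (\<phi> d) (\<lambda>y. h1 (x, y)) = 0" for d
    proof -
      have "ip M (\<phi> d) (\<lambda>y. h1 (x, y)) = ip M (\<phi> d) (\<lambda>y. g (x, y)) - (\<Sum>c\<in>UNIV. ip M (\<phi> d) (\<lambda>y. \<beta> c x * \<phi> c y))"
        unfolding h1_def by (simp add: ip_diff_right ip_sum_right elim \<phi> sq_int_sum sq_int_cmult)
      also have "\<dots> = 0"
        by (simp add: ip_cmult_right orth \<beta>_def if_distrib[of "\<lambda>x. _ * x"] cong: if_cong)
      finally show ?thesis .
    qed
    with elim show ?case by simp
  qed
  \<comment> \<open>The component along the orbitals in the first variable, taken of
    \<open>h1\<close> and not of \<open>g\<close>: the two projections act one after the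
    other.\<close>
  define \<alpha> where "\<alpha> c y = ip M (\<phi> c) (\<lambda>x. h1 (x, y))" for c y
  have \<alpha>: "sq_int M (\<alpha> c)" for c
    using sq_int_partial_ip[OF M \<phi>[of c] sq_int_swap[OF M h1]] by (simp add: \<alpha>_def[abs_def])
  \<comment> \<open>The second projection must not spoil the first. It does not, because
    \<open>\<alpha> c\<close> inherits from \<open>h1\<close> the orthogonality to all orbitals;
    exchanging the order of integration shows this.\<close>
  have \<phi>\<alpha>: "ip M (\<phi> d) (\<alpha> c) = 0" for c d
  proof -
    have int: "integrable (M \<Otimes>\<^sub>M M) (\<lambda>(x, y). cnj (\<phi> c x) * (cnj (\<phi> d y) * h1 (x, y)))"
    proof -
      have "integrable (M \<Otimes>\<^sub>M M) (\<lambda>z. cnj ((\<lambda>(x, y). \<phi> c x * \<phi> d y) z) * h1 z)"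
        by (rule integrable_ip[OF sq_int_pair[OF M \<phi> \<phi>] h1])
      then show ?thesis by (simp add: case_prod_unfold mult.assoc)
    qed
    have "ip M (\<phi> d) (\<alpha> c) = (\<integral>y. (\<integral>x. cnj (\<phi> c x) * (cnj (\<phi> d y) * h1 (x, y)) \<partial>M) \<partial>M)"
      unfolding ip_def \<alpha>_def
      by (subst Bochner_Integration.integral_mult_right_zero[symmetric]) (simp add: mult.commute mult.left_commute)
    also have "\<dots> = (\<integral>x. (\<integral>y. cnj (\<phi> c x) * (cnj (\<phi> d y) * h1 (x, y)) \<partial>M) \<partial>M)"
      by (rule Fubini_integral[OF int])
    also have "\<dots> = 0"
    proof (rule integral_eq_zero_AE)
      show "AE x in M. (\<integral>y. cnj (\<phi> c x) * (cnj (\<phi> d y) * h1 (x, y)) \<partial>M) = 0"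
        using h1x by eventually_elim (simp add: ip_def)
    qed
    finally show ?thesis .
  qed
  have eq: "g (x, y) - (\<Sum>c\<in>UNIV. \<phi> c x * \<alpha> c y) - (\<Sum>c\<in>UNIV. \<beta> c x * \<phi> c y) = h1 (x, y) - (\<Sum>c\<in>UNIV. \<phi> c x * \<alpha> c y)" for x y
    by (simp add: h1_def)
  show ?thesis
  proof (rule exI[of _ \<alpha>], rule exI[of _ \<beta>], unfold eq, intro conjI allI \<alpha> \<beta>)
    show "AE x in M. sq_int M (\<lambda>y. h1 (x, y) - (\<Sum>c\<in>UNIV. \<phi> c x * \<alpha> c y)) \<and>
       (\<forall>d. ip M (\<phi> d) (\<lambda>y. h1 (x, y) - (\<Sum>c\<in>UNIV. \<phi> c x * \<alpha> c y)) = 0)"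
      using h1x
    proof eventually_elim
      case (elim x)
      have c: "sq_int M (\<lambda>y. \<phi> c x * \<alpha> c y)" for c by (rule sq_int_cmult[OF \<alpha>])
      have "ip M (\<phi> d) (\<lambda>y. h1 (x, y) - (\<Sum>c\<in>UNIV. \<phi> c x * \<alpha> c y)) = 0" for d
        using elim by (simp add: ip_diff_right ip_sum_right c \<phi> sq_int_sum ip_cmult_right \<phi>\<alpha>)
      then show ?case using elim c by (auto intro!: sq_int_diff sq_int_sum)
    qed
    show "AE y in M. sq_int M (\<lambda>x. h1 (x, y) - (\<Sum>c\<in>UNIV. \<phi> c x * \<alpha> c y)) \<and>
       (\<forall>d. ip M (\<phi> d) (\<lambda>x. h1 (x, y) - (\<Sum>c\<in>UNIV. \<phi> c x * \<alpha> c y)) = 0)"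
      using AE_sq_int_slice[OF M sq_int_swap[OF M h1]]
    proof eventually_elim
      case (elim y)
      then have s: "sq_int M (\<lambda>x. h1 (x, y))" by simp
      have c: "sq_int M (\<lambda>x. \<phi> c x * \<alpha> c y)" for c
        using sq_int_cmult[OF \<phi>, of "\<alpha> c y" c] by (simp add: mult.commute)
      have "ip M (\<phi> d) (\<lambda>x. \<phi> c x * \<alpha> c y) = \<alpha> c y * (if d = c then 1 else 0)" for c d
        using ip_cmult_right[of M "\<phi> d" "\<alpha> c y" "\<phi> c"] by (simp add: mult.commute orth)
      then have "ip M (\<phi> d) (\<lambda>x. h1 (x, y) - (\<Sum>c\<in>UNIV. \<phi> c x * \<alpha> c y)) = 0" for d
        by (simp add: ip_diff_right ip_sum_right s c \<phi> sq_int_sum if_distrib[of "\<lambda>x. _ * x"] cong: if_cong)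
           (simp add: \<alpha>_def)
      then show ?case using s c by (auto intro!: sq_int_diff sq_int_sum)
    qed
  qed
qed

text \<open>Only slot \<open>i\<close> may hold a foreign function. If two other slots share an
  orbital, the determinant has equal rows; otherwise they miss exactly one orbital \<open>j\<close>,
  and up to a permutation the determinant is that of the orbitals with \<open>j\<close> replaced by
  \<open>f i\<close>, which \<open>perp\<close> covers.\<close>

lemma ip_tensor_almost_occupied:
  fixes \<phi> :: "'n::finite \<Rightarrow> 'a \<Rightarrow> complex"
  assumes M: "sigma_finite_measure M" and f: "\<And>k. sq_int M (f k)"
    and r: "sq_int (PiU M) r" "antisymmetric r"
    and perp: "\<And>i \<psi>. sq_int M \<psi> \<Longrightarrow> ip (PiU M) (slater (\<phi>(i := \<psi>))) r = 0"
    and occ: "\<And>k. k \<noteq> i \<Longrightarrow> f k \<in> range \<phi>"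
  shows "ip (PiU M) (tensor f) r = 0"
proof -
  have "ip (PiU M) (slater f) r = 0"
  proof -
    from occ have "\<forall>k. \<exists>c. k \<noteq> i \<longrightarrow> f k = \<phi> c" by blast
    then obtain \<kappa> where \<kappa>: "\<And>k. k \<noteq> i \<Longrightarrow> f k = \<phi> (\<kappa> k)" by metis
    show ?thesis
    proof (cases "inj_on \<kappa> (UNIV - {i})")
      case False
      then obtain k l where "k \<noteq> i" "l \<noteq> i" "k \<noteq> l" "\<kappa> k = \<kappa> l" by (auto simp: inj_on_def)
      with \<kappa> have "f k = f l" by simp
      with \<open>k \<noteq> l\<close> have "slater f = (\<lambda>X. 0)" by (intro ext) (rule slater_eq_0)
      then show ?thesis by simp
    next
      case True
      have "card (\<kappa> ` (UNIV - {i})) < CARD('n)"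
        using True by (simp add: card_image card_Diff_singleton)
      then obtain j where j: "j \<notin> \<kappa> ` (UNIV - {i})" by (metis UNIV_eq_I less_irrefl)
      \<comment> \<open>Sending the foreign slot to the missing label completes the injective
        labelling to a permutation.\<close>
      define p where "p = \<kappa>(i := j)"
      have "inj p" unfolding p_def inj_on_def
      proof (intro ballI impI)
        fix x y assume e: "(\<kappa>(i := j)) x = (\<kappa>(i := j)) y"
        show "x = y"
          using e j True by (cases "x = i"; cases "y = i") (auto simp: inj_on_def)
      qed
      then have "bij p" by (simp add: bij_def finite_UNIV_inj_surj)
      then have p: "p permutes UNIV" by (auto intro: bij_imp_permutes)
      have "f = \<phi>(j := f i) \<circ> p"
        using \<kappa> j by (auto simp: p_def fun_eq_iff)
      then have "slater f = (\<lambda>X. of_int (sign p) * slater (\<phi>(j := f i)) X)"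
        using slater_comp_perm[OF p] by metis
      then show ?thesis using perp[OF f[of i], of j] by (simp add: ip_cmult_left)
    qed
  qed
  then show ?thesis using ip_slater_antisymmetric[OF M f r] by simp
qed

text \<open>The Slater sum with the factors of particles \<open>i\<close> and \<open>j\<close>
  replaced by a two-body function that may depend on the orbital labels they carry. This dependence
  makes it possible to project \<open>v x y * (\<phi> a x * \<phi> b y)\<close> separately for every
  pair of labels.\<close>

definition pair_slater ::
  "('n::finite \<Rightarrow> 'a \<Rightarrow> complex) \<Rightarrow> ('n \<Rightarrow> 'n \<Rightarrow> 'a \<Rightarrow> 'a \<Rightarrow> complex) \<Rightarrow> 'n \<Rightarrow> 'n \<Rightarrow> ('n \<Rightarrow> 'a) \<Rightarrow> complex" where
  "pair_slater \<phi> h i j X = (\<Sum>p\<in>{p. p permutes UNIV}.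
     of_int (sign p) * (h (p i) (p j) (X i) (X j) * (\<Prod>k\<in>UNIV - {i, j}. \<phi> (p k) (X k))))"

lemma pair_slater_potential:
  assumes "i \<noteq> j"
  shows "pair_slater \<phi> (\<lambda>a b x y. v x y * (\<phi> a x * \<phi> b y)) i j X = v (X i) (X j) * slater \<phi> X"
proof -
  have "(\<Prod>k\<in>UNIV. \<phi> (p k) (X k)) = \<phi> (p i) (X i) * \<phi> (p j) (X j) * (\<Prod>k\<in>UNIV - {i, j}. \<phi> (p k) (X k))" for p
  proof -
    have "(UNIV::'a set) = insert i (insert j (UNIV - {i, j}))" by auto
    then have "(\<Prod>k\<in>UNIV. \<phi> (p k) (X k)) = (\<Prod>k\<in>insert i (insert j (UNIV - {i, j})). \<phi> (p k) (X k))" by simp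
    also have "\<dots> = \<phi> (p i) (X i) * \<phi> (p j) (X j) * (\<Prod>k\<in>UNIV - {i, j}. \<phi> (p k) (X k))"
      using assms by (subst prod.insert; simp)
    finally show ?thesis .
  qed
  then show ?thesis
    by (simp add: pair_slater_def slater_def tensor_def sum_distrib_left mult_ac)
qed

lemma pair_slater_product:
  assumes "i \<noteq> j"
  shows "of_int (sign p) * (f (X i) * g (X j) * (\<Prod>k\<in>UNIV - {i, j}. \<phi> (p k) (X k))) =
    of_int (sign p) * tensor ((\<phi> \<circ> p)(i := f, j := g)) X"
proof -
  have "(\<Prod>k\<in>UNIV. ((\<phi> \<circ> p)(i := f, j := g)) k (X k)) = f (X i) * g (X j) * (\<Prod>k\<in>UNIV - {i, j}. \<phi> (p k) (X k))"
  proof -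
    have "(UNIV::'a set) = insert i (insert j (UNIV - {i, j}))" by auto
    then have "(\<Prod>k\<in>UNIV. ((\<phi> \<circ> p)(i := f, j := g)) k (X k)) = (\<Prod>k\<in>insert i (insert j (UNIV - {i, j})). ((\<phi> \<circ> p)(i := f, j := g)) k (X k))" by simp
    also have "\<dots> = f (X i) * (g (X j) * (\<Prod>k\<in>UNIV - {i, j}. ((\<phi> \<circ> p)(i := f, j := g)) k (X k)))"
      using assms by (subst prod.insert; simp)
    also have "(\<Prod>k\<in>UNIV - {i, j}. ((\<phi> \<circ> p)(i := f, j := g)) k (X k)) = (\<Prod>k\<in>UNIV - {i, j}. \<phi> (p k) (X k))"
      by (rule prod.cong) auto
    finally show ?thesis by (simp only: mult.assoc)
  qed
  then show ?thesis by (simp only: tensor_def)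
qed

text \<open>With all coordinates but \<open>j\<close> fixed, \<open>E\<close> and the spectator
  orbitals are constants, and each permutation contributes a multiple of the product of
  \<open>\<phi> c\<close> with a slice of \<open>h\<close>, which is zero. Slices are good for
  almost every first argument, so this is transported to coordinate \<open>i\<close>.\<close>

lemma ip_pair_slater_zero_snd:
  fixes \<phi> :: "'n::finite \<Rightarrow> 'a \<Rightarrow> complex"
  assumes M: "sigma_finite_measure M" and \<phi>: "\<And>c. sq_int M (\<phi> c)" and ij: "i \<noteq> j"
    and y: "sq_int (PiU M) (pair_slater \<phi> h i j)"
    and F: "sq_int (PiU M) (\<lambda>X. \<phi> c (X j) * E X)" and E: "\<And>X y. E (X(j := y)) = E X"
    and h: "\<And>a b. AE x in M. sq_int M (\<lambda>y. h a b x y) \<and> (\<forall>d. ip M (\<phi> d) (\<lambda>y. h a b x y) = 0)"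
  shows "ip (PiU M) (\<lambda>X. \<phi> c (X j) * E X) (pair_slater \<phi> h i j) = 0"
  unfolding ip_def
proof (rule integral_PiM_coordinate_zero[OF M integrable_ip[OF F y]])
  let ?P = "\<lambda>x. \<forall>a b. sq_int M (\<lambda>y. h a b x y) \<and> (\<forall>d. ip M (\<phi> d) (\<lambda>y. h a b x y) = 0)"
  have "AE x in M. ?P x" using h by (simp add: AE_all_countable)
  then have "AE X in PiM (UNIV - {j}) (\<lambda>_. M). ?P (X i)"
    by (intro AE_PiM_coordinate[OF M]) (use ij in auto)
  then show "AE X in PiM (UNIV - {j}) (\<lambda>_. M).
     (\<integral>y. cnj (\<phi> c ((X(j := y)) j) * E (X(j := y))) * pair_slater \<phi> h i j (X(j := y)) \<partial>M) = 0"
  proof eventually_elim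
    case (elim X)
    define B where "B p = (\<Prod>k\<in>UNIV - {i, j}. \<phi> (p k) (X k))" for p
    have int: "integrable M (\<lambda>y. cnj (\<phi> c y) * h (p i) (p j) (X i) y)" for p
      using integrable_ip[OF \<phi>] elim by blast
    have B: "(\<Prod>k\<in>UNIV - {i, j}. \<phi> (p k) ((X(j := y)) k)) = B p" for p y
      unfolding B_def by (rule prod.cong) auto
    have "cnj (\<phi> c ((X(j := y)) j) * E (X(j := y))) * pair_slater \<phi> h i j (X(j := y)) =
       (\<Sum>p\<in>{p. p permutes UNIV}. (cnj (E X) * of_int (sign p) * B p) * (cnj (\<phi> c y) * h (p i) (p j) (X i) y))" for y
      unfolding pair_slater_def B using ij by (simp add: E sum_distrib_left mult_ac)
    then have "(\<integral>y. cnj (\<phi> c ((X(j := y)) j) * E (X(j := y))) * pair_slater \<phi> h i j (X(j := y)) \<partial>M) =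
       (\<integral>y. (\<Sum>p\<in>{p. p permutes UNIV}. (cnj (E X) * of_int (sign p) * B p) * (cnj (\<phi> c y) * h (p i) (p j) (X i) y)) \<partial>M)"
      by simp
    also have "\<dots> = (\<Sum>p\<in>{p. p permutes UNIV}. (cnj (E X) * of_int (sign p) * B p) * ip M (\<phi> c) (\<lambda>y. h (p i) (p j) (X i) y))"
      using int by (subst Bochner_Integration.integral_sum) (auto simp: ip_def)
    also have "\<dots> = 0" using elim by simp
    finally show ?case .
  qed
qed

lemma pair_slater_swap:
  "pair_slater \<phi> h i j = pair_slater \<phi> (\<lambda>a b x y. h b a y x) j i"
  by (rule ext) (simp add: pair_slater_def insert_commute)

text \<open>Exchanging the roles of the two particles reduces this to the case of the second
  variable.\<close>

lemma ip_pair_slater_zero_fst: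
  fixes \<phi> :: "'n::finite \<Rightarrow> 'a \<Rightarrow> complex"
  assumes M: "sigma_finite_measure M" and \<phi>: "\<And>c. sq_int M (\<phi> c)" and ij: "i \<noteq> j"
    and y: "sq_int (PiU M) (pair_slater \<phi> h i j)"
    and F: "sq_int (PiU M) (\<lambda>X. \<phi> c (X i) * E X)" and E: "\<And>X y. E (X(i := y)) = E X"
    and h: "\<And>a b. AE y in M. sq_int M (\<lambda>x. h a b x y) \<and> (\<forall>d. ip M (\<phi> d) (\<lambda>x. h a b x y) = 0)"
  shows "ip (PiU M) (\<lambda>X. \<phi> c (X i) * E X) (pair_slater \<phi> h i j) = 0"
  unfolding pair_slater_swap[of \<phi> h i j]
  by (rule ip_pair_slater_zero_snd[OF M \<phi> ij[symmetric] y[unfolded pair_slater_swap[of \<phi> h i j]] F E h])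

text \<open>Pairs off the diagonal are halved by the swap; this count is the origin of
  \<open>N (N - 1) / 2\<close>.\<close>

lemma card_less_pairs:
  "2 * card {(i::'n::{finite,linorder}, j). i < j} = CARD('n) * (CARD('n) - 1)"
proof -
  let ?P = "{(i::'n, j). i < j}" and ?Q = "{(i::'n, j). j < i}"
  have "bij_betw prod.swap ?P ?Q" by (rule bij_betwI[of _ _ _ prod.swap]) auto
  then have c: "card ?P = card ?Q" by (rule bij_betw_same_card)
  have "(UNIV :: ('n \<times> 'n) set) = (?P \<union> ?Q) \<union> (\<lambda>i. (i, i)) ` UNIV" by (auto simp: image_iff)
  then have "CARD('n \<times> 'n) = card ((?P \<union> ?Q) \<union> (\<lambda>i::'n. (i, i)) ` UNIV)" by simp
  also have "\<dots> = card ?P + card ?Q + card ((\<lambda>i::'n. (i, i)) ` UNIV)"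
    by (subst card_Un_disjoint; (subst card_Un_disjoint)?) (auto simp: card_Un_disjoint)
  also have "card ((\<lambda>i::'n. (i, i)) ` UNIV) = CARD('n)" by (rule card_image) (auto simp: inj_on_def)
  finally have "CARD('n) * CARD('n) = 2 * card ?P + CARD('n)" using c by (simp add: card_prod)
  then show ?thesis by (simp add: right_diff_distrib')
qed

text \<open>Cauchy-Schwarz is applied once, to the sum over all pairs; estimating pair by pair would
  cost the number of pairs instead of its square root. The determinant is unnormalised here, so its
  norm stays in the bound.\<close>

lemma pair_potential_bound:
  fixes \<phi> :: "'n::{finite,linorder} \<Rightarrow> 'a \<Rightarrow> complex" and v :: "'a \<Rightarrow> 'a \<Rightarrow> real"
  assumes M: "sigma_finite_measure M" and \<phi>: "\<And>c. sq_int M (\<phi> c)"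
    and orth: "\<And>c d. ip M (\<phi> c) (\<phi> d) = (if c = d then 1 else 0)"
    and r: "sq_int (PiU M) r" "antisymmetric r"
    and perp: "\<And>i \<psi>. sq_int M \<psi> \<Longrightarrow> ip (PiU M) (slater (\<phi>(i := \<psi>))) r = 0"
    and v[measurable]: "(\<lambda>(x, y). v x y) \<in> borel_measurable (M \<Otimes>\<^sub>M M)"
    and vC: "\<And>x y. \<bar>v x y\<bar> \<le> C"
  shows "norm (ip (PiU M) r (\<lambda>X. of_real (\<Sum>(i, j)\<in>{(i, j). i < j}. v (X i) (X j)) * slater \<phi> X))
    \<le> nrm (PiU M) r * (C * sqrt (real (CARD('n) * (CARD('n) - 1)) / 2) * nrm (PiU M) (slater \<phi>))"
proof -
  have C0: "C \<ge> 0" using vC[of undefined undefined] by linarith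
  note [measurable] = sq_int_measurable[OF \<phi>]
  define g where "g a b x y = of_real (v x y) * (\<phi> a x * \<phi> b y)" for a b x y
  have g: "sq_int (M \<Otimes>\<^sub>M M) (\<lambda>(x, y). g a b x y)" for a b
  proof -
    have "sq_int (M \<Otimes>\<^sub>M M) (\<lambda>z. of_real ((\<lambda>(x, y). v x y) z) * (\<lambda>(x, y). \<phi> a x * \<phi> b y) z)"
      by (rule sq_int_mult_bounded[where C=C]) (auto intro: sq_int_pair[OF M \<phi> \<phi>] vC)
    then show ?thesis by (simp add: g_def case_prod_unfold)
  qed
  \<comment> \<open>The splitting gets a name so that its coefficient functions can be chosen
    simultaneously for all pairs of labels \<open>a\<close>, \<open>b\<close>.\<close>
  define Q where "Q a b \<alpha> \<beta> \<longleftrightarrow> (\<forall>c. sq_int M (\<alpha> c) \<and> sq_int M (\<beta> c)) \<and>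
    (AE x in M. sq_int M (\<lambda>y. g a b x y - (\<Sum>c\<in>UNIV. \<phi> c x * \<alpha> c y) - (\<Sum>c\<in>UNIV. \<beta> c x * \<phi> c y)) \<and>
       (\<forall>d. ip M (\<phi> d) (\<lambda>y. g a b x y - (\<Sum>c\<in>UNIV. \<phi> c x * \<alpha> c y) - (\<Sum>c\<in>UNIV. \<beta> c x * \<phi> c y)) = 0)) \<and>
    (AE y in M. sq_int M (\<lambda>x. g a b x y - (\<Sum>c\<in>UNIV. \<phi> c x * \<alpha> c y) - (\<Sum>c\<in>UNIV. \<beta> c x * \<phi> c y)) \<and>
       (\<forall>d. ip M (\<phi> d) (\<lambda>x. g a b x y - (\<Sum>c\<in>UNIV. \<phi> c x * \<alpha> c y) - (\<Sum>c\<in>UNIV. \<beta> c x * \<phi> c y)) = 0))"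
    for a b and \<alpha> \<beta> :: "'n \<Rightarrow> 'a \<Rightarrow> complex"
  have "\<forall>a b. \<exists>\<alpha> \<beta>. Q a b \<alpha> \<beta>"
    using two_particle_split[OF M \<phi> orth g] by (simp add: Q_def)
  then obtain \<alpha> \<beta> where \<alpha>\<beta>: "\<And>a b. Q a b (\<alpha> a b) (\<beta> a b)" by metis
  have \<alpha>: "sq_int M (\<alpha> a b c)" and \<beta>: "sq_int M (\<beta> a b c)" for a b c using \<alpha>\<beta>[of a b] unfolding Q_def by auto
  define h where "h a b x y = g a b x y - (\<Sum>c\<in>UNIV. \<phi> c x * \<alpha> a b c y) - (\<Sum>c\<in>UNIV. \<beta> a b c x * \<phi> c y)" for a b x y
  have hx: "AE x in M. sq_int M (\<lambda>y. h a b x y) \<and> (\<forall>d. ip M (\<phi> d) (\<lambda>y. h a b x y) = 0)"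
    and hy: "AE y in M. sq_int M (\<lambda>x. h a b x y) \<and> (\<forall>d. ip M (\<phi> d) (\<lambda>x. h a b x y) = 0)" for a b
    unfolding h_def using \<alpha>\<beta>[of a b] unfolding Q_def by simp_all
  define w where "w i j X = of_real (v (X i) (X j)) * slater \<phi> X" for i j :: 'n and X
  define y where "y i j = pair_slater \<phi> h i j" for i j
  have sl: "sq_int (PiU M) (slater \<phi>)" by (rule sq_int_slater[OF M \<phi>])
  have w: "sq_int (PiU M) (w i j)" and wn: "nrm (PiU M) (w i j) \<le> C * nrm (PiU M) (slater \<phi>)" for i j
  proof -
    have m[measurable]: "(\<lambda>X. (X i, X j)) \<in> measurable (PiU M) (M \<Otimes>\<^sub>M M)" by measurable
    have m2[measurable]: "(\<lambda>X. v (X i) (X j)) \<in> borel_measurable (PiU M)"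
      using measurable_compose[OF m v] by simp
    show 1: "sq_int (PiU M) (w i j)" unfolding w_def
      by (rule sq_int_mult_bounded[OF _ sl, where C=C]) (auto simp: vC)
    show "nrm (PiU M) (w i j) \<le> C * nrm (PiU M) (slater \<phi>)"
      by (rule nrm_mono_AE[OF sq_int_measurable[OF 1] sl C0])
         (auto simp: w_def norm_mult vC intro!: mult_right_mono)
  qed
  \<comment> \<open>An elementary discarded term: slots \<open>i\<close> and \<open>j\<close> hold
    \<open>f\<close> and \<open>g\<close>, all others the permuted orbitals.\<close>
  define T where "T i j p f g = (\<lambda>X. of_int (sign p) * tensor ((\<phi> \<circ> p)(i := f, j := g)) X :: complex)" for i j p f g
  have T: "sq_int (PiU M) (T i j p f g)" if "sq_int M f" "sq_int M g" for i j p f g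
    unfolding T_def by (intro sq_int_cmult sq_int_tensor[OF M]) (auto simp: \<phi> that)
  have wy: "w i j X - y i j X = (\<Sum>p\<in>{p. p permutes UNIV}. \<Sum>c\<in>UNIV.
      T i j p (\<phi> c) (\<alpha> (p i) (p j) c) X + T i j p (\<beta> (p i) (p j) c) (\<phi> c) X)" if "i \<noteq> j" for i j X
  proof -
    have "w i j X = pair_slater \<phi> g i j X"
      using pair_slater_potential[OF that, of \<phi> "\<lambda>x y. of_real (v x y)" X] by (simp add: w_def g_def[abs_def])
    then have "w i j X - y i j X = (\<Sum>p\<in>{p. p permutes UNIV}. \<Sum>c\<in>UNIV.
       of_int (sign p) * (\<phi> c (X i) * \<alpha> (p i) (p j) c (X j) * (\<Prod>k\<in>UNIV - {i, j}. \<phi> (p k) (X k))) +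
       of_int (sign p) * (\<beta> (p i) (p j) c (X i) * \<phi> c (X j) * (\<Prod>k\<in>UNIV - {i, j}. \<phi> (p k) (X k))))"
      by (simp add: y_def pair_slater_def h_def sum_subtractf[symmetric] left_diff_distrib right_diff_distrib
          sum.distrib sum_distrib_left sum_distrib_right)
    then show ?thesis unfolding T_def pair_slater_product[OF that] by simp
  qed
  have Tsum: "sq_int (PiU M) (\<lambda>X. T i j p (\<phi> c) (\<alpha> (p i) (p j) c) X + T i j p (\<beta> (p i) (p j) c) (\<phi> c) X)" for i j p c
    by (intro sq_int_add T \<phi> \<alpha> \<beta>)
  have wy_sq: "sq_int (PiU M) (\<lambda>X. w i j X - y i j X)" if "i \<noteq> j" for i j
    unfolding wy[OF that] by (intro sq_int_sum Tsum)
  have y: "sq_int (PiU M) (y i j)" if "i \<noteq> j" for i j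
    using sq_int_diff[OF w[of i j] wy_sq[OF that]] by simp
  \<comment> \<open>The factor of particle \<open>i\<close> is split off from a rest that ignores
    this coordinate, the form in which the vanishing results for pair sums apply.\<close>
  have Tsplit1: "\<exists>E. T i j p f g = (\<lambda>X. f (X i) * E X) \<and> (\<forall>X y. E (X(i := y)) = E X)" if "i \<noteq> j" for i j p f g
  proof (intro exI conjI allI ext)
    fix X
    have "(\<Prod>k\<in>UNIV. ((\<phi> \<circ> p)(i := f, j := g)) k (X k)) = ((\<phi> \<circ> p)(i := f, j := g)) i (X i) * (\<Prod>k\<in>UNIV - {i}. ((\<phi> \<circ> p)(i := f, j := g)) k (X k))"
      by (rule prod.remove) auto
    then show "T i j p f g X = f (X i) * (of_int (sign p) * (\<Prod>k\<in>UNIV - {i}. ((\<phi> \<circ> p)(i := f, j := g)) k (X k)))"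
      using that by (simp add: T_def tensor_def mult_ac)
    fix y
    show "of_int (sign p) * (\<Prod>k\<in>UNIV - {i}. ((\<phi> \<circ> p)(i := f, j := g)) k ((X(i := y)) k)) =
       of_int (sign p) * (\<Prod>k\<in>UNIV - {i}. ((\<phi> \<circ> p)(i := f, j := g)) k (X k))"
      by (intro arg_cong2[of _ _ _ _ "(*)"] refl prod.cong) auto
  qed
  have Tsplit2: "\<exists>E. T i j p f g = (\<lambda>X. g (X j) * E X) \<and> (\<forall>X y. E (X(j := y)) = E X)" if "i \<noteq> j" for i j p f g
    using Tsplit1[of j i p g f] that by (simp add: T_def fun_upd_twist)
  have y_perp: "ip (PiU M) F (y i j) = 0"
    if "i \<noteq> j" "m = i \<or> m = j" "sq_int (PiU M) F" "\<exists>E. F = (\<lambda>X. \<phi> c (X m) * E X) \<and> (\<forall>X y. E (X(m := y)) = E X)" for i j m F c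
  proof -
    from that(4) obtain E where E: "F = (\<lambda>X. \<phi> c (X m) * E X)" "\<And>X y. E (X(m := y)) = E X" by blast
    show ?thesis
      using that(2)
    proof
      assume "m = i"
      with that(3) E show ?thesis unfolding y_def
        using ip_pair_slater_zero_fst[OF M \<phi> that(1) y[OF that(1), unfolded y_def] _ _ hy] by simp
    next
      assume "m = j"
      with that(3) E show ?thesis unfolding y_def
        using ip_pair_slater_zero_snd[OF M \<phi> that(1) y[OF that(1), unfolded y_def] _ _ hx] by simp
    qed
  qed
  have y_wy: "ip (PiU M) (y i j) (\<lambda>X. w i j X - y i j X) = 0" if "i \<noteq> j" for i j
  proof -
    have "ip (PiU M) (\<lambda>X. w i j X - y i j X) (y i j) = (\<Sum>p\<in>{p. p permutes UNIV}. \<Sum>c\<in>UNIV.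
       ip (PiU M) (T i j p (\<phi> c) (\<alpha> (p i) (p j) c)) (y i j) + ip (PiU M) (T i j p (\<beta> (p i) (p j) c) (\<phi> c)) (y i j))"
      unfolding wy[OF that] using that
      by (simp add: ip_sum_left ip_add_left y sq_int_sum Tsum T \<phi> \<alpha> \<beta>)
    also have "\<dots> = 0"
    proof (intro sum.neutral ballI)
      fix p c
      have "ip (PiU M) (T i j p (\<phi> c) (\<alpha> (p i) (p j) c)) (y i j) = 0"
        by (rule y_perp[of _ _ i]) (use that in \<open>auto intro!: T \<phi> \<alpha> Tsplit1\<close>)
      moreover have "ip (PiU M) (T i j p (\<beta> (p i) (p j) c) (\<phi> c)) (y i j) = 0"
        by (rule y_perp[of _ _ j]) (use that in \<open>auto intro!: T \<phi> \<beta> Tsplit2\<close>)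
      ultimately show "ip (PiU M) (T i j p (\<phi> c) (\<alpha> (p i) (p j) c)) (y i j) + ip (PiU M) (T i j p (\<beta> (p i) (p j) c) (\<phi> c)) (y i j) = 0" by simp
    qed
    finally show ?thesis by (metis cnj_ip complex_cnj_zero)
  qed
  \<comment> \<open>In each discarded term one of the two inserted functions is an orbital, so all
    slots but one are occupied and \<open>r\<close> does not see the term.\<close>
  have r_wy: "ip (PiU M) r (\<lambda>X. w i j X - y i j X) = 0" if "i \<noteq> j" for i j
  proof -
    have z: "ip (PiU M) (T i j p f g) r = 0" if fg: "sq_int M f" "sq_int M g" "f \<in> range \<phi> \<or> g \<in> range \<phi>" for p f g
    proof -
      have s: "sq_int M (((\<phi> \<circ> p)(i := f, j := g)) k)" for k using fg \<phi> by simp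
      have "ip (PiU M) (tensor ((\<phi> \<circ> p)(i := f, j := g))) r = 0"
        using fg(3)
      proof
        assume "f \<in> range \<phi>"
        then show ?thesis
          by (intro ip_tensor_almost_occupied[OF M s r perp, where i=j]) auto
      next
        assume "g \<in> range \<phi>"
        then show ?thesis
          by (intro ip_tensor_almost_occupied[OF M s r perp, where i=i]) auto
      qed
      then show ?thesis by (simp add: T_def ip_cmult_left)
    qed
    have "ip (PiU M) (\<lambda>X. w i j X - y i j X) r = (\<Sum>p\<in>{p. p permutes UNIV}. \<Sum>c\<in>UNIV.
       ip (PiU M) (T i j p (\<phi> c) (\<alpha> (p i) (p j) c)) r + ip (PiU M) (T i j p (\<beta> (p i) (p j) c) (\<phi> c)) r)"
      unfolding wy[OF that]
      by (simp add: ip_sum_left ip_add_left r(1) sq_int_sum Tsum T \<phi> \<alpha> \<beta>)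
    also have "\<dots> = 0" by (simp add: z \<phi> \<alpha> \<beta>)
    finally show ?thesis by (metis cnj_ip complex_cnj_zero)
  qed
  \<comment> \<open>Two different pairs leave some particle \<open>m\<close> of the pair
    \<open>i\<close>, \<open>j\<close> outside the pair \<open>k\<close>, \<open>l\<close>. In
    \<open>y k l\<close> this particle sits in an orbital; in \<open>y i j\<close> it has been
    projected away from all orbitals.\<close>
  have y_orth: "ip (PiU M) (y k l) (y i j) = 0" if "i < j" "k < l" "(i, j) \<noteq> (k, l)" for i j k l
  proof -
    have "i \<notin> {k, l} \<or> j \<notin> {k, l}" using that by auto
    then obtain m where m: "m = i \<or> m = j" "m \<noteq> k" "m \<noteq> l" by blast
    have "y k l = (\<lambda>X. \<Sum>p\<in>{p. p permutes UNIV}. \<phi> (p m) (X m) *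
       (of_int (sign p) * (h (p k) (p l) (X k) (X l) * (\<Prod>n\<in>UNIV - {k, l} - {m}. \<phi> (p n) (X n)))))"
    proof
      fix X
      have "(\<Prod>n\<in>UNIV - {k, l}. \<phi> (p n) (X n)) = \<phi> (p m) (X m) * (\<Prod>n\<in>UNIV - {k, l} - {m}. \<phi> (p n) (X n))" for p
        by (rule prod.remove) (use m in auto)
      then show "y k l X = (\<Sum>p\<in>{p. p permutes UNIV}. \<phi> (p m) (X m) *
       (of_int (sign p) * (h (p k) (p l) (X k) (X l) * (\<Prod>n\<in>UNIV - {k, l} - {m}. \<phi> (p n) (X n)))))"
        by (simp add: y_def pair_slater_def mult_ac)
    qed
    moreover define Z where "Z p X = \<phi> (p m) (X m) *
       (of_int (sign p) * (h (p k) (p l) (X k) (X l) * (\<Prod>n\<in>UNIV - {k, l} - {m}. \<phi> (p n) (X n))))" for p X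
    ultimately have yZ: "y k l = (\<lambda>X. \<Sum>p\<in>{p. p permutes UNIV}. Z p X)" by simp
    \<comment> \<open>Square integrability is read off by writing the term as a bounded multiple of
      a product state minus discarded product states.\<close>
    have Z: "sq_int (PiU M) (Z p)" for p
    proof -
      have klne: "k \<noteq> l" using that by simp
      have UN: "(\<Prod>n\<in>UNIV. \<phi> (p n) (X n)) = \<phi> (p k) (X k) * \<phi> (p l) (X l) * (\<Prod>n\<in>UNIV - {k, l}. \<phi> (p n) (X n))" for X
        using pair_slater_product[OF klne, of "id" "\<phi> (p k)" X "\<phi> (p l)" "\<phi> \<circ> p"]
        by (simp add: tensor_def sign_id fun_upd_idem[of "\<phi> \<circ> p"] fun_upd_idem[of "\<lambda>x. \<phi> (p x)"] comp_def)
      have rem: "(\<Prod>n\<in>UNIV - {k, l}. \<phi> (p n) (X n)) = \<phi> (p m) (X m) * (\<Prod>n\<in>UNIV - {k, l} - {m}. \<phi> (p n) (X n))" for X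
        by (rule prod.remove) (use m in auto)
      have Zeq: "Z p = (\<lambda>X. of_int (sign p) * (of_real (v (X k) (X l)) * tensor (\<phi> \<circ> p) X) -
          (\<Sum>c\<in>UNIV. T k l p (\<phi> c) (\<alpha> (p k) (p l) c) X + T k l p (\<beta> (p k) (p l) c) (\<phi> c) X))"
      proof
        fix X
      have "Z p X = of_int (sign p) * (h (p k) (p l) (X k) (X l) * (\<Prod>n\<in>UNIV - {k, l}. \<phi> (p n) (X n)))"
        by (simp add: Z_def rem mult_ac)
      also have "\<dots> = of_int (sign p) * (of_real (v (X k) (X l)) * tensor (\<phi> \<circ> p) X) -
          (\<Sum>c\<in>UNIV. T k l p (\<phi> c) (\<alpha> (p k) (p l) c) X + T k l p (\<beta> (p k) (p l) c) (\<phi> c) X)"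
        unfolding T_def pair_slater_product[OF klne, symmetric]
        by (simp add: tensor_def UN h_def g_def left_diff_distrib right_diff_distrib sum.distrib sum_distrib_left sum_distrib_right mult_ac)
      finally show "Z p X = of_int (sign p) * (of_real (v (X k) (X l)) * tensor (\<phi> \<circ> p) X) -
          (\<Sum>c\<in>UNIV. T k l p (\<phi> c) (\<alpha> (p k) (p l) c) X + T k l p (\<beta> (p k) (p l) c) (\<phi> c) X)" .
      qed
      have m[measurable]: "(\<lambda>X. (X k, X l)) \<in> measurable (PiU M) (M \<Otimes>\<^sub>M M)" by measurable
      have m2[measurable]: "(\<lambda>X. v (X k) (X l)) \<in> borel_measurable (PiU M)"
        using measurable_compose[OF m v] by simp
      have "sq_int (PiU M) (\<lambda>X. of_real (v (X k) (X l)) * tensor (\<phi> \<circ> p) X)"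
        by (rule sq_int_mult_bounded[where C=C]) (auto intro!: sq_int_tensor[OF M] \<phi> vC)
      then show ?thesis unfolding Zeq by (intro sq_int_diff sq_int_cmult sq_int_sum Tsum)
    qed
    have "ip (PiU M) (Z p) (y i j) = 0" for p
    proof (rule y_perp[OF _ m(1) Z])
      show "\<exists>E. Z p = (\<lambda>X. \<phi> (p m) (X m) * E X) \<and> (\<forall>X y. E (X(m := y)) = E X)"
      proof (intro exI[of _ "\<lambda>X. of_int (sign p) * (h (p k) (p l) (X k) (X l) * (\<Prod>n\<in>UNIV - {k, l} - {m}. \<phi> (p n) (X n)))"] conjI allI)
        fix X y
        have "(\<Prod>n\<in>UNIV - {k, l} - {m}. \<phi> (p n) ((X(m := y)) n)) = (\<Prod>n\<in>UNIV - {k, l} - {m}. \<phi> (p n) (X n))"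
          by (rule prod.cong) auto
        then show "of_int (sign p) * (h (p k) (p l) ((X(m := y)) k) ((X(m := y)) l) * (\<Prod>n\<in>UNIV - {k, l} - {m}. \<phi> (p n) ((X(m := y)) n))) =
           of_int (sign p) * (h (p k) (p l) (X k) (X l) * (\<Prod>n\<in>UNIV - {k, l} - {m}. \<phi> (p n) (X n)))"
          using m by simp
      qed (simp add: Z_def[abs_def])
    qed (use that in auto)
    then show ?thesis unfolding yZ using y[of i j] that Z by (simp add: ip_sum_left)
  qed
  let ?P = "{(i::'n, j). i < j}"
  have fin: "finite ?P" by simp
  have "ip (PiU M) r (\<lambda>X. of_real (\<Sum>(i, j)\<in>?P. v (X i) (X j)) * slater \<phi> X) = ip (PiU M) r (\<lambda>X. \<Sum>z\<in>?P. w (fst z) (snd z) X)"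
    by (simp add: w_def sum_distrib_right case_prod_unfold)
  also have "\<dots> = (\<Sum>z\<in>?P. ip (PiU M) r (w (fst z) (snd z)))"
    by (rule ip_sum_right[OF r(1) w])
  also have "\<dots> = (\<Sum>z\<in>?P. ip (PiU M) r (y (fst z) (snd z)))"
  proof (rule sum.cong[OF refl])
    fix z assume "z \<in> ?P"
    then have ne: "fst z \<noteq> snd z" by auto
    show "ip (PiU M) r (w (fst z) (snd z)) = ip (PiU M) r (y (fst z) (snd z))"
      using r_wy[OF ne] by (simp add: ip_diff_right r w y[OF ne])
  qed
  also have "\<dots> = ip (PiU M) r (\<lambda>X. \<Sum>z\<in>?P. y (fst z) (snd z) X)"
    by (rule ip_sum_right[OF r(1), symmetric]) (auto intro!: y)
  finally have eq: "ip (PiU M) r (\<lambda>X. of_real (\<Sum>(i, j)\<in>?P. v (X i) (X j)) * slater \<phi> X) = ip (PiU M) r (\<lambda>X. \<Sum>z\<in>?P. y (fst z) (snd z) X)" .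
  have "(nrm (PiU M) (\<lambda>X. \<Sum>z\<in>?P. y (fst z) (snd z) X))\<^sup>2 = (\<Sum>z\<in>?P. (nrm (PiU M) (y (fst z) (snd z)))\<^sup>2)"
    by (rule nrm_sum_orthogonal[OF fin]) (auto intro!: y y_orth)
  \<comment> \<open>Projecting does not increase the norm, and multiplication by the potential costs
    at most the factor \<open>C\<close>.\<close>
  also have "\<dots> \<le> (\<Sum>z\<in>?P. (C * nrm (PiU M) (slater \<phi>))\<^sup>2)"
  proof (intro sum_mono power_mono)
    fix z assume "z \<in> ?P"
    then have ne: "fst z \<noteq> snd z" by auto
    show "nrm (PiU M) (y (fst z) (snd z)) \<le> C * nrm (PiU M) (slater \<phi>)"
      using nrm_le_of_ip_zero[OF y[OF ne] w y_wy[OF ne]] wn[of "fst z" "snd z"] by linarith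
  qed simp
  also have "\<dots> = real (card ?P) * (C * nrm (PiU M) (slater \<phi>))\<^sup>2" by simp
  also have "real (card ?P) = real (CARD('n) * (CARD('n) - 1)) / 2"
    using arg_cong[OF card_less_pairs[where 'n='n], of real] by simp
  also have "\<dots> * (C * nrm (PiU M) (slater \<phi>))\<^sup>2 = (C * sqrt (real (CARD('n) * (CARD('n) - 1)) / 2) * nrm (PiU M) (slater \<phi>))\<^sup>2"
    by (simp add: power_mult_distrib)
  finally have "nrm (PiU M) (\<lambda>X. \<Sum>z\<in>?P. y (fst z) (snd z) X) \<le> C * sqrt (real (CARD('n) * (CARD('n) - 1)) / 2) * nrm (PiU M) (slater \<phi>)"
    by (rule power2_le_imp_le) (simp add: C0)
  then have "nrm (PiU M) r * nrm (PiU M) (\<lambda>X. \<Sum>z\<in>?P. y (fst z) (snd z) X) \<le> nrm (PiU M) r * (C * sqrt (real (CARD('n) * (CARD('n) - 1)) / 2) * nrm (PiU M) (slater \<phi>))"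
    by (rule mult_left_mono) simp
  moreover have "norm (ip (PiU M) r (\<lambda>X. \<Sum>z\<in>?P. y (fst z) (snd z) X)) \<le> nrm (PiU M) r * nrm (PiU M) (\<lambda>X. \<Sum>z\<in>?P. y (fst z) (snd z) X)"
    by (rule ip_Cauchy_Schwarz[OF r(1)]) (auto intro!: sq_int_sum y)
  ultimately show ?thesis unfolding eq by linarith
qed

section \<open>Borel versions of functions on the box\<close>

lemma L2on_iff_sq_int: "S \<in> sets lebesgue \<Longrightarrow> L2on S f \<longleftrightarrow> sq_int (lebesgue_on S) f"
  unfolding L2on_def sq_int_def set_borel_measurable_def set_integrable_def
  by (simp add: borel_measurable_restrict_space_iff integrable_restrict_space)

lemma inner_on_eq_ip: "S \<in> sets lebesgue \<Longrightarrow> inner_on S f g = ip (lebesgue_on S) f g"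
  by (simp add: inner_on_def ip_def set_lebesgue_integral_def integral_restrict_space)

lemma norm_on_eq_nrm: "S \<in> sets lebesgue \<Longrightarrow> norm_on S f = nrm (lebesgue_on S) f"
  by (simp add: norm_on_def nrm_def set_lebesgue_integral_def integral_restrict_space)

text \<open>A Borel version of \<open>f\<close> on \<open>S\<close>, extended by zero. Borel
  functions pass through coordinate projections and product measures without any completion, and
  vanishing outside \<open>S\<close> turns integrals over \<open>S\<close> into integrals over the
  whole space.\<close>

definition borel_rep :: "'a::euclidean_space set \<Rightarrow> ('a \<Rightarrow> complex) \<Rightarrow> ('a \<Rightarrow> complex) \<Rightarrow> bool" where
  "borel_rep S f g \<longleftrightarrow> g \<in> borel_measurable borel \<and> (\<forall>x. x \<notin> S \<longrightarrow> g x = 0) \<and> (AE x in lborel. x \<in> S \<longrightarrow> f x = g x)"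

lemma completion_ex_borel_measurable_complex:
  fixes f :: "'a \<Rightarrow> complex"
  assumes "f \<in> borel_measurable (completion M)"
  shows "\<exists>g\<in>borel_measurable M. AE x in M. f x = g x"
proof -
  have "(\<lambda>x. Re (f x)) \<in> borel_measurable (completion M)" "(\<lambda>x. Im (f x)) \<in> borel_measurable (completion M)"
    using assms by measurable
  then obtain g h where g: "g \<in> borel_measurable M" "AE x in M. Re (f x) = g x"
    and h: "h \<in> borel_measurable M" "AE x in M. Im (f x) = h x"
    using completion_ex_borel_measurable_real by metis
  show ?thesis
  proof (rule bexI[of _ "\<lambda>x. complex_of_real (g x) + \<i> * complex_of_real (h x)"])
    show "AE x in M. f x = complex_of_real (g x) + \<i> * complex_of_real (h x)"
      using g(2) h(2) by eventually_elim (simp add: complex_eq_iff)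
  qed (use g h in measurable)
qed

lemma borel_rep_exists:
  assumes "S \<in> sets borel" "set_borel_measurable lebesgue S f"
  shows "\<exists>g. borel_rep S f g"
proof -
  from assms(2) obtain g where g: "g \<in> borel_measurable lborel" "AE x in lborel. indicat_real S x *\<^sub>R f x = g x"
    using completion_ex_borel_measurable_complex unfolding set_borel_measurable_def by metis
  have "borel_rep S f (\<lambda>x. indicat_real S x *\<^sub>R g x)"
    unfolding borel_rep_def
  proof (intro conjI allI impI)
    show "AE x in lborel. x \<in> S \<longrightarrow> f x = indicat_real S x *\<^sub>R g x"
      using g(2) by eventually_elim auto
  qed (use g(1) assms(1) in auto)
  then show ?thesis by blast
qed

lemma borel_repD:
  assumes "borel_rep S f g"
  shows "g \<in> borel_measurable borel" "x \<notin> S \<Longrightarrow> g x = 0" "AE x in lborel. x \<in> S \<longrightarrow> f x = g x"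
  using assms by (auto simp: borel_rep_def)

lemma borel_rep_lebesgue:
  assumes "borel_rep S f g"
  shows "AE x in lebesgue. indicat_real S x *\<^sub>R f x = g x"
  using AE_completion[OF borel_repD(3)[OF assms]]
  by eventually_elim (use borel_repD(2)[OF assms] in \<open>auto simp: indicator_def\<close>)

text \<open>In a complete measure space, sets that differ by a null set are measurable together;
  this is applied to preimages.\<close>

lemma borel_measurable_completion_AE_cong:
  assumes f: "f \<in> borel_measurable (completion M)" and eq: "AE x in completion M. f x = g x"
  shows "g \<in> borel_measurable (completion M)"
proof (rule measurableI)
  fix A :: "'b set" assume "A \<in> sets borel"
  then have "f -` A \<inter> space (completion M) \<in> sets (completion M)" using f by (rule measurable_sets[rotated])
  moreover have "AE x in completion M. x \<in> f -` A \<inter> space (completion M) \<longleftrightarrow> x \<in> g -` A \<inter> space (completion M)"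
    using eq by eventually_elim auto
  ultimately show "g -` A \<inter> space (completion M) \<in> sets (completion M)"
    using completion.in_sets_AE by blast
qed simp

lemma borel_rep_measurable:
  assumes "borel_rep S f g"
  shows "(\<lambda>x. indicat_real S x *\<^sub>R f x) \<in> borel_measurable lebesgue"
proof -
  have "g \<in> borel_measurable lebesgue" using borel_repD(1)[OF assms] by (simp add: measurable_completion)
  then show ?thesis
    by (rule borel_measurable_completion_AE_cong) (use borel_rep_lebesgue[OF assms] in \<open>auto simp: eq_commute\<close>)
qed

lemma borel_rep_sq_int:
  assumes "borel_rep S f g"
  shows "L2on S f \<longleftrightarrow> sq_int lborel g"
proof -
  note m = borel_rep_measurable[OF assms]
  have gm[measurable]: "g \<in> borel_measurable lborel" using borel_repD(1)[OF assms] by simp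
  have n: "(\<lambda>x. indicat_real S x * (norm (f x))\<^sup>2) = (\<lambda>x. (norm (indicat_real S x *\<^sub>R f x))\<^sup>2)"
    by (auto simp: indicator_def)
  have "integrable lebesgue (\<lambda>x. (norm (indicat_real S x *\<^sub>R f x))\<^sup>2) \<longleftrightarrow> integrable lebesgue (\<lambda>x. (norm (g x))\<^sup>2)"
  proof (rule integrable_cong_AE)
    show "AE x in lebesgue. (norm (indicat_real S x *\<^sub>R f x))\<^sup>2 = (norm (g x))\<^sup>2"
      using borel_rep_lebesgue[OF assms] by eventually_elim simp
    show "(\<lambda>x. (norm (g x))\<^sup>2) \<in> borel_measurable lebesgue"
      by (rule measurable_completion) (use gm in measurable)
    show "(\<lambda>x. (norm (indicat_real S x *\<^sub>R f x))\<^sup>2) \<in> borel_measurable lebesgue"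
      by (rule borel_measurable_power, rule measurable_compose[OF m], measurable)
  qed
  also have "\<dots> \<longleftrightarrow> integrable lborel (\<lambda>x. (norm (g x))\<^sup>2)"
    by (rule integrable_completion) measurable
  finally show ?thesis
    unfolding L2on_def sq_int_def set_borel_measurable_def set_integrable_def real_scaleR_def
    using m gm by (simp only: n)
qed

lemma borel_rep_inner_on:
  assumes "borel_rep S f f'" "borel_rep S g g'"
  shows "inner_on S f g = ip lborel f' g'"
proof -
  have [measurable]: "f' \<in> borel_measurable lborel" "g' \<in> borel_measurable lborel"
    using borel_repD(1) assms by auto
  have [measurable]: "f' \<in> borel_measurable lebesgue" "g' \<in> borel_measurable lebesgue" by (auto intro: measurable_completion)
  note [measurable] = borel_rep_measurable[OF assms(1)] borel_rep_measurable[OF assms(2)]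
  have "inner_on S f g = (\<integral>x. cnj (indicat_real S x *\<^sub>R f x) * (indicat_real S x *\<^sub>R g x) \<partial>lebesgue)"
    unfolding inner_on_def set_lebesgue_integral_def
    by (rule Bochner_Integration.integral_cong) (auto simp: indicator_def)
  also have "\<dots> = (\<integral>x. cnj (f' x) * g' x \<partial>lebesgue)"
  proof (rule integral_cong_AE)
    show "AE x in lebesgue. cnj (indicat_real S x *\<^sub>R f x) * (indicat_real S x *\<^sub>R g x) = cnj (f' x) * g' x"
      using borel_rep_lebesgue[OF assms(1)] borel_rep_lebesgue[OF assms(2)] by eventually_elim (simp only:)
  qed measurable
  also have "\<dots> = ip lborel f' g'" unfolding ip_def by (rule integral_completion) measurable
  finally show ?thesis .
qed

lemma cnj_mult_self: "cnj z * z = complex_of_real ((cmod z)\<^sup>2)"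
  by (subst mult.commute, simp only: complex_norm_square)

lemma inner_on_self: "inner_on S f f = of_real ((norm_on S f)\<^sup>2)"
proof -
  have nn: "(LINT x:S|lebesgue. (norm (f x))\<^sup>2) \<ge> 0"
    unfolding set_lebesgue_integral_def by (intro integral_nonneg_AE) auto
  have "indicat_real S x *\<^sub>R (cnj (f x) * f x) = complex_of_real (indicat_real S x * (norm (f x))\<^sup>2)" for x
    by (simp only: cnj_mult_self scaleR_conv_of_real of_real_mult)
  then have "inner_on S f f = of_real (\<integral>x. indicat_real S x * (norm (f x))\<^sup>2 \<partial>lebesgue)"
    unfolding inner_on_def set_lebesgue_integral_def by (simp only: integral_complex_of_real)
  also have "(\<integral>x. indicat_real S x * (norm (f x))\<^sup>2 \<partial>lebesgue) = (norm_on S f)\<^sup>2"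
    using nn by (simp add: norm_on_def set_lebesgue_integral_def)
  finally show ?thesis .
qed

lemma borel_rep_norm_on:
  assumes "borel_rep S f f'"
  shows "norm_on S f = nrm lborel f'"
proof (rule power2_eq_imp_eq[OF _ _ nrm_nonneg])
  have "complex_of_real ((norm_on S f)\<^sup>2) = of_real ((nrm lborel f')\<^sup>2)"
    using borel_rep_inner_on[OF assms assms] by (simp only: inner_on_self ip_self)
  then show "(norm_on S f)\<^sup>2 = (nrm lborel f')\<^sup>2" by (simp only: of_real_eq_iff)
  show "norm_on S f \<ge> 0" unfolding norm_on_def set_lebesgue_integral_def
    by (intro real_sqrt_ge_zero integral_nonneg_AE) auto
qed

section \<open>Lebesgue measure on configuration space as a product measure\<close>

lemma measurable_vec_lambda [measurable]:
  "vec_lambda \<in> measurable (PiM UNIV (\<lambda>_::'n::finite. borel)) (borel :: ('a::euclidean_space ^ 'n) measure)"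
proof (rule borel_measurable_euclidean_space[THEN iffD2], rule ballI)
  fix b :: "'a ^ 'n" assume "b \<in> Basis"
  then obtain i c where b: "b = axis i c" "c \<in> Basis" by (auto simp: Basis_vec_def)
  show "(\<lambda>X. vec_lambda X \<bullet> b) \<in> borel_measurable (PiM UNIV (\<lambda>_::'n. borel))"
    unfolding b inner_axis vec_lambda_beta by measurable
qed

lemma measurable_vec_lambda_lborel [measurable]:
  "vec_lambda \<in> measurable (PiU lborel) (borel :: ('a::euclidean_space ^ 'n::finite) measure)"
proof -
  have "sets (PiU lborel) = sets (PiM UNIV (\<lambda>_::'n. (borel :: 'a measure)))" by (rule sets_PiM_cong) auto
  then show ?thesis using measurable_vec_lambda measurable_cong_sets by blast
qed

lemma measurable_vec_nth_borel [measurable]: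
  "(\<lambda>X::'a::euclidean_space ^ 'n::finite. X $ i) \<in> borel_measurable borel"
  by (intro borel_measurable_continuous_onI continuous_intros)

text \<open>Both measures give an open box its volume, which factorises over the particles and then
  over the directions of each particle, the basis being the set of all
  \<open>axis i b\<close>.\<close>

lemma lborel_vec:
  "(lborel :: ('a::euclidean_space ^ 'n::finite) measure) = distr (PiU lborel) borel vec_lambda"
proof (rule lborel_eqI)
  interpret product_sigma_finite "\<lambda>_::'n. (lborel :: 'a measure)" by (rule product_sigma_finite_const) (rule sigma_finite_lborel)
  fix l u :: "'a ^ 'n" assume lu: "\<And>b. b \<in> Basis \<Longrightarrow> l \<bullet> b \<le> u \<bullet> b"
  have "vec_lambda -` box l u \<inter> space (PiU lborel) = Pi\<^sub>E UNIV (\<lambda>i::'n. box (l $ i) (u $ i))"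
  proof (intro set_eqI iffI)
    fix X assume "X \<in> vec_lambda -` box l u \<inter> space (PiU lborel)"
    then have "l \<bullet> axis i b < vec_lambda X \<bullet> axis i b" "vec_lambda X \<bullet> axis i b < u \<bullet> axis i b" if "b \<in> Basis" for i b
      using that by (auto simp: mem_box Basis_vec_def)
    then show "X \<in> Pi\<^sub>E UNIV (\<lambda>i::'n. box (l $ i) (u $ i))"
      by (auto simp: mem_box inner_axis)
  next
    fix X assume "X \<in> Pi\<^sub>E UNIV (\<lambda>i::'n. box (l $ i) (u $ i))"
    then have "X i \<in> box (l $ i) (u $ i)" for i by auto
    then show "X \<in> vec_lambda -` box l u \<inter> space (PiU lborel)"
      by (auto simp: mem_box Basis_vec_def inner_axis space_PiM)
  qed
  then have "emeasure (distr (PiU lborel) borel vec_lambda) (box l u) = (\<Prod>i\<in>UNIV. emeasure lborel (box (l $ i) (u $ i)))"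
    by (subst emeasure_distr) (auto simp: emeasure_PiM)
  also have "\<dots> = (\<Prod>i\<in>UNIV. ennreal (\<Prod>b\<in>Basis. (u $ i - l $ i) \<bullet> b))"
  proof (rule prod.cong[OF refl])
    fix i :: 'n
    have "l $ i \<bullet> b \<le> u $ i \<bullet> b" if "b \<in> Basis" for b
      using lu[of "axis i b"] that by (auto simp: inner_axis Basis_vec_def)
    then show "emeasure lborel (box (l $ i) (u $ i)) = ennreal (\<Prod>b\<in>Basis. (u $ i - l $ i) \<bullet> b)"
      by (rule emeasure_lborel_box)
  qed
  also have "\<dots> = ennreal (\<Prod>i\<in>UNIV. \<Prod>b\<in>Basis. (u $ i - l $ i) \<bullet> b)"
  proof (rule prod_ennreal)
    fix i :: 'n
    show "0 \<le> (\<Prod>b\<in>Basis. (u $ i - l $ i) \<bullet> b)"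
      using lu[of "axis i _"] by (intro prod_nonneg) (auto simp: inner_axis Basis_vec_def inner_diff_left)
  qed
  also have "(\<Prod>i\<in>UNIV. \<Prod>b\<in>Basis. (u $ i - l $ i) \<bullet> b) = (\<Prod>(i, b)\<in>UNIV \<times> Basis. (u - l) \<bullet> axis i b)"
    by (subst prod.cartesian_product[symmetric]) (simp add: inner_axis)
  also have "\<dots> = (\<Prod>b\<in>Basis. (u - l) \<bullet> b)"
  proof -
    have inj: "inj_on (\<lambda>(i, b). axis i b) (UNIV \<times> Basis :: ('n \<times> 'a) set)"
      by (auto simp: inj_on_def axis_eq_axis)
    have img: "(\<lambda>(i, b). axis i b) ` (UNIV \<times> Basis :: ('n \<times> 'a) set) = Basis"
      by (auto simp: Basis_vec_def image_iff)
    show ?thesis unfolding img[symmetric] by (subst prod.reindex[OF inj]) (simp add: case_prod_unfold comp_def)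
  qed
  finally show "emeasure (distr (PiU lborel) borel vec_lambda) (box l u) = (\<Prod>b\<in>Basis. (u - l) \<bullet> b)" .
qed simp

lemma integral_lborel_vec:
  fixes F :: "'a::euclidean_space ^ 'n::finite \<Rightarrow> complex"
  assumes "F \<in> borel_measurable borel"
  shows "(\<integral>X. F X \<partial>lborel) = (\<integral>X. F (vec_lambda X) \<partial>PiU lborel)"
  by (subst lborel_vec, rule integral_distr) (use assms in measurable)

lemma integrable_lborel_vec:
  fixes F :: "'a::euclidean_space ^ 'n::finite \<Rightarrow> 'b::{banach, second_countable_topology}"
  assumes "F \<in> borel_measurable borel"
  shows "integrable lborel F \<longleftrightarrow> integrable (PiU lborel) (\<lambda>X. F (vec_lambda X))"
  by (subst lborel_vec, rule integrable_distr_eq) (use assms in measurable)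

lemma sq_int_lborel_vec:
  fixes F :: "'a::euclidean_space ^ 'n::finite \<Rightarrow> complex"
  assumes F: "F \<in> borel_measurable borel"
  shows "sq_int lborel F \<longleftrightarrow> sq_int (PiU lborel) (\<lambda>X. F (vec_lambda X))"
proof -
  have "(\<lambda>X. F (vec_lambda X)) \<in> borel_measurable (PiU lborel)" using F by measurable
  then show ?thesis using F by (simp add: sq_int_def integrable_lborel_vec)
qed

lemma ip_lborel_vec:
  fixes F G :: "'a::euclidean_space ^ 'n::finite \<Rightarrow> complex"
  assumes "F \<in> borel_measurable borel" "G \<in> borel_measurable borel"
  shows "ip lborel F G = ip (PiU lborel) (\<lambda>X. F (vec_lambda X)) (\<lambda>X. G (vec_lambda X))"
  unfolding ip_def by (rule integral_lborel_vec) (use assms in measurable)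

lemma nrm_lborel_vec:
  fixes F :: "'a::euclidean_space ^ 'n::finite \<Rightarrow> complex"
  assumes "F \<in> borel_measurable borel"
  shows "nrm lborel F = nrm (PiU lborel) (\<lambda>X. F (vec_lambda X))"
proof -
  have "(nrm lborel F)\<^sup>2 = (nrm (PiU lborel) (\<lambda>X. F (vec_lambda X)))\<^sup>2"
    using ip_lborel_vec[OF assms assms] unfolding ip_self by (simp only: of_real_eq_iff)
  then show ?thesis by (rule power2_eq_imp_eq) auto
qed

lemma AE_lborel_vec:
  assumes "AE X in PiU lborel. P (vec_lambda X)" "{X. P X} \<in> sets borel"
  shows "AE X in (lborel :: ('a::euclidean_space ^ 'n::finite) measure). P X"
  unfolding lborel_vec by (subst AE_distr_iff) (use assms in auto)

lemma AE_lborel_coordinate: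
  assumes "AE x in lborel. P x"
  shows "AE X in (lborel :: ('a::euclidean_space ^ 'n::finite) measure). P (X $ j)"
proof -
  from assms obtain N where N: "{x\<in>space lborel. \<not> P x} \<subseteq> N" "emeasure lborel N = 0" "N \<in> sets lborel"
    by (rule AE_E)
  have N': "N \<in> sets borel" using N by simp
  have "AE x in lborel. x \<notin> N" using N by (auto intro!: AE_not_in simp: null_sets_def)
  then have "AE X in PiU lborel. X j \<notin> N" by (intro AE_PiM_coordinate) (auto simp: sigma_finite_lborel)
  moreover have "{X :: 'a ^ 'n. X $ j \<notin> N} \<in> sets borel"
    using measurable_sets[OF measurable_vec_nth_borel, of "- N" j] N' by (simp add: vimage_def)
  ultimately have "AE X in (lborel :: ('a ^ 'n) measure). X $ j \<notin> N"
    by (intro AE_lborel_vec) auto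
  then show ?thesis by eventually_elim (use N in auto)
qed

text \<open>By Fubini almost every slice of a null set is null. This is transported to coordinate
  \<open>i\<close>, and then coordinate \<open>j\<close> is integrated out. It carries
  almost-everywhere facts about the potential over to pairs of particles.\<close>

lemma AE_PiM_pair_coordinates:
  fixes i j :: "'n::finite"
  assumes M: "sigma_finite_measure M" and ij: "i \<noteq> j" and N: "N \<in> null_sets (M \<Otimes>\<^sub>M M)"
  shows "AE X in PiU M. (X i, X j) \<notin> N"
proof -
  interpret product_sigma_finite "\<lambda>_::'n. M" by (rule product_sigma_finite_const[OF M])
  interpret sigma_finite_measure M by (rule M)
  have [measurable]: "N \<in> sets (M \<Otimes>\<^sub>M M)" using N by auto
  have UN: "insert j (UNIV - {j}) = (UNIV :: 'n set)" by auto
  have "(\<integral>\<^sup>+x. (\<integral>\<^sup>+y. indicator N (x, y) \<partial>M) \<partial>M) = (\<integral>\<^sup>+z. indicator N z \<partial>(M \<Otimes>\<^sub>M M))"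
    by (rule nn_integral_fst) measurable
  also have "\<dots> = 0" using N by (simp add: null_sets_def)
  finally have "AE x in M. (\<integral>\<^sup>+y. indicator N (x, y) \<partial>M) = 0"
    by (subst (asm) nn_integral_0_iff_AE) measurable
  then have 0: "AE X in PiM (UNIV - {j}) (\<lambda>_. M). (\<integral>\<^sup>+y. indicator N (X i, y) \<partial>M) = 0"
    by (intro AE_PiM_coordinate[OF M]) (use ij in auto)
  have m: "(\<lambda>X. indicator N (X i, X j) :: ennreal) \<in> borel_measurable (PiU M)" by measurable
  have "(\<integral>\<^sup>+X. indicator N (X i, X j) \<partial>PiU M) =
     (\<integral>\<^sup>+X. (\<integral>\<^sup>+y. indicator N ((X(j := y)) i, (X(j := y)) j) \<partial>M) \<partial>PiM (UNIV - {j}) (\<lambda>_. M))"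
    using product_nn_integral_insert[of "UNIV - {j}" j "\<lambda>X. indicator N (X i, X j)"] m unfolding UN by simp
  also have "\<dots> = (\<integral>\<^sup>+X. 0 \<partial>PiM (UNIV - {j}) (\<lambda>_. M))"
    by (rule nn_integral_cong_AE) (use 0 ij in simp)
  finally have "AE X in PiU M. indicator N (X i, X j) = (0::ennreal)"
    by (subst nn_integral_0_iff_AE[symmetric]) (use m in auto)
  then show ?thesis by eventually_elim (auto simp: indicator_def split: if_splits)
qed

lemma AE_lborel_pair_coordinates:
  fixes i j :: "'n::finite"
  assumes "i \<noteq> j" "AE z in lborel. P z"
  shows "AE X in (lborel :: ('a::euclidean_space ^ 'n) measure). P (X $ i, X $ j)"
proof -
  from assms(2) obtain N where N: "{x\<in>space lborel. \<not> P x} \<subseteq> N" "emeasure lborel N = 0" "N \<in> sets lborel"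
    by (rule AE_E)
  have "N \<in> null_sets (lborel \<Otimes>\<^sub>M lborel)" using N by (simp add: null_sets_def lborel_prod)
  then have "AE X in PiU lborel. (X i, X j) \<notin> N"
    by (intro AE_PiM_pair_coordinates assms sigma_finite_lborel)
  moreover have m: "(\<lambda>X :: 'a ^ 'n. (X $ i, X $ j)) \<in> borel_measurable borel"
    by (intro borel_measurable_continuous_onI continuous_intros)
  have "{X :: 'a ^ 'n. (X $ i, X $ j) \<notin> N} \<in> sets borel"
    using measurable_sets[OF m, of "- N"] N by (simp add: vimage_def)
  ultimately have "AE X in (lborel :: ('a ^ 'n) measure). (X $ i, X $ j) \<notin> N"
    by (intro AE_lborel_vec) auto
  then show ?thesis by eventually_elim (use N in auto)
qed

section \<open>The boxes, wedge products and tangent vectors\<close>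

lemma closed_box_Lambda: "closed (box_Lambda L1 L2)"
  unfolding box_Lambda_def by (intro closed_Times) auto

lemma closed_box_LambdaN: "closed (box_LambdaN L1 L2 :: ((real \<times> real) ^ 'n) set)"
proof -
  have "box_LambdaN L1 L2 = (\<Inter>j. (\<lambda>X::(real \<times> real) ^ 'n. X $ j) -` box_Lambda L1 L2)"
    by (auto simp: box_LambdaN_def)
  then show ?thesis
    by (auto intro!: closed_INT closed_vimage closed_box_Lambda continuous_intros)
qed

lemma box_Lambda_sets [measurable, simp]: "box_Lambda L1 L2 \<in> sets borel" "box_Lambda L1 L2 \<in> sets lebesgue"
  by (auto intro!: borel_closed closed_box_Lambda sets_completionI_sets)

lemma box_LambdaN_sets [measurable, simp]:
  "(box_LambdaN L1 L2 :: ((real \<times> real) ^ 'n::finite) set) \<in> sets borel" "(box_LambdaN L1 L2 :: ((real \<times> real) ^ 'n::finite) set) \<in> sets lebesgue"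
  by (auto intro!: borel_closed closed_box_LambdaN sets_completionI_sets)

lemma wedge_eq_slater: "wedge \<psi> X = slater \<psi> (vec_nth X) / complex_of_real (sqrt (fact CARD('n)))"
  for \<psi> :: "'n::finite \<Rightarrow> real \<times> real \<Rightarrow> complex"
  by (simp add: wedge_def slater_det)

lemma borel_measurable_wedge:
  assumes "\<And>i. \<psi> i \<in> borel_measurable borel"
  shows "wedge \<psi> \<in> borel_measurable borel"
proof -
  have "(\<lambda>X. \<psi> i (X $ j)) \<in> borel_measurable borel" for i j
    by (rule measurable_compose[OF measurable_vec_nth_borel assms])
  then show ?thesis
    unfolding wedge_eq_slater[abs_def] slater_def tensor_def comp_def by measurable
qed

lemma wedge_zero_outside:
  fixes \<psi> :: "'n::finite \<Rightarrow> real \<times> real \<Rightarrow> complex"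
  assumes "\<And>i x. x \<notin> box_Lambda L1 L2 \<Longrightarrow> \<psi> i x = 0" "X \<notin> box_LambdaN L1 L2"
  shows "wedge \<psi> X = 0"
proof -
  from assms(2) obtain j where "X $ j \<notin> box_Lambda L1 L2" by (auto simp: box_LambdaN_def)
  with assms(1) have "\<psi> i (X $ j) = 0" for i by simp
  then have "tensor (\<psi> \<circ> p) (vec_nth X) = 0" for p
    unfolding tensor_def by (intro prod_zero) (auto intro: exI[of _ j])
  then show ?thesis by (simp add: wedge_eq_slater slater_def)
qed

text \<open>The exceptional sets of all orbitals are pulled back along all coordinates; off this
  null set the two matrices agree entrywise on the box.\<close>

lemma borel_rep_wedge:
  fixes \<psi> \<psi>' :: "'n::finite \<Rightarrow> real \<times> real \<Rightarrow> complex"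
  assumes "\<And>i. borel_rep (box_Lambda L1 L2) (\<psi> i) (\<psi>' i)"
  shows "borel_rep (box_LambdaN L1 L2) (wedge \<psi>) (wedge \<psi>')"
  unfolding borel_rep_def
proof (intro conjI allI impI)
  show "wedge \<psi>' \<in> borel_measurable borel" by (rule borel_measurable_wedge) (rule borel_repD(1)[OF assms])
  show "wedge \<psi>' X = 0" if "X \<notin> box_LambdaN L1 L2" for X
    by (rule wedge_zero_outside[OF borel_repD(2)[OF assms] that])
  have "AE X in lborel. \<forall>i j. (X::(real \<times> real)^'n) $ j \<in> box_Lambda L1 L2 \<longrightarrow> \<psi> i (X $ j) = \<psi>' i (X $ j)"
    unfolding AE_all_countable by (intro allI AE_lborel_coordinate borel_repD(3)[OF assms])
  then show "AE X in lborel. X \<in> box_LambdaN L1 L2 \<longrightarrow> wedge \<psi> X = wedge \<psi>' X"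
  proof eventually_elim
    case (elim X)
    show ?case
    proof
      assume "X \<in> box_LambdaN L1 L2"
      then have "(\<chi> i j. \<psi> i (X $ j)) = (\<chi> i j. \<psi>' i (X $ j))" using elim by (simp add: box_LambdaN_def)
      then show "wedge \<psi> X = wedge \<psi>' X" by (simp add: wedge_def)
    qed
  qed
qed

lemma borel_rep_sum:
  assumes "\<And>i. i \<in> I \<Longrightarrow> borel_rep S (f i) (g i)" "finite I"
  shows "borel_rep S (\<lambda>x. \<Sum>i\<in>I. f i x) (\<lambda>x. \<Sum>i\<in>I. g i x)"
  unfolding borel_rep_def
proof (intro conjI allI impI)
  have "AE x in lborel. \<forall>i\<in>I. x \<in> S \<longrightarrow> f i x = g i x"
    using assms by (intro AE_finite_allI borel_repD(3))
  then show "AE x in lborel. x \<in> S \<longrightarrow> (\<Sum>i\<in>I. f i x) = (\<Sum>i\<in>I. g i x)"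
    by eventually_elim (auto intro: sum.cong)
qed (use assms in \<open>auto simp: borel_rep_def intro!: sum.neutral borel_measurable_sum\<close>)

lemma borel_rep_add:
  assumes "borel_rep S f f'" "borel_rep S g g'"
  shows "borel_rep S (\<lambda>x. f x + g x) (\<lambda>x. f' x + g' x)"
  unfolding borel_rep_def
proof (intro conjI allI impI)
  show "AE x in lborel. x \<in> S \<longrightarrow> f x + g x = f' x + g' x"
    using borel_repD(3)[OF assms(1)] borel_repD(3)[OF assms(2)] by eventually_elim auto
qed (use assms in \<open>auto simp: borel_rep_def\<close>)

lemma borel_rep_cmult:
  assumes "borel_rep S f f'"
  shows "borel_rep S (\<lambda>x. c * f x) (\<lambda>x. c * f' x)"
  unfolding borel_rep_def
proof (intro conjI allI impI)
  show "AE x in lborel. x \<in> S \<longrightarrow> c * f x = c * f' x"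
    using borel_repD(3)[OF assms(1)] by eventually_elim auto
qed (use assms in \<open>auto simp: borel_rep_def\<close>)

lemma borel_rep_tangent_vec:
  fixes \<psi> \<psi>' \<eta> \<eta>' :: "'n::finite \<Rightarrow> real \<times> real \<Rightarrow> complex"
  assumes "\<And>i. borel_rep (box_Lambda L1 L2) (\<psi> i) (\<psi>' i)" "\<And>i. borel_rep (box_Lambda L1 L2) (\<eta> i) (\<eta>' i)"
  shows "borel_rep (box_LambdaN L1 L2) (tangent_vec a \<psi> c \<eta>) (tangent_vec a \<psi>' c \<eta>')"
  unfolding tangent_vec_def
  by (intro borel_rep_add borel_rep_cmult borel_rep_wedge borel_rep_sum) (simp_all add: assms)

section \<open>Periodic functions and shifted cells\<close>

text \<open>Half-open, so that its lattice translates cover every point exactly once; the closed box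
  differs from it by a null set.\<close>

definition cell :: "'a::euclidean_space \<Rightarrow> 'a set" where
  "cell P = {X. \<forall>b\<in>Basis. - (P \<bullet> b) / 2 \<le> X \<bullet> b \<and> X \<bullet> b < P \<bullet> b / 2}"

abbreviation cellM :: "'a::euclidean_space \<Rightarrow> 'a measure" where
  "cellM P \<equiv> restrict_space lborel (cell P)"

definition lattice_vec :: "'a::euclidean_space \<Rightarrow> ('a \<Rightarrow> int) \<Rightarrow> 'a" where
  "lattice_vec P k = (\<Sum>b\<in>Basis. (of_int (k b) * (P \<bullet> b)) *\<^sub>R b)"

definition periodic :: "'a::euclidean_space \<Rightarrow> ('a \<Rightarrow> 'b) \<Rightarrow> bool" where
  "periodic P h \<longleftrightarrow> (\<forall>b\<in>Basis. \<forall>X. h (X + (P \<bullet> b) *\<^sub>R b) = h X)"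

text \<open>Extensional functions, so that an index is determined by its values on the basis and
  there are only countably many.\<close>

abbreviation lattice_indices :: "('a::euclidean_space \<Rightarrow> int) set" where
  "lattice_indices \<equiv> Basis \<rightarrow>\<^sub>E UNIV"

lemma cell_sets [measurable, simp]: "cell P \<in> sets borel"
proof -
  have "cell P = (\<Inter>b\<in>Basis. {X. - (P \<bullet> b) / 2 \<le> X \<bullet> b} \<inter> {X. X \<bullet> b < P \<bullet> b / 2})"
    by (auto simp: cell_def)
  also have "\<dots> \<in> sets borel"
    by (intro sets.finite_INT sets.Int) (auto simp: borel_measurable_le borel_measurable_less)
  finally show ?thesis .
qed

lemma inner_lattice_vec: "b \<in> Basis \<Longrightarrow> lattice_vec P k \<bullet> b = of_int (k b) * (P \<bullet> b)"
  by (simp add: lattice_vec_def inner_sum_left inner_Basis if_distrib cong: if_cong)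

lemma periodic_int_multiple:
  assumes "periodic P h" "b \<in> Basis"
  shows "h (X + (of_int i * (P \<bullet> b)) *\<^sub>R b) = h X"
proof (induction i rule: int_induct[of _ 0])
  case (step1 i)
  have "h (X + (of_int (i + 1) * (P \<bullet> b)) *\<^sub>R b) = h ((X + (of_int i * (P \<bullet> b)) *\<^sub>R b) + (P \<bullet> b) *\<^sub>R b)"
    by (simp add: algebra_simps)
  also have "\<dots> = h X" using assms step1 by (simp add: periodic_def)
  finally show ?case .
next
  case (step2 i)
  have "h (X + (of_int (i - 1) * (P \<bullet> b)) *\<^sub>R b) = h ((X + (of_int (i - 1) * (P \<bullet> b)) *\<^sub>R b) + (P \<bullet> b) *\<^sub>R b)"
    using assms by (simp add: periodic_def)
  also have "\<dots> = h (X + (of_int i * (P \<bullet> b)) *\<^sub>R b)" by (simp add: algebra_simps)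
  finally show ?case using step2 by simp
qed simp

lemma periodic_lattice_vec:
  assumes "periodic P h"
  shows "h (X + lattice_vec P k) = h X"
proof -
  have "h (X + (\<Sum>b\<in>B. (of_int (k b) * (P \<bullet> b)) *\<^sub>R b)) = h X" if "finite B" "B \<subseteq> Basis" for B
    using that
  proof (induction B rule: finite_induct)
    case (insert b B)
    have "h (X + (\<Sum>b\<in>insert b B. (of_int (k b) * (P \<bullet> b)) *\<^sub>R b)) = h ((X + (\<Sum>b\<in>B. (of_int (k b) * (P \<bullet> b)) *\<^sub>R b)) + (of_int (k b) * (P \<bullet> b)) *\<^sub>R b)"
      using insert by (simp add: algebra_simps)
    then show ?case using insert periodic_int_multiple[OF assms] by simp
  qed simp
  from this[of Basis] show ?thesis by (simp add: lattice_vec_def)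
qed

text \<open>The index is the nearest lattice point, ties being rounded up: \<open>k b\<close> is the
  floor of one half plus the coordinate measured in periods.\<close>

lemma cell_lattice_unique:
  assumes P: "\<And>b. b \<in> Basis \<Longrightarrow> P \<bullet> b > 0"
  shows "\<exists>k0. {k \<in> lattice_indices. X - lattice_vec P k \<in> cell P} = {k0}"
proof (rule exI, rule set_eqI)
  fix k
  let ?k0 = "\<lambda>b\<in>Basis. \<lfloor>(X \<bullet> b) / (P \<bullet> b) + 1 / 2\<rfloor>"
  have "- (P \<bullet> b) / 2 \<le> (X - lattice_vec P k) \<bullet> b \<and> (X - lattice_vec P k) \<bullet> b < P \<bullet> b / 2
      \<longleftrightarrow> k b = \<lfloor>(X \<bullet> b) / (P \<bullet> b) + 1 / 2\<rfloor>" if b: "b \<in> Basis" for b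
  proof -
    have "- (P \<bullet> b) / 2 \<le> (X - lattice_vec P k) \<bullet> b \<longleftrightarrow> of_int (k b) \<le> (X \<bullet> b) / (P \<bullet> b) + 1 / 2"
      using P[OF b] b by (simp add: inner_diff_left inner_lattice_vec field_simps)
    moreover have "(X - lattice_vec P k) \<bullet> b < P \<bullet> b / 2 \<longleftrightarrow> (X \<bullet> b) / (P \<bullet> b) + 1 / 2 < of_int (k b) + 1"
      using P[OF b] b by (simp add: inner_diff_left inner_lattice_vec field_simps)
    ultimately show ?thesis by (metis floor_unique floor_correct of_int_add of_int_1)
  qed
  then have "X - lattice_vec P k \<in> cell P \<longleftrightarrow> (\<forall>b\<in>Basis. k b = \<lfloor>(X \<bullet> b) / (P \<bullet> b) + 1 / 2\<rfloor>)"
    by (simp add: cell_def)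
  then show "k \<in> {k \<in> lattice_indices. X - lattice_vec P k \<in> cell P} \<longleftrightarrow> k \<in> {?k0}"
    by (auto simp: PiE_iff extensional_def restrict_def fun_eq_iff)
qed

text \<open>Changing the sign of an index on the basis, with the default value kept elsewhere, is an
  involution of the index set.\<close>

lemma cell_lattice_unique':
  assumes P: "\<And>b. b \<in> Basis \<Longrightarrow> P \<bullet> b > 0"
  shows "\<exists>k0. {k \<in> lattice_indices. X + lattice_vec P k \<in> cell P} = {k0}"
proof -
  let ?m = "\<lambda>k. \<lambda>b\<in>Basis. - (k b :: int)"
  have m: "lattice_vec P (?m k) = - lattice_vec P k" for k
    by (simp add: lattice_vec_def sum_negf[symmetric])
  have mm: "?m (?m k) = k" if "k \<in> lattice_indices" for k
    using that by (auto simp: PiE_iff extensional_def fun_eq_iff)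
  obtain k0 where k0: "{k \<in> lattice_indices. X - lattice_vec P k \<in> cell P} = {k0}"
    using cell_lattice_unique[OF P] by blast
  have "{k \<in> lattice_indices. X + lattice_vec P k \<in> cell P} = {?m k0}"
  proof (rule set_eqI)
    fix k
    have "k \<in> lattice_indices \<and> X + lattice_vec P k \<in> cell P \<longleftrightarrow> k \<in> lattice_indices \<and> ?m k \<in> {k \<in> lattice_indices. X - lattice_vec P k \<in> cell P}"
      by (auto simp: m)
    also have "\<dots> \<longleftrightarrow> k = ?m k0"
    proof
      assume "k \<in> lattice_indices \<and> ?m k \<in> {k \<in> lattice_indices. X - lattice_vec P k \<in> cell P}"
      then have "k \<in> lattice_indices" "?m k = k0" unfolding k0 by (blast, blast)
      then show "k = ?m k0" using mm[of k] by metis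
    next
      assume k: "k = ?m k0"
      have "k0 \<in> lattice_indices" using k0 by blast
      then have "?m k = k0" unfolding k by (rule mm)
      moreover have "k \<in> lattice_indices" unfolding k by auto
      ultimately show "k \<in> lattice_indices \<and> ?m k \<in> {k \<in> lattice_indices. X - lattice_vec P k \<in> cell P}"
        unfolding k0 by blast
    qed
    finally show "k \<in> {k \<in> lattice_indices. X + lattice_vec P k \<in> cell P} \<longleftrightarrow> k \<in> {?m k0}" by simp
  qed
  then show ?thesis by blast
qed

text \<open>The translates of the cell form a partition of unity, the device for moving integrals
  between fundamental domains. Both signs occur because a lattice translation of the variable turns
  one into the other.\<close>

lemma nn_integral_lattice_indicator:
  assumes P: "\<And>b. b \<in> Basis \<Longrightarrow> P \<bullet> b > 0"
  shows "(\<integral>\<^sup>+k. indicator (cell P) (X - lattice_vec P k) \<partial>count_space lattice_indices) = 1"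
    and "(\<integral>\<^sup>+k. indicator (cell P) (X + lattice_vec P k) \<partial>count_space lattice_indices) = 1"
proof -
  have one: "(\<integral>\<^sup>+k. indicator (cell P) (F k) \<partial>count_space lattice_indices) = 1"
    if "\<exists>k0. {k \<in> lattice_indices. F k \<in> cell P} = {k0}" for F
  proof -
    from that obtain k0 where k0: "{k \<in> lattice_indices. F k \<in> cell P} = {k0}" by blast
    have "(\<integral>\<^sup>+k. indicator (cell P) (F k) \<partial>count_space lattice_indices) = (\<integral>\<^sup>+k. indicator {k0} k \<partial>count_space lattice_indices)"
      by (rule nn_integral_cong) (use k0 in \<open>auto simp: indicator_def\<close>)
    also have "\<dots> = emeasure (count_space lattice_indices) {k0}"
      by (rule nn_integral_indicator) (use k0 in auto)
    also have "\<dots> = 1" using k0 by (subst emeasure_count_space_finite) auto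
    finally show ?thesis .
  qed
  show "(\<integral>\<^sup>+k. indicator (cell P) (X - lattice_vec P k) \<partial>count_space lattice_indices) = 1"
    by (rule one[OF cell_lattice_unique[OF P]])
  show "(\<integral>\<^sup>+k. indicator (cell P) (X + lattice_vec P k) \<partial>count_space lattice_indices) = 1"
    by (rule one[OF cell_lattice_unique'[OF P]])
qed

lemma nn_integral_lborel_shift:
  fixes h :: "'a::euclidean_space \<Rightarrow> ennreal"
  assumes "h \<in> borel_measurable borel"
  shows "(\<integral>\<^sup>+X. h (X + c) \<partial>lborel) = (\<integral>\<^sup>+X. h X \<partial>lborel)"
proof -
  have "(\<integral>\<^sup>+X. h X \<partial>lborel) = (\<integral>\<^sup>+X. h X \<partial>distr lborel borel ((+) c))" by (simp add: lborel_distr_plus)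
  also have "\<dots> = (\<integral>\<^sup>+X. h (c + X) \<partial>lborel)" by (rule nn_integral_distr) (use assms in measurable)
  finally show ?thesis by (simp add: add.commute)
qed

lemma integral_lborel_shift:
  fixes h :: "'a::euclidean_space \<Rightarrow> 'b::{banach, second_countable_topology}"
  assumes "h \<in> borel_measurable borel"
  shows "(\<integral>X. h (X + c) \<partial>lborel) = (\<integral>X. h X \<partial>lborel)"
proof -
  have "(\<integral>X. h X \<partial>lborel) = (\<integral>X. h X \<partial>distr lborel borel ((+) c))" by (simp add: lborel_distr_plus)
  also have "\<dots> = (\<integral>X. h (c + X) \<partial>lborel)" by (rule integral_distr) (use assms in measurable)
  finally show ?thesis by (simp add: add.commute)
qed

lemma countable_lattice_indices: "countable (lattice_indices :: ('a::euclidean_space \<Rightarrow> int) set)"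
  by (rule countable_PiE) auto

text \<open>Both \<open>cell P\<close> and its translate by \<open>Z\<close> tile the space under the lattice.\<close>

lemma nn_integral_cell_shift:
  fixes h :: "'a::euclidean_space \<Rightarrow> ennreal"
  assumes P: "\<And>b. b \<in> Basis \<Longrightarrow> P \<bullet> b > 0" and h[measurable]: "h \<in> borel_measurable borel" and per: "periodic P h"
  shows "(\<integral>\<^sup>+X. h (X + Z) \<partial>cellM P) = (\<integral>\<^sup>+X. h X \<partial>cellM P)"
proof -
  have "(\<integral>\<^sup>+X. h (X + Z) \<partial>cellM P) = (\<integral>\<^sup>+X. h (X + Z) * indicator (cell P) X \<partial>lborel)"
    by (subst nn_integral_restrict_space) auto
  also have "\<dots> = (\<integral>\<^sup>+Y. h Y * indicator (cell P) (Y - Z) \<partial>lborel)"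
    using nn_integral_lborel_shift[of "\<lambda>Y. h Y * indicator (cell P) (Y - Z)" Z] by simp
  \<comment> \<open>Insert the partition of unity. With nonnegative integrands the sum over the
    lattice may be exchanged freely with the integral.\<close>
  also have "\<dots> = (\<integral>\<^sup>+Y. (\<integral>\<^sup>+k. h Y * indicator (cell P) (Y - Z) * indicator (cell P) (Y - lattice_vec P k) \<partial>count_space lattice_indices) \<partial>lborel)"
    by (subst nn_integral_cmult) (auto simp: nn_integral_lattice_indicator[OF P])
  also have "\<dots> = (\<integral>\<^sup>+k. (\<integral>\<^sup>+Y. h Y * indicator (cell P) (Y - Z) * indicator (cell P) (Y - lattice_vec P k) \<partial>lborel) \<partial>count_space lattice_indices)"
    by (rule nn_integral_count_space_nn_integral[OF countable_lattice_indices]) measurable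
  \<comment> \<open>Translation by a lattice vector leaves \<open>h\<close> alone and exchanges the
    roles of the two cells; the indicators of the shifted one then sum to 1.\<close>
  also have "\<dots> = (\<integral>\<^sup>+k. (\<integral>\<^sup>+Y. h Y * indicator (cell P) Y * indicator (cell P) (Y - Z + lattice_vec P k) \<partial>lborel) \<partial>count_space lattice_indices)"
  proof (rule nn_integral_cong)
    fix k
    have "(\<integral>\<^sup>+Y. h Y * indicator (cell P) (Y - Z) * indicator (cell P) (Y - lattice_vec P k) \<partial>lborel) =
       (\<integral>\<^sup>+Y. h (Y + lattice_vec P k) * indicator (cell P) (Y + lattice_vec P k - Z) * indicator (cell P) (Y + lattice_vec P k - lattice_vec P k) \<partial>lborel)"
      by (rule nn_integral_lborel_shift[symmetric]) measurable
    then show "(\<integral>\<^sup>+Y. h Y * indicator (cell P) (Y - Z) * indicator (cell P) (Y - lattice_vec P k) \<partial>lborel) =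
       (\<integral>\<^sup>+Y. h Y * indicator (cell P) Y * indicator (cell P) (Y - Z + lattice_vec P k) \<partial>lborel)"
      by (simp add: periodic_lattice_vec[OF per] algebra_simps)
  qed
  also have "\<dots> = (\<integral>\<^sup>+Y. (\<integral>\<^sup>+k. h Y * indicator (cell P) Y * indicator (cell P) (Y - Z + lattice_vec P k) \<partial>count_space lattice_indices) \<partial>lborel)"
    by (rule nn_integral_count_space_nn_integral[OF countable_lattice_indices, symmetric]) measurable
  also have "\<dots> = (\<integral>\<^sup>+Y. h Y * indicator (cell P) Y \<partial>lborel)"
    by (subst nn_integral_cmult) (auto simp: nn_integral_lattice_indicator[OF P])
  also have "\<dots> = (\<integral>\<^sup>+X. h X \<partial>cellM P)"
    by (subst nn_integral_restrict_space) auto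
  finally show ?thesis .
qed

lemma measurable_cellM: "f \<in> borel_measurable borel \<Longrightarrow> f \<in> borel_measurable (cellM P)"
  by (simp add: measurable_restrict_space1)

lemma periodic_comp: "periodic P h \<Longrightarrow> periodic P (\<lambda>X. f (h X))"
  by (simp add: periodic_def)

text \<open>Positive and negative parts are shifted separately, each by the nonnegative
  version.\<close>

lemma real_integral_cell_shift:
  fixes h :: "'a::euclidean_space \<Rightarrow> real"
  assumes P: "\<And>b. b \<in> Basis \<Longrightarrow> P \<bullet> b > 0" and h[measurable]: "h \<in> borel_measurable borel" and per: "periodic P h"
    and int: "integrable (cellM P) h"
  shows "integrable (cellM P) (\<lambda>X. h (X + Z))" "(\<integral>X. h (X + Z) \<partial>cellM P) = (\<integral>X. h X \<partial>cellM P)"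
proof -
  have sh: "(\<integral>\<^sup>+X. ennreal (f (h (X + Z))) \<partial>cellM P) = (\<integral>\<^sup>+X. ennreal (f (h X)) \<partial>cellM P)"
    if [measurable]: "f \<in> borel_measurable borel" for f
    by (rule nn_integral_cell_shift[OF P _ periodic_comp[OF per]]) measurable
  show 1: "integrable (cellM P) (\<lambda>X. h (X + Z))"
  proof -
    have "(\<lambda>X. h (X + Z)) \<in> borel_measurable (cellM P)" by (rule measurable_cellM) measurable
    then show ?thesis using int sh[of "\<lambda>x. norm x"] by (simp add: integrable_iff_bounded)
  qed
  show "(\<integral>X. h (X + Z) \<partial>cellM P) = (\<integral>X. h X \<partial>cellM P)"
    unfolding real_lebesgue_integral_def[OF 1] real_lebesgue_integral_def[OF int]
    using sh[of "\<lambda>x. x"] sh[of "\<lambda>x. - x"] by simp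
qed

lemma integral_cell_shift:
  fixes h :: "'a::euclidean_space \<Rightarrow> complex"
  assumes P: "\<And>b. b \<in> Basis \<Longrightarrow> P \<bullet> b > 0" and h[measurable]: "h \<in> borel_measurable borel" and per: "periodic P h"
    and int: "integrable (cellM P) h"
  shows "(\<integral>X. h (X + Z) \<partial>cellM P) = (\<integral>X. h X \<partial>cellM P)"
proof -
  note re = real_integral_cell_shift[OF P _ periodic_comp[OF per] integrable_Re[OF int], simplified]
  note im = real_integral_cell_shift[OF P _ periodic_comp[OF per] integrable_Im[OF int], simplified]
  have 1: "integrable (cellM P) (\<lambda>X. h (X + Z))"
  proof -
    have "integrable (cellM P) (\<lambda>X. complex_of_real (Re (h (X + Z))) + \<i> * complex_of_real (Im (h (X + Z))))"
      using re(1)[of Z] im(1)[of Z]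
      by (intro Bochner_Integration.integrable_add integrable_mult_right integrable_of_real) auto
    then show ?thesis by (simp add: complex_eq[symmetric])
  qed
  show ?thesis
    using re(2)[of Z] im(2)[of Z] by (simp add: complex_eq_iff integral_Re[OF int] integral_Im[OF int] integral_Re[OF 1] integral_Im[OF 1])
qed

text \<open>Formulated with a periodic modulus, because that is what a quasi-periodic function
  offers.\<close>

lemma sq_int_cell_shift:
  assumes P: "\<And>b. b \<in> Basis \<Longrightarrow> P \<bullet> b > 0" and h[measurable]: "h \<in> borel_measurable borel"
    and per: "periodic P (\<lambda>X. norm (h X))" and sq: "sq_int (cellM P) h"
  shows "sq_int (cellM P) (\<lambda>X. h (X + Z))" "nrm (cellM P) (\<lambda>X. h (X + Z)) = nrm (cellM P) h"
proof -
  have *: "integrable (cellM P) (\<lambda>X. (norm (h (X + Z)))\<^sup>2)" "(\<integral>X. (norm (h (X + Z)))\<^sup>2 \<partial>cellM P) = (\<integral>X. (norm (h X))\<^sup>2 \<partial>cellM P)"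
    using real_integral_cell_shift[OF P, of "\<lambda>X. (norm (h X))\<^sup>2" Z] periodic_comp[OF per, of "\<lambda>x. x\<^sup>2"] sq_int_integrable[OF sq] by simp_all
  have "(\<lambda>X. h (X + Z)) \<in> borel_measurable (cellM P)" by (rule measurable_cellM) measurable
  then show "sq_int (cellM P) (\<lambda>X. h (X + Z))" using *(1) by (simp add: sq_int_def)
  show "nrm (cellM P) (\<lambda>X. h (X + Z)) = nrm (cellM P) h" using *(2) by (simp add: nrm_def)
qed

section \<open>Approximation by continuous functions supported inside the cell\<close>

lemma box_subset_cell: "box (- P /\<^sub>R 2) (P /\<^sub>R 2) \<subseteq> cell P"
  by (auto simp: mem_box cell_def less_imp_le field_simps)

lemma cell_subset_cbox: "cell P \<subseteq> cbox (- P /\<^sub>R 2) (P /\<^sub>R 2)"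
  by (auto simp: mem_box cell_def less_imp_le field_simps)

lemma finite_measure_cellM: "finite_measure (cellM P)"
proof (rule finite_measureI)
  have "emeasure lborel (cell P) \<le> emeasure lborel (cbox (- P /\<^sub>R 2) (P /\<^sub>R 2))"
    by (intro emeasure_mono cell_subset_cbox) auto
  also have "\<dots> < \<infinity>" by (rule emeasure_bounded_finite) auto
  finally show "emeasure (cellM P) (space (cellM P)) \<noteq> \<infinity>"
    by (simp add: space_restrict_space emeasure_restrict_space)
qed

lemma AE_not_box_boundary: "AE X in lborel. X \<notin> cbox a b - box a b"
proof -
  have "emeasure lborel (cbox a b - box a b) = 0"
    by (subst emeasure_Diff) (auto simp: box_subset_cbox emeasure_lborel_box_eq emeasure_lborel_cbox_eq)
  then show ?thesis by (intro AE_not_in) (auto simp: null_sets_def)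
qed

lemma AE_cellM: "(AE X in lborel. X \<in> cell P \<longrightarrow> Q X) \<Longrightarrow> AE X in cellM P. Q X"
  by (simp add: AE_restrict_space_iff)

lemma AE_cellM_box: "AE X in cellM P. X \<in> box (- P /\<^sub>R 2) (P /\<^sub>R 2)"
  by (rule AE_cellM) (use AE_not_box_boundary cell_subset_cbox in \<open>fastforce elim!: eventually_mono\<close>)

lemma cell_approx_truncated:
  assumes A: "sq_int (cellM P) A" and e: "e > 0"
  shows "\<exists>n::nat. nrm (cellM P) (\<lambda>X. A X - (if norm (A X) \<le> real n then A X else 0)) < e"
proof -
  note [measurable] = sq_int_measurable[OF A]
  have "(\<lambda>n::nat. \<integral>X. (norm (A X - (if norm (A X) \<le> real n then A X else 0)))\<^sup>2 \<partial>cellM P) \<longlonglongrightarrow> (\<integral>X. 0 \<partial>cellM P)"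
  proof (rule integral_dominated_convergence)
    show "integrable (cellM P) (\<lambda>X. (norm (A X))\<^sup>2)" by (rule sq_int_integrable[OF A])
    show "AE X in cellM P. (\<lambda>n::nat. (norm (A X - (if norm (A X) \<le> real n then A X else 0)))\<^sup>2) \<longlonglongrightarrow> 0"
    proof (rule AE_I2)
      fix X
      have "eventually (\<lambda>n::nat. norm (A X) \<le> real n) sequentially"
        using real_arch_simple[of "norm (A X)"] eventually_sequentially by (meson le_trans of_nat_le_iff order_trans)
      then have "eventually (\<lambda>n::nat. (norm (A X - (if norm (A X) \<le> real n then A X else 0)))\<^sup>2 = 0) sequentially"
        by eventually_elim simp
      then show "(\<lambda>n::nat. (norm (A X - (if norm (A X) \<le> real n then A X else 0)))\<^sup>2) \<longlonglongrightarrow> 0"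
        by (rule tendsto_eventually)
    qed
    show "AE X in cellM P. norm ((norm (A X - (if norm (A X) \<le> real n then A X else 0)))\<^sup>2) \<le> (norm (A X))\<^sup>2" for n
      by (rule AE_I2) auto
  qed measurable
  then have "(\<lambda>n::nat. nrm (cellM P) (\<lambda>X. A X - (if norm (A X) \<le> real n then A X else 0))) \<longlonglongrightarrow> sqrt 0"
    unfolding nrm_def by (intro tendsto_real_sqrt) simp
  then have "eventually (\<lambda>n::nat. nrm (cellM P) (\<lambda>X. A X - (if norm (A X) \<le> real n then A X else 0)) < e) sequentially"
    using e by (intro order_tendstoD(2)) auto
  then show ?thesis by (rule eventually_happens'[rotated]) simp
qed

lemma infdist_gt_imp_ball_subset:
  assumes "infdist X (- U) > d"
  shows "ball X d \<subseteq> U"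
proof
  fix Y assume Y: "Y \<in> ball X d"
  show "Y \<in> U"
  proof (rule ccontr)
    assume "Y \<notin> U"
    then have "infdist X (- U) \<le> dist X Y" by (intro infdist_le) auto
    with Y assms show False by simp
  qed
qed

text \<open>A measurable function is an almost-everywhere limit of continuous ones. Their values are
  clamped to the disc of radius \<open>C\<close> and they are cut off near the boundary; as the cell
  has finite measure, dominated convergence with a constant bound gives the limit in norm.\<close>

lemma cell_approx_bounded:
  assumes B: "B \<in> borel_measurable (cellM P)" and C: "C > 0" "\<And>X. norm (B X) \<le> C" and e: "e > 0"
  shows "\<exists>A' \<eta>. continuous_on UNIV A' \<and> (\<forall>X. norm (A' X) \<le> C) \<and> \<eta> > 0 \<and> (\<forall>X. A' X \<noteq> 0 \<longrightarrow> ball X \<eta> \<subseteq> cell P)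
    \<and> nrm (cellM P) (\<lambda>X. B X - A' X) < e"
proof -
  interpret finite_measure "cellM P" by (rule finite_measure_cellM)
  let ?U = "box (- P /\<^sub>R 2) (P /\<^sub>R 2)"
  have "(\<lambda>X. indicat_real (cell P) X *\<^sub>R B X) \<in> borel_measurable lborel"
    using B by (simp add: borel_measurable_restrict_space_iff)
  then have "(\<lambda>X. indicat_real (cell P) X *\<^sub>R B X) \<in> borel_measurable lebesgue" by (rule measurable_completion)
  then have "(\<lambda>X. indicat_real (cell P) X *\<^sub>R B X) measurable_on UNIV"
    by (intro lebesgue_measurable_imp_measurable_on) auto
  then obtain N g where N: "negligible N" and g: "\<And>n. continuous_on UNIV (g n)"
    and lim: "\<And>X. X \<notin> N \<Longrightarrow> (\<lambda>n. g n X) \<longlonglongrightarrow> indicat_real (cell P) X *\<^sub>R B X"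
    unfolding measurable_on_def by auto
  \<comment> \<open>Radial retraction onto the disc of radius \<open>C\<close>; it fixes all values
    of \<open>B\<close>.\<close>
  define cl where "cl z = (C / max C (norm z)) *\<^sub>R z" for z :: complex
  have cl_cont: "continuous_on UNIV cl" unfolding cl_def using C(1) by (intro continuous_intros) auto
  have cl_le: "norm (cl z) \<le> C" for z
    unfolding cl_def using C(1) by (auto simp: field_simps max_def)
  have cl_id: "cl z = z" if "norm z \<le> C" for z
    using that C(1) by (simp add: cl_def max_def)
  \<comment> \<open>A ramp: zero up to distance \<open>1 / (n + 1)\<close> from the complement of
    the open cell, one from distance \<open>2 / (n + 1)\<close> on. The first number becomes the
    \<open>\<eta>\<close> of the statement.\<close>
  define et where "et n X = min 1 (max 0 (real (Suc n) * infdist X (- ?U) - 1))" for n X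
  have et01: "0 \<le> et n X" "et n X \<le> 1" for n X by (auto simp: et_def)
  define A' where "A' n X = et n X *\<^sub>R cl (g n X)" for n X
  have A'_cont: "continuous_on UNIV (A' n)" for n
    unfolding A'_def et_def
    by (intro continuous_intros continuous_on_compose2[OF cl_cont g]) auto
  have A'_le: "norm (A' n X) \<le> C" for n X
  proof -
    have "norm (A' n X) \<le> 1 * norm (cl (g n X))" using et01[of n X] unfolding A'_def norm_scaleR by (intro mult_right_mono) auto
    with cl_le[of "g n X"] show ?thesis by simp
  qed
  have A'_supp: "ball X (1 / real (Suc n)) \<subseteq> cell P" if "A' n X \<noteq> 0" for n X
  proof -
    have "et n X \<noteq> 0" using that by (auto simp: A'_def)
    then have "real (Suc n) * infdist X (- ?U) > 1" by (auto simp: et_def min_def max_def split: if_splits)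
    then have "infdist X (- ?U) > 1 / real (Suc n)" by (simp add: field_simps)
    then show ?thesis using infdist_gt_imp_ball_subset box_subset_cell by blast
  qed
  have [measurable]: "A' n \<in> borel_measurable borel" for n
    by (rule borel_measurable_continuous_onI[OF A'_cont])
  have [measurable]: "A' n \<in> borel_measurable (cellM P)" for n by (rule measurable_cellM) measurable
  note [measurable] = B
  have nU: "- ?U \<noteq> {}" using bounded_box not_bounded_UNIV[where 'a='a] by (metis Compl_empty_eq double_complement)
  have et_lim: "(\<lambda>n. et n X) \<longlonglongrightarrow> 1" if "X \<in> ?U" for X
  proof (rule tendsto_eventually)
    have "closed (- ?U)" by (rule closed_Compl[OF open_box])
    then have "infdist X (- ?U) \<noteq> 0" using that nU in_closed_iff_infdist_zero[of "- ?U" X] by simp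
    then have pos: "infdist X (- ?U) > 0" using infdist_nonneg[of X "- ?U"] by linarith
    obtain m :: nat where m: "2 / infdist X (- ?U) < real m" using reals_Archimedean2 by blast
    show "eventually (\<lambda>n. et n X = 1) sequentially"
      unfolding eventually_sequentially
    proof (intro exI allI impI)
      fix n assume "m \<le> n"
      then have "2 / infdist X (- ?U) < real (Suc n)" using m by linarith
      then have "2 < real (Suc n) * infdist X (- ?U)" using pos by (simp add: field_simps)
      then show "et n X = 1" by (simp add: et_def)
    qed
  qed
  have "(\<lambda>n. \<integral>X. (norm (B X - A' n X))\<^sup>2 \<partial>cellM P) \<longlonglongrightarrow> (\<integral>X. 0 \<partial>cellM P)"
  proof (rule integral_dominated_convergence)
    show "integrable (cellM P) (\<lambda>X. (2 * C)\<^sup>2)" by simp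
    have "AE X in lborel. X \<notin> N"
    proof -
      have "N \<in> null_sets lebesgue" using N by (simp add: negligible_iff_null_sets)
      then have "AE X in lebesgue. X \<notin> N" by (rule AE_not_in)
      then show ?thesis by (simp add: AE_completion_iff)
    qed
    then have "AE X in cellM P. X \<notin> N" by (intro AE_cellM) auto
    moreover have "AE X in cellM P. X \<in> cell P" using AE_space[of "cellM P"] by (simp add: space_restrict_space)
    ultimately show "AE X in cellM P. (\<lambda>n. (norm (B X - A' n X))\<^sup>2) \<longlonglongrightarrow> 0"
      using AE_cellM_box
    proof eventually_elim
      case (elim X)
      have "(\<lambda>n. g n X) \<longlonglongrightarrow> B X" using lim[OF elim(1)] elim(2) by simp
      then have "(\<lambda>n. cl (g n X)) \<longlonglongrightarrow> cl (B X)"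
        using continuous_on_tendsto_compose[OF cl_cont] by simp
      then have "(\<lambda>n. A' n X) \<longlonglongrightarrow> 1 *\<^sub>R cl (B X)"
        unfolding A'_def by (intro tendsto_scaleR et_lim[OF elim(3)])
      then have "(\<lambda>n. A' n X) \<longlonglongrightarrow> B X" using cl_id[OF C(2)] by simp
      then have "(\<lambda>n. (norm (B X - A' n X))\<^sup>2) \<longlonglongrightarrow> (norm (B X - B X))\<^sup>2" by (intro tendsto_intros)
      then show ?case by simp
    qed
    show "AE X in cellM P. norm ((norm (B X - A' n X))\<^sup>2) \<le> (2 * C)\<^sup>2" for n
    proof (rule AE_I2)
      fix X
      have "norm (B X - A' n X) \<le> 2 * C" using norm_triangle_ineq4[of "B X" "A' n X"] C(2)[of X] A'_le[of n X] by linarith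
      then show "norm ((norm (B X - A' n X))\<^sup>2) \<le> (2 * C)\<^sup>2"
        using power_mono[of "norm (B X - A' n X)" "2 * C" 2] by simp
    qed
  qed measurable
  then have "(\<lambda>n. nrm (cellM P) (\<lambda>X. B X - A' n X)) \<longlonglongrightarrow> sqrt 0"
    unfolding nrm_def by (intro tendsto_real_sqrt) simp
  then have "eventually (\<lambda>n. nrm (cellM P) (\<lambda>X. B X - A' n X) < e) sequentially"
    using e by (intro order_tendstoD(2)) auto
  then obtain n where n: "nrm (cellM P) (\<lambda>X. B X - A' n X) < e" by (auto simp: eventually_sequentially)
  show ?thesis
    by (rule exI[of _ "A' n"], rule exI[of _ "1 / real (Suc n)"]) (use A'_cont A'_le A'_supp n in auto)
qed

lemma bounded_sq_int_cellM:
  assumes "A \<in> borel_measurable (cellM P)" "\<And>X. norm (A X) \<le> C"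
  shows "sq_int (cellM P) A"
proof -
  interpret finite_measure "cellM P" by (rule finite_measure_cellM)
  have "integrable (cellM P) (\<lambda>X. (norm (A X))\<^sup>2)"
  proof (rule integrable_const_bound[of _ "C\<^sup>2"])
    show "AE X in cellM P. norm ((norm (A X))\<^sup>2) \<le> C\<^sup>2" by (rule AE_I2) (use assms(2) in \<open>auto intro: power_mono\<close>)
  qed (use assms(1) in measurable)
  then show ?thesis using assms(1) by (simp add: sq_int_def)
qed

text \<open>Truncation reduces the claim to bounded functions. The margin \<open>\<eta>\<close> is
  what later permits small translations without leaving the cell.\<close>

lemma cell_approx:
  assumes A: "sq_int (cellM P) A" and e: "e > 0"
  shows "\<exists>A' C \<eta>. continuous_on UNIV A' \<and> (\<forall>X. norm (A' X) \<le> C) \<and> \<eta> > 0 \<and> (\<forall>X. A' X \<noteq> 0 \<longrightarrow> ball X \<eta> \<subseteq> cell P)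
    \<and> sq_int (cellM P) A' \<and> nrm (cellM P) (\<lambda>X. A X - A' X) < e"
proof -
  note [measurable] = sq_int_measurable[OF A]
  obtain n :: nat where n: "nrm (cellM P) (\<lambda>X. A X - (if norm (A X) \<le> real n then A X else 0)) < e / 2"
    using cell_approx_truncated[OF A, of "e / 2"] e by auto
  define B where "B X = (if norm (A X) \<le> real n then A X else 0)" for X
  have [measurable]: "B \<in> borel_measurable (cellM P)" unfolding B_def by measurable
  have Bn: "norm (B X) \<le> real n + 1" for X by (auto simp: B_def)
  have B: "sq_int (cellM P) B" by (rule bounded_sq_int_cellM[OF _ Bn]) measurable
  obtain A' \<eta> where A': "continuous_on UNIV A'" "\<And>X. norm (A' X) \<le> real n + 1" "\<eta> > 0" "\<And>X. A' X \<noteq> 0 \<Longrightarrow> ball X \<eta> \<subseteq> cell P"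
    "nrm (cellM P) (\<lambda>X. B X - A' X) < e / 2"
    using cell_approx_bounded[where P=P and B=B and C="real n + 1" and e="e / 2"] Bn e by auto
  have "A' \<in> borel_measurable (cellM P)" by (intro measurable_cellM borel_measurable_continuous_onI A')
  then have A'sq: "sq_int (cellM P) A'" by (rule bounded_sq_int_cellM[OF _ A'(2)])
  have "nrm (cellM P) (\<lambda>X. (A X - B X) + (B X - A' X)) \<le> nrm (cellM P) (\<lambda>X. A X - B X) + nrm (cellM P) (\<lambda>X. B X - A' X)"
    by (rule nrm_triangle) (intro sq_int_diff A B A'sq)+
  also have "\<dots> < e" using n A'(5) by (simp add: B_def)
  finally have "nrm (cellM P) (\<lambda>X. A X - A' X) < e" by simp
  then show ?thesis using A' A'sq by blast
qed

section \<open>Twisted correlations\<close>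

text \<open>The cross-correlation over one cell, with a phase \<open>w\<close>. The phase stays
  abstract in this section: continuity and the bound 1 on its modulus carry the arguments.\<close>

definition twisted_corr ::
  "'a::euclidean_space \<Rightarrow> ('a \<Rightarrow> 'a \<Rightarrow> complex) \<Rightarrow> ('a \<Rightarrow> complex) \<Rightarrow> ('a \<Rightarrow> complex) \<Rightarrow> 'a \<Rightarrow> complex" where
  "twisted_corr P w A B Z = (\<integral>X. cnj (A X) * (w X Z * B (X + Z)) \<partial>cellM P)"

lemma measurable_ident_cellM [measurable]: "(\<lambda>X. X) \<in> borel_measurable (cellM P)"
  by (rule measurable_cellM) simp

lemma sigma_finite_cellM: "sigma_finite_measure (cellM P)"
proof -
  interpret finite_measure "cellM P" by (rule finite_measure_cellM)
  show ?thesis by (rule sigma_finite_measure_axioms)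
qed

context
  fixes P :: "'a::euclidean_space" and w :: "'a \<Rightarrow> 'a \<Rightarrow> complex" and B :: "'a \<Rightarrow> complex"
  assumes P: "\<And>b. b \<in> Basis \<Longrightarrow> P \<bullet> b > 0"
    and w_cont: "continuous_on UNIV (\<lambda>(X, Z). w X Z)" and w_le: "\<And>X Z. norm (w X Z) \<le> 1"
    and B: "B \<in> borel_measurable borel" "sq_int (cellM P) B" and B_per: "periodic P (\<lambda>X. norm (B X))"
begin

lemma w_measurable: "(\<lambda>(X, Z). w X Z) \<in> borel_measurable (borel \<Otimes>\<^sub>M borel)"
  unfolding borel_prod by (rule borel_measurable_continuous_onI[OF w_cont])

text \<open>Shift invariance over the cell applies to the modulus of \<open>B\<close>, and the phase
  cannot enlarge it; the bound is therefore uniform in \<open>Z\<close>.\<close>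

lemma twisted_shift:
  shows "sq_int (cellM P) (\<lambda>X. w X Z * B (X + Z))" "nrm (cellM P) (\<lambda>X. w X Z * B (X + Z)) \<le> nrm (cellM P) B"
proof -
  note [measurable] = w_measurable B(1)
  have [measurable]: "(\<lambda>X. w X Z) \<in> borel_measurable (cellM P)" by (rule measurable_cellM) measurable
  have sh: "sq_int (cellM P) (\<lambda>X. B (X + Z))" "nrm (cellM P) (\<lambda>X. B (X + Z)) = nrm (cellM P) B"
    by (rule sq_int_cell_shift[OF P B(1) B_per B(2)], assumption)+
  show 1: "sq_int (cellM P) (\<lambda>X. w X Z * B (X + Z))"
    by (rule sq_int_mult_bounded[OF _ sh(1), where C=1]) (auto simp: w_le)
  have "nrm (cellM P) (\<lambda>X. w X Z * B (X + Z)) \<le> 1 * nrm (cellM P) (\<lambda>X. B (X + Z))"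
    by (rule nrm_mono_AE[OF sq_int_measurable[OF 1] sh(1)])
       (auto simp: norm_mult intro!: mult_left_le_one_le w_le)
  then show "nrm (cellM P) (\<lambda>X. w X Z * B (X + Z)) \<le> nrm (cellM P) B" using sh(2) by simp
qed

lemma twisted_corr_bound:
  assumes "sq_int (cellM P) A"
  shows "norm (twisted_corr P w A B Z) \<le> nrm (cellM P) A * nrm (cellM P) B"
proof -
  have "norm (twisted_corr P w A B Z) \<le> nrm (cellM P) A * nrm (cellM P) (\<lambda>X. w X Z * B (X + Z))"
    using ip_Cauchy_Schwarz[OF assms twisted_shift(1)] by (simp add: twisted_corr_def ip_def)
  also have "\<dots> \<le> nrm (cellM P) A * nrm (cellM P) B"
    by (intro mult_left_mono twisted_shift) simp
  finally show ?thesis .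
qed

text \<open>\<open>B\<close> is merely measurable, so the translation is moved to the continuous
  \<open>A\<close>. As the support of \<open>A\<close> keeps the distance \<open>\<eta>\<close> from
  the complement of the cell, shifts shorter than \<open>\<eta>\<close> stay inside and no boundary
  terms arise; dominated convergence does the rest.\<close>

lemma twisted_corr_tendsto_compact:
  assumes A: "continuous_on UNIV A" "\<And>X. norm (A X) \<le> C" and eta: "\<eta> > 0"
    and supp: "\<And>X. A X \<noteq> 0 \<Longrightarrow> ball X \<eta> \<subseteq> cell P"
  shows "((\<lambda>Z. twisted_corr P w A B Z) \<longlongrightarrow> twisted_corr P w A B 0) (at 0)"
  unfolding tendsto_at_iff_sequentially
proof (intro allI impI)
  fix S :: "nat \<Rightarrow> 'a" assume S: "S \<longlonglongrightarrow> 0"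
  interpret finite_measure "cellM P" by (rule finite_measure_cellM)
  note [measurable] = w_measurable B(1) borel_measurable_continuous_onI[OF A(1)]
  have w_isCont: "isCont (\<lambda>(X, Z). w X Z) x" for x
    using w_cont unfolding continuous_on_eq_continuous_at[OF open_UNIV] by blast
  have C0: "C \<ge> 0" using A(2)[of 0] norm_ge_zero[of "A 0"] by linarith
  have eq: "twisted_corr P w A B Z = (\<integral>Y. cnj (A (Y - Z)) * (w (Y - Z) Z * B Y) \<partial>cellM P)" if Z: "norm Z < \<eta>" for Z
  proof -
    have "twisted_corr P w A B Z = (\<integral>X. indicat_real (cell P) X *\<^sub>R (cnj (A X) * (w X Z * B (X + Z))) \<partial>lborel)"
      unfolding twisted_corr_def by (rule integral_restrict_space) simp
    also have "\<dots> = (\<integral>X. cnj (A ((X + Z) - Z)) * (w ((X + Z) - Z) Z * B (X + Z)) \<partial>lborel)"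
    proof (rule Bochner_Integration.integral_cong[OF refl])
      fix X
      show "indicat_real (cell P) X *\<^sub>R (cnj (A X) * (w X Z * B (X + Z))) = cnj (A ((X + Z) - Z)) * (w ((X + Z) - Z) Z * B (X + Z))"
      proof (cases "A X = 0")
        case False
        then have "X \<in> cell P" using supp[of X] eta by (auto simp: subset_eq)
        then show ?thesis by simp
      qed simp
    qed
    also have "\<dots> = (\<integral>Y. cnj (A (Y - Z)) * (w (Y - Z) Z * B Y) \<partial>lborel)"
      by (rule integral_lborel_shift[of "\<lambda>Y. cnj (A (Y - Z)) * (w (Y - Z) Z * B Y)"]) measurable
    also have "\<dots> = (\<integral>Y. indicat_real (cell P) Y *\<^sub>R (cnj (A (Y - Z)) * (w (Y - Z) Z * B Y)) \<partial>lborel)"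
    proof (rule Bochner_Integration.integral_cong[OF refl])
      fix Y
      show "cnj (A (Y - Z)) * (w (Y - Z) Z * B Y) = indicat_real (cell P) Y *\<^sub>R (cnj (A (Y - Z)) * (w (Y - Z) Z * B Y))"
      proof (cases "A (Y - Z) = 0")
        case False
        then have "Y \<in> cell P" using supp[of "Y - Z"] Z by (auto simp: subset_eq dist_norm)
        then show ?thesis by simp
      qed simp
    qed
    also have "\<dots> = (\<integral>Y. cnj (A (Y - Z)) * (w (Y - Z) Z * B Y) \<partial>cellM P)"
      by (rule integral_restrict_space[symmetric]) simp
    finally show ?thesis .
  qed
  have "(\<lambda>n. \<integral>Y. cnj (A (Y - S n)) * (w (Y - S n) (S n) * B Y) \<partial>cellM P) \<longlonglongrightarrow> (\<integral>Y. cnj (A (Y - 0)) * (w (Y - 0) 0 * B Y) \<partial>cellM P)"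
  proof (rule integral_dominated_convergence)
    show "integrable (cellM P) (\<lambda>Y. C * norm (B Y))"
    proof -
      have "sq_int (cellM P) (\<lambda>Y. 1)" by (rule bounded_sq_int_cellM[of _ _ 1]) auto
      from integrable_norm[OF integrable_sq_int_mult[OF this B(2)]] show ?thesis by simp
    qed
    show "AE Y in cellM P. (\<lambda>n. cnj (A (Y - S n)) * (w (Y - S n) (S n) * B Y)) \<longlonglongrightarrow> cnj (A (Y - 0)) * (w (Y - 0) 0 * B Y)"
    proof (rule AE_I2)
      fix Y
      have 1: "(\<lambda>n. A (Y - S n)) \<longlonglongrightarrow> A (Y - 0)"
        using A(1) by (intro isCont_tendsto_compose[of _ A] tendsto_intros S) (simp add: continuous_on_eq_continuous_at)
      have "(\<lambda>n. (\<lambda>(X, Z). w X Z) (Y - S n, S n)) \<longlonglongrightarrow> (\<lambda>(X, Z). w X Z) (Y - 0, 0)"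
        by (intro isCont_tendsto_compose[OF w_isCont] tendsto_intros S)
      then show "(\<lambda>n. cnj (A (Y - S n)) * (w (Y - S n) (S n) * B Y)) \<longlonglongrightarrow> cnj (A (Y - 0)) * (w (Y - 0) 0 * B Y)"
        using 1 by (intro tendsto_intros) auto
    qed
    show "AE Y in cellM P. norm (cnj (A (Y - S n)) * (w (Y - S n) (S n) * B Y)) \<le> C * norm (B Y)" for n
    proof (rule AE_I2)
      fix Y
      have "norm (w (Y - S n) (S n)) * norm (B Y) \<le> 1 * norm (B Y)" by (intro mult_right_mono w_le) simp
      then have "norm (A (Y - S n)) * (norm (w (Y - S n) (S n)) * norm (B Y)) \<le> C * norm (B Y)"
        by (intro mult_mono A(2) C0) auto
      then show "norm (cnj (A (Y - S n)) * (w (Y - S n) (S n) * B Y)) \<le> C * norm (B Y)" by (simp add: norm_mult)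
    qed
    show "(\<lambda>Y. cnj (A (Y - S n)) * (w (Y - S n) (S n) * B Y)) \<in> borel_measurable (cellM P)" for n
      by (rule measurable_cellM) measurable
    show "(\<lambda>Y. cnj (A (Y - 0)) * (w (Y - 0) 0 * B Y)) \<in> borel_measurable (cellM P)"
      by (rule measurable_cellM) measurable
  qed
  then have lim: "(\<lambda>n. \<integral>Y. cnj (A (Y - S n)) * (w (Y - S n) (S n) * B Y) \<partial>cellM P) \<longlonglongrightarrow> twisted_corr P w A B 0"
    using eq[of 0] eta by simp
  have "eventually (\<lambda>n. norm (S n) < \<eta>) sequentially"
    using tendsto_norm[OF S] eta by (intro order_tendstoD(2)) auto
  then have "eventually (\<lambda>n. (\<integral>Y. cnj (A (Y - S n)) * (w (Y - S n) (S n) * B Y) \<partial>cellM P) = twisted_corr P w A B (S n)) sequentially"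
    by eventually_elim (simp add: eq)
  from Lim_transform_eventually[OF lim this]
  show "((\<lambda>Z. twisted_corr P w A B Z) \<circ> S) \<longlonglongrightarrow> twisted_corr P w A B 0" by (simp add: comp_def)
qed

text \<open>Approximate \<open>A\<close> in norm: the resulting error of the correlation is uniform
  in \<open>Z\<close>.\<close>

lemma twisted_corr_tendsto:
  assumes A: "sq_int (cellM P) A"
  shows "((\<lambda>Z. twisted_corr P w A B Z) \<longlongrightarrow> twisted_corr P w A B 0) (at 0)"
proof (rule tendstoI)
  fix e :: real assume e: "e > 0"
  \<comment> \<open>A third of \<open>e\<close> divided by the norm of \<open>B\<close>; the added 1
    keeps the quotient meaningful when that norm is zero.\<close>
  define d where "d = e / (3 * (nrm (cellM P) B + 1))"
  have nB: "nrm (cellM P) B + 1 > 0" using nrm_nonneg[of "cellM P" B] by linarith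
  have d: "d > 0" using e nB by (simp add: d_def)
  have dB: "d * nrm (cellM P) B \<le> e / 3"
  proof -
    have "d * nrm (cellM P) B \<le> d * (nrm (cellM P) B + 1)" using d by simp
    also have "\<dots> = e / 3" using nB by (simp add: d_def field_simps)
    finally show ?thesis .
  qed
  obtain A' C \<eta> where A': "continuous_on UNIV A'" "\<And>X. norm (A' X) \<le> C" "\<eta> > 0" "\<And>X. A' X \<noteq> 0 \<Longrightarrow> ball X \<eta> \<subseteq> cell P"
     "sq_int (cellM P) A'" "nrm (cellM P) (\<lambda>X. A X - A' X) < d"
    using cell_approx[OF A d] by auto
  have close: "norm (twisted_corr P w A B Z - twisted_corr P w A' B Z) \<le> e / 3" for Z
  proof -
    have "twisted_corr P w A B Z - twisted_corr P w A' B Z = twisted_corr P w (\<lambda>X. A X - A' X) B Z"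
      using ip_diff_left[OF twisted_shift(1) A A'(5)] by (simp add: twisted_corr_def ip_def)
    also have "norm \<dots> \<le> nrm (cellM P) (\<lambda>X. A X - A' X) * nrm (cellM P) B"
      by (rule twisted_corr_bound[OF sq_int_diff[OF A A'(5)]])
    also have "\<dots> \<le> d * nrm (cellM P) B" using A'(6) by (intro mult_right_mono) auto
    finally show ?thesis using dB by linarith
  qed
  have "eventually (\<lambda>Z. dist (twisted_corr P w A' B Z) (twisted_corr P w A' B 0) < e / 3) (at 0)"
    using tendstoD[OF twisted_corr_tendsto_compact[OF A'(1-4)], of "e / 3"] e by simp
  then show "eventually (\<lambda>Z. dist (twisted_corr P w A B Z) (twisted_corr P w A B 0) < e) (at 0)"
  proof eventually_elim
    case (elim Z)
    have "dist (twisted_corr P w A B Z) (twisted_corr P w A B 0) \<le> dist (twisted_corr P w A B Z) (twisted_corr P w A' B Z) +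
       dist (twisted_corr P w A' B Z) (twisted_corr P w A' B 0) + dist (twisted_corr P w A' B 0) (twisted_corr P w A B 0)"
      by metric
    with elim close[of Z] close[of 0] show ?case by (simp add: dist_norm norm_minus_commute)
  qed
qed

text \<open>The inner integral of the modulus is dominated by a constant multiple of the weight,
  because the correlation bound is uniform in \<open>Z\<close>; this licenses the exchange of
  integrals.\<close>

lemma twisted_corr_Fubini:
  assumes A: "sq_int (cellM P) A" and rho: "integrable lborel \<rho>"
  shows "integrable lborel (\<lambda>Z. \<rho> Z * twisted_corr P w A B Z)"
    and "(\<integral>Z. \<rho> Z * twisted_corr P w A B Z \<partial>lborel) = (\<integral>X. cnj (A X) * (\<integral>Z. \<rho> Z * (w X Z * B (X + Z)) \<partial>lborel) \<partial>cellM P)"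
proof -
  interpret pair_sigma_finite lborel "cellM P"
    by (simp add: pair_sigma_finite_def sigma_finite_cellM sigma_finite_lborel)
  note [measurable] = w_measurable B(1) sq_int_measurable[OF A] borel_measurable_integrable[OF rho]
  define F where "F = (\<lambda>(Z, X). \<rho> Z * (cnj (A X) * (w X Z * B (X + Z))))"
  have Fm: "F \<in> borel_measurable (lborel \<Otimes>\<^sub>M cellM P)"
    unfolding F_def by measurable
  have inner: "integrable (cellM P) (\<lambda>X. F (Z, X))" for Z
    unfolding F_def by (auto intro!: integrable_mult_right integrable_ip[OF A twisted_shift(1)])
  have innerI: "(\<integral>X. F (Z, X) \<partial>cellM P) = \<rho> Z * twisted_corr P w A B Z" for Z
    by (simp add: F_def twisted_corr_def)
  have nb: "(\<integral>X. norm (F (Z, X)) \<partial>cellM P) \<le> norm (\<rho> Z) * (nrm (cellM P) A * nrm (cellM P) B)" for Z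
  proof -
    have "(\<integral>X. norm (F (Z, X)) \<partial>cellM P) = norm (\<rho> Z) * (\<integral>X. norm (A X) * norm (w X Z * B (X + Z)) \<partial>cellM P)"
      by (simp add: F_def norm_mult)
    also have "\<dots> \<le> norm (\<rho> Z) * (nrm (cellM P) A * nrm (cellM P) (\<lambda>X. w X Z * B (X + Z)))"
      by (intro mult_left_mono integral_norm_mult_le A twisted_shift) simp
    also have "\<dots> \<le> norm (\<rho> Z) * (nrm (cellM P) A * nrm (cellM P) B)"
      by (intro mult_left_mono twisted_shift) auto
    finally show ?thesis .
  qed
  have int: "integrable (lborel \<Otimes>\<^sub>M cellM P) F"
  proof (rule Fubini_integrable[OF Fm])
    show "integrable lborel (\<lambda>Z. \<integral>X. norm (F (Z, X)) \<partial>cellM P)"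
    proof (rule Bochner_Integration.integrable_bound)
      show "integrable lborel (\<lambda>Z. norm (\<rho> Z) * (nrm (cellM P) A * nrm (cellM P) B))" using rho by simp
      show "(\<lambda>Z. \<integral>X. norm (F (Z, X)) \<partial>cellM P) \<in> borel_measurable lborel" using Fm by measurable
      show "AE Z in lborel. norm (\<integral>X. norm (F (Z, X)) \<partial>cellM P) \<le> norm (norm (\<rho> Z) * (nrm (cellM P) A * nrm (cellM P) B))"
        by (rule AE_I2) (use nb in \<open>simp add: abs_mult\<close>)
    qed
    show "AE Z in lborel. integrable (cellM P) (\<lambda>X. F (Z, X))" by (rule AE_I2) (rule inner)
  qed
  show "integrable lborel (\<lambda>Z. \<rho> Z * twisted_corr P w A B Z)"
    using integrable_fst'[OF int] by (simp add: innerI)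
  have "(\<integral>Z. (\<integral>X. F (Z, X) \<partial>cellM P) \<partial>lborel) = (\<integral>X. (\<integral>Z. F (Z, X) \<partial>lborel) \<partial>cellM P)"
    by (rule Fubini_integral[of "\<lambda>Z X. F (Z, X)", symmetric]) (use int in simp)
  also have "\<dots> = (\<integral>X. cnj (A X) * (\<integral>Z. \<rho> Z * (w X Z * B (X + Z)) \<partial>lborel) \<partial>cellM P)"
  proof (rule Bochner_Integration.integral_cong[OF refl])
    fix X
    have "(\<integral>Z. F (Z, X) \<partial>lborel) = (\<integral>Z. cnj (A X) * (\<rho> Z * (w X Z * B (X + Z))) \<partial>lborel)"
      by (simp add: F_def mult_ac)
    then show "(\<integral>Z. F (Z, X) \<partial>lborel) = cnj (A X) * (\<integral>Z. \<rho> Z * (w X Z * B (X + Z)) \<partial>lborel)" by simp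
  qed
  finally show "(\<integral>Z. \<rho> Z * twisted_corr P w A B Z \<partial>lborel) = (\<integral>X. cnj (A X) * (\<integral>Z. \<rho> Z * (w X Z * B (X + Z)) \<partial>lborel) \<partial>cellM P)"
    by (simp add: innerI)
qed

end

declare measurable_ident_cellM [measurable del]

text \<open>If \<open>f 0\<close> were positive, \<open>f\<close> would stay above half of it near
  the origin, and a nonnegative weight of positive mass concentrated there could not average it to
  zero. The weights act as an approximate identity that is not normalised.\<close>

lemma averages_zero_imp_zero:
  fixes f :: "'a::euclidean_space \<Rightarrow> real"
  assumes lim: "(f \<longlongrightarrow> f 0) (at 0)"
    and avg: "\<And>e. e > 0 \<Longrightarrow> \<exists>\<rho>. integrable lborel \<rho> \<and> integrable lborel (\<lambda>Z. \<rho> Z * f Z) \<and> (\<forall>Z. \<rho> Z \<ge> 0) \<and>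
       (\<forall>Z. norm Z \<ge> e \<longrightarrow> \<rho> Z = 0) \<and> (\<integral>Z. \<rho> Z \<partial>lborel) > 0 \<and> (\<integral>Z. \<rho> Z * f Z \<partial>lborel) = 0"
  shows "f 0 = 0"
proof -
  have pos: False
    if g: "(g \<longlongrightarrow> g 0) (at 0)" "g 0 > 0" and av: "\<And>e. e > 0 \<Longrightarrow> \<exists>\<rho>. integrable lborel \<rho> \<and> integrable lborel (\<lambda>Z. \<rho> Z * g Z) \<and> (\<forall>Z. \<rho> Z \<ge> 0) \<and>
       (\<forall>Z. norm Z \<ge> e \<longrightarrow> \<rho> Z = 0) \<and> (\<integral>Z. \<rho> Z \<partial>lborel) > 0 \<and> (\<integral>Z. \<rho> Z * g Z \<partial>lborel) = 0"
    for g :: "'a \<Rightarrow> real"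
  proof -
    have "eventually (\<lambda>Z. g Z > g 0 / 2) (at 0)" using g by (intro order_tendstoD(1)) auto
    then obtain e where e: "e > 0" "\<And>Z. Z \<noteq> 0 \<Longrightarrow> dist Z 0 < e \<Longrightarrow> g Z > g 0 / 2" by (auto simp: eventually_at)
    then have ge: "norm Z < e \<Longrightarrow> g Z \<ge> g 0 / 2" for Z using g(2) by (cases "Z = 0") (auto simp: less_imp_le)
    obtain \<rho> where r: "integrable lborel \<rho>" "integrable lborel (\<lambda>Z. \<rho> Z * g Z)" "\<And>Z. \<rho> Z \<ge> 0" "\<And>Z. norm Z \<ge> e \<Longrightarrow> \<rho> Z = 0"
      "(\<integral>Z. \<rho> Z \<partial>lborel) > 0" "(\<integral>Z. \<rho> Z * g Z \<partial>lborel) = 0" using av[OF e(1)] by blast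
    have "(\<integral>Z. \<rho> Z * (g 0 / 2) \<partial>lborel) \<le> (\<integral>Z. \<rho> Z * g Z \<partial>lborel)"
    proof (rule integral_mono)
      fix Z
      show "\<rho> Z * (g 0 / 2) \<le> \<rho> Z * g Z"
        using r(3)[of Z] r(4)[of Z] mult_left_mono[of "g 0 / 2" "g Z" "\<rho> Z"] ge[of Z] by (cases "norm Z < e") auto
    qed (use r in auto)
    then have "(\<integral>Z. \<rho> Z \<partial>lborel) * (g 0 / 2) \<le> 0" using r by simp
    moreover have "(\<integral>Z. \<rho> Z \<partial>lborel) * (g 0 / 2) > 0" using r g by (intro mult_pos_pos) auto
    ultimately show False by linarith
  qed
  have "\<not> f 0 > 0" using pos[OF lim _ avg] by blast
  moreover have "\<not> - f 0 > 0"
  proof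
    assume "- f 0 > 0"
    then show False by (rule pos[of "\<lambda>Z. - f Z", OF tendsto_minus[OF lim]]) (use avg in simp)
  qed
  ultimately show ?thesis by linarith
qed

section \<open>A bump function and smooth test functions\<close>

text \<open>The function \<open>exp (- 1 / s)\<close>, extended by zero, with a polynomial in
  \<open>1 / s\<close> as prefactor: this family contains all its own derivatives.\<close>

fun bump :: "real poly \<Rightarrow> real \<Rightarrow> real" where
  "bump p s = (if s > 0 then poly p (1 / s) * exp (- 1 / s) else 0)"

declare bump.simps [simp del]

text \<open>With \<open>x = 1 / s\<close> one has \<open>dx/ds = - x^2\<close>, so the prefactor
  \<open>p\<close> turns into \<open>x^2 (p - p')\<close>.\<close>

definition bump_deriv :: "real poly \<Rightarrow> real poly" where
  "bump_deriv p = [:0, 0, 1:] * (p - pderiv p)"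

lemma poly_times_exp_tendsto_0: "((\<lambda>x. poly p x * exp (- x)) \<longlongrightarrow> (0::real)) at_top"
proof (induction p)
  case (pCons a p)
  have "((\<lambda>x::real. x * poly p x * exp (- x)) \<longlongrightarrow> 0) at_top"
  proof -
    have *: "((\<lambda>x. poly p x * exp (- x)) \<longlongrightarrow> (0::real)) at_top" by (rule pCons)
    show ?thesis
    proof -
      have "poly p x * x = poly (p * [:0, 1:]) x" for x by simp
      have pw: "((\<lambda>x::real. x ^ k * exp (- x)) \<longlongrightarrow> 0) at_top" for k
        using tendsto_power_div_exp_0[of k] by (simp add: exp_minus field_simps)
      have "(\<lambda>x. x * poly p x * exp (- x)) = (\<lambda>x. \<Sum>i\<le>degree p. coeff p i * (x ^ Suc i * exp (- x)))"
        by (auto simp: poly_altdef sum_distrib_left sum_distrib_right mult_ac fun_eq_iff)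
      moreover have "((\<lambda>x. \<Sum>i\<le>degree p. coeff p i * (x ^ Suc i * exp (- x))) \<longlongrightarrow> (\<Sum>i\<le>degree p. coeff p i * 0)) at_top"
        by (intro tendsto_intros pw)
      ultimately show ?thesis by simp
    qed
  qed
  moreover have "((\<lambda>x::real. a * exp (- x)) \<longlongrightarrow> a * 0) at_top"
    using tendsto_power_div_exp_0[of 0] by (intro tendsto_intros) (simp add: exp_minus field_simps)
  ultimately have "((\<lambda>x::real. a * exp (- x) + x * poly p x * exp (- x)) \<longlongrightarrow> 0) at_top"
    using tendsto_add by fastforce
  then show ?case by (simp add: algebra_simps)
qed simp

lemma has_real_derivative_bump: "(bump p has_real_derivative bump (bump_deriv p) s) (at s)"
proof -
  consider "s > 0" | "s < 0" | "s = 0" by linarith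
  then show ?thesis
  proof cases
    case 1
    have "((\<lambda>s. poly p (1 / s) * exp (- 1 / s)) has_real_derivative bump (bump_deriv p) s) (at s)"
      using 1 by (auto intro!: derivative_eq_intros DERIV_chain2[OF poly_DERIV]
        simp: bump.simps bump_deriv_def field_simps power2_eq_square)
    then show ?thesis
      by (rule DERIV_cong_ev[OF refl _ refl, THEN iffD1, rotated])
         (use 1 in \<open>auto simp: bump.simps eventually_nhds intro!: exI[of _ "{0<..}"]\<close>)
  next
    case 2
    have "((\<lambda>s. 0) has_real_derivative bump (bump_deriv p) s) (at s)"
      using 2 by (simp add: bump.simps)
    then show ?thesis
      by (rule DERIV_cong_ev[OF refl _ refl, THEN iffD1, rotated])
         (use 2 in \<open>auto simp: bump.simps eventually_nhds intro!: exI[of _ "{..<0}"]\<close>)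
  next
    case 3
    have inv: "filterlim (\<lambda>h::real. 1 / h) at_top (at_right 0)"
      using filterlim_inverse_at_top_right by (simp add: inverse_eq_divide)
    \<comment> \<open>The difference quotient at 0 has one more factor \<open>1 / h\<close>, which
      raises the prefactor to \<open>pCons 0 p\<close>.\<close>
    have "((\<lambda>h. poly (pCons 0 p) (1 / h) * exp (- (1 / h))) \<longlongrightarrow> 0) (at_right 0)"
      by (rule filterlim_compose[OF poly_times_exp_tendsto_0 inv])
    moreover have "eventually (\<lambda>h. poly (pCons 0 p) (1 / h) * exp (- (1 / h)) = bump p h / h) (at_right 0)"
      by (auto simp: eventually_at_right_field bump.simps intro!: exI[of _ 1])
    ultimately have "((\<lambda>h. bump p h / h) \<longlongrightarrow> 0) (at_right 0)"
      by (rule Lim_transform_eventually)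
    moreover have "((\<lambda>h. bump p h / h) \<longlongrightarrow> 0) (at_left 0)"
      by (rule tendsto_eventually) (auto simp: eventually_at_left_field bump.simps intro!: exI[of _ "-1"])
    ultimately have "((\<lambda>h. bump p h / h) \<longlongrightarrow> 0) (at 0)"
      by (simp add: filterlim_split_at)
    then show ?thesis using 3 by (simp add: DERIV_def bump.simps)
  qed
qed

lemma continuous_on_bump: "continuous_on S (bump p)"
  by (intro continuous_at_imp_continuous_on ballI) (rule DERIV_isCont[OF has_real_derivative_bump])

text \<open>A syntactic class closed under directional derivatives. Membership delivers all iterated
  derivatives at once, as the definition of a test function demands.\<close>

inductive_set smooth_class :: "('a::euclidean_space \<Rightarrow> complex) set" where
  const: "(\<lambda>X. c) \<in> smooth_class"
| lin: "(\<lambda>X. of_real (X \<bullet> v)) \<in> smooth_class"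
| add: "f \<in> smooth_class \<Longrightarrow> g \<in> smooth_class \<Longrightarrow> (\<lambda>X. f X + g X) \<in> smooth_class"
| mult: "f \<in> smooth_class \<Longrightarrow> g \<in> smooth_class \<Longrightarrow> (\<lambda>X. f X * g X) \<in> smooth_class"
| exp: "f \<in> smooth_class \<Longrightarrow> (\<lambda>X. exp (f X)) \<in> smooth_class"
| bump: "(\<lambda>X. of_real (q X)) \<in> smooth_class \<Longrightarrow> (\<lambda>X. of_real (bump p (q X))) \<in> smooth_class"

text \<open>The real argument of \<open>bump\<close> is differentiated as a complex curve; a curve
  of embedded reals has a real derivative, so the real chain rule can be used on it.\<close>

lemma vector_derivative_of_real_unique_Re:
  assumes "((\<lambda>s. complex_of_real (q s)) has_vector_derivative d) (at x)"
  shows "(q has_real_derivative Re d) (at x)" "d = of_real (Re d)"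
proof -
  have re: "((\<lambda>s. Re (complex_of_real (q s))) has_vector_derivative Re d) (at x)"
    by (rule bounded_linear.has_vector_derivative[OF bounded_linear_Re assms])
  then show "(q has_real_derivative Re d) (at x)" by (simp add: has_real_derivative_iff_has_vector_derivative)
  have "((\<lambda>s. Im (complex_of_real (q s))) has_vector_derivative Im d) (at x)"
    by (rule bounded_linear.has_vector_derivative[OF bounded_linear_Im assms])
  then have "((\<lambda>s. 0) has_vector_derivative Im d) (at x)" by simp
  then have "Im d = 0" by (metis has_vector_derivative_const vector_derivative_unique_at)
  then show "d = of_real (Re d)" by (simp add: complex_eq_iff)
qed

lemma smooth_class_deriv:
  assumes "f \<in> smooth_class"
  shows "\<exists>f'\<in>smooth_class. \<forall>X. ((\<lambda>s. f (X + s *\<^sub>R e)) has_vector_derivative f' X) (at 0)"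
  using assms
proof induction
  case (const c)
  show ?case by (rule bexI[of _ "\<lambda>X. 0"]) (auto intro: smooth_class.const)
next
  case (lin v)
  show ?case
    by (rule bexI[of _ "\<lambda>X. of_real (e \<bullet> v)"])
       (auto intro!: smooth_class.const derivative_eq_intros simp: inner_add_left)
next
  case (add f g)
  then obtain f' g' where "f' \<in> smooth_class" "g' \<in> smooth_class"
    and d: "\<And>X. ((\<lambda>s. f (X + s *\<^sub>R e)) has_vector_derivative f' X) (at 0)" "\<And>X. ((\<lambda>s. g (X + s *\<^sub>R e)) has_vector_derivative g' X) (at 0)" by blast
  then show ?case
    by (intro bexI[of _ "\<lambda>X. f' X + g' X"]) (auto intro!: smooth_class.add has_vector_derivative_add)
next
  case (mult f g)
  then obtain f' g' where s: "f' \<in> smooth_class" "g' \<in> smooth_class"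
    and d: "\<And>X. ((\<lambda>s. f (X + s *\<^sub>R e)) has_vector_derivative f' X) (at 0)" "\<And>X. ((\<lambda>s. g (X + s *\<^sub>R e)) has_vector_derivative g' X) (at 0)" by blast
  show ?case
  proof (rule bexI[of _ "\<lambda>X. f X * g' X + f' X * g X"])
    show "\<forall>X. ((\<lambda>s. f (X + s *\<^sub>R e) * g (X + s *\<^sub>R e)) has_vector_derivative f X * g' X + f' X * g X) (at 0)"
    proof
      fix X show "((\<lambda>s. f (X + s *\<^sub>R e) * g (X + s *\<^sub>R e)) has_vector_derivative f X * g' X + f' X * g X) (at 0)"
        using has_vector_derivative_mult[OF d(1)[of X] d(2)[of X]] by simp
    qed
  qed (use s mult in \<open>auto intro!: smooth_class.add smooth_class.mult\<close>)
next
  case (exp f)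
  then obtain f' where s: "f' \<in> smooth_class"
    and d: "\<And>X. ((\<lambda>s. f (X + s *\<^sub>R e)) has_vector_derivative f' X) (at 0)" by blast
  show ?case
  proof (rule bexI[of _ "\<lambda>X. f' X * exp (f X)"])
    show "\<forall>X. ((\<lambda>s. exp (f (X + s *\<^sub>R e))) has_vector_derivative f' X * exp (f X)) (at 0)"
    proof
      fix X
      have "(exp has_field_derivative exp (f X)) (at (f (X + 0 *\<^sub>R e)))" using DERIV_exp[of "f X"] by simp
      from field_vector_diff_chain_at[OF d[of X] this]
      show "((\<lambda>s. exp (f (X + s *\<^sub>R e))) has_vector_derivative f' X * exp (f X)) (at 0)"
        by (simp add: comp_def)
    qed
  qed (use s exp in \<open>auto intro!: smooth_class.mult smooth_class.exp\<close>)
next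
  case (bump q p)
  then obtain q' where s: "q' \<in> smooth_class"
    and d: "\<And>X. ((\<lambda>s. complex_of_real (q (X + s *\<^sub>R e))) has_vector_derivative q' X) (at 0)" by blast
  show ?case
  proof (rule bexI[of _ "\<lambda>X. of_real (bump (bump_deriv p) (q X)) * q' X"])
    show "\<forall>X. ((\<lambda>s. complex_of_real (bump p (q (X + s *\<^sub>R e)))) has_vector_derivative of_real (bump (bump_deriv p) (q X)) * q' X) (at 0)"
    proof
      fix X
      note r = vector_derivative_of_real_unique_Re[OF d[of X]]
      have "((\<lambda>s. bump p (q (X + s *\<^sub>R e))) has_real_derivative bump (bump_deriv p) (q X) * Re (q' X)) (at 0)"
        using DERIV_chain2[OF has_real_derivative_bump r(1)] by simp
      then have "((\<lambda>s. complex_of_real (bump p (q (X + s *\<^sub>R e)))) has_vector_derivative of_real (bump (bump_deriv p) (q X) * Re (q' X))) (at 0)"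
        by (rule has_vector_derivative_of_real)
      moreover have "complex_of_real (bump (bump_deriv p) (q X) * Re (q' X)) = of_real (bump (bump_deriv p) (q X)) * q' X"
        by (subst r(2), simp)
      ultimately show "((\<lambda>s. complex_of_real (bump p (q (X + s *\<^sub>R e)))) has_vector_derivative of_real (bump (bump_deriv p) (q X)) * q' X) (at 0)"
        by (simp only:)
    qed
  qed (use s bump in \<open>auto intro!: smooth_class.mult smooth_class.bump\<close>)
qed

lemma smooth_class_continuous: "f \<in> smooth_class \<Longrightarrow> continuous_on UNIV f"
proof (induction rule: smooth_class.induct)
  case (bump q p)
  have "continuous_on UNIV (\<lambda>X. Re (complex_of_real (q X)))" by (intro continuous_intros bump)
  then have "continuous_on UNIV q" by simp
  then show ?case by (intro continuous_intros continuous_on_compose2[OF continuous_on_bump]) auto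
qed (auto intro!: continuous_intros)

lemma ddir_smooth_class:
  assumes "f \<in> smooth_class"
  shows "ddir e f \<in> smooth_class" "((\<lambda>s. f (X + s *\<^sub>R e)) has_vector_derivative ddir e f X) (at 0)"
proof -
  obtain f' where f': "f' \<in> smooth_class" "\<And>X. ((\<lambda>s. f (X + s *\<^sub>R e)) has_vector_derivative f' X) (at 0)"
    using smooth_class_deriv[OF assms] by blast
  have "ddir e f = f'" unfolding ddir_def using f'(2) by (auto intro: vector_derivative_at)
  with f' show "ddir e f \<in> smooth_class" "((\<lambda>s. f (X + s *\<^sub>R e)) has_vector_derivative ddir e f X) (at 0)" by auto
qed

lemma iter_ddir_smooth_class: "f \<in> smooth_class \<Longrightarrow> iter_ddir es f \<in> smooth_class"
  by (induction es) (auto intro: ddir_smooth_class)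

lemma test_fun_smooth_class:
  assumes "f \<in> smooth_class" "compact (closure {x. f x \<noteq> 0})"
  shows "test_fun f"
  unfolding test_fun_def using assms
  by (auto intro!: smooth_class_continuous iter_ddir_smooth_class ddir_smooth_class(2))

section \<open>Magnetically translated test functions\<close>

text \<open>The line integral of the vector potential \<open>(0, b x1)\<close> along the straight
  segment from \<open>X\<close> to \<open>Y\<close>, summed over the particles: \<open>b\<close>
  times the mean first coordinate times the increment of the second.\<close>

definition gauge_phase :: "real \<Rightarrow> (real \<times> real) ^ 'n \<Rightarrow> (real \<times> real) ^ 'n \<Rightarrow> real" where
  "gauge_phase b Y X = (\<Sum>j\<in>UNIV. b / 2 * (fst (X $ j) + fst (Y $ j)) * (snd (Y $ j) - snd (X $ j)))"

definition bump_profile :: "real \<Rightarrow> (real \<times> real) ^ 'n \<Rightarrow> real" where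
  "bump_profile e Z = bump 1 (e\<^sup>2 - (norm Z)\<^sup>2)"

text \<open>Per particle, \<open>hbar^2 / (2 m0)\<close> times
  \<open>- Laplacian + b^2 |z|^2 / 4\<close> applied to the bump: the kinetic energy in the
  symmetric gauge without its angular momentum term. The argument of \<open>bump\<close> has inner
  derivative \<open>- 2 z\<close>, whence the factors 4.\<close>

definition kin_profile :: "real \<Rightarrow> real \<Rightarrow> real \<Rightarrow> real \<Rightarrow> (real \<times> real) ^ 'n::finite \<Rightarrow> real" where
  "kin_profile hbar m0 b e Z = (\<Sum>j\<in>UNIV. hbar\<^sup>2 * (b\<^sup>2 / 4 * (norm (Z $ j))\<^sup>2 * bump 1 (e\<^sup>2 - (norm Z)\<^sup>2)
      + 4 * bump (bump_deriv 1) (e\<^sup>2 - (norm Z)\<^sup>2)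
      - 4 * (norm (Z $ j))\<^sup>2 * bump (bump_deriv (bump_deriv 1)) (e\<^sup>2 - (norm Z)\<^sup>2)) / (2 * m0))"

definition twisted_kernel :: "real \<Rightarrow> real \<Rightarrow> (real \<times> real) ^ 'n::finite \<Rightarrow> (real \<times> real) ^ 'n \<Rightarrow> complex" where
  "twisted_kernel b e X Y = exp (\<i> * of_real (gauge_phase b Y X)) * of_real (bump_profile e (Y - X))"

lemma smooth_class_sum: "(\<And>i. i \<in> I \<Longrightarrow> f i \<in> smooth_class) \<Longrightarrow> (\<lambda>X. \<Sum>i\<in>I. f i X) \<in> smooth_class"
  by (induction I rule: infinite_finite_induct) (auto intro: smooth_class.const smooth_class.add)

lemma smooth_class_fst: "(\<lambda>Y::(real \<times> real) ^ 'n::finite. complex_of_real (fst (Y $ j))) \<in> smooth_class"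
  using smooth_class.lin[of "axis j (1, 0) :: (real \<times> real) ^ 'n"] by (simp add: inner_axis inner_prod_def)

lemma smooth_class_snd: "(\<lambda>Y::(real \<times> real) ^ 'n::finite. complex_of_real (snd (Y $ j))) \<in> smooth_class"
  using smooth_class.lin[of "axis j (0, 1) :: (real \<times> real) ^ 'n"] by (simp add: inner_axis inner_prod_def)

lemma smooth_class_diff: "f \<in> smooth_class \<Longrightarrow> g \<in> smooth_class \<Longrightarrow> (\<lambda>X. f X - g X) \<in> smooth_class"
  using smooth_class.add[of f "\<lambda>X. (-1) * g X"] smooth_class.mult[OF smooth_class.const, of g "-1"] by simp

lemma norm_vec_sq: "(norm (Z :: (real \<times> real) ^ 'n::finite))\<^sup>2 = (\<Sum>j\<in>UNIV. (fst (Z $ j))\<^sup>2 + (snd (Z $ j))\<^sup>2)"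
  unfolding power2_norm_eq_inner inner_vec_def
  by (intro sum.cong refl) (simp add: inner_prod_def power2_eq_square)

lemma twisted_kernel_smooth: "twisted_kernel b e X \<in> smooth_class"
proof -
  have "(\<lambda>Y. complex_of_real (gauge_phase b Y X)) \<in> smooth_class"
    unfolding gauge_phase_def of_real_sum of_real_mult of_real_add of_real_diff
    by (intro smooth_class_sum smooth_class.mult smooth_class.add smooth_class_diff smooth_class.const smooth_class_fst smooth_class_snd)
  moreover have "(\<lambda>Y. complex_of_real (e\<^sup>2 - (norm (Y - X))\<^sup>2)) \<in> smooth_class"
    unfolding norm_vec_sq vector_minus_component fst_diff snd_diff
    unfolding of_real_sum of_real_add of_real_diff of_real_power power2_eq_square of_real_mult
    by (intro smooth_class_sum smooth_class.mult smooth_class.add smooth_class_diff smooth_class.const smooth_class_fst smooth_class_snd)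
  ultimately show ?thesis
    unfolding twisted_kernel_def[abs_def] bump_profile_def
    by (intro smooth_class.mult smooth_class.exp smooth_class.const smooth_class.bump)
qed

lemma bump_profile_zero: "norm Z \<ge> e \<Longrightarrow> e \<ge> 0 \<Longrightarrow> bump p (e\<^sup>2 - (norm Z)\<^sup>2) = 0"
proof -
  assume "norm Z \<ge> e" "e \<ge> 0"
  then have "e\<^sup>2 \<le> (norm Z)\<^sup>2" by (rule power_mono)
  then have "\<not> 0 < e\<^sup>2 - (norm Z)\<^sup>2" by linarith
  then show "bump p (e\<^sup>2 - (norm Z)\<^sup>2) = 0" by (simp only: bump.simps if_False)
qed

lemma test_fun_twisted_kernel:
  assumes "e > 0" shows "test_fun (twisted_kernel b e X)"
proof (rule test_fun_smooth_class[OF twisted_kernel_smooth])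
  have "{Y. twisted_kernel b e X Y \<noteq> 0} \<subseteq> cball X e"
  proof
    fix Y assume "Y \<in> {Y. twisted_kernel b e X Y \<noteq> 0}"
    then have "bump 1 (e\<^sup>2 - (norm (Y - X))\<^sup>2) \<noteq> 0" by (auto simp: twisted_kernel_def bump_profile_def)
    then have "\<not> norm (Y - X) \<ge> e" using bump_profile_zero[of e "Y - X"] assms by auto
    then show "Y \<in> cball X e" by (simp add: dist_norm norm_minus_commute)
  qed
  then show "compact (closure {Y. twisted_kernel b e X Y \<noteq> 0})"
    unfolding compact_closure by (rule bounded_subset[OF bounded_cball])
qed

lemma ddirI: "((\<lambda>s. f (X + s *\<^sub>R e)) has_vector_derivative d) (at 0) \<Longrightarrow> ddir e f X = d"
  unfolding ddir_def by (rule vector_derivative_at)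

text \<open>In the following two lemmas \<open>z = Y - X\<close>; the kinetic momenta act on
  \<open>exp (\<i> \<theta>) R\<close> as \<open>exp (\<i> \<theta>) (\<plusminus> \<hbar> b z / 2 - \<i> \<hbar> \<partial>) R\<close>, i.e. as in the symmetric gauge centred at \<open>X\<close>.\<close>

lemma exp_line_deriv:
  "((\<lambda>s. exp (\<i> * complex_of_real (g + s * a))) has_vector_derivative exp (\<i> * of_real g) * (\<i> * of_real a)) (at 0)"
proof -
  have "((\<lambda>s. g + s * a) has_real_derivative a) (at 0)" by (auto intro!: derivative_eq_intros)
  then have "((\<lambda>s. \<i> * complex_of_real (g + s * a)) has_vector_derivative \<i> * of_real a) (at 0)"
    by (intro bounded_linear.has_vector_derivative[OF bounded_linear_mult_right] has_vector_derivative_of_real)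
  from field_vector_diff_chain_at[OF this, of exp "exp (\<i> * of_real g)"]
  show ?thesis using DERIV_exp[of "\<i> * of_real g"] by (simp add: comp_def mult.commute)
qed

lemma phase_deriv:
  fixes X Y :: "(real \<times> real) ^ 'n::finite"
  shows "((\<lambda>s. exp (\<i> * complex_of_real (gauge_phase b (Y + s *\<^sub>R axis j (1, 0)) X))) has_vector_derivative
     exp (\<i> * of_real (gauge_phase b Y X)) * (\<i> * of_real (b / 2 * snd ((Y - X) $ j)))) (at 0)" (is ?A)
  and "((\<lambda>s. exp (\<i> * complex_of_real (gauge_phase b (Y + s *\<^sub>R axis j (0, 1)) X))) has_vector_derivative
     exp (\<i> * of_real (gauge_phase b Y X)) * (\<i> * of_real (b / 2 * (fst (X $ j) + fst (Y $ j))))) (at 0)" (is ?B)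
proof -
  have "gauge_phase b (Y + s *\<^sub>R axis j (1, 0)) X = gauge_phase b Y X + s * (b / 2 * snd ((Y - X) $ j))" for s
  proof -
    have "gauge_phase b (Y + s *\<^sub>R axis j (1, 0)) X = (\<Sum>i\<in>UNIV. b / 2 * (fst (X $ i) + fst (Y $ i)) * (snd (Y $ i) - snd (X $ i)) +
        (if i = j then s * (b / 2 * snd ((Y - X) $ j)) else 0))"
      unfolding gauge_phase_def by (rule sum.cong[OF refl]) (auto simp: axis_def field_simps)
    then show ?thesis by (simp add: sum.distrib gauge_phase_def)
  qed
  then show ?A by (simp only: exp_line_deriv)
  have "gauge_phase b (Y + s *\<^sub>R axis j (0, 1)) X = gauge_phase b Y X + s * (b / 2 * (fst (X $ j) + fst (Y $ j)))" for s
  proof -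
    have "gauge_phase b (Y + s *\<^sub>R axis j (0, 1)) X = (\<Sum>i\<in>UNIV. b / 2 * (fst (X $ i) + fst (Y $ i)) * (snd (Y $ i) - snd (X $ i)) +
        (if i = j then s * (b / 2 * (fst (X $ j) + fst (Y $ j))) else 0))"
      unfolding gauge_phase_def by (rule sum.cong[OF refl]) (auto simp: axis_def field_simps)
    then show ?thesis by (simp add: sum.distrib gauge_phase_def)
  qed
  then show ?B by (simp only: exp_line_deriv)
qed

lemma bump_line_deriv:
  fixes Z v :: "'a::real_inner"
  shows "((\<lambda>s. bump p (c - (norm (Z + s *\<^sub>R v))\<^sup>2)) has_real_derivative bump (bump_deriv p) (c - (norm Z)\<^sup>2) * (- 2 * (Z \<bullet> v))) (at 0)"
proof -
  have eq: "(norm (Z + s *\<^sub>R v))\<^sup>2 = (norm Z)\<^sup>2 + 2 * s * (Z \<bullet> v) + s\<^sup>2 * (v \<bullet> v)" for s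
    unfolding power2_norm_eq_inner by (simp add: inner_add_left inner_add_right inner_commute power2_eq_square algebra_simps)
  have "((\<lambda>s. c - ((norm Z)\<^sup>2 + 2 * s * (Z \<bullet> v) + s\<^sup>2 * (v \<bullet> v))) has_real_derivative - 2 * (Z \<bullet> v)) (at 0)"
    by (auto intro!: derivative_eq_intros)
  then have "((\<lambda>s. c - (norm (Z + s *\<^sub>R v))\<^sup>2) has_real_derivative - 2 * (Z \<bullet> v)) (at 0)" by (simp only: eq)
  from DERIV_chain2[OF has_real_derivative_bump this] show ?thesis by simp
qed

text \<open>After one kinetic momentum the amplitude of the kernel is complex. Its real and
  imaginary parts are kept as separate real functions, so that the rules for real derivatives apply
  to them.\<close>

lemma kernel_line_deriv:
  fixes E :: "'a::real_normed_vector \<Rightarrow> complex" and R1 R2 :: "'a \<Rightarrow> real"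
  assumes E: "((\<lambda>s. E (Y + s *\<^sub>R v)) has_vector_derivative E Y * (\<i> * of_real t)) (at 0)"
    and R1: "((\<lambda>s. R1 (Y + s *\<^sub>R v)) has_real_derivative d1) (at 0)"
    and R2: "((\<lambda>s. R2 (Y + s *\<^sub>R v)) has_real_derivative d2) (at 0)"
  shows "ddir v (\<lambda>Y. E Y * (of_real (R1 Y) + \<i> * of_real (R2 Y))) Y =
     E Y * (\<i> * of_real t * (of_real (R1 Y) + \<i> * of_real (R2 Y)) + of_real d1 + \<i> * of_real d2)"
proof (rule ddirI)
  have "((\<lambda>s. complex_of_real (R1 (Y + s *\<^sub>R v)) + \<i> * of_real (R2 (Y + s *\<^sub>R v))) has_vector_derivative of_real d1 + \<i> * of_real d2) (at 0)"
    by (intro has_vector_derivative_add bounded_linear.has_vector_derivative[OF bounded_linear_mult_right] has_vector_derivative_of_real R1 R2)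
  from has_vector_derivative_mult[OF E this]
  show "((\<lambda>s. E (Y + s *\<^sub>R v) * (of_real (R1 (Y + s *\<^sub>R v)) + \<i> * of_real (R2 (Y + s *\<^sub>R v)))) has_vector_derivative
      E Y * (\<i> * of_real t * (of_real (R1 Y) + \<i> * of_real (R2 Y)) + of_real d1 + \<i> * of_real d2)) (at 0)"
    by (simp add: algebra_simps)
qed

text \<open>The squares of the two momenta produce imaginary cross terms in \<open>z1 z2\<close>
  with opposite signs. Their cancellation is the vanishing of the angular momentum on a radial
  function, and it leaves a real multiplier.\<close>

lemma kin_cl_twisted_kernel:
  fixes X Y :: "(real \<times> real) ^ 'n::finite"
  shows "kin_cl hbar m0 b (twisted_kernel b e X) Y =
    exp (\<i> * of_real (gauge_phase b Y X)) * of_real (kin_profile hbar m0 b e (Y - X))"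
proof -
  define E where "E Y = exp (\<i> * complex_of_real (gauge_phase b Y X))" for Y
  \<comment> \<open>The bump with its profile differentiated \<open>k\<close> times; a derivative
    along a coordinate raises \<open>k\<close> by one and brings down \<open>- 2 z\<close>.\<close>
  define B where "B k Y = bump ((bump_deriv ^^ k) 1) (e\<^sup>2 - (norm (Y - X))\<^sup>2)" for k :: nat and Y
  define z1 where "z1 j Y = fst ((Y - X) $ j)" for j and Y :: "(real \<times> real) ^ 'n"
  define z2 where "z2 j Y = snd ((Y - X) $ j)" for j and Y :: "(real \<times> real) ^ 'n"
  have E1: "((\<lambda>s. E (Y + s *\<^sub>R axis j (1, 0))) has_vector_derivative E Y * (\<i> * of_real (b / 2 * z2 j Y))) (at 0)" for j Y
    unfolding E_def z2_def by (rule phase_deriv)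
  have E2: "((\<lambda>s. E (Y + s *\<^sub>R axis j (0, 1))) has_vector_derivative E Y * (\<i> * of_real (b / 2 * (fst (X $ j) + fst (Y $ j))))) (at 0)" for j Y
    unfolding E_def by (rule phase_deriv)
  have B1: "((\<lambda>s. B k (Y + s *\<^sub>R axis j (1, 0))) has_real_derivative B (Suc k) Y * (- 2 * z1 j Y)) (at 0)" for k j Y
    using bump_line_deriv[of "(bump_deriv ^^ k) 1" "e\<^sup>2" "Y - X" "axis j (1, 0)"]
    by (simp add: B_def z1_def inner_axis inner_prod_def algebra_simps)
  have B2: "((\<lambda>s. B k (Y + s *\<^sub>R axis j (0, 1))) has_real_derivative B (Suc k) Y * (- 2 * z2 j Y)) (at 0)" for k j Y
    using bump_line_deriv[of "(bump_deriv ^^ k) 1" "e\<^sup>2" "Y - X" "axis j (0, 1)"]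
    by (simp add: B_def z2_def inner_axis inner_prod_def algebra_simps)
  have z11: "((\<lambda>s. z1 j (Y + s *\<^sub>R axis j (1, 0))) has_real_derivative 1) (at 0)"
    and z21: "((\<lambda>s. z2 j (Y + s *\<^sub>R axis j (1, 0))) has_real_derivative 0) (at 0)"
    and z12: "((\<lambda>s. z1 j (Y + s *\<^sub>R axis j (0, 1))) has_real_derivative 0) (at 0)"
    and z22: "((\<lambda>s. z2 j (Y + s *\<^sub>R axis j (0, 1))) has_real_derivative 1) (at 0)" for j Y
    unfolding z1_def z2_def by (auto intro!: derivative_eq_intros simp: axis_def)
  have K: "twisted_kernel b e X = (\<lambda>Y. E Y * (of_real (B 0 Y) + \<i> * of_real 0))"
    by (auto simp: twisted_kernel_def E_def B_def bump_profile_def)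
  have p1a: "p1_opN hbar j (twisted_kernel b e X) = (\<lambda>Y. E Y * (of_real (hbar * (b / 2) * z2 j Y * B 0 Y) + \<i> * of_real (2 * hbar * z1 j Y * B 1 Y)))" for j
  proof
    fix Y
    have d: "ddir (axis j (1, 0)) (twisted_kernel b e X) Y = E Y * (\<i> * of_real (b / 2 * z2 j Y) * (of_real (B 0 Y) + \<i> * of_real 0) + of_real (B 1 Y * (- 2 * z1 j Y)) + \<i> * of_real 0)"
      unfolding K by (rule kernel_line_deriv[where ?R2.0="\<lambda>_. 0", OF E1 B1[of 0, unfolded One_nat_def[symmetric]] DERIV_const])
    show "p1_opN hbar j (twisted_kernel b e X) Y = E Y * (of_real (hbar * (b / 2) * z2 j Y * B 0 Y) + \<i> * of_real (2 * hbar * z1 j Y * B 1 Y))"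
      unfolding p1_opN_def d by (simp add: algebra_simps)
  qed
  have p1b: "p1_opN hbar j (p1_opN hbar j (twisted_kernel b e X)) Y = E Y * of_real (hbar\<^sup>2) *
     (of_real (b\<^sup>2 / 4 * (z2 j Y)\<^sup>2 * B 0 Y + 2 * B 1 Y - 4 * (z1 j Y)\<^sup>2 * B 2 Y) + \<i> * of_real (2 * b * z1 j Y * z2 j Y * B 1 Y))" for j Y
  proof -
    have r1: "((\<lambda>s. hbar * (b / 2) * z2 j (Y + s *\<^sub>R axis j (1, 0)) * B 0 (Y + s *\<^sub>R axis j (1, 0))) has_real_derivative
        hbar * (b / 2) * z2 j Y * (B 1 Y * (- 2 * z1 j Y))) (at 0)"
      using DERIV_mult[OF DERIV_cmult[OF z21[where j=j and Y=Y], of "hbar * (b / 2)"] B1[where k=0 and j=j and Y=Y]] by (simp add: algebra_simps numeral_2_eq_2)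
    have r2: "((\<lambda>s. 2 * hbar * z1 j (Y + s *\<^sub>R axis j (1, 0)) * B 1 (Y + s *\<^sub>R axis j (1, 0))) has_real_derivative
        2 * hbar * (B 1 Y + z1 j Y * (B 2 Y * (- 2 * z1 j Y)))) (at 0)"
      using DERIV_mult[OF DERIV_cmult[OF z11[where j=j and Y=Y], of "2 * hbar"] B1[where k=1 and j=j and Y=Y]] by (simp add: algebra_simps numeral_2_eq_2)
    show ?thesis
      unfolding p1a unfolding p1_opN_def kernel_line_deriv[OF E1 r1 r2]
      by (simp add: algebra_simps power2_eq_square)
  qed
  \<comment> \<open>The phase contributes \<open>hbar b / 2\<close> times the sum of the first
    coordinates of \<open>X\<close> and \<open>Y\<close>. Subtracting the vector potential at
    \<open>Y\<close> leaves only their difference, and the centre \<open>X\<close> has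
    disappeared.\<close>
  have p2a: "pi2_opN hbar b j (twisted_kernel b e X) = (\<lambda>Y. E Y * (of_real (- hbar * (b / 2) * z1 j Y * B 0 Y) + \<i> * of_real (2 * hbar * z2 j Y * B 1 Y)))" for j
  proof
    fix Y
    have d: "ddir (axis j (0, 1)) (twisted_kernel b e X) Y = E Y * (\<i> * of_real (b / 2 * (fst (X $ j) + fst (Y $ j))) * (of_real (B 0 Y) + \<i> * of_real 0) + of_real (B 1 Y * (- 2 * z2 j Y)) + \<i> * of_real 0)"
      unfolding K by (rule kernel_line_deriv[where ?R2.0="\<lambda>_. 0", OF E2 B2[of 0, unfolded One_nat_def[symmetric]] DERIV_const])
    show "pi2_opN hbar b j (twisted_kernel b e X) Y = E Y * (of_real (- hbar * (b / 2) * z1 j Y * B 0 Y) + \<i> * of_real (2 * hbar * z2 j Y * B 1 Y))"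
      unfolding pi2_opN_def d by (simp add: K z1_def field_simps)
  qed
  have p2b: "pi2_opN hbar b j (pi2_opN hbar b j (twisted_kernel b e X)) Y = E Y * of_real (hbar\<^sup>2) *
     (of_real (b\<^sup>2 / 4 * (z1 j Y)\<^sup>2 * B 0 Y + 2 * B 1 Y - 4 * (z2 j Y)\<^sup>2 * B 2 Y) - \<i> * of_real (2 * b * z1 j Y * z2 j Y * B 1 Y))" for j Y
  proof -
    have r1: "((\<lambda>s. - hbar * (b / 2) * z1 j (Y + s *\<^sub>R axis j (0, 1)) * B 0 (Y + s *\<^sub>R axis j (0, 1))) has_real_derivative
        - hbar * (b / 2) * z1 j Y * (B 1 Y * (- 2 * z2 j Y))) (at 0)"
      using DERIV_mult[OF DERIV_cmult[OF z12[where j=j and Y=Y], of "- hbar * (b / 2)"] B2[where k=0 and j=j and Y=Y]] by (simp add: algebra_simps numeral_2_eq_2)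
    have r2: "((\<lambda>s. 2 * hbar * z2 j (Y + s *\<^sub>R axis j (0, 1)) * B 1 (Y + s *\<^sub>R axis j (0, 1))) has_real_derivative
        2 * hbar * (B 1 Y + z2 j Y * (B 2 Y * (- 2 * z2 j Y)))) (at 0)"
      using DERIV_mult[OF DERIV_cmult[OF z22[where j=j and Y=Y], of "2 * hbar"] B2[where k=1 and j=j and Y=Y]] by (simp add: algebra_simps numeral_2_eq_2)
    have f: "complex_of_real (fst (Y $ j)) = of_real (z1 j Y) + of_real (fst (X $ j))" by (simp add: z1_def)
    show ?thesis
      unfolding p2a unfolding pi2_opN_def kernel_line_deriv[OF E2 r1 r2]
      by (simp add: f field_simps power2_eq_square)
  qed
  have nz: "(norm ((Y - X) $ j))\<^sup>2 = (z1 j Y)\<^sup>2 + (z2 j Y)\<^sup>2" for j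
    unfolding z1_def z2_def power2_norm_eq_inner by (simp add: inner_prod_def power2_eq_square)
  have "kin_cl hbar m0 b (twisted_kernel b e X) Y = (\<Sum>j\<in>UNIV. E Y * of_real (hbar\<^sup>2 * (b\<^sup>2 / 4 * ((z1 j Y)\<^sup>2 + (z2 j Y)\<^sup>2) * B 0 Y
      + 4 * B 1 Y - 4 * ((z1 j Y)\<^sup>2 + (z2 j Y)\<^sup>2) * B 2 Y) / (2 * m0)))"
    unfolding kin_cl_def p1b p2b
    by (intro sum.cong refl) (simp add: algebra_simps add_divide_distrib diff_divide_distrib)
  also have "\<dots> = E Y * of_real (kin_profile hbar m0 b e (Y - X))"
    unfolding kin_profile_def nz by (simp add: sum_distrib_left B_def numeral_2_eq_2)
  finally show ?thesis by (simp add: E_def)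
qed

section \<open>Symmetry of the kinetic energy\<close>

definition box_period :: "real \<Rightarrow> real \<Rightarrow> (real \<times> real) ^ 'n" where
  "box_period L1 L2 = (\<chi> j. (L1, L2))"

text \<open>The conjugate of the phase of the kernel, since test functions enter the weak equation
  conjugated.\<close>

definition twist :: "real \<Rightarrow> (real \<times> real) ^ 'n \<Rightarrow> (real \<times> real) ^ 'n \<Rightarrow> complex" where
  "twist b X Z = exp (- \<i> * of_real (gauge_phase b (X + Z) X))"

lemma Basis_vec_real2: "B \<in> (Basis :: ((real \<times> real) ^ 'n::finite) set) \<longleftrightarrow> (\<exists>j. B = axis j (1, 0) \<or> B = axis j (0, 1))"
  by (auto simp: Basis_vec_def Basis_prod_def)

lemma inner_axis_real2 [simp]:
  "(X :: (real \<times> real) ^ 'n::finite) \<bullet> axis j (1, 0) = fst (X $ j)"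
  "(X :: (real \<times> real) ^ 'n::finite) \<bullet> axis j (0, 1) = snd (X $ j)"
  by (simp_all add: inner_axis inner_prod_def)

lemma box_period_pos: "L1 > 0 \<Longrightarrow> L2 > 0 \<Longrightarrow> B \<in> Basis \<Longrightarrow> (box_period L1 L2 :: (real \<times> real) ^ 'n::finite) \<bullet> B > 0"
  by (auto simp: Basis_vec_real2 box_period_def)

lemma scaleR_axis: "c *\<^sub>R (axis j v :: 'a::real_vector ^ 'n::finite) = axis j (c *\<^sub>R v)"
  by (simp add: vec_eq_iff axis_def)

lemma periodic_box_period_iff:
  "periodic (box_period L1 L2) h \<longleftrightarrow> (\<forall>j X. h (X + axis j (L1, 0)) = h X \<and> h (X + axis j (0, L2)) = h X)"
  for h :: "(real \<times> real) ^ 'n::finite \<Rightarrow> 'b"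
proof -
  have "periodic (box_period L1 L2) h \<longleftrightarrow> (\<forall>B. (\<exists>j. B = axis j (1, 0) \<or> B = axis j (0, 1)) \<longrightarrow> (\<forall>X. h (X + (box_period L1 L2 \<bullet> B) *\<^sub>R B) = h X))"
    by (simp add: periodic_def Ball_def Basis_vec_real2)
  also have "\<dots> \<longleftrightarrow> (\<forall>j X. h (X + axis j (L1, 0)) = h X \<and> h (X + axis j (0, L2)) = h X)"
  proof -
    have "(box_period L1 L2 \<bullet> axis j (1, 0)) *\<^sub>R axis j (1, 0) = (axis j (L1, 0) :: (real \<times> real) ^ 'n)"
      "(box_period L1 L2 \<bullet> axis j (0, 1)) *\<^sub>R axis j (0, 1) = (axis j (0, L2) :: (real \<times> real) ^ 'n)" for j
      by (simp_all add: box_period_def scaleR_axis)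
    then show ?thesis by (metis (no_types, lifting))
  qed
  finally show ?thesis .
qed

lemma gauge_phase_antisym: "gauge_phase b X Y = - gauge_phase b Y X"
  unfolding gauge_phase_def sum_negf[symmetric] by (rule sum.cong) (auto simp: field_simps)

lemma gauge_phase_shift: "gauge_phase b (X + Z) X = (\<Sum>j\<in>UNIV. b / 2 * (2 * fst (X $ j) + fst (Z $ j)) * snd (Z $ j))"
  unfolding gauge_phase_def by (rule sum.cong) (auto simp: algebra_simps)

lemma continuous_on_gauge_phase: "continuous_on UNIV (\<lambda>(X :: (real \<times> real) ^ 'n::finite, Z). gauge_phase b (X + Z) X)"
  unfolding gauge_phase_shift case_prod_unfold by (intro continuous_intros)

lemma continuous_on_twist: "continuous_on UNIV (\<lambda>(X :: (real \<times> real) ^ 'n::finite, Z). twist b X Z)"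
  using continuous_on_gauge_phase[of b] unfolding twist_def case_prod_unfold by (intro continuous_intros)

lemma norm_twist [simp]: "norm (twist b X Z) = 1"
  unfolding twist_def by simp

lemma twist_measurable: "(\<lambda>(X :: (real \<times> real) ^ 'n::finite, Z). twist b X Z) \<in> borel_measurable (borel \<Otimes>\<^sub>M borel)"
  unfolding borel_prod by (rule borel_measurable_continuous_onI[OF continuous_on_twist])

lemma compact_support_integrable:
  fixes f :: "'a::euclidean_space \<Rightarrow> real"
  assumes "continuous_on UNIV f" "\<And>Z. norm Z \<ge> e \<Longrightarrow> f Z = 0"
  shows "integrable lborel f"
proof -
  have "integrable lborel (\<lambda>x. indicator (cball 0 e) x *\<^sub>R f x)"
    by (rule borel_integrable_compact[OF compact_cball]) (use assms(1) continuous_on_subset in blast)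
  moreover have "(\<lambda>x. indicator (cball 0 e) x *\<^sub>R f x) = f"
    using assms(2) by (auto simp: indicator_def fun_eq_iff)
  ultimately show ?thesis by simp
qed

lemma continuous_on_bump_norm: "continuous_on UNIV (\<lambda>Z::'a::real_inner. bump p (c - (norm Z)\<^sup>2))"
  by (intro continuous_on_compose2[OF continuous_on_bump[of UNIV]] continuous_intros) auto

lemma bump_profile_props:
  fixes Z :: "(real \<times> real) ^ 'n::finite"
  assumes e: "e > 0"
  shows "continuous_on UNIV (bump_profile e :: (real \<times> real) ^ 'n \<Rightarrow> real)" "integrable lborel (bump_profile e :: (real \<times> real) ^ 'n \<Rightarrow> real)"
    "bump_profile e Z \<ge> 0" "norm Z \<ge> e \<Longrightarrow> bump_profile e Z = 0"
    "(\<integral>Z. bump_profile e (Z :: (real \<times> real) ^ 'n) \<partial>lborel) > 0"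
proof -
  show c: "continuous_on UNIV (bump_profile e :: (real \<times> real) ^ 'n \<Rightarrow> real)"
    unfolding bump_profile_def[abs_def] by (rule continuous_on_bump_norm)
  have z: "bump_profile e Z = 0" if "norm Z \<ge> e" for Z :: "(real \<times> real) ^ 'n"
    unfolding bump_profile_def using that e by (intro bump_profile_zero) auto
  then show "norm Z \<ge> e \<Longrightarrow> bump_profile e Z = 0" .
  show i: "integrable lborel (bump_profile e :: (real \<times> real) ^ 'n \<Rightarrow> real)"
    by (rule compact_support_integrable[OF c z])
  have nn: "bump_profile e Z \<ge> 0" for Z :: "(real \<times> real) ^ 'n" by (simp add: bump_profile_def bump.simps)
  then show "bump_profile e Z \<ge> 0" .
  have "(\<integral>Z. bump_profile e (Z :: (real \<times> real) ^ 'n) \<partial>lborel) \<noteq> 0"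
  proof
    assume "(\<integral>Z. bump_profile e (Z :: (real \<times> real) ^ 'n) \<partial>lborel) = 0"
    then have "AE Z :: (real \<times> real) ^ 'n in lborel. bump_profile e Z = 0"
      using integral_nonneg_eq_0_iff_AE[OF i] nn by simp
    then have "AE Z :: (real \<times> real) ^ 'n in lborel. Z \<notin> ball 0 e"
    proof eventually_elim
      case (elim Z)
      show ?case
      proof
        assume "Z \<in> ball 0 e"
        then have "(norm Z)\<^sup>2 < e\<^sup>2" by (intro power_strict_mono) auto
        with elim show False by (simp add: bump_profile_def bump.simps)
      qed
    qed
    then have "emeasure lborel (ball 0 e :: ((real \<times> real) ^ 'n) set) = 0"
      by (subst (asm) AE_iff_measurable[of "ball 0 e"]) auto
    moreover have "\<not> negligible (ball 0 e :: ((real \<times> real) ^ 'n) set)"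
      using e by (intro open_not_negligible) auto
    ultimately show False by (simp add: negligible_iff_emeasure0)
  qed
  moreover have "(\<integral>Z. bump_profile e (Z :: (real \<times> real) ^ 'n) \<partial>lborel) \<ge> 0"
    by (intro integral_nonneg_AE) (use nn in auto)
  ultimately show "(\<integral>Z. bump_profile e (Z :: (real \<times> real) ^ 'n) \<partial>lborel) > 0" by linarith
qed

lemma kin_profile_props:
  assumes e: "e > 0"
  shows "continuous_on UNIV (kin_profile hbar m0 b e :: (real \<times> real) ^ 'n::finite \<Rightarrow> real)"
    "integrable lborel (kin_profile hbar m0 b e :: (real \<times> real) ^ 'n \<Rightarrow> real)"
    "kin_profile hbar m0 b e (- Z) = kin_profile hbar m0 b e (Z :: (real \<times> real) ^ 'n)"
proof -
  show c: "continuous_on UNIV (kin_profile hbar m0 b e :: (real \<times> real) ^ 'n \<Rightarrow> real)"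
    unfolding kin_profile_def[abs_def] divide_inverse by (intro continuous_intros continuous_on_bump_norm)
  have z: "kin_profile hbar m0 b e Z = 0" if "norm Z \<ge> e" for Z :: "(real \<times> real) ^ 'n"
    unfolding kin_profile_def using that e by (simp add: bump_profile_zero)
  show i: "integrable lborel (kin_profile hbar m0 b e :: (real \<times> real) ^ 'n \<Rightarrow> real)"
    by (rule compact_support_integrable[OF c z])
  show "kin_profile hbar m0 b e (- Z) = kin_profile hbar m0 b e Z"
    by (simp add: kin_profile_def)
qed

text \<open>Testing with the kernel centred at \<open>X\<close> and substituting
  \<open>Y = X + Z\<close> turns the weak equation into an equality of two twisted convolutions,
  valid for every single \<open>X\<close>.\<close>

lemma weak_kin_convolution:
  fixes \<Psi> G :: "(real \<times> real) ^ 'n::finite \<Rightarrow> complex"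
  assumes [measurable]: "\<Psi> \<in> borel_measurable borel" "G \<in> borel_measurable borel"
    and weak: "weak_kin hbar m0 b \<Psi> G" and e: "e > 0"
  shows "(\<integral>Z. of_real (kin_profile hbar m0 b e Z) * (twist b X Z * \<Psi> (X + Z)) \<partial>lborel) =
    (\<integral>Z. of_real (bump_profile e Z) * (twist b X Z * G (X + Z)) \<partial>lborel)"
proof -
  have [measurable]: "bump_profile e \<in> borel_measurable (borel :: ((real \<times> real) ^ 'n) measure)"
    "kin_profile hbar m0 b e \<in> borel_measurable (borel :: ((real \<times> real) ^ 'n) measure)"
    by (intro borel_measurable_continuous_onI bump_profile_props kin_profile_props e)+
  note [measurable] = twist_measurable
  have key: "(\<integral>Y. cnj (exp (\<i> * of_real (gauge_phase b Y X)) * of_real (f (Y - X))) * F Y \<partial>lebesgue) =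
     (\<integral>Z. of_real (f Z) * (twist b X Z * F (X + Z)) \<partial>lborel)"
    if [measurable]: "f \<in> borel_measurable borel" "F \<in> borel_measurable borel" for f :: "(real \<times> real) ^ 'n \<Rightarrow> real" and F
  proof -
    have c: "cnj (exp (\<i> * of_real (gauge_phase b Y X)) * of_real (f (Y - X))) * F Y = of_real (f (Y - X)) * (twist b X (Y - X) * F Y)" for Y
      by (simp add: twist_def exp_cnj)
    have m: "(\<lambda>Y. of_real (f (Y - X)) * (twist b X (Y - X) * F Y)) \<in> borel_measurable borel" by measurable
    have "(\<integral>Y. cnj (exp (\<i> * of_real (gauge_phase b Y X)) * of_real (f (Y - X))) * F Y \<partial>lebesgue) = (\<integral>Y. of_real (f (Y - X)) * (twist b X (Y - X) * F Y) \<partial>lborel)"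
      unfolding c by (rule integral_completion) (use m in simp)
    also have "\<dots> = (\<integral>Z. of_real (f (Z + X - X)) * (twist b X (Z + X - X) * F (Z + X)) \<partial>lborel)"
      by (rule integral_lborel_shift[OF m, symmetric])
    finally show ?thesis by (simp add: add.commute)
  qed
  have k1: "(\<integral>Y. cnj (exp (\<i> * of_real (gauge_phase b Y X)) * of_real (kin_profile hbar m0 b e (Y - X))) * \<Psi> Y \<partial>lebesgue) =
     (\<integral>Z. of_real (kin_profile hbar m0 b e Z) * (twist b X Z * \<Psi> (X + Z)) \<partial>lborel)"
    by (rule key) measurable
  have k2: "(\<integral>Y. cnj (exp (\<i> * of_real (gauge_phase b Y X)) * of_real (bump_profile e (Y - X))) * G Y \<partial>lebesgue) =
     (\<integral>Z. of_real (bump_profile e Z) * (twist b X Z * G (X + Z)) \<partial>lborel)"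
    by (rule key) measurable
  have "(\<integral>Y. cnj (kin_cl hbar m0 b (twisted_kernel b e X) Y) * \<Psi> Y \<partial>lebesgue) = (\<integral>Y. cnj (twisted_kernel b e X Y) * G Y \<partial>lebesgue)"
    using weak test_fun_twisted_kernel[OF e] unfolding weak_kin_def by blast
  then show ?thesis
    unfolding kin_cl_twisted_kernel twisted_kernel_def k1 k2 .
qed

lemma integral_lborel_reflect:
  fixes f :: "'a::euclidean_space \<Rightarrow> complex"
  assumes "f \<in> borel_measurable borel"
  shows "(\<integral>Z. f (- Z) \<partial>lborel) = (\<integral>Z. f Z \<partial>lborel)"
proof -
  have "lborel = distr lborel borel (\<lambda>x::'a. - x)"
    using lborel_affine[of "-1" "0::'a"] by (simp add: density_1)
  then have "(\<integral>Z. f Z \<partial>lborel) = (\<integral>Z. f Z \<partial>distr lborel borel (\<lambda>x::'a. - x))" by simp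
  also have "\<dots> = (\<integral>Z. f (- Z) \<partial>lborel)" by (rule integral_distr[OF _ assms]) simp
  finally show ?thesis ..
qed

locale magnetic_box =
  fixes L1 L2 b :: real and M :: nat
  assumes L1: "L1 > 0" and L2: "L2 > 0" and flux: "b * L1 * L2 = 2 * pi * real M"
begin

text \<open>Flux quantisation in the form used below: the exponent of the boundary condition is the
  phase that a magnetic translation by \<open>L1\<close> produces.\<close>

lemma flux': "2 * pi * real M * x / L2 = b * L1 * x"
  using flux L2 by (simp add: field_simps)

lemma mag_perN_phase:
  assumes "mag_perN L1 L2 M \<Psi>"
  shows "\<Psi> (X + axis j (L1, 0)) = exp (\<i> * of_real (b * L1 * snd (X $ j))) * \<Psi> X" "\<Psi> (X + axis j (0, L2)) = \<Psi> X"
  using assms unfolding mag_perN_def flux' by auto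

lemma periodic_norm_mag_perN:
  fixes \<Psi> :: "(real \<times> real) ^ 'n::finite \<Rightarrow> complex"
  assumes "mag_perN L1 L2 M \<Psi>"
  shows "periodic (box_period L1 L2) (\<lambda>X. norm (\<Psi> X))"
  unfolding periodic_box_period_iff by (simp add: mag_perN_phase[OF assms] norm_mult del: of_real_mult)

text \<open>For fixed displacement \<open>Z\<close> the gauge phase depends on the starting point
  through its first components; moving the one of particle \<open>j\<close> by \<open>L1\<close>
  adds \<open>b L1\<close> times the second component of \<open>Z\<close> at
  \<open>j\<close>.\<close>

lemma twist_period:
  fixes X Z :: "(real \<times> real) ^ 'n::finite"
  shows "twist b (X + axis j (L1, 0)) Z = exp (- \<i> * of_real (b * L1 * snd (Z $ j))) * twist b X Z"
    "twist b (X + axis j (0, L2)) Z = twist b X Z"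
proof -
  have "gauge_phase b (X + axis j (L1, 0) + Z) (X + axis j (L1, 0)) = gauge_phase b (X + Z) X + b * L1 * snd (Z $ j)"
  proof -
    have "gauge_phase b (X + axis j (L1, 0) + Z) (X + axis j (L1, 0)) = (\<Sum>i\<in>UNIV. b / 2 * (2 * fst (X $ i) + fst (Z $ i)) * snd (Z $ i) + (if i = j then b * L1 * snd (Z $ j) else 0))"
      unfolding gauge_phase_shift by (rule sum.cong) (auto simp: axis_def field_simps)
    then show ?thesis by (simp add: sum.distrib gauge_phase_shift)
  qed
  then show "twist b (X + axis j (L1, 0)) Z = exp (- \<i> * of_real (b * L1 * snd (Z $ j))) * twist b X Z"
    unfolding twist_def by (simp add: exp_add[symmetric] algebra_simps del: exp_add)
  have "gauge_phase b (X + axis j (0, L2) + Z) (X + axis j (0, L2)) = gauge_phase b (X + Z) X"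
    unfolding gauge_phase_shift by (rule sum.cong) (auto simp: axis_def)
  then show "twist b (X + axis j (0, L2)) Z = twist b X Z" by (simp add: twist_def)
qed

text \<open>Under a shift by \<open>L1\<close> the conjugated \<open>\<Psi>\<close> contributes the
  phase \<open>- b L1 x2\<close>, the twist \<open>- b L1 z2\<close>, and the shifted
  \<open>G\<close> the phase \<open>b L1 (x2 + z2)\<close>; they cancel. This is why the
  translations have to be magnetic.\<close>

lemma periodic_twisted_product:
  fixes \<Psi> G :: "(real \<times> real) ^ 'n::finite \<Rightarrow> complex"
  assumes \<Psi>: "mag_perN L1 L2 M \<Psi>" and G: "mag_perN L1 L2 M G"
  shows "periodic (box_period L1 L2) (\<lambda>X. cnj (\<Psi> X) * (twist b X Z * G (X + Z)))"
  unfolding periodic_box_period_iff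
proof (intro allI conjI)
  fix j X
  have s: "X + axis j v + Z = (X + Z) + axis j v" for v by (simp add: algebra_simps)
  have "exp (- (\<i> * of_real (b * L1 * snd (X $ j)))) * exp (- \<i> * of_real (b * L1 * snd (Z $ j))) * exp (\<i> * of_real (b * L1 * snd ((X + Z) $ j))) = 1"
    by (simp add: exp_add[symmetric] algebra_simps del: exp_add)
  then have "cnj (exp (\<i> * of_real (b * L1 * snd (X $ j)))) * exp (- \<i> * of_real (b * L1 * snd (Z $ j))) * exp (\<i> * of_real (b * L1 * snd ((X + Z) $ j))) = 1"
    by (simp only: exp_cnj complex_cnj_mult complex_cnj_i complex_cnj_complex_of_real mult_minus_left)
  then have "cnj (\<Psi> X) * (twist b X Z * G (X + Z)) = (cnj (exp (\<i> * of_real (b * L1 * snd (X $ j)))) * exp (- \<i> * of_real (b * L1 * snd (Z $ j))) * exp (\<i> * of_real (b * L1 * snd ((X + Z) $ j)))) * (cnj (\<Psi> X) * (twist b X Z * G (X + Z)))"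
    by simp
  then show "cnj (\<Psi> (X + axis j (L1, 0))) * (twist b (X + axis j (L1, 0)) Z * G (X + axis j (L1, 0) + Z)) = cnj (\<Psi> X) * (twist b X Z * G (X + Z))"
    unfolding s mag_perN_phase[OF \<Psi>] mag_perN_phase[OF G] twist_period complex_cnj_mult by (simp only: mult_ac)
  show "cnj (\<Psi> (X + axis j (0, L2))) * (twist b (X + axis j (0, L2)) Z * G (X + axis j (0, L2) + Z)) = cnj (\<Psi> X) * (twist b X Z * G (X + Z))"
    unfolding s mag_perN_phase[OF \<Psi>] mag_perN_phase[OF G] twist_period ..
qed

abbreviation torusM :: "((real \<times> real) ^ 'n::finite) measure" where
  "torusM \<equiv> cellM (box_period L1 L2)"

lemma twist_0: "twist b X 0 = 1"
  by (simp add: twist_def gauge_phase_def)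

lemma twist_reflect: "twist b (X + Z) (- Z) = cnj (twist b X Z)"
  by (simp add: twist_def exp_cnj gauge_phase_antisym[of b X])

text \<open>Shift the integration variable by \<open>Z\<close> over the torus; the reversed segment
  carries the conjugate phase.\<close>

lemma twisted_corr_reflect:
  fixes \<Psi> :: "(real \<times> real) ^ 'n::finite \<Rightarrow> complex"
  assumes \<Psi>[measurable]: "\<Psi> \<in> borel_measurable borel" and sq: "sq_int torusM \<Psi>" and per: "mag_perN L1 L2 M \<Psi>"
  shows "twisted_corr (box_period L1 L2) (twist b) \<Psi> \<Psi> (- Z) = cnj (twisted_corr (box_period L1 L2) (twist b) \<Psi> \<Psi> Z)"
proof -
  note P = box_period_pos[OF L1 L2, where 'n='n]
  note [measurable] = twist_measurable
  let ?h = "\<lambda>X. cnj (\<Psi> X) * (twist b X (- Z) * \<Psi> (X + - Z))"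
  have int: "integrable torusM ?h"
    by (intro integrable_ip sq twisted_shift[OF P continuous_on_twist _ \<Psi> sq periodic_norm_mag_perN[OF per]]) auto
  have "twisted_corr (box_period L1 L2) (twist b) \<Psi> \<Psi> (- Z) = (\<integral>X. ?h X \<partial>torusM)" by (simp add: twisted_corr_def)
  also have "\<dots> = (\<integral>X. ?h (X + Z) \<partial>torusM)"
    by (rule integral_cell_shift[OF P _ periodic_twisted_product[OF per per] int, symmetric]) measurable
  also have "\<dots> = (\<integral>X. cnj (cnj (\<Psi> X) * (twist b X Z * \<Psi> (X + Z))) \<partial>torusM)"
    by (simp add: twist_reflect mult_ac)
  finally show ?thesis unfolding twisted_corr_def Bochner_Integration.integral_cnj .
qed

text \<open>The convolution identity is paired with a general \<open>A\<close>, because it serves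
  with \<open>A = \<Psi>\<close> for symmetry and with \<open>A = G\<close> for uniqueness.\<close>

lemma twisted_corr_weak_kin:
  fixes A \<Psi> G :: "(real \<times> real) ^ 'n::finite \<Rightarrow> complex"
  assumes \<Psi>[measurable]: "\<Psi> \<in> borel_measurable borel" and \<Psi>sq: "sq_int torusM \<Psi>" and \<Psi>per: "mag_perN L1 L2 M \<Psi>"
    and G[measurable]: "G \<in> borel_measurable borel" and Gsq: "sq_int torusM G" and Gper: "mag_perN L1 L2 M G"
    and weak: "weak_kin hbar m0 b \<Psi> G" and A: "sq_int torusM A" and e: "e > 0"
  shows "integrable lborel (\<lambda>Z. of_real (bump_profile e Z) * twisted_corr (box_period L1 L2) (twist b) A G Z)"
    "integrable lborel (\<lambda>Z. of_real (kin_profile hbar m0 b e Z) * twisted_corr (box_period L1 L2) (twist b) A \<Psi> Z)"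
    "(\<integral>Z. of_real (kin_profile hbar m0 b e Z) * twisted_corr (box_period L1 L2) (twist b) A \<Psi> Z \<partial>lborel) =
     (\<integral>Z. of_real (bump_profile e Z) * twisted_corr (box_period L1 L2) (twist b) A G Z \<partial>lborel)"
proof -
  note P = box_period_pos[OF L1 L2, where 'n='n]
  note F1 = twisted_corr_Fubini[OF P continuous_on_twist _ \<Psi> \<Psi>sq periodic_norm_mag_perN[OF \<Psi>per] A, of b "\<lambda>Z. of_real (kin_profile hbar m0 b e Z)"]
  note F2 = twisted_corr_Fubini[OF P continuous_on_twist _ G Gsq periodic_norm_mag_perN[OF Gper] A, of b "\<lambda>Z. of_real (bump_profile e Z)"]
  have i: "integrable lborel (\<lambda>Z :: (real \<times> real) ^ 'n. complex_of_real (kin_profile hbar m0 b e Z))"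
    "integrable lborel (\<lambda>Z :: (real \<times> real) ^ 'n. complex_of_real (bump_profile e Z))"
    by (intro integrable_of_real kin_profile_props bump_profile_props e)+
  show "integrable lborel (\<lambda>Z. of_real (bump_profile e Z) * twisted_corr (box_period L1 L2) (twist b) A G Z)"
    by (rule F2(1)[OF _ _ i(2)]) auto
  show "integrable lborel (\<lambda>Z. of_real (kin_profile hbar m0 b e Z) * twisted_corr (box_period L1 L2) (twist b) A \<Psi> Z)"
    by (rule F1(1)[OF _ _ i(1)]) auto
  have "(\<integral>Z. of_real (kin_profile hbar m0 b e Z) * twisted_corr (box_period L1 L2) (twist b) A \<Psi> Z \<partial>lborel) =
      (\<integral>X. cnj (A X) * (\<integral>Z. of_real (kin_profile hbar m0 b e Z) * (twist b X Z * \<Psi> (X + Z)) \<partial>lborel) \<partial>torusM)"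
    by (rule F1(2)[OF _ _ i(1)]) auto
  also have "\<dots> = (\<integral>X. cnj (A X) * (\<integral>Z. of_real (bump_profile e Z) * (twist b X Z * G (X + Z)) \<partial>lborel) \<partial>torusM)"
    by (simp only: weak_kin_convolution[OF \<Psi> G weak e])
  also have "\<dots> = (\<integral>Z. of_real (bump_profile e Z) * twisted_corr (box_period L1 L2) (twist b) A G Z \<partial>lborel)"
    by (rule F2(2)[OF _ _ i(2), symmetric]) auto
  finally show "(\<integral>Z. of_real (kin_profile hbar m0 b e Z) * twisted_corr (box_period L1 L2) (twist b) A \<Psi> Z \<partial>lborel) =
     (\<integral>Z. of_real (bump_profile e Z) * twisted_corr (box_period L1 L2) (twist b) A G Z \<partial>lborel)" .
qed

lemma twisted_corr_at_0: "twisted_corr P (twist b) A B 0 = ip (cellM P) A B"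
  by (simp add: twisted_corr_def ip_def twist_0)

lemma weak_kin_symmetric_borel:
  fixes \<Psi> G :: "(real \<times> real) ^ 'n::finite \<Rightarrow> complex"
  assumes \<Psi>: "\<Psi> \<in> borel_measurable borel" and \<Psi>sq: "sq_int torusM \<Psi>" and \<Psi>per: "mag_perN L1 L2 M \<Psi>"
    and G: "G \<in> borel_measurable borel" and Gsq: "sq_int torusM G" and Gper: "mag_perN L1 L2 M G"
    and weak: "weak_kin hbar m0 b \<Psi> G"
  shows "Im (ip torusM \<Psi> G) = 0"
proof -
  note P = box_period_pos[OF L1 L2, where 'n='n]
  let ?J = "\<lambda>B Z. twisted_corr (box_period L1 L2) (twist b) \<Psi> B Z"
  have lim: "((\<lambda>Z. ?J G Z) \<longlongrightarrow> ?J G 0) (at 0)"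
    by (rule twisted_corr_tendsto[OF P continuous_on_twist _ G Gsq periodic_norm_mag_perN[OF Gper] \<Psi>sq]) auto
  have "Im (?J G 0) = 0"
  proof (rule averages_zero_imp_zero[where f="\<lambda>Z. Im (?J G Z)"])
    show "((\<lambda>Z. Im (?J G Z)) \<longlongrightarrow> Im (?J G 0)) (at 0)" by (rule tendsto_Im[OF lim])
    fix e :: real assume e: "e > 0"
    note tw = twisted_corr_weak_kin[OF \<Psi> \<Psi>sq \<Psi>per G Gsq Gper weak \<Psi>sq e]
    have "cnj (\<integral>Z. of_real (kin_profile hbar m0 b e Z) * ?J \<Psi> Z \<partial>lborel) = (\<integral>Z. of_real (kin_profile hbar m0 b e (- Z)) * ?J \<Psi> (- Z) \<partial>lborel)"
      unfolding twisted_corr_reflect[OF \<Psi> \<Psi>sq \<Psi>per] kin_profile_props(3)[OF e]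
      by (subst Bochner_Integration.integral_cnj[symmetric]) simp
    also have "\<dots> = (\<integral>Z. of_real (kin_profile hbar m0 b e Z) * ?J \<Psi> Z \<partial>lborel)"
      using borel_measurable_integrable[OF tw(2)] by (intro integral_lborel_reflect) simp
    finally have "Im (\<integral>Z. of_real (kin_profile hbar m0 b e Z) * ?J \<Psi> Z \<partial>lborel) = 0"
      by (simp add: complex_eq_iff)
    then have "Im (\<integral>Z. of_real (bump_profile e Z) * ?J G Z \<partial>lborel) = 0" using tw(3) by simp
    then have "(\<integral>Z. bump_profile e Z * Im (?J G Z) \<partial>lborel) = 0"
      unfolding integral_Im[OF tw(1), symmetric] by simp
    moreover have "integrable lborel (\<lambda>Z. bump_profile e Z * Im (?J G Z))" using integrable_Im[OF tw(1)] by simp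
    ultimately show "\<exists>\<rho>. integrable lborel \<rho> \<and> integrable lborel (\<lambda>Z. \<rho> Z * Im (?J G Z)) \<and> (\<forall>Z. \<rho> Z \<ge> 0) \<and>
       (\<forall>Z. norm Z \<ge> e \<longrightarrow> \<rho> Z = 0) \<and> (\<integral>Z. \<rho> Z \<partial>lborel) > 0 \<and> (\<integral>Z. \<rho> Z * Im (?J G Z) \<partial>lborel) = 0"
      using bump_profile_props[OF e] by (intro exI[of _ "bump_profile e"]) blast
  qed
  then show ?thesis by (simp only: twisted_corr_at_0)
qed

text \<open>For the zero function the bump averages of the autocorrelation of \<open>G\<close> all
  vanish, and at the origin that autocorrelation is the square norm. This is the source of
  uniqueness.\<close>

lemma weak_kin_zero_borel:
  fixes G :: "(real \<times> real) ^ 'n::finite \<Rightarrow> complex"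
  assumes G: "G \<in> borel_measurable borel" and Gsq: "sq_int torusM G" and Gper: "mag_perN L1 L2 M G"
    and weak: "weak_kin hbar m0 b (\<lambda>X. 0) G"
  shows "nrm torusM G = 0"
proof -
  note P = box_period_pos[OF L1 L2, where 'n='n]
  let ?J = "\<lambda>Z. twisted_corr (box_period L1 L2) (twist b) G G Z"
  have lim: "((\<lambda>Z. ?J Z) \<longlongrightarrow> ?J 0) (at 0)"
    by (rule twisted_corr_tendsto[OF P continuous_on_twist _ G Gsq periodic_norm_mag_perN[OF Gper] Gsq]) auto
  have per0: "mag_perN L1 L2 M (\<lambda>X :: (real \<times> real) ^ 'n. 0)" by (simp add: mag_perN_def)
  have "Re (?J 0) = 0"
  proof (rule averages_zero_imp_zero[where f="\<lambda>Z. Re (?J Z)"])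
    show "((\<lambda>Z. Re (?J Z)) \<longlongrightarrow> Re (?J 0)) (at 0)" by (rule tendsto_Re[OF lim])
    fix e :: real assume e: "e > 0"
    note tw = twisted_corr_weak_kin[OF _ _ per0 G Gsq Gper weak Gsq e, simplified]
    have "(\<integral>Z. of_real (bump_profile e Z) * ?J Z \<partial>lborel) = 0" using tw(3) by (simp add: twisted_corr_def)
    then have "Re (\<integral>Z. of_real (bump_profile e Z) * ?J Z \<partial>lborel) = 0" by simp
    then have "(\<integral>Z. bump_profile e Z * Re (?J Z) \<partial>lborel) = 0"
      unfolding integral_Re[OF tw(1), symmetric] by simp
    moreover have "integrable lborel (\<lambda>Z. bump_profile e Z * Re (?J Z))" using integrable_Re[OF tw(1)] by simp
    ultimately show "\<exists>\<rho>. integrable lborel \<rho> \<and> integrable lborel (\<lambda>Z. \<rho> Z * Re (?J Z)) \<and> (\<forall>Z. \<rho> Z \<ge> 0) \<and>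
       (\<forall>Z. norm Z \<ge> e \<longrightarrow> \<rho> Z = 0) \<and> (\<integral>Z. \<rho> Z \<partial>lborel) > 0 \<and> (\<integral>Z. \<rho> Z * Re (?J Z) \<partial>lborel) = 0"
      using bump_profile_props[OF e] by (intro exI[of _ "bump_profile e"]) blast
  qed
  then show ?thesis by (simp add: twisted_corr_at_0 ip_self)
qed

end

section \<open>Local integrability of quasi-periodic functions\<close>

text \<open>Common abstraction of the one-particle and the N-particle boundary condition: a period
  multiplies by a continuous unimodular factor that may depend on the point.\<close>

definition quasi_periodic :: "'a::euclidean_space \<Rightarrow> ('a \<Rightarrow> complex) \<Rightarrow> bool" where
  "quasi_periodic P F \<longleftrightarrow> (\<forall>B\<in>Basis. \<exists>c. continuous_on UNIV c \<and> (\<forall>X. norm (c X) = 1) \<and>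
     (\<forall>X. F (X + (P \<bullet> B) *\<^sub>R B) = c X * F X))"

text \<open>The vectors whose translation acts by such a factor form a group, and this group
  contains the periods.\<close>

lemma quasi_periodic_lattice_vec:
  assumes "quasi_periodic P F"
  shows "\<exists>c. continuous_on UNIV c \<and> (\<forall>X. norm (c X) = 1) \<and> (\<forall>X. F (X + lattice_vec P k) = c X * F X)"
proof -
  define T where "T = {v. \<exists>c. continuous_on UNIV c \<and> (\<forall>X. norm (c X) = 1) \<and> (\<forall>X. F (X + v) = c X * F X)}"
  have T0: "0 \<in> T" unfolding T_def by (auto intro!: exI[of _ "\<lambda>_. 1"])
  have Tadd: "v + w \<in> T" if v: "v \<in> T" and w: "w \<in> T" for v w
  proof -
    from v obtain c where c: "continuous_on UNIV c" "\<And>X. norm (c X) = 1" "\<And>X. F (X + v) = c X * F X" unfolding T_def by blast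
    from w obtain d where d: "continuous_on UNIV d" "\<And>X. norm (d X) = 1" "\<And>X. F (X + w) = d X * F X" unfolding T_def by blast
    have "F (X + (v + w)) = d (X + v) * c X * F X" for X
      using d(3)[of "X + v"] c(3)[of X] by (simp add: add.assoc)
    moreover have "continuous_on UNIV (\<lambda>X. d (X + v) * c X)"
      by (intro continuous_intros c continuous_on_compose2[OF d(1)]) auto
    ultimately show ?thesis unfolding T_def using c(2) d(2) by (auto intro!: exI[of _ "\<lambda>X. d (X + v) * c X"] simp: norm_mult)
  qed
  have Tneg: "- v \<in> T" if v: "v \<in> T" for v
  proof -
    from v obtain c where c: "continuous_on UNIV c" "\<And>X. norm (c X) = 1" "\<And>X. F (X + v) = c X * F X" unfolding T_def by blast
    have "F (X + - v) = cnj (c (X + - v)) * F X" for X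
    proof -
      have "cnj (c (X + - v)) * F X = cnj (c (X + - v)) * (c (X + - v) * F (X + - v))" using c(3)[of "X + - v"] by simp
      also have "\<dots> = F (X + - v)" using c(2)[of "X + - v"] by (simp add: mult.assoc[symmetric] cnj_mult_self)
      finally show ?thesis ..
    qed
    moreover have "continuous_on UNIV (\<lambda>X. cnj (c (X + - v)))"
      by (intro continuous_intros continuous_on_compose2[OF c(1)]) auto
    ultimately show ?thesis unfolding T_def using c(2) by (auto intro!: exI[of _ "\<lambda>X. cnj (c (X + - v))"])
  qed
  have Tint: "(of_int i * (P \<bullet> B)) *\<^sub>R B \<in> T" if "B \<in> Basis" for i B
  proof -
    have gen: "(P \<bullet> B) *\<^sub>R B \<in> T" using assms that unfolding quasi_periodic_def T_def by blast
    show ?thesis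
    proof (induction i rule: int_induct[of _ 0])
      case (step1 i) then show ?case using Tadd[OF step1(2) gen] by (simp add: algebra_simps)
    next
      case (step2 i) then show ?case using Tadd[OF step2(2) Tneg[OF gen]] by (simp add: algebra_simps)
    qed (simp add: T0)
  qed
  have "(\<Sum>B\<in>S. (of_int (k B) * (P \<bullet> B)) *\<^sub>R B) \<in> T" if "finite S" "S \<subseteq> Basis" for S
    using that by (induction S rule: finite_induct) (auto intro: T0 Tadd Tint)
  from this[of Basis] have "lattice_vec P k \<in> T" by (simp add: lattice_vec_def)
  then show ?thesis by (simp add: T_def)
qed

lemma periodic_norm_quasi_periodic: "quasi_periodic P F \<Longrightarrow> periodic P (\<lambda>X. norm (F X))"
  unfolding quasi_periodic_def periodic_def by (metis mult_1 norm_mult)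

definition tile :: "'a::euclidean_space \<Rightarrow> ('a \<Rightarrow> int) \<Rightarrow> 'a set" where
  "tile P k = {X. X - lattice_vec P k \<in> cell P}"

lemma tile_sets [measurable, simp]: "tile P k \<in> sets borel"
  unfolding tile_def using measurable_sets_borel[of "\<lambda>X. X - lattice_vec P k" borel "cell P"]
  by (simp add: vimage_def)

lemma tiles_cover:
  assumes P: "\<And>b. b \<in> Basis \<Longrightarrow> P \<bullet> b > 0"
  shows "(\<Union>k\<in>lattice_indices. tile P k) = UNIV"
proof -
  have "X \<in> (\<Union>k\<in>lattice_indices. tile P k)" for X
    using cell_lattice_unique[OF P, of X] by (auto simp: tile_def)
  then show ?thesis by blast
qed

lemma lattice_vec_shift_index:
  assumes "B \<in> Basis"
  shows "lattice_vec P (k(B := k B + 1)) = lattice_vec P k + (P \<bullet> B) *\<^sub>R B"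
proof -
  have "lattice_vec P (k(B := k B + 1)) = (\<Sum>b\<in>Basis. (of_int (k b) * (P \<bullet> b)) *\<^sub>R b + (if b = B then (P \<bullet> B) *\<^sub>R B else 0))"
    unfolding lattice_vec_def by (rule sum.cong) (auto simp: algebra_simps)
  then show ?thesis using assms by (simp add: sum.distrib lattice_vec_def)
qed

text \<open>Measurability is known on one cell; the phase factor of a lattice translation carries it
  to each tile. The exceptional set is saturated under the lattice, so that setting the function to
  zero on it keeps the boundary condition.\<close>

lemma quasi_periodic_borel_version:
  assumes P: "\<And>b. b \<in> Basis \<Longrightarrow> P \<bullet> b > 0" and F: "quasi_periodic P F"
    and meas: "(\<lambda>X. indicat_real (cell P) X *\<^sub>R F X) \<in> borel_measurable lebesgue"
  shows "\<exists>N. N \<in> sets borel \<and> (AE X in lborel. X \<notin> N) \<and> periodic P (\<lambda>X. X \<in> N) \<and>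
     (\<lambda>X. if X \<in> N then 0 else F X) \<in> borel_measurable borel"
proof -
  obtain F0 where F0: "F0 \<in> borel_measurable lborel" "AE X in lborel. indicat_real (cell P) X *\<^sub>R F X = F0 X"
    using completion_ex_borel_measurable_complex[OF meas] by blast
  from F0(2) obtain N0 where N0: "{X \<in> space lborel. indicat_real (cell P) X *\<^sub>R F X \<noteq> F0 X} \<subseteq> N0" "emeasure lborel N0 = 0" "N0 \<in> sets lborel"
    by (rule AE_E)
  have [measurable]: "N0 \<in> sets borel" "F0 \<in> borel_measurable borel" using N0 F0 by auto
  define N where "N = (\<Union>k\<in>lattice_indices. {X. X - lattice_vec P k \<in> N0 \<inter> cell P})"
  have Nk: "{X. X - lattice_vec P k \<in> N0 \<inter> cell P} \<in> sets borel" for k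
    using measurable_sets_borel[of "\<lambda>X. X - lattice_vec P k" borel "N0 \<inter> cell P"] by (simp add: vimage_def)
  have N: "N \<in> sets borel" unfolding N_def by (rule sets.countable_UN'[OF countable_lattice_indices]) (use Nk in auto)
  \<comment> \<open>Tiles are disjoint, so within tile \<open>k\<close> membership in the saturated
    set is decided by the index \<open>k\<close> alone.\<close>
  have mem: "X \<in> N \<longleftrightarrow> X - lattice_vec P k \<in> N0" if "X \<in> tile P k" "k \<in> lattice_indices" for X k
  proof -
    have uniq: "l = k" if "l \<in> lattice_indices" "X - lattice_vec P l \<in> cell P" for l
    proof -
      obtain k0 where k0: "{k \<in> lattice_indices. X - lattice_vec P k \<in> cell P} = {k0}"
        using cell_lattice_unique[OF P, of X] by blast
      have "l \<in> {k0}" "k \<in> {k0}"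
        unfolding k0[symmetric] using that \<open>X \<in> tile P k\<close> \<open>k \<in> lattice_indices\<close> by (simp_all add: tile_def)
      then show ?thesis by simp
    qed
    have "X \<in> N \<longleftrightarrow> (\<exists>l\<in>lattice_indices. X - lattice_vec P l \<in> N0 \<and> X - lattice_vec P l \<in> cell P)"
      by (simp add: N_def)
    also have "\<dots> \<longleftrightarrow> X - lattice_vec P k \<in> N0"
    proof
      assume "\<exists>l\<in>lattice_indices. X - lattice_vec P l \<in> N0 \<and> X - lattice_vec P l \<in> cell P"
      then obtain l where "l \<in> lattice_indices" "X - lattice_vec P l \<in> N0" "X - lattice_vec P l \<in> cell P" by blast
      with uniq[of l] show "X - lattice_vec P k \<in> N0" by simp
    next
      assume "X - lattice_vec P k \<in> N0"
      with that show "\<exists>l\<in>lattice_indices. X - lattice_vec P l \<in> N0 \<and> X - lattice_vec P l \<in> cell P"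
        by (intro bexI[of _ k]) (simp_all add: tile_def)
    qed
    finally show ?thesis .
  qed
  have AEN: "AE X in lborel. X \<notin> N"
  proof -
    have "AE X in lborel. \<forall>k\<in>lattice_indices. X - lattice_vec P k \<notin> N0"
    proof (rule AE_ball_countable'[OF _ countable_lattice_indices])
      fix k :: "'a \<Rightarrow> int"
      have "AE X in lborel. X \<notin> N0" using N0 by (intro AE_not_in) (simp add: null_sets_def)
      then have "AE X in distr lborel borel ((+) (- lattice_vec P k)). X \<notin> N0"
        unfolding lborel_distr_plus .
      then have "AE X in lborel. - lattice_vec P k + X \<notin> N0" by (subst (asm) AE_distr_iff) auto
      then show "AE X in lborel. X - lattice_vec P k \<notin> N0" by (simp add: algebra_simps)
    qed
    then show ?thesis by eventually_elim (auto simp: N_def)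
  qed
  have perN: "periodic P (\<lambda>X. X \<in> N)"
    unfolding periodic_def
  proof (intro ballI allI)
    fix B X assume B: "B \<in> (Basis :: 'a set)"
    obtain k where k: "k \<in> lattice_indices" "X \<in> tile P k" using tiles_cover[OF P] by blast
    let ?k = "k(B := k B + 1)"
    have e: "X + (P \<bullet> B) *\<^sub>R B - lattice_vec P ?k = X - lattice_vec P k"
      by (simp add: lattice_vec_shift_index[OF B])
    have "X + (P \<bullet> B) *\<^sub>R B \<in> tile P ?k" using k(2) by (simp only: tile_def mem_Collect_eq e)
    moreover have "?k \<in> lattice_indices" using k B by (auto simp: PiE_iff extensional_def)
    ultimately show "(X + (P \<bullet> B) *\<^sub>R B \<in> N) = (X \<in> N)"
      using mem[of "X + (P \<bullet> B) *\<^sub>R B" ?k] mem[OF k(2,1)] by (simp only: e)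
  qed
  have "(\<lambda>X. if X \<in> N then 0 else F X) \<in> borel_measurable borel"
  proof (rule measurable_piecewise_restrict[of "tile P ` lattice_indices"])
    show "countable (tile P ` lattice_indices)" by (intro countable_image countable_lattice_indices)
    show "space borel \<subseteq> \<Union> (tile P ` lattice_indices)" using tiles_cover[OF P] by simp
    fix S assume "S \<in> tile P ` (lattice_indices :: ('a \<Rightarrow> int) set)"
    then obtain k where k: "k \<in> lattice_indices" "S = tile P k" by blast
    show "S \<inter> space borel \<in> sets borel" using k by simp
    obtain c where c: "continuous_on UNIV c" "\<And>X. F (X + lattice_vec P k) = c X * F X"
      using quasi_periodic_lattice_vec[OF F] by blast
    have [measurable]: "c \<in> borel_measurable borel" by (rule borel_measurable_continuous_onI[OF c(1)])
    have g: "(\<lambda>X. if X - lattice_vec P k \<in> N0 then 0 else c (X - lattice_vec P k) * F0 (X - lattice_vec P k)) \<in> borel_measurable (restrict_space borel S)"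
      by (rule measurable_restrict_space1) measurable
    show "(\<lambda>X. if X \<in> N then 0 else F X) \<in> borel_measurable (restrict_space borel S)"
    proof (rule measurable_cong[THEN iffD1, OF _ g])
      fix X assume "X \<in> space (restrict_space borel S)"
      then have X: "X \<in> tile P k" using k by (simp add: space_restrict_space)
      have "F0 (X - lattice_vec P k) = F (X - lattice_vec P k)" if "X - lattice_vec P k \<notin> N0"
      proof -
        have "indicat_real (cell P) (X - lattice_vec P k) *\<^sub>R F (X - lattice_vec P k) = F0 (X - lattice_vec P k)"
          using that N0(1) by auto
        then show ?thesis using X by (simp add: tile_def)
      qed
      then show "(if X - lattice_vec P k \<in> N0 then 0 else c (X - lattice_vec P k) * F0 (X - lattice_vec P k)) = (if X \<in> N then 0 else F X)"
        using mem[OF X k(1)] c(2)[of "X - lattice_vec P k"] by simp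
    qed
  qed
  with N AEN perN show ?thesis by blast
qed

text \<open>A bounded set meets finitely many tiles, and periodicity gives every tile the integral
  of the cell.\<close>

lemma nn_integral_bounded_finite:
  fixes h :: "'a::euclidean_space \<Rightarrow> ennreal"
  assumes P: "\<And>b. b \<in> Basis \<Longrightarrow> P \<bullet> b > 0" and h[measurable]: "h \<in> borel_measurable borel" and per: "periodic P h"
    and fin: "(\<integral>\<^sup>+X. h X \<partial>cellM P) < \<infinity>" and K: "bounded K"
  shows "(\<integral>\<^sup>+X. h X * indicator K X \<partial>lborel) < \<infinity>"
proof -
  obtain R where R: "\<And>X. X \<in> K \<Longrightarrow> norm X \<le> R" using K by (auto simp: bounded_iff)
  \<comment> \<open>A finite set with all indices of tiles that meet the ball of radius
    \<open>R\<close>; half a period of slack would do, a whole one is taken and rounded up.\<close>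
  define F where "F = Pi\<^sub>E Basis (\<lambda>b. {- \<lceil>R / (P \<bullet> b) + 1\<rceil>..\<lceil>R / (P \<bullet> b) + 1\<rceil>})"
  have finF: "finite F" unfolding F_def by (intro finite_PiE) auto
  have cover: "\<exists>k\<in>F. X \<in> tile P k" if X: "X \<in> K" for X
  proof -
    obtain k where k: "k \<in> lattice_indices" "X \<in> tile P k" using tiles_cover[OF P] by blast
    have "k b \<in> {- \<lceil>R / (P \<bullet> b) + 1\<rceil>..\<lceil>R / (P \<bullet> b) + 1\<rceil>}" if b: "b \<in> Basis" for b
    proof -
      have pb: "P \<bullet> b > 0" by (rule P[OF b])
      have "\<bar>X \<bullet> b\<bar> \<le> R" using Basis_le_norm[OF b, of X] R[OF X] by linarith
      moreover have "- (P \<bullet> b) / 2 \<le> X \<bullet> b - of_int (k b) * (P \<bullet> b)" "X \<bullet> b - of_int (k b) * (P \<bullet> b) < P \<bullet> b / 2"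
        using k b by (auto simp: tile_def cell_def inner_diff_left inner_lattice_vec)
      ultimately have "of_int (k b) * (P \<bullet> b) \<le> R + P \<bullet> b" "- (R + P \<bullet> b) \<le> of_int (k b) * (P \<bullet> b)" using pb by linarith+
      then have "of_int (k b) \<le> R / (P \<bullet> b) + 1" "- (R / (P \<bullet> b) + 1) \<le> of_int (k b)" using pb by (auto simp: field_simps)
      then show ?thesis by (auto simp: le_ceiling_iff) linarith+
    qed
    then have "k \<in> F" using k by (auto simp: F_def PiE_iff)
    with k show ?thesis by blast
  qed
  have "(\<integral>\<^sup>+X. h X * indicator K X \<partial>lborel) \<le> (\<integral>\<^sup>+X. (\<Sum>k\<in>F. h X * indicator (tile P k) X) \<partial>lborel)"
  proof (rule nn_integral_mono)
    fix X
    show "h X * indicator K X \<le> (\<Sum>k\<in>F. h X * indicator (tile P k) X)"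
    proof (cases "X \<in> K")
      case True
      then obtain k where k: "k \<in> F" "X \<in> tile P k" using cover by blast
      have "h X * indicator (tile P k) X \<le> (\<Sum>k\<in>F. h X * indicator (tile P k) X)"
        by (rule member_le_sum[OF k(1) _ finF]) auto
      with k True show ?thesis by simp
    qed simp
  qed
  also have "\<dots> = (\<Sum>k\<in>F. \<integral>\<^sup>+X. h X * indicator (tile P k) X \<partial>lborel)"
    by (rule nn_integral_sum) measurable
  also have "\<dots> = (\<Sum>k\<in>F. \<integral>\<^sup>+X. h X \<partial>cellM P)"
  proof (rule sum.cong[OF refl])
    fix k
    have "(\<integral>\<^sup>+X. h X * indicator (tile P k) X \<partial>lborel) = (\<integral>\<^sup>+X. h (X + lattice_vec P k) * indicator (tile P k) (X + lattice_vec P k) \<partial>lborel)"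
      by (rule nn_integral_lborel_shift[symmetric]) measurable
    also have "\<dots> = (\<integral>\<^sup>+X. h X * indicator (cell P) X \<partial>lborel)"
      by (simp add: periodic_lattice_vec[OF per] tile_def indicator_def)
    also have "\<dots> = (\<integral>\<^sup>+X. h X \<partial>cellM P)" by (subst nn_integral_restrict_space) auto
    finally show "(\<integral>\<^sup>+X. h X * indicator (tile P k) X \<partial>lborel) = (\<integral>\<^sup>+X. h X \<partial>cellM P)" .
  qed
  also have "\<dots> < \<infinity>" using fin by (simp add: ennreal_mult_less_top less_top of_nat_less_top)
  finally show ?thesis .
qed

lemma sq_int_on_bounded:
  assumes P: "\<And>b. b \<in> Basis \<Longrightarrow> P \<bullet> b > 0" and F[measurable]: "F \<in> borel_measurable borel"
    and per: "periodic P (\<lambda>X. norm (F X))" and sq: "sq_int (cellM P) F" and K[measurable]: "K \<in> sets borel" "bounded K"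
  shows "sq_int lborel (\<lambda>X. indicat_real K X *\<^sub>R F X)"
proof -
  have fin: "(\<integral>\<^sup>+X. ennreal ((norm (F X))\<^sup>2) * indicator K X \<partial>lborel) < \<infinity>"
  proof (rule nn_integral_bounded_finite[OF P _ _ _ K(2)])
    show "periodic P (\<lambda>X. ennreal ((norm (F X))\<^sup>2))" by (rule periodic_comp[OF per, of "\<lambda>x. ennreal (x\<^sup>2)"])
    show "(\<integral>\<^sup>+X. ennreal ((norm (F X))\<^sup>2) \<partial>cellM P) < \<infinity>" unfolding nn_integral_sq_int[OF sq] by simp
  qed auto
  have eq: "(norm (indicat_real K X *\<^sub>R F X))\<^sup>2 = indicat_real K X * (norm (F X))\<^sup>2" for X
    by (simp add: indicator_def)
  have "(\<integral>\<^sup>+X. ennreal (norm ((norm (indicat_real K X *\<^sub>R F X))\<^sup>2)) \<partial>lborel) = (\<integral>\<^sup>+X. ennreal ((norm (F X))\<^sup>2) * indicator K X \<partial>lborel)"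
    by (rule nn_integral_cong) (auto simp: indicator_def)
  with fin have "integrable lborel (\<lambda>X. (norm (indicat_real K X *\<^sub>R F X))\<^sup>2)"
    by (intro integrableI_bounded) auto
  moreover have "(\<lambda>X. indicat_real K X *\<^sub>R F X) \<in> borel_measurable lborel" by measurable
  ultimately show ?thesis by (simp add: sq_int_def)
qed

text \<open>Local square integrability and Cauchy-Schwarz: the integrals in the weak formulations
  converge absolutely although the wave functions extend over the whole space.\<close>

lemma integrable_continuous_mult:
  fixes g F :: "'a::euclidean_space \<Rightarrow> complex"
  assumes P: "\<And>b. b \<in> Basis \<Longrightarrow> P \<bullet> b > 0" and F[measurable]: "F \<in> borel_measurable borel"
    and per: "periodic P (\<lambda>X. norm (F X))" and sq: "sq_int (cellM P) F"
    and g: "continuous_on UNIV g" and K: "compact K" "\<And>X. X \<notin> K \<Longrightarrow> g X = 0"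
  shows "integrable lborel (\<lambda>X. g X * F X)"
proof -
  have Kb: "K \<in> sets borel" "bounded K" using K by (auto simp: compact_imp_closed compact_imp_bounded)
  have [measurable]: "g \<in> borel_measurable borel" by (rule borel_measurable_continuous_onI[OF g])
  have "integrable lborel (\<lambda>x. indicator K x *\<^sub>R ((norm (g x))\<^sup>2))"
    by (rule borel_integrable_compact[OF K(1)]) (intro continuous_intros continuous_on_subset[OF g] subset_UNIV)
  moreover have "(\<lambda>x. indicator K x *\<^sub>R ((norm (g x))\<^sup>2)) = (\<lambda>x. (norm (g x))\<^sup>2)"
    using K(2) by (auto simp: indicator_def fun_eq_iff)
  ultimately have "sq_int lborel g" by (simp add: sq_int_def)
  from integrable_sq_int_mult[OF this sq_int_on_bounded[OF P F per sq Kb]]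
  have "integrable lborel (\<lambda>X. g X * (indicat_real K X *\<^sub>R F X))" .
  moreover have "g X * (indicat_real K X *\<^sub>R F X) = g X * F X" for X using K(2)[of X] by (auto simp: indicator_def)
  ultimately show ?thesis by simp
qed

section \<open>The kinetic energy of test functions and their slices\<close>

lemma test_funD:
  assumes "test_fun f" "es \<in> lists Basis"
  shows "continuous_on UNIV (iter_ddir es f)"
    "B \<in> Basis \<Longrightarrow> ((\<lambda>s. iter_ddir es f (x + s *\<^sub>R B)) has_vector_derivative iter_ddir (B # es) f x) (at 0)"
  using assms unfolding test_fun_def by blast+

text \<open>Off a closed set containing the support, a short segment in any direction stays off it,
  so each directional derivative sees a function that is zero near the point.\<close>

lemma iter_ddir_zero_outside:
  assumes "closed K" "{x. f x \<noteq> 0} \<subseteq> K" "x \<notin> K"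
  shows "iter_ddir es f x = 0"
  using assms(3)
proof (induction es arbitrary: x)
  case Nil then show ?case using assms(2) by auto
next
  case (Cons e es)
  have "((\<lambda>s::real. x + s *\<^sub>R e) \<longlongrightarrow> x + 0 *\<^sub>R e) (at 0)" by (intro tendsto_intros)
  then have "((\<lambda>s::real. x + s *\<^sub>R e) \<longlongrightarrow> x) (nhds 0)"
    by (simp add: tendsto_nhds_iff)
  then have "eventually (\<lambda>s::real. x + s *\<^sub>R e \<in> - K) (nhds 0)"
    by (rule topological_tendstoD) (use Cons.prems assms(1) in auto)
  then have "eventually (\<lambda>s::real. iter_ddir es f (x + s *\<^sub>R e) = 0) (nhds 0)"
    by eventually_elim (use Cons.IH in auto)
  moreover have "((\<lambda>s::real. 0 :: complex) has_vector_derivative 0) (at 0)" by simp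
  ultimately have "((\<lambda>s. iter_ddir es f (x + s *\<^sub>R e)) has_vector_derivative 0) (at 0)"
    by (subst has_vector_derivative_cong_ev[where g="\<lambda>_. 0"]) (auto simp: Cons.IH[OF Cons.prems] elim: eventually_mono)
  then show ?case by (simp add: ddir_def vector_derivative_at)
qed

lemma ddir_cmult:
  assumes "((\<lambda>s. f (x + s *\<^sub>R e)) has_vector_derivative d) (at 0)"
  shows "ddir e (\<lambda>x. c * f x) x = c * d"
  by (rule ddirI) (rule bounded_linear.has_vector_derivative[OF bounded_linear_mult_right assms])

text \<open>The expanded one-particle operator with the derivatives as arguments. The one-particle
  and the N-particle operator both reduce to it, so that slices can be compared argument by argument
  and continuity is immediate.\<close>

definition magnetic_symbol :: "real \<Rightarrow> real \<Rightarrow> real \<Rightarrow> real \<Rightarrow> complex \<Rightarrow> complex \<Rightarrow> complex \<Rightarrow> complex \<Rightarrow> complex" where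
  "magnetic_symbol hbar m0 b x d11 d22 d2 d0 =
     (- of_real (hbar\<^sup>2) * (d11 + d22) + 2 * \<i> * of_real (hbar\<^sup>2 * b * x) * d2 + of_real ((hbar * b * x)\<^sup>2) * d0) / of_real (2 * m0)"

text \<open>Expanding the square of the second kinetic momentum; \<open>x\<close> is constant in its direction.\<close>

lemma second_order_expand:
  fixes f :: "'a::euclidean_space \<Rightarrow> complex" and x :: "'a \<Rightarrow> real"
  assumes f: "test_fun f" and e: "e1 \<in> Basis" "e2 \<in> Basis" and x: "\<And>X s. x (X + s *\<^sub>R e2) = x X"
  shows "(- \<i> * of_real hbar * ddir e1 (\<lambda>X. - \<i> * of_real hbar * ddir e1 f X) X +
    (- \<i> * of_real hbar * ddir e2 (\<lambda>X. - \<i> * of_real hbar * ddir e2 f X - of_real (hbar * b * x X) * f X) X -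
     of_real (hbar * b * x X) * (- \<i> * of_real hbar * ddir e2 f X - of_real (hbar * b * x X) * f X))) / of_real (2 * m0) =
    magnetic_symbol hbar m0 b (x X) (iter_ddir [e1, e1] f X) (iter_ddir [e2, e2] f X) (iter_ddir [e2] f X) (f X)"
proof -
  have d1: "((\<lambda>s. ddir e (\<lambda>X. f X) (X + s *\<^sub>R e)) has_vector_derivative iter_ddir [e, e] f X) (at 0)" if "e \<in> Basis" for e
    using test_funD(2)[OF f, of "[e]" e X] that by simp
  have d0: "((\<lambda>s. f (X + s *\<^sub>R e)) has_vector_derivative iter_ddir [e] f X) (at 0)" if "e \<in> Basis" for e
    using test_funD(2)[OF f, of "[]" e X] that by simp
  have 1: "ddir e1 (\<lambda>X. - \<i> * of_real hbar * ddir e1 f X) X = - \<i> * of_real hbar * iter_ddir [e1, e1] f X"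
    by (rule ddir_cmult) (use d1[OF e(1)] in simp)
  have "((\<lambda>s. - \<i> * of_real hbar * ddir e2 f (X + s *\<^sub>R e2) - of_real (hbar * b * x (X + s *\<^sub>R e2)) * f (X + s *\<^sub>R e2)) has_vector_derivative
      - \<i> * of_real hbar * iter_ddir [e2, e2] f X - of_real (hbar * b * x X) * iter_ddir [e2] f X) (at 0)"
    unfolding x
    by (intro has_vector_derivative_diff bounded_linear.has_vector_derivative[OF bounded_linear_mult_right]) (use d1[OF e(2)] d0[OF e(2)] in auto)
  then have 2: "ddir e2 (\<lambda>X. - \<i> * of_real hbar * ddir e2 f X - of_real (hbar * b * x X) * f X) X =
      - \<i> * of_real hbar * iter_ddir [e2, e2] f X - of_real (hbar * b * x X) * iter_ddir [e2] f X"
    by (rule ddirI)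
  show ?thesis
    unfolding 1 2 magnetic_symbol_def
    by (rule arg_cong[where f="\<lambda>z. z / of_real (2 * m0)"]) (simp add: algebra_simps power2_eq_square)
qed

lemma axis_in_lists_Basis:
  "axis j (1, 0) \<in> (Basis :: ((real \<times> real) ^ 'n::finite) set)" "axis j (0, 1) \<in> (Basis :: ((real \<times> real) ^ 'n) set)"
  by (auto simp: Basis_vec_real2)

lemma kin_cl_expand:
  fixes f :: "(real \<times> real) ^ 'n::finite \<Rightarrow> complex"
  assumes f: "test_fun f"
  shows "kin_cl hbar m0 b f X = (\<Sum>j\<in>UNIV. magnetic_symbol hbar m0 b (fst (X $ j))
     (iter_ddir [axis j (1, 0), axis j (1, 0)] f X) (iter_ddir [axis j (0, 1), axis j (0, 1)] f X) (iter_ddir [axis j (0, 1)] f X) (f X))"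
proof -
  have x: "fst ((X + s *\<^sub>R axis j (0, 1)) $ j) = fst (X $ j)" for X :: "(real \<times> real) ^ 'n" and s j by (simp add: axis_def)
  show ?thesis
    unfolding kin_cl_def
  proof (rule sum.cong[OF refl])
    fix j
    show "(p1_opN hbar j (p1_opN hbar j f) X + pi2_opN hbar b j (pi2_opN hbar b j f) X) / complex_of_real (2 * m0) =
      magnetic_symbol hbar m0 b (fst (X $ j)) (iter_ddir [axis j (1, 0), axis j (1, 0)] f X) (iter_ddir [axis j (0, 1), axis j (0, 1)] f X) (iter_ddir [axis j (0, 1)] f X) (f X)"
      unfolding p1_opN_def[abs_def] pi2_opN_def[abs_def]
      by (rule second_order_expand[OF f axis_in_lists_Basis x])
  qed
qed

lemma H1_cl_expand:
  fixes f :: "real \<times> real \<Rightarrow> complex"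
  assumes f: "test_fun f"
  shows "H1_cl hbar m0 b f X = magnetic_symbol hbar m0 b (fst X)
     (iter_ddir [(1, 0), (1, 0)] f X) (iter_ddir [(0, 1), (0, 1)] f X) (iter_ddir [(0, 1)] f X) (f X)"
  using second_order_expand[OF f, of "(1, 0)" "(0, 1)" fst hbar X b m0]
  by (simp only: H1_cl_def p1_op_def[abs_def] pi2_op_def[abs_def]) (simp add: Basis_prod_def)

lemma continuous_on_magnetic_symbol [continuous_intros]:
  assumes "continuous_on S x" "continuous_on S d11" "continuous_on S d22" "continuous_on S d2" "continuous_on S d0"
  shows "continuous_on S (\<lambda>X. magnetic_symbol hbar m0 b (x X) (d11 X) (d22 X) (d2 X) (d0 X))"
  unfolding magnetic_symbol_def divide_inverse by (intro continuous_intros assms)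

lemma kin_cl_continuous:
  fixes f :: "(real \<times> real) ^ 'n::finite \<Rightarrow> complex"
  assumes f: "test_fun f"
  shows "continuous_on UNIV (kin_cl hbar m0 b f)"
proof -
  have "continuous_on UNIV f" using test_funD(1)[OF f, of "[]"] by simp
  then show ?thesis
    unfolding kin_cl_expand[OF f, abs_def]
    by (intro continuous_intros test_funD(1)[OF f]) (auto simp: Basis_prod_def)
qed

lemma test_fun_compact_support:
  assumes "test_fun f"
  shows "compact (closure {x. f x \<noteq> 0})" "x \<notin> closure {x. f x \<noteq> 0} \<Longrightarrow> iter_ddir es f x = 0"
  using assms iter_ddir_zero_outside[OF closed_closure closure_subset] by (auto simp: test_fun_def)

lemma magnetic_symbol_0 [simp]: "magnetic_symbol hbar m0 b x 0 0 0 0 = 0"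
  by (simp add: magnetic_symbol_def)

lemma kin_cl_zero_outside:
  fixes f :: "(real \<times> real) ^ 'n::finite \<Rightarrow> complex"
  assumes f: "test_fun f" and X: "X \<notin> closure {X. f X \<noteq> 0}"
  shows "kin_cl hbar m0 b f X = 0"
  using test_fun_compact_support(2)[OF f X] test_fun_compact_support(2)[OF f X, of "[]"]
  by (simp add: kin_cl_expand[OF f] del: iter_ddir.simps(2))

section \<open>Freezing all particles but one\<close>

definition vec_upd :: "'a ^ 'n \<Rightarrow> 'n \<Rightarrow> 'a \<Rightarrow> 'a ^ 'n" where
  "vec_upd X j y = (\<chi> i. if i = j then y else X $ i)"

lemma vec_upd_nth [simp]: "vec_upd X j y $ i = (if i = j then y else X $ i)"
  by (simp add: vec_upd_def)

lemma vec_upd_add: "vec_upd X j (y + s *\<^sub>R e) = vec_upd X j y + s *\<^sub>R axis j e"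
  for X :: "'a::real_vector ^ 'n"
  by (simp add: vec_eq_iff axis_def)

lemma iter_ddir_slice:
  fixes f :: "(real \<times> real) ^ 'n::finite \<Rightarrow> complex"
  shows "iter_ddir es (\<lambda>y. f (vec_upd X j y)) y = iter_ddir (map (axis j) es) f (vec_upd X j y)"
proof (induction es arbitrary: y)
  case (Cons e es)
  then have "iter_ddir es (\<lambda>y. f (vec_upd X j y)) = (\<lambda>y. iter_ddir (map (axis j) es) f (vec_upd X j y))" by blast
  then show ?case by (simp add: ddir_def vec_upd_add)
qed simp

lemma continuous_on_vec_upd: "continuous_on UNIV (vec_upd X j)"
  for X :: "'a::real_normed_vector ^ 'n::finite"
  unfolding vec_upd_def[abs_def]
proof (rule continuous_on_vec_lambda)
  fix i show "continuous_on UNIV (\<lambda>y. if i = j then y else X $ i)" by (cases "i = j") auto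
qed

text \<open>The one-particle weak equations will be tested with an N-particle test function in which
  the other particles are frozen. The support of a slice is bounded because a component is never
  longer than its vector.\<close>

lemma test_fun_slice:
  fixes f :: "(real \<times> real) ^ 'n::finite \<Rightarrow> complex"
  assumes f: "test_fun f"
  shows "test_fun (\<lambda>y. f (vec_upd X j y))"
  unfolding test_fun_def
proof (intro conjI ballI allI)
  let ?K = "closure {X. f X \<noteq> 0}"
  have "bounded ?K" using test_fun_compact_support(1)[OF f] compact_imp_bounded by blast
  then obtain R where R: "\<And>X. X \<in> ?K \<Longrightarrow> norm X \<le> R" by (auto simp: bounded_iff)
  have "norm y \<le> R" if "f (vec_upd X j y) \<noteq> 0" for y
  proof -
    have "vec_upd X j y \<in> ?K" using that closure_subset[of "{X. f X \<noteq> 0}"] by auto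
    then have "norm (vec_upd X j y) \<le> R" by (rule R)
    then show ?thesis using Finite_Cartesian_Product.norm_nth_le[of "vec_upd X j y" j] by simp
  qed
  then have "bounded {y. f (vec_upd X j y) \<noteq> 0}" by (auto simp: bounded_iff)
  then show "compact (closure {y. f (vec_upd X j y) \<noteq> 0})" by (simp add: compact_closure)
next
  fix es :: "(real \<times> real) list" assume es: "es \<in> lists Basis"
  then have es': "map (axis j) es \<in> lists (Basis :: ((real \<times> real) ^ 'n) set)" by auto
  show "continuous_on UNIV (iter_ddir es (\<lambda>y. f (vec_upd X j y)))"
    unfolding iter_ddir_slice[abs_def]
    by (rule continuous_on_compose2[OF test_funD(1)[OF f es'] continuous_on_vec_upd]) auto
  fix e x assume e: "e \<in> (Basis :: (real \<times> real) set)"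
  then have "axis j e \<in> (Basis :: ((real \<times> real) ^ 'n) set)" by simp
  from test_funD(2)[OF f es' this, of "vec_upd X j x"]
  show "((\<lambda>s. iter_ddir es (\<lambda>y. f (vec_upd X j y)) (x + s *\<^sub>R e)) has_vector_derivative iter_ddir (e # es) (\<lambda>y. f (vec_upd X j y)) x) (at 0)"
    unfolding iter_ddir_slice by (simp add: vec_upd_add)
qed

lemma kin_cl_slices:
  fixes f :: "(real \<times> real) ^ 'n::finite \<Rightarrow> complex"
  assumes f: "test_fun f"
  shows "kin_cl hbar m0 b f X = (\<Sum>j\<in>UNIV. H1_cl hbar m0 b (\<lambda>y. f (vec_upd X j y)) (X $ j))"
proof -
  have u: "vec_upd X j (X $ j) = X" for j by (simp add: vec_eq_iff)
  show ?thesis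
    unfolding kin_cl_expand[OF f]
    by (intro sum.cong refl) (simp add: H1_cl_expand[OF test_fun_slice[OF f]] iter_ddir_slice u del: iter_ddir.simps)
qed

section \<open>Symmetry and uniqueness of the weak kinetic energy\<close>

abbreviation closed_cell :: "'a::euclidean_space \<Rightarrow> 'a set" where
  "closed_cell P \<equiv> cbox (- P /\<^sub>R 2) (P /\<^sub>R 2)"

text \<open>Square integrability is asked on the closed cell to match the closed box; the boundary
  has measure zero.\<close>

definition torus_fun :: "'a::euclidean_space \<Rightarrow> ('a \<Rightarrow> complex) \<Rightarrow> bool" where
  "torus_fun P F \<longleftrightarrow> quasi_periodic P F \<and> L2on (closed_cell P) F"

lemma AE_closed_cell: "AE X in lborel. X \<in> closed_cell P \<longleftrightarrow> X \<in> cell P"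
  using AE_not_box_boundary[of "- P /\<^sub>R 2" "P /\<^sub>R 2"]
  by eventually_elim (use box_subset_cell[of P] cell_subset_cbox[of P] in blast)

lemma borel_rep_closed_cell:
  assumes F: "AE X in lborel. F X = F' X" "F' \<in> borel_measurable borel"
  shows "borel_rep (closed_cell P) F (\<lambda>X. indicat_real (cell P) X *\<^sub>R F' X)"
  unfolding borel_rep_def
proof (intro conjI allI impI)
  show "AE X in lborel. X \<in> closed_cell P \<longrightarrow> F X = indicat_real (cell P) X *\<^sub>R F' X"
    using F(1) AE_closed_cell[of P] by eventually_elim simp
  show "indicat_real (cell P) X *\<^sub>R F' X = 0" if "X \<notin> closed_cell P" for X
  proof -
    have "X \<notin> cell P" using that cell_subset_cbox by blast
    then show ?thesis by simp
  qed
qed (use F(2) in measurable)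

lemma inner_on_closed_cell:
  assumes F: "AE X in lborel. F X = F' X" "F' \<in> borel_measurable borel"
    and G: "AE X in lborel. G X = G' X" "G' \<in> borel_measurable borel"
  shows "inner_on (closed_cell P) F G = ip (cellM P) F' G'"
proof -
  note F'' = borel_rep_closed_cell[OF F, of P]
  note G'' = borel_rep_closed_cell[OF G, of P]
  have "inner_on (closed_cell P) F G = ip lborel (\<lambda>X. indicat_real (cell P) X *\<^sub>R F' X) (\<lambda>X. indicat_real (cell P) X *\<^sub>R G' X)"
    by (rule borel_rep_inner_on[OF F'' G''])
  also have "\<dots> = (\<integral>X. indicat_real (cell P) X *\<^sub>R (cnj (F' X) * G' X) \<partial>lborel)"
    unfolding ip_def by (rule Bochner_Integration.integral_cong) (auto simp: indicator_def)
  also have "\<dots> = ip (cellM P) F' G'"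
    unfolding ip_def by (rule integral_restrict_space[symmetric]) simp
  finally show ?thesis .
qed

lemma L2on_closed_cell:
  assumes F: "AE X in lborel. F X = F' X" "F' \<in> borel_measurable borel"
  shows "L2on (closed_cell P) F \<longleftrightarrow> sq_int (cellM P) F'"
proof -
  note F'' = borel_rep_closed_cell[OF F, of P]
  have eq: "(\<lambda>X. (norm (indicat_real (cell P) X *\<^sub>R F' X))\<^sup>2) = (\<lambda>X. indicat_real (cell P) X *\<^sub>R (norm (F' X))\<^sup>2)"
    by (auto simp: indicator_def)
  have "L2on (closed_cell P) F \<longleftrightarrow> sq_int lborel (\<lambda>X. indicat_real (cell P) X *\<^sub>R F' X)"
    by (rule borel_rep_sq_int[OF F''])
  also have "\<dots> \<longleftrightarrow> integrable lborel (\<lambda>X. indicat_real (cell P) X *\<^sub>R (norm (F' X))\<^sup>2)"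
    using F(2) unfolding sq_int_def eq by simp
  also have "\<dots> \<longleftrightarrow> integrable (cellM P) (\<lambda>X. (norm (F' X))\<^sup>2)"
    by (rule integrable_restrict_space[symmetric]) simp
  also have "\<dots> \<longleftrightarrow> sq_int (cellM P) F'"
    using measurable_cellM[OF F(2)] by (simp add: sq_int_def)
  finally show ?thesis .
qed

text \<open>The version equals \<open>F\<close> off a periodic null set and zero on it, so that it
  still satisfies an exact boundary condition and not merely an almost-everywhere form of
  it.\<close>

lemma torus_fun_borel_version:
  assumes P: "\<And>b. b \<in> Basis \<Longrightarrow> P \<bullet> b > 0" and F: "torus_fun P F"
  shows "\<exists>N. periodic P (\<lambda>X. X \<in> N) \<and> (AE X in lborel. F X = (if X \<in> N then 0 else F X)) \<and>
    (\<lambda>X. if X \<in> N then 0 else F X) \<in> borel_measurable borel \<and> sq_int (cellM P) (\<lambda>X. if X \<in> N then 0 else F X) \<and>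
    periodic P (\<lambda>X. norm (if X \<in> N then 0 else F X))"
proof -
  have q: "quasi_periodic P F" and L2: "L2on (closed_cell P) F" using F by (auto simp: torus_fun_def)
  have "(\<lambda>X. indicat_real (closed_cell P) X *\<^sub>R F X) \<in> borel_measurable lebesgue"
    using L2 by (simp add: L2on_def set_borel_measurable_def)
  moreover have "(\<lambda>X. indicat_real (cell P) X) \<in> borel_measurable lebesgue" by (rule measurable_completion) measurable
  ultimately have "(\<lambda>X. indicat_real (cell P) X *\<^sub>R (indicat_real (closed_cell P) X *\<^sub>R F X)) \<in> borel_measurable lebesgue"
    by (rule borel_measurable_scaleR[rotated])
  moreover have "indicat_real (cell P) X *\<^sub>R (indicat_real (closed_cell P) X *\<^sub>R F X) = indicat_real (cell P) X *\<^sub>R F X" for X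
    using cell_subset_cbox[of P] by (auto simp: indicator_def)
  ultimately have "(\<lambda>X. indicat_real (cell P) X *\<^sub>R F X) \<in> borel_measurable lebesgue" by (simp only:)
  from quasi_periodic_borel_version[OF P q this] obtain N where N: "AE X in lborel. X \<notin> N" "periodic P (\<lambda>X. X \<in> N)"
    "(\<lambda>X. if X \<in> N then 0 else F X) \<in> borel_measurable borel" by blast
  have ae: "AE X in lborel. F X = (if X \<in> N then 0 else F X)" using N(1) by eventually_elim simp
  have "periodic P (\<lambda>X. norm (if X \<in> N then 0 else F X))"
    using N(2) periodic_norm_quasi_periodic[OF q] by (simp add: periodic_def)
  moreover have "sq_int (cellM P) (\<lambda>X. if X \<in> N then 0 else F X)"
    using L2on_closed_cell[OF ae N(3)] L2 by blast
  ultimately show ?thesis using N ae by blast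
qed

lemma torus_fun_integrable:
  assumes P: "\<And>b. b \<in> Basis \<Longrightarrow> P \<bullet> b > 0" and F: "torus_fun P F"
    and g: "continuous_on UNIV g" and K: "compact K" "\<And>X. X \<notin> K \<Longrightarrow> g X = 0"
  shows "integrable lebesgue (\<lambda>X. g X * F X)"
proof -
  obtain N where N: "AE X in lborel. F X = (if X \<in> N then 0 else F X)"
    "(\<lambda>X. if X \<in> N then 0 else F X) \<in> borel_measurable borel" "sq_int (cellM P) (\<lambda>X. if X \<in> N then 0 else F X)"
    "periodic P (\<lambda>X. norm (if X \<in> N then 0 else F X))"
    using torus_fun_borel_version[OF P F] by blast
  let ?F = "\<lambda>X. if X \<in> N then 0 else F X"
  note [measurable] = N(2) borel_measurable_continuous_onI[OF g]
  have int: "integrable lborel (\<lambda>X. g X * ?F X)"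
    by (rule integrable_continuous_mult[OF P N(2,4,3) g K])
  then have intl: "integrable lebesgue (\<lambda>X. g X * ?F X)" by (subst integrable_completion) auto
  have ae: "AE X in lebesgue. g X * ?F X = g X * F X" using AE_completion[OF N(1)] by eventually_elim simp
  have m: "(\<lambda>X. g X * F X) \<in> borel_measurable lebesgue"
    by (rule borel_measurable_completion_AE_cong[OF borel_measurable_integrable[OF intl] ae])
  show ?thesis
    by (rule integrable_cong_AE[THEN iffD1, OF borel_measurable_integrable[OF intl] m ae intl])
qed

lemma integral_lebesgue_cong:
  fixes f g :: "'a::euclidean_space \<Rightarrow> complex"
  assumes "AE X in lborel. f X = g X" "g \<in> borel_measurable borel"
  shows "(\<integral>X. f X \<partial>lebesgue) = (\<integral>X. g X \<partial>lborel)"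
proof -
  have g: "g \<in> borel_measurable lebesgue" by (rule measurable_completion) (use assms(2) in simp)
  have ae: "AE X in lebesgue. g X = f X" using AE_completion[OF assms(1)] by eventually_elim simp
  have f: "f \<in> borel_measurable lebesgue" by (rule borel_measurable_completion_AE_cong[OF g ae])
  have "(\<integral>X. f X \<partial>lebesgue) = (\<integral>X. g X \<partial>lebesgue)"
    by (rule integral_cong_AE[OF f g]) (use ae in \<open>auto simp: eq_commute\<close>)
  also have "\<dots> = (\<integral>X. g X \<partial>lborel)" by (rule integral_completion) (use assms(2) in simp)
  finally show ?thesis .
qed

lemma closed_cell_box_LambdaN: "closed_cell (box_period L1 L2) = (box_LambdaN L1 L2 :: ((real \<times> real) ^ 'n::finite) set)"
proof -
  have "X \<in> closed_cell (box_period L1 L2) \<longleftrightarrow> X \<in> box_LambdaN L1 L2" for X :: "(real \<times> real) ^ 'n"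
  proof -
    have "X \<in> closed_cell (box_period L1 L2) \<longleftrightarrow> (\<forall>j. (- L1 / 2 \<le> fst (X $ j) \<and> fst (X $ j) \<le> L1 / 2) \<and> (- L2 / 2 \<le> snd (X $ j) \<and> snd (X $ j) \<le> L2 / 2))"
      unfolding mem_box Ball_def Basis_vec_real2
      by (auto simp: box_period_def dest: spec[of _ "axis _ (1, 0)"] spec[of _ "axis _ (0, 1)"])
    then show ?thesis by (auto simp: box_LambdaN_def box_Lambda_def mem_Times_iff)
  qed
  then show ?thesis by blast
qed

lemma closed_cell_box_Lambda: "closed_cell (L1, L2) = box_Lambda L1 L2"
  by (auto simp: mem_box box_Lambda_def Basis_prod_def)

context magnetic_box
begin

lemma quasi_periodic_mag_per:
  assumes "mag_per L1 L2 M \<phi>" shows "quasi_periodic (L1, L2) \<phi>"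
  unfolding quasi_periodic_def
proof
  fix B :: "real \<times> real" assume "B \<in> Basis"
  then consider "B = (1, 0)" | "B = (0, 1)" by (auto simp: Basis_prod_def)
  then show "\<exists>c. continuous_on UNIV c \<and> (\<forall>X. norm (c X) = 1) \<and> (\<forall>X. \<phi> (X + ((L1, L2) \<bullet> B) *\<^sub>R B) = c X * \<phi> X)"
  proof cases
    case 1
    have "\<forall>X. \<phi> (X + ((L1, L2) \<bullet> B) *\<^sub>R B) = exp (\<i> * complex_of_real (2 * pi * real M * snd X / L2)) * \<phi> X"
      using assms 1 by (auto simp: mag_per_def split_paired_all)
    moreover have "continuous_on UNIV (\<lambda>X :: real \<times> real. exp (\<i> * complex_of_real (2 * pi * real M * snd X / L2)))"
      unfolding divide_inverse by (intro continuous_intros)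
    ultimately show ?thesis by (intro exI[of _ "\<lambda>X. exp (\<i> * complex_of_real (2 * pi * real M * snd X / L2))"]) simp
  next
    case 2
    then show ?thesis using assms by (intro exI[of _ "\<lambda>X. 1"]) (auto simp: mag_per_def split_paired_all)
  qed
qed

lemma quasi_periodic_mag_perN:
  fixes \<Psi> :: "(real \<times> real) ^ 'n::finite \<Rightarrow> complex"
  assumes "mag_perN L1 L2 M \<Psi>" shows "quasi_periodic (box_period L1 L2) \<Psi>"
  unfolding quasi_periodic_def
proof
  fix B :: "(real \<times> real) ^ 'n" assume "B \<in> Basis"
  then obtain j where "B = axis j (1, 0) \<or> B = axis j (0, 1)" by (auto simp: Basis_vec_real2)
  then consider "B = axis j (1, 0)" | "B = axis j (0, 1)" by blast
  then show "\<exists>c. continuous_on UNIV c \<and> (\<forall>X. norm (c X) = 1) \<and> (\<forall>X. \<Psi> (X + (box_period L1 L2 \<bullet> B) *\<^sub>R B) = c X * \<Psi> X)"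
  proof cases
    case 1
    have "\<forall>X. \<Psi> (X + (box_period L1 L2 \<bullet> B) *\<^sub>R B) = exp (\<i> * of_real (b * L1 * snd (X $ j))) * \<Psi> X"
      using mag_perN_phase(1)[OF assms] 1 by (simp add: box_period_def scaleR_axis del: of_real_mult)
    moreover have "continuous_on UNIV (\<lambda>X :: (real \<times> real) ^ 'n. exp (\<i> * complex_of_real (b * L1 * snd (X $ j))))"
      by (intro continuous_intros)
    ultimately show ?thesis by (intro exI[of _ "\<lambda>X. exp (\<i> * of_real (b * L1 * snd (X $ j)))"]) simp
  next
    case 2
    then show ?thesis using mag_perN_phase(2)[OF assms] by (intro exI[of _ "\<lambda>X. 1"]) (simp add: box_period_def scaleR_axis)
  qed
qed

lemma torus_fun_mag_per: "mag_per L1 L2 M \<phi> \<Longrightarrow> L2on (box_Lambda L1 L2) \<phi> \<Longrightarrow> torus_fun (L1, L2) \<phi>"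
  unfolding torus_fun_def closed_cell_box_Lambda by (blast intro: quasi_periodic_mag_per)

lemma torus_fun_mag_perN:
  "mag_perN L1 L2 M \<Psi> \<Longrightarrow> L2on (box_LambdaN L1 L2) \<Psi> \<Longrightarrow> torus_fun (box_period L1 L2) \<Psi>"
  for \<Psi> :: "(real \<times> real) ^ 'n::finite \<Rightarrow> complex"
  unfolding torus_fun_def closed_cell_box_LambdaN by (blast intro: quasi_periodic_mag_perN)

lemma mag_perN_modify:
  fixes \<Psi> :: "(real \<times> real) ^ 'n::finite \<Rightarrow> complex"
  assumes "mag_perN L1 L2 M \<Psi>" "periodic (box_period L1 L2) (\<lambda>X. X \<in> N)"
  shows "mag_perN L1 L2 M (\<lambda>X. if X \<in> N then 0 else \<Psi> X)"
  using assms unfolding periodic_box_period_iff mag_perN_def by simp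

lemma period_pos: "B \<in> Basis \<Longrightarrow> (L1, L2) \<bullet> B > 0" for B :: "real \<times> real"
  using L1 L2 by (auto simp: Basis_prod_def)

lemma weak_kin_borel:
  fixes \<Psi> G :: "(real \<times> real) ^ 'n::finite \<Rightarrow> complex"
  assumes weak: "weak_kin hbar m0 b \<Psi> G"
    and \<Psi>: "AE X in lborel. \<Psi> X = \<Psi>' X" "\<Psi>' \<in> borel_measurable borel"
    and G: "AE X in lborel. G X = G' X" "G' \<in> borel_measurable borel"
  shows "weak_kin hbar m0 b \<Psi>' G'"
  unfolding weak_kin_def
proof (intro allI impI)
  fix f :: "(real \<times> real) ^ 'n \<Rightarrow> complex" assume f: "test_fun f"
  have [measurable]: "kin_cl hbar m0 b f \<in> borel_measurable borel" "f \<in> borel_measurable borel"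
    using kin_cl_continuous[OF f] test_funD(1)[OF f, of "[]"] by (auto intro: borel_measurable_continuous_onI)
  note [measurable] = \<Psi>(2) G(2)
  have a: "AE X in lborel. cnj (kin_cl hbar m0 b f X) * \<Psi> X = cnj (kin_cl hbar m0 b f X) * \<Psi>' X"
    using \<Psi>(1) by eventually_elim simp
  have c: "AE X in lborel. cnj (f X) * G X = cnj (f X) * G' X" using G(1) by eventually_elim simp
  have "(\<integral>X. cnj (kin_cl hbar m0 b f X) * \<Psi>' X \<partial>lebesgue) = (\<integral>X. cnj (kin_cl hbar m0 b f X) * \<Psi> X \<partial>lebesgue)"
    by (subst integral_lebesgue_cong[OF a], measurable) (rule integral_completion, measurable)
  also have "\<dots> = (\<integral>X. cnj (f X) * G X \<partial>lebesgue)" using weak f unfolding weak_kin_def by blast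
  also have "\<dots> = (\<integral>X. cnj (f X) * G' X \<partial>lebesgue)"
    by (subst integral_lebesgue_cong[OF c], measurable) (rule integral_completion[symmetric], measurable)
  finally show "(\<integral>X. cnj (kin_cl hbar m0 b f X) * \<Psi>' X \<partial>lebesgue) = (\<integral>X. cnj (f X) * G' X \<partial>lebesgue)" .
qed

text \<open>Splitting the integral of a difference calls for absolute convergence of both parts,
  which quasi-periodicity together with square integrability on the cell provides.\<close>

lemma weak_kin_diff:
  fixes \<Psi>1 \<Psi>2 G1 G2 :: "(real \<times> real) ^ 'n::finite \<Rightarrow> complex"
  assumes w: "weak_kin hbar m0 b \<Psi>1 G1" "weak_kin hbar m0 b \<Psi>2 G2"
    and t: "torus_fun (box_period L1 L2) \<Psi>1" "torus_fun (box_period L1 L2) \<Psi>2" "torus_fun (box_period L1 L2) G1" "torus_fun (box_period L1 L2) G2"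
  shows "weak_kin hbar m0 b (\<lambda>X. \<Psi>1 X - \<Psi>2 X) (\<lambda>X. G1 X - G2 X)"
  unfolding weak_kin_def
proof (intro allI impI)
  note P = box_period_pos[OF L1 L2, where 'n='n]
  fix f :: "(real \<times> real) ^ 'n \<Rightarrow> complex" assume f: "test_fun f"
  have i1: "integrable lebesgue (\<lambda>X. cnj (kin_cl hbar m0 b f X) * F X)" if F: "torus_fun (box_period L1 L2) F" for F
    by (rule torus_fun_integrable[OF P F continuous_on_cnj[OF kin_cl_continuous[OF f]] test_fun_compact_support(1)[OF f]])
       (simp_all add: kin_cl_zero_outside[OF f])
  have fc: "continuous_on UNIV (\<lambda>X. cnj (f X))" using test_funD(1)[OF f, of "[]"] by (auto intro: continuous_on_cnj)
  have i2: "integrable lebesgue (\<lambda>X. cnj (f X) * F X)" if F: "torus_fun (box_period L1 L2) F" for F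
  proof (rule torus_fun_integrable[OF P F fc test_fun_compact_support(1)[OF f]])
    fix X assume "X \<notin> closure {X. f X \<noteq> 0}"
    from test_fun_compact_support(2)[OF f this, of "[]"] show "cnj (f X) = 0" by (simp only: iter_ddir.simps complex_cnj_zero)
  qed
  have "(\<integral>X. cnj (kin_cl hbar m0 b f X) * (\<Psi>1 X - \<Psi>2 X) \<partial>lebesgue) =
      (\<integral>X. cnj (kin_cl hbar m0 b f X) * \<Psi>1 X \<partial>lebesgue) - (\<integral>X. cnj (kin_cl hbar m0 b f X) * \<Psi>2 X \<partial>lebesgue)"
    unfolding right_diff_distrib by (intro Bochner_Integration.integral_diff i1 t)
  also have "\<dots> = (\<integral>X. cnj (f X) * G1 X \<partial>lebesgue) - (\<integral>X. cnj (f X) * G2 X \<partial>lebesgue)"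
    using w f unfolding weak_kin_def by simp
  also have "\<dots> = (\<integral>X. cnj (f X) * (G1 X - G2 X) \<partial>lebesgue)"
    unfolding right_diff_distrib by (intro Bochner_Integration.integral_diff[symmetric] i2 t)
  finally show "(\<integral>X. cnj (kin_cl hbar m0 b f X) * (\<Psi>1 X - \<Psi>2 X) \<partial>lebesgue) = (\<integral>X. cnj (f X) * (G1 X - G2 X) \<partial>lebesgue)" .
qed

lemma weak_kin_symmetric:
  fixes \<Psi> G :: "(real \<times> real) ^ 'n::finite \<Rightarrow> complex"
  assumes "L2on (box_LambdaN L1 L2) \<Psi>" "mag_perN L1 L2 M \<Psi>" "L2on (box_LambdaN L1 L2) G" "mag_perN L1 L2 M G"
    and "weak_kin hbar m0 b \<Psi> G"
  shows "Im (inner_on (box_LambdaN L1 L2) \<Psi> G) = 0"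
proof -
  note P = box_period_pos[OF L1 L2, where 'n='n]
  obtain N where N: "periodic (box_period L1 L2) (\<lambda>X. X \<in> N)" "AE X in lborel. \<Psi> X = (if X \<in> N then 0 else \<Psi> X)"
    "(\<lambda>X. if X \<in> N then 0 else \<Psi> X) \<in> borel_measurable borel" "sq_int torusM (\<lambda>X. if X \<in> N then 0 else \<Psi> X)"
    using torus_fun_borel_version[OF P torus_fun_mag_perN[OF assms(2,1)]] by blast
  obtain N' where N': "periodic (box_period L1 L2) (\<lambda>X. X \<in> N')" "AE X in lborel. G X = (if X \<in> N' then 0 else G X)"
    "(\<lambda>X. if X \<in> N' then 0 else G X) \<in> borel_measurable borel" "sq_int torusM (\<lambda>X. if X \<in> N' then 0 else G X)"
    using torus_fun_borel_version[OF P torus_fun_mag_perN[OF assms(4,3)]] by blast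
  have "inner_on (box_LambdaN L1 L2) \<Psi> G = ip torusM (\<lambda>X. if X \<in> N then 0 else \<Psi> X) (\<lambda>X. if X \<in> N' then 0 else G X)"
    unfolding closed_cell_box_LambdaN[symmetric] by (rule inner_on_closed_cell[OF N(2,3) N'(2,3)])
  also have "Im \<dots> = 0"
    by (rule weak_kin_symmetric_borel[OF N(3,4) mag_perN_modify[OF assms(2) N(1)] N'(3,4) mag_perN_modify[OF assms(4) N'(1)]
          weak_kin_borel[OF assms(5) N(2,3) N'(2,3)]])
  finally show ?thesis .
qed

lemma mag_perN_diff:
  "mag_perN L1 L2 M \<Psi>1 \<Longrightarrow> mag_perN L1 L2 M \<Psi>2 \<Longrightarrow> mag_perN L1 L2 M (\<lambda>X. \<Psi>1 X - \<Psi>2 X)"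
  unfolding mag_perN_def by (simp add: right_diff_distrib)

lemma L2on_diff: "S \<in> sets lebesgue \<Longrightarrow> L2on S f \<Longrightarrow> L2on S g \<Longrightarrow> L2on S (\<lambda>x. f x - g x)"
  by (simp add: L2on_iff_sq_int sq_int_diff)

text \<open>The difference of two candidates is a weak kinetic energy of the zero function. Hence
  the choice operator in \<open>HN\<close> is determined up to a null set of the box.\<close>

lemma weak_kin_unique:
  fixes \<Psi> G1 G2 :: "(real \<times> real) ^ 'n::finite \<Rightarrow> complex"
  assumes \<Psi>: "L2on (box_LambdaN L1 L2) \<Psi>" "mag_perN L1 L2 M \<Psi>"
    and G1: "L2on (box_LambdaN L1 L2) G1" "mag_perN L1 L2 M G1"
    and G2: "L2on (box_LambdaN L1 L2) G2" "mag_perN L1 L2 M G2"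
    and w: "weak_kin hbar m0 b \<Psi> G1" "weak_kin hbar m0 b \<Psi> G2"
  shows "norm_on (box_LambdaN L1 L2) (\<lambda>X. G1 X - G2 X) = 0"
proof -
  note P = box_period_pos[OF L1 L2, where 'n='n]
  let ?G = "\<lambda>X. G1 X - G2 X"
  have G: "L2on (box_LambdaN L1 L2) ?G" "mag_perN L1 L2 M ?G"
    using G1 G2 by (auto intro: L2on_diff mag_perN_diff)
  have weak: "weak_kin hbar m0 b (\<lambda>X. 0) ?G"
    using weak_kin_diff[OF w torus_fun_mag_perN[OF \<Psi>(2,1)] torus_fun_mag_perN[OF \<Psi>(2,1)]
      torus_fun_mag_perN[OF G1(2,1)] torus_fun_mag_perN[OF G2(2,1)]] by simp
  obtain N' where N': "periodic (box_period L1 L2) (\<lambda>X. X \<in> N')" "AE X in lborel. ?G X = (if X \<in> N' then 0 else ?G X)"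
    "(\<lambda>X. if X \<in> N' then 0 else ?G X) \<in> borel_measurable borel" "sq_int torusM (\<lambda>X. if X \<in> N' then 0 else ?G X)"
    using torus_fun_borel_version[OF P torus_fun_mag_perN[OF G(2,1)]] by blast
  have "nrm torusM (\<lambda>X. if X \<in> N' then 0 else ?G X) = 0"
    by (rule weak_kin_zero_borel[OF N'(3,4) mag_perN_modify[OF G(2) N'(1)] weak_kin_borel[OF weak _ _ N'(2,3)]]) auto
  then have "inner_on (closed_cell (box_period L1 L2)) ?G ?G = 0"
    unfolding inner_on_closed_cell[OF N'(2,3) N'(2,3)] ip_self by simp
  then show ?thesis unfolding closed_cell_box_LambdaN inner_on_self by simp
qed

end

section \<open>The kinetic energy of a Slater determinant\<close>

context magnetic_box
begin

text \<open>The two sides of the weak equation are put under one integral, in the form in which the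
  coordinate-wise vanishing argument consumes them.\<close>

lemma weak_H1_slice:
  fixes f :: "(real \<times> real) ^ 'n::finite \<Rightarrow> complex"
  assumes f: "test_fun f" and \<psi>: "torus_fun (L1, L2) \<psi>" and g: "torus_fun (L1, L2) g" and w: "weak_H1 hbar m0 b \<psi> g"
    and \<psi>': "AE x in lborel. \<psi> x = \<psi>' x" "\<psi>' \<in> borel_measurable borel"
    and g': "AE x in lborel. g x = g' x" "g' \<in> borel_measurable borel"
  shows "(\<integral>y. cnj (H1_cl hbar m0 b (\<lambda>y. f (vec_upd X j y)) y) * \<psi>' y - cnj (f (vec_upd X j y)) * g' y \<partial>lborel) = 0"
proof -
  let ?f = "\<lambda>y. f (vec_upd X j y)"
  note tf = test_fun_slice[OF f, of X j]
  have c0: "continuous_on UNIV ?f" using test_funD(1)[OF tf, of "[]"] by simp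
  have c1: "continuous_on UNIV (H1_cl hbar m0 b ?f)"
    unfolding H1_cl_expand[OF tf, abs_def]
    by (intro continuous_intros test_funD(1)[OF tf] c0) (auto simp: Basis_prod_def)
  have z0: "cnj (?f y) = 0" if "y \<notin> closure {y. ?f y \<noteq> 0}" for y
    using test_fun_compact_support(2)[OF tf that, of "[]"] by (simp only: iter_ddir.simps complex_cnj_zero)
  have z1: "cnj (H1_cl hbar m0 b ?f y) = 0" if "y \<notin> closure {y. ?f y \<noteq> 0}" for y
  proof -
    have "?f y = 0" using test_fun_compact_support(2)[OF tf that, of "[]"] by (simp only: iter_ddir.simps)
    then show ?thesis unfolding H1_cl_expand[OF tf] by (simp only: test_fun_compact_support(2)[OF tf that] magnetic_symbol_0 complex_cnj_zero)
  qed
  have i1: "integrable lebesgue (\<lambda>y. cnj (H1_cl hbar m0 b ?f y) * \<psi> y)"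
    by (rule torus_fun_integrable[OF period_pos \<psi> continuous_on_cnj[OF c1] test_fun_compact_support(1)[OF tf] z1])
  have i0: "integrable lebesgue (\<lambda>y. cnj (?f y) * g y)"
    by (rule torus_fun_integrable[OF period_pos g continuous_on_cnj[OF c0] test_fun_compact_support(1)[OF tf] z0])
  have [measurable]: "H1_cl hbar m0 b ?f \<in> borel_measurable borel" "?f \<in> borel_measurable borel"
    using c0 c1 by (auto intro: borel_measurable_continuous_onI)
  note [measurable] = \<psi>'(2) g'(2)
  have "AE y in lborel. cnj (H1_cl hbar m0 b ?f y) * \<psi> y - cnj (?f y) * g y = cnj (H1_cl hbar m0 b ?f y) * \<psi>' y - cnj (?f y) * g' y"
    using \<psi>'(1) g'(1) by eventually_elim simp
  then have "(\<integral>y. cnj (H1_cl hbar m0 b ?f y) * \<psi>' y - cnj (?f y) * g' y \<partial>lborel) =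
     (\<integral>y. cnj (H1_cl hbar m0 b ?f y) * \<psi> y - cnj (?f y) * g y \<partial>lebesgue)"
    by (intro integral_lebesgue_cong[symmetric]) measurable
  also have "\<dots> = 0"
    using w tf unfolding weak_H1_def by (simp add: Bochner_Integration.integral_diff[OF i1 i0])
  finally show ?thesis .
qed

text \<open>The support of \<open>f\<close> lies in a ball, so every orbital may be cut off at the
  same radius without changing the product; the truncated tensor is square integrable on the whole
  space.\<close>

lemma integrable_continuous_mult_tensor:
  fixes f :: "(real \<times> real) ^ 'n::finite \<Rightarrow> complex" and \<psi> :: "'n \<Rightarrow> real \<times> real \<Rightarrow> complex"
  assumes f: "continuous_on UNIV f" and K: "compact K" "\<And>X. X \<notin> K \<Longrightarrow> f X = 0"
    and \<psi>: "\<And>k. \<psi> k \<in> borel_measurable borel" "\<And>k. sq_int (cellM (L1, L2)) (\<psi> k)" "\<And>k. periodic (L1, L2) (\<lambda>x. norm (\<psi> k x))"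
  shows "integrable lborel (\<lambda>X. f X * tensor \<psi> (vec_nth X))"
proof -
  obtain R where R: "\<And>X. X \<in> K \<Longrightarrow> norm X \<le> R" using compact_imp_bounded[OF K(1)] by (auto simp: bounded_iff)
  let ?B = "cball 0 R :: (real \<times> real) set"
  have fm[measurable]: "f \<in> borel_measurable borel" by (rule borel_measurable_continuous_onI[OF f])
  have "integrable lborel (\<lambda>x. indicator K x *\<^sub>R ((norm (f x))\<^sup>2))"
    by (rule borel_integrable_compact[OF K(1)]) (intro continuous_intros continuous_on_subset[OF f] subset_UNIV)
  moreover have "(\<lambda>x. indicator K x *\<^sub>R ((norm (f x))\<^sup>2)) = (\<lambda>x. (norm (f x))\<^sup>2)"
    using K(2) by (auto simp: indicator_def fun_eq_iff)
  ultimately have fsq: "sq_int lborel f" by (simp add: sq_int_def)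
  let ?\<psi> = "\<lambda>k x. indicat_real ?B x *\<^sub>R \<psi> k x"
  have B[measurable]: "?B \<in> sets borel" by simp
  have s: "sq_int lborel (?\<psi> k)" for k
    by (rule sq_int_on_bounded[OF period_pos \<psi>(1,3,2)]) auto
  have "sq_int (PiU lborel) (tensor ?\<psi>)"
    by (rule sq_int_tensor[OF sigma_finite_lborel s])
  moreover have "(\<lambda>X :: (real \<times> real) ^ 'n. tensor ?\<psi> (vec_nth X)) \<in> borel_measurable borel"
  proof -
    have "(\<lambda>X :: (real \<times> real) ^ 'n. ?\<psi> k (X $ k)) \<in> borel_measurable borel" for k
      by (rule measurable_compose[OF measurable_vec_nth_borel]) (use \<psi>(1) in measurable)
    then show ?thesis unfolding tensor_def by measurable
  qed
  ultimately have "sq_int lborel (\<lambda>X :: (real \<times> real) ^ 'n. tensor ?\<psi> (vec_nth X))"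
    by (subst sq_int_lborel_vec) (auto simp: vec_lambda_inverse)
  from integrable_sq_int_mult[OF fsq this]
  have "integrable lborel (\<lambda>X. f X * tensor ?\<psi> (vec_nth X))" .
  moreover have "f X * tensor ?\<psi> (vec_nth X) = f X * tensor \<psi> (vec_nth X)" for X
  proof (cases "X \<in> K")
    case True
    then have "X $ k \<in> ?B" for k using R[OF True] Finite_Cartesian_Product.norm_nth_le[of X k] by simp
    then show ?thesis by (simp add: tensor_def)
  qed (simp add: K(2))
  ultimately show ?thesis by simp
qed

text \<open>Slicing the operator leaves, for each particle \<open>j\<close>, a one-particle equation
  in which the other factors are constants. Product states come before determinants because in them
  the spectators factor out.\<close>

lemma weak_kin_tensor_borel:
  fixes f :: "(real \<times> real) ^ 'n::finite \<Rightarrow> complex" and \<psi> g \<psi>' g' :: "'n \<Rightarrow> real \<times> real \<Rightarrow> complex"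
  assumes f: "test_fun f"
    and \<psi>: "\<And>k. torus_fun (L1, L2) (\<psi> k)" and g: "\<And>k. torus_fun (L1, L2) (g k)" and w: "\<And>k. weak_H1 hbar m0 b (\<psi> k) (g k)"
    and \<psi>': "\<And>k. AE x in lborel. \<psi> k x = \<psi>' k x" "\<And>k. \<psi>' k \<in> borel_measurable borel"
      "\<And>k. sq_int (cellM (L1, L2)) (\<psi>' k)" "\<And>k. periodic (L1, L2) (\<lambda>x. norm (\<psi>' k x))"
    and g': "\<And>k. AE x in lborel. g k x = g' k x" "\<And>k. g' k \<in> borel_measurable borel"
      "\<And>k. sq_int (cellM (L1, L2)) (g' k)" "\<And>k. periodic (L1, L2) (\<lambda>x. norm (g' k x))"
  shows "integrable lborel (\<lambda>X. cnj (kin_cl hbar m0 b f X) * tensor \<psi>' (vec_nth X))"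
    "\<And>j. integrable lborel (\<lambda>X. cnj (f X) * tensor (\<psi>'(j := g' j)) (vec_nth X))"
    "(\<integral>X. cnj (kin_cl hbar m0 b f X) * tensor \<psi>' (vec_nth X) \<partial>lborel) =
     (\<Sum>j\<in>UNIV. \<integral>X. cnj (f X) * tensor (\<psi>'(j := g' j)) (vec_nth X) \<partial>lborel)"
proof -
  let ?K = "closure {X. f X \<noteq> 0}"
  let ?H = "\<lambda>j X. H1_cl hbar m0 b (\<lambda>y. f (vec_upd X j y)) (X $ j)"
  have c0: "continuous_on UNIV f" using test_funD(1)[OF f, of "[]"] by simp
  have z0: "f X = 0" if "X \<notin> ?K" for X
    using test_fun_compact_support(2)[OF f that, of "[]"] by (simp only: iter_ddir.simps)
  have u: "vec_upd X j (X $ j) = X" for X :: "(real \<times> real) ^ 'n" and j by (simp add: vec_eq_iff)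
  have H: "?H j X = magnetic_symbol hbar m0 b (fst (X $ j)) (iter_ddir [axis j (1, 0), axis j (1, 0)] f X)
     (iter_ddir [axis j (0, 1), axis j (0, 1)] f X) (iter_ddir [axis j (0, 1)] f X) (f X)" for j X
    by (simp add: H1_cl_expand[OF test_fun_slice[OF f]] iter_ddir_slice u del: iter_ddir.simps)
  have cH: "continuous_on UNIV (?H j)" for j
    unfolding H by (intro continuous_intros test_funD(1)[OF f] c0) (auto simp: Basis_prod_def)
  have zH: "?H j X = 0" if "X \<notin> ?K" for X j
    unfolding H by (simp only: test_fun_compact_support(2)[OF f that] z0[OF that] magnetic_symbol_0)
  have i1: "integrable lborel (\<lambda>X. cnj (?H j X) * tensor \<psi>' (vec_nth X))" for j
  proof (rule integrable_continuous_mult_tensor[OF continuous_on_cnj[OF cH] test_fun_compact_support(1)[OF f] _ \<psi>'(2-4)])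
    show "cnj (?H j X) = 0" if "X \<notin> ?K" for X unfolding zH[OF that] by simp
  qed
  have m': "(\<psi>'(j := g' j)) k \<in> borel_measurable borel" "sq_int (cellM (L1, L2)) ((\<psi>'(j := g' j)) k)" "periodic (L1, L2) (\<lambda>x. norm ((\<psi>'(j := g' j)) k x))" for j k
    using \<psi>' g' by simp_all
  show i2: "integrable lborel (\<lambda>X. cnj (f X) * tensor (\<psi>'(j := g' j)) (vec_nth X))" for j
  proof (rule integrable_continuous_mult_tensor[OF continuous_on_cnj[OF c0] test_fun_compact_support(1)[OF f] _ m'])
    show "cnj (f X) = 0" if "X \<notin> ?K" for X unfolding z0[OF that] by simp
  qed
  have kin: "cnj (kin_cl hbar m0 b f X) * tensor \<psi>' (vec_nth X) = (\<Sum>j\<in>UNIV. cnj (?H j X) * tensor \<psi>' (vec_nth X))" for X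
    by (simp add: kin_cl_slices[OF f] sum_distrib_right)
  show "integrable lborel (\<lambda>X. cnj (kin_cl hbar m0 b f X) * tensor \<psi>' (vec_nth X))"
    unfolding kin by (intro Bochner_Integration.integrable_sum i1)
  have one: "(\<integral>X. cnj (?H j X) * tensor \<psi>' (vec_nth X) \<partial>lborel) = (\<integral>X. cnj (f X) * tensor (\<psi>'(j := g' j)) (vec_nth X) \<partial>lborel)" for j
  proof -
    \<comment> \<open>The zero has to come from the inner integral over particle \<open>j\<close>,
      so the two sides are subtracted before integrating.\<close>
    let ?F = "\<lambda>X. cnj (?H j X) * tensor \<psi>' (vec_nth X) - cnj (f X) * tensor (\<psi>'(j := g' j)) (vec_nth X)"
    have intF: "integrable lborel ?F" by (intro Bochner_Integration.integrable_diff i1 i2)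
    then have Fm: "?F \<in> borel_measurable borel" using borel_measurable_integrable by fastforce
    have "integrable (PiU lborel) (\<lambda>X. ?F (vec_lambda X))"
      using intF unfolding integrable_lborel_vec[OF Fm] .
    then have "(\<integral>X. ?F (vec_lambda X) \<partial>PiU lborel) = 0"
    proof (rule integral_PiM_coordinate_zero[OF sigma_finite_lborel, where j=j])
      show "AE X in PiM (UNIV - {j}) (\<lambda>_. lborel). (\<integral>y. ?F (vec_lambda (X(j := y))) \<partial>lborel) = 0"
      proof (rule AE_I2)
        fix X :: "'n \<Rightarrow> real \<times> real"
        define C where "C = (\<Prod>k\<in>UNIV - {j}. \<psi>' k (X k))"
        have vu: "vec_lambda (X(j := y)) = vec_upd (vec_lambda X) j y" for y by (simp add: vec_eq_iff)
        have vv: "vec_upd (vec_upd Y j y) j z = vec_upd Y j z" for Y :: "(real \<times> real) ^ 'n" and y z by (simp add: vec_eq_iff)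
        have t: "tensor h (X(j := y)) = h j y * (\<Prod>k\<in>UNIV - {j}. h k (X k))" for h :: "'n \<Rightarrow> real \<times> real \<Rightarrow> complex" and y
        proof -
          have "tensor h (X(j := y)) = h j ((X(j := y)) j) * (\<Prod>k\<in>UNIV - {j}. h k ((X(j := y)) k))"
            unfolding tensor_def by (rule prod.remove) auto
          also have "(\<Prod>k\<in>UNIV - {j}. h k ((X(j := y)) k)) = (\<Prod>k\<in>UNIV - {j}. h k (X k))" by (rule prod.cong) auto
          finally show ?thesis by (simp only: fun_upd_same)
        qed
        have t1: "tensor \<psi>' (X(j := y)) = \<psi>' j y * C" for y by (simp add: t C_def)
        have t2: "tensor (\<psi>'(j := g' j)) (X(j := y)) = g' j y * C" for y
        proof -
          have "(\<Prod>k\<in>UNIV - {j}. (\<psi>'(j := g' j)) k (X k)) = C" unfolding C_def by (rule prod.cong) auto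
          then show ?thesis by (simp only: t fun_upd_same)
        qed
        have "?F (vec_lambda (X(j := y))) = C * (cnj (H1_cl hbar m0 b (\<lambda>y. f (vec_upd (vec_lambda X) j y)) y) * \<psi>' j y - cnj (f (vec_upd (vec_lambda X) j y)) * g' j y)" for y
        proof -
          have "vec_nth (vec_lambda (X(j := y))) = X(j := y)" by (rule vec_lambda_inverse) simp
          then show ?thesis by (simp only: t1 t2) (simp only: vu vv vec_upd_nth if_True fun_upd_same right_diff_distrib mult_ac)
        qed
        then have "(\<integral>y. ?F (vec_lambda (X(j := y))) \<partial>lborel) =
           C * (\<integral>y. cnj (H1_cl hbar m0 b (\<lambda>y. f (vec_upd (vec_lambda X) j y)) y) * \<psi>' j y - cnj (f (vec_upd (vec_lambda X) j y)) * g' j y \<partial>lborel)"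
          by simp
        also have "\<dots> = 0"
          by (simp only: weak_H1_slice[OF f \<psi> g w \<psi>'(1,2) g'(1,2)] mult_zero_right)
        finally show "(\<integral>y. ?F (vec_lambda (X(j := y))) \<partial>lborel) = 0" .
      qed
    qed
    then have "(\<integral>X. ?F X \<partial>lborel) = 0" unfolding integral_lborel_vec[OF Fm] .
    then show ?thesis by (simp add: Bochner_Integration.integral_diff[OF i1 i2])
  qed
  show "(\<integral>X. cnj (kin_cl hbar m0 b f X) * tensor \<psi>' (vec_nth X) \<partial>lborel) =
     (\<Sum>j\<in>UNIV. \<integral>X. cnj (f X) * tensor (\<psi>'(j := g' j)) (vec_nth X) \<partial>lborel)"
    unfolding kin one[symmetric] by (rule Bochner_Integration.integral_sum) (rule i1)
qed

lemma AE_wedge_cong: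
  fixes \<psi> \<psi>' :: "'n::finite \<Rightarrow> real \<times> real \<Rightarrow> complex"
  assumes "\<And>k. AE x in lborel. \<psi> k x = \<psi>' k x"
  shows "AE X in lborel. wedge \<psi> X = wedge \<psi>' X"
proof -
  have "AE X in lborel. \<forall>i j. \<psi> i ((X :: (real \<times> real) ^ 'n) $ j) = \<psi>' i (X $ j)"
    unfolding AE_all_countable by (intro allI AE_lborel_coordinate assms)
  then show ?thesis by eventually_elim (simp add: wedge_def)
qed

lemma torus_fun_borel_ex:
  assumes "torus_fun (L1, L2) F"
  shows "\<exists>F'. (AE x in lborel. F x = F' x) \<and> F' \<in> borel_measurable borel \<and> sq_int (cellM (L1, L2)) F' \<and> periodic (L1, L2) (\<lambda>x. norm (F' x))"
proof -
  obtain N where "AE X in lborel. F X = (if X \<in> N then 0 else F X)"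
    "(\<lambda>X. if X \<in> N then 0 else F X) \<in> borel_measurable borel" "sq_int (cellM (L1, L2)) (\<lambda>X. if X \<in> N then 0 else F X)"
    "periodic (L1, L2) (\<lambda>X. norm (if X \<in> N then 0 else F X))"
    using torus_fun_borel_version[OF period_pos assms] by blast
  then show ?thesis by (intro exI[of _ "\<lambda>X. if X \<in> N then 0 else F X"]) blast
qed

lemma torus_fun_borel_family:
  assumes "\<And>k. torus_fun (L1, L2) (F k)"
  obtains F' where "\<And>k. AE x in lborel. F k x = F' k x" "\<And>k. F' k \<in> borel_measurable borel"
    "\<And>k. sq_int (cellM (L1, L2)) (F' k)" "\<And>k. periodic (L1, L2) (\<lambda>x. norm (F' k x))"
proof -
  have "\<exists>F'. \<forall>k. (AE x in lborel. F k x = F' k x) \<and> F' k \<in> borel_measurable borel \<and> sq_int (cellM (L1, L2)) (F' k) \<and>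
      periodic (L1, L2) (\<lambda>x. norm (F' k x))"
    by (rule choice) (rule allI, rule torus_fun_borel_ex[OF assms])
  then obtain F' where "\<forall>k. (AE x in lborel. F k x = F' k x) \<and> F' k \<in> borel_measurable borel \<and> sq_int (cellM (L1, L2)) (F' k) \<and>
      periodic (L1, L2) (\<lambda>x. norm (F' k x))" ..
  then show ?thesis by (intro that[of F']) blast+
qed

text \<open>The kinetic energy acts on a determinant as a derivation. This follows from product
  states by linearity, with some bookkeeping of which slot holds which orbital.\<close>

lemma weak_kin_wedge:
  fixes \<psi> g :: "'n::finite \<Rightarrow> real \<times> real \<Rightarrow> complex"
  assumes \<psi>: "\<And>k. torus_fun (L1, L2) (\<psi> k)" and g: "\<And>k. torus_fun (L1, L2) (g k)" and w: "\<And>k. weak_H1 hbar m0 b (\<psi> k) (g k)"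
  shows "weak_kin hbar m0 b (wedge \<psi>) (\<lambda>X. \<Sum>j\<in>UNIV. wedge (\<psi>(j := g j)) X)"
  unfolding weak_kin_def
proof (intro allI impI)
  fix f :: "(real \<times> real) ^ 'n \<Rightarrow> complex" assume f: "test_fun f"
  obtain \<psi>' where \<psi>': "\<And>k. AE x in lborel. \<psi> k x = \<psi>' k x" "\<And>k. \<psi>' k \<in> borel_measurable borel"
      "\<And>k. sq_int (cellM (L1, L2)) (\<psi>' k)" "\<And>k. periodic (L1, L2) (\<lambda>x. norm (\<psi>' k x))"
    by (rule torus_fun_borel_family[of \<psi>, OF \<psi>]) (rule that)
  obtain g' where g': "\<And>k. AE x in lborel. g k x = g' k x" "\<And>k. g' k \<in> borel_measurable borel"
      "\<And>k. sq_int (cellM (L1, L2)) (g' k)" "\<And>k. periodic (L1, L2) (\<lambda>x. norm (g' k x))"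
    by (rule torus_fun_borel_family[of g, OF g]) (rule that)
  let ?S = "{p. p permutes (UNIV :: 'n set)}"
  let ?c = "complex_of_real (sqrt (fact CARD('n)))"
  have W: "integrable lborel (\<lambda>X. cnj (kin_cl hbar m0 b f X) * tensor (\<psi>' \<circ> p) (vec_nth X))"
    "\<And>j. integrable lborel (\<lambda>X. cnj (f X) * tensor ((\<psi>' \<circ> p)(j := (g' \<circ> p) j)) (vec_nth X))"
    "(\<integral>X. cnj (kin_cl hbar m0 b f X) * tensor (\<psi>' \<circ> p) (vec_nth X) \<partial>lborel) =
     (\<Sum>j\<in>UNIV. \<integral>X. cnj (f X) * tensor ((\<psi>' \<circ> p)(j := (g' \<circ> p) j)) (vec_nth X) \<partial>lborel)" for p
    by (rule weak_kin_tensor_borel[OF f, where \<psi>="\<psi> \<circ> p" and g="g \<circ> p" and hbar=hbar and ?m0.0=m0 and \<psi>'="\<psi>' \<circ> p" and g'="g' \<circ> p"];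
        unfold comp_apply; rule \<psi> g w \<psi>' g')+
  have km[measurable]: "kin_cl hbar m0 b f \<in> borel_measurable borel" and fm[measurable]: "f \<in> borel_measurable borel"
    using kin_cl_continuous[OF f] test_funD(1)[OF f, of "[]"] by (auto intro: borel_measurable_continuous_onI)
  have wm[measurable]: "wedge \<psi>' \<in> borel_measurable borel" by (rule borel_measurable_wedge[OF \<psi>'(2)])
  have wm2[measurable]: "wedge (\<psi>'(j := g' j)) \<in> borel_measurable borel" for j
    by (rule borel_measurable_wedge) (use \<psi>'(2) g'(2) in simp)
  have a1: "AE X in lborel. cnj (kin_cl hbar m0 b f X) * wedge \<psi> X = cnj (kin_cl hbar m0 b f X) * wedge \<psi>' X"
    using AE_wedge_cong[of \<psi> \<psi>', OF \<psi>'(1)] by eventually_elim simp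
  have a2': "AE X in lborel. \<forall>j. wedge (\<psi>(j := g j)) X = wedge (\<psi>'(j := g' j)) X"
    unfolding AE_all_countable by (intro allI AE_wedge_cong) (use \<psi>'(1) g'(1) in simp)
  have a2: "AE X in lborel. cnj (f X) * (\<Sum>j\<in>UNIV. wedge (\<psi>(j := g j)) X) = cnj (f X) * (\<Sum>j\<in>UNIV. wedge (\<psi>'(j := g' j)) X)"
    using a2' by eventually_elim simp
  \<comment> \<open>Changing orbital \<open>p l\<close> before permuting is changing slot
    \<open>l\<close> afterwards; \<open>p\<close> thus matches the sum over slots with the sum over
    orbitals.\<close>
  have upd: "(\<psi>'(p l := g' (p l))) \<circ> p = (\<psi>' \<circ> p)(l := (g' \<circ> p) l)" if "p permutes UNIV" for p l
    using permutes_inj[OF that] by (auto simp: fun_eq_iff inj_eq)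
  have "(\<integral>X. cnj (kin_cl hbar m0 b f X) * wedge \<psi> X \<partial>lebesgue) = (\<integral>X. cnj (kin_cl hbar m0 b f X) * wedge \<psi>' X \<partial>lborel)"
    by (rule integral_lebesgue_cong[OF a1]) measurable
  also have "\<dots> = (\<integral>X. (\<Sum>p\<in>?S. (of_int (sign p) / ?c) * (cnj (kin_cl hbar m0 b f X) * tensor (\<psi>' \<circ> p) (vec_nth X))) \<partial>lborel)"
    unfolding wedge_eq_slater slater_def
    by (intro Bochner_Integration.integral_cong refl) (simp add: sum_divide_distrib sum_distrib_left mult_ac)
  also have "\<dots> = (\<Sum>p\<in>?S. (of_int (sign p) / ?c) * (\<integral>X. cnj (kin_cl hbar m0 b f X) * tensor (\<psi>' \<circ> p) (vec_nth X) \<partial>lborel))"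
    using W(1) by (subst Bochner_Integration.integral_sum) auto
  also have "\<dots> = (\<Sum>p\<in>?S. (of_int (sign p) / ?c) * (\<Sum>l\<in>UNIV. \<integral>X. cnj (f X) * tensor ((\<psi>' \<circ> p)(l := (g' \<circ> p) l)) (vec_nth X) \<partial>lborel))"
    by (simp only: W(3))
  also have "\<dots> = (\<integral>X. (\<Sum>p\<in>?S. (of_int (sign p) / ?c) * (\<Sum>l\<in>UNIV. cnj (f X) * tensor ((\<psi>' \<circ> p)(l := (g' \<circ> p) l)) (vec_nth X))) \<partial>lborel)"
    using W(2) by (subst Bochner_Integration.integral_sum) (auto simp: Bochner_Integration.integral_sum)
  also have "\<dots> = (\<integral>X. cnj (f X) * (\<Sum>j\<in>UNIV. wedge (\<psi>'(j := g' j)) X) \<partial>lborel)"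
  proof (rule Bochner_Integration.integral_cong[OF refl])
    fix X
    have "(\<Sum>p\<in>?S. (of_int (sign p) / ?c) * (\<Sum>l\<in>UNIV. cnj (f X) * tensor ((\<psi>' \<circ> p)(l := (g' \<circ> p) l)) (vec_nth X))) =
       (\<Sum>p\<in>?S. (of_int (sign p) / ?c) * (\<Sum>j\<in>UNIV. cnj (f X) * tensor ((\<psi>'(j := g' j)) \<circ> p) (vec_nth X)))"
    proof (rule sum.cong[OF refl])
      fix p assume "p \<in> ?S"
      then have p: "p permutes UNIV" by simp
      have "(\<Sum>j\<in>UNIV. cnj (f X) * tensor ((\<psi>'(j := g' j)) \<circ> p) (vec_nth X)) = (\<Sum>l\<in>UNIV. cnj (f X) * tensor ((\<psi>'(p l := g' (p l))) \<circ> p) (vec_nth X))"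
        by (rule sum.reindex_bij_betw[symmetric, of p UNIV UNIV "\<lambda>j. cnj (f X) * tensor ((\<psi>'(j := g' j)) \<circ> p) (vec_nth X)"]) (use p permutes_imp_bij in blast)
      then show "(of_int (sign p) / ?c) * (\<Sum>l\<in>UNIV. cnj (f X) * tensor ((\<psi>' \<circ> p)(l := (g' \<circ> p) l)) (vec_nth X)) =
        (of_int (sign p) / ?c) * (\<Sum>j\<in>UNIV. cnj (f X) * tensor ((\<psi>'(j := g' j)) \<circ> p) (vec_nth X))"
        by (simp only: upd[OF p])
    qed
    also have "\<dots> = (\<Sum>j\<in>UNIV. \<Sum>p\<in>?S. (of_int (sign p) / ?c) * (cnj (f X) * tensor ((\<psi>'(j := g' j)) \<circ> p) (vec_nth X)))"
      unfolding sum_distrib_left by (rule sum.swap)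
    also have "\<dots> = cnj (f X) * (\<Sum>j\<in>UNIV. wedge (\<psi>'(j := g' j)) X)"
      unfolding wedge_eq_slater slater_def by (simp add: sum_distrib_left sum_divide_distrib mult_ac)
    finally show "(\<Sum>p\<in>?S. (of_int (sign p) / ?c) * (\<Sum>l\<in>UNIV. cnj (f X) * tensor ((\<psi>' \<circ> p)(l := (g' \<circ> p) l)) (vec_nth X))) =
       cnj (f X) * (\<Sum>j\<in>UNIV. wedge (\<psi>'(j := g' j)) X)" .
  qed
  also have "\<dots> = (\<integral>X. cnj (f X) * (\<Sum>j\<in>UNIV. wedge (\<psi>(j := g j)) X) \<partial>lebesgue)"
    by (rule integral_lebesgue_cong[OF a2, symmetric]) measurable
  finally show "(\<integral>X. cnj (kin_cl hbar m0 b f X) * wedge \<psi> X \<partial>lebesgue) = (\<integral>X. cnj (f X) * (\<Sum>j\<in>UNIV. wedge (\<psi>(j := g j)) X) \<partial>lebesgue)" .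
qed

text \<open>Moving particle \<open>j\<close> by a period affects one factor of each product, and the
  phase does not depend on which orbital stands there.\<close>

lemma mag_perN_wedge:
  fixes \<psi> :: "'n::finite \<Rightarrow> real \<times> real \<Rightarrow> complex"
  assumes "\<And>k. mag_per L1 L2 M (\<psi> k)"
  shows "mag_perN L1 L2 M (wedge \<psi>)"
proof -
  have t: "tensor (\<psi> \<circ> p) (vec_nth (X + axis j v)) = c * tensor (\<psi> \<circ> p) (vec_nth X)"
    if "\<psi> (p j) (X $ j + v) = c * \<psi> (p j) (X $ j)" for p j X v c
  proof -
    have "tensor (\<psi> \<circ> p) (vec_nth (X + axis j v)) = \<psi> (p j) ((X + axis j v) $ j) * (\<Prod>k\<in>UNIV - {j}. \<psi> (p k) ((X + axis j v) $ k))"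
      unfolding tensor_def comp_def by (rule prod.remove) auto
    also have "(\<Prod>k\<in>UNIV - {j}. \<psi> (p k) ((X + axis j v) $ k)) = (\<Prod>k\<in>UNIV - {j}. \<psi> (p k) (X $ k))"
      by (rule prod.cong) (auto simp: axis_def)
    also have "\<psi> (p j) ((X + axis j v) $ j) = c * \<psi> (p j) (X $ j)" using that by simp
    also have "c * \<psi> (p j) (X $ j) * (\<Prod>k\<in>UNIV - {j}. \<psi> (p k) (X $ k)) = c * tensor (\<psi> \<circ> p) (vec_nth X)"
    proof -
      have "tensor (\<psi> \<circ> p) (vec_nth X) = \<psi> (p j) (X $ j) * (\<Prod>k\<in>UNIV - {j}. \<psi> (p k) (X $ k))"
        unfolding tensor_def comp_def by (rule prod.remove) auto
      then show ?thesis by simp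
    qed
    finally show ?thesis .
  qed
  have s: "slater \<psi> (vec_nth (X + axis j v)) = c * slater \<psi> (vec_nth X)"
    if "\<And>k. \<psi> k (X $ j + v) = c * \<psi> k (X $ j)" for j X v c
    unfolding slater_def by (simp add: t[OF that] sum_distrib_left mult_ac)
  have p1: "\<psi> k (x + (L1, 0)) = exp (\<i> * complex_of_real (2 * pi * real M * snd x / L2)) * \<psi> k x"
    and p2: "\<psi> k (x + (0, L2)) = 1 * \<psi> k x" for k x
    using assms[of k] by (cases x; simp add: mag_per_def)+
  show ?thesis
    unfolding mag_perN_def wedge_eq_slater by (simp only: s[OF p1] s[OF p2]) simp
qed

end

section \<open>Differentiation in $L^2$\<close>

text \<open>A crude bound: \<open>N!\<close> products of equal norm against the normalisation
  \<open>1 / sqrt (N!)\<close>. It serves to pass to limits, not to find the norm of a Slater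
  determinant.\<close>

lemma L2on_wedge:
  fixes \<psi> :: "'n::finite \<Rightarrow> real \<times> real \<Rightarrow> complex"
  assumes "\<And>k. L2on (box_Lambda L1 L2) (\<psi> k)"
  shows "L2on (box_LambdaN L1 L2) (wedge \<psi>)"
    "norm_on (box_LambdaN L1 L2) (wedge \<psi>) \<le> sqrt (fact CARD('n)) * (\<Prod>k\<in>UNIV. norm_on (box_Lambda L1 L2) (\<psi> k))"
proof -
  have "\<forall>k. \<exists>g. borel_rep (box_Lambda L1 L2) (\<psi> k) g"
    using assms by (auto intro!: borel_rep_exists simp: L2on_def)
  then obtain \<psi>' where \<psi>': "\<And>k. borel_rep (box_Lambda L1 L2) (\<psi> k) (\<psi>' k)" by metis
  have sq: "sq_int lborel (\<psi>' k)" for k using borel_rep_sq_int[OF \<psi>'] assms by blast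
  have t: "sq_int (PiU lborel) (tensor (\<psi>' \<circ> p))" for p :: "'n \<Rightarrow> 'n"
    by (rule sq_int_tensor[OF sigma_finite_lborel]) (simp add: sq)
  have rep: "borel_rep (box_LambdaN L1 L2) (wedge \<psi>) (wedge \<psi>')" by (rule borel_rep_wedge[OF \<psi>'])
  have m: "wedge \<psi>' \<in> borel_measurable borel" by (rule borel_repD(1)[OF rep])
  let ?c = "complex_of_real (sqrt (fact CARD('n)))"
  have w: "(\<lambda>X. wedge \<psi>' (vec_lambda X)) = (\<lambda>X. inverse ?c * slater \<psi>' X)"
    by (auto simp: wedge_eq_slater vec_lambda_inverse field_simps)
  have "sq_int lborel (wedge \<psi>')"
    unfolding sq_int_lborel_vec[OF m] w by (intro sq_int_cmult sq_int_slater[OF sigma_finite_lborel sq])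
  then show "L2on (box_LambdaN L1 L2) (wedge \<psi>)" using borel_rep_sq_int[OF rep] by blast
  have "norm_on (box_LambdaN L1 L2) (wedge \<psi>) = nrm (PiU lborel) (\<lambda>X. inverse ?c * slater \<psi>' X)"
    unfolding borel_rep_norm_on[OF rep] nrm_lborel_vec[OF m] w ..
  also have "\<dots> = inverse (sqrt (fact CARD('n))) * nrm (PiU lborel) (slater \<psi>')"
    unfolding nrm_cmult by (simp add: norm_inverse)
  also have "nrm (PiU lborel) (slater \<psi>') \<le> (\<Sum>p\<in>{p. p permutes UNIV}. nrm (PiU lborel) (\<lambda>X. of_int (sign p) * tensor (\<psi>' \<circ> p) X))"
    unfolding slater_def by (rule nrm_triangle_sum) (intro sq_int_cmult t)
  also have "\<dots> = (\<Sum>p\<in>{p. p permutes (UNIV::'n set)}. \<Prod>k\<in>UNIV. nrm lborel (\<psi>' k))"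
  proof (rule sum.cong[OF refl])
    fix p :: "'n \<Rightarrow> 'n" assume "p \<in> {p. p permutes UNIV}"
    then have b: "bij p" using permutes_imp_bij by blast
    have "norm (of_int (sign p) :: complex) = 1" by (cases p rule: sign_cases) auto
    then have "nrm (PiU lborel) (\<lambda>X. of_int (sign p) * tensor (\<psi>' \<circ> p) X) = (\<Prod>k\<in>UNIV. nrm lborel (\<psi>' (p k)))"
      unfolding nrm_cmult using nrm_tensor[OF sigma_finite_lborel, of "\<psi>' \<circ> p"] sq by simp
    also have "\<dots> = (\<Prod>k\<in>UNIV. nrm lborel (\<psi>' k))"
      by (rule prod.reindex_bij_betw[of p UNIV UNIV "\<lambda>k. nrm lborel (\<psi>' k)"]) (use b in auto)
    finally show "nrm (PiU lborel) (\<lambda>X. of_int (sign p) * tensor (\<psi>' \<circ> p) X) = (\<Prod>k\<in>UNIV. nrm lborel (\<psi>' k))" .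
  qed
  also have "\<dots> = fact CARD('n) * (\<Prod>k\<in>UNIV. nrm lborel (\<psi>' k))" by (simp add: card_permutations[OF refl])
  also have "inverse (sqrt (fact CARD('n))) * (fact CARD('n) * (\<Prod>k\<in>UNIV. nrm lborel (\<psi>' k))) = sqrt (fact CARD('n)) * (\<Prod>k\<in>UNIV. nrm lborel (\<psi>' k))"
    by (simp add: field_simps)
  also have "(\<Prod>k\<in>UNIV. nrm lborel (\<psi>' k)) = (\<Prod>k\<in>UNIV. norm_on (box_Lambda L1 L2) (\<psi> k))"
    by (simp add: borel_rep_norm_on[OF \<psi>'])
  finally show "norm_on (box_LambdaN L1 L2) (wedge \<psi>) \<le> sqrt (fact CARD('n)) * (\<Prod>k\<in>UNIV. norm_on (box_Lambda L1 L2) (\<psi> k))"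
    by simp
qed

text \<open>Factors are exchanged one after another in the order of the labels: those below
  \<open>j\<close> are already \<open>a\<close>, those above still \<open>c\<close>. The induction
  adds a new largest label.\<close>

lemma prod_diff_telescope:
  fixes a c :: "'n::linorder \<Rightarrow> 'a::comm_ring_1"
  assumes "finite S"
  shows "(\<Prod>k\<in>S. a k) - (\<Prod>k\<in>S. c k) = (\<Sum>j\<in>S. \<Prod>k\<in>S. if k < j then a k else if k = j then a j - c j else c k)"
  using assms
proof (induction S rule: finite_linorder_max_induct)
  case (insert m S)
  have m: "m \<notin> S" using insert by auto
  have fin: "finite S" and less: "\<And>k. k \<in> S \<Longrightarrow> k < m" using insert by auto
  let ?G = "\<lambda>S j. \<Prod>k\<in>S. if k < j then a k else if k = j then a j - c j else c k"
  have "?G S m = (\<Prod>k\<in>S. a k)" by (rule prod.cong) (use less in auto)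
  then have e1: "?G (insert m S) m = (a m - c m) * (\<Prod>k\<in>S. a k)"
    by (subst prod.insert[OF fin m]) simp
  have e2: "?G (insert m S) j = c m * ?G S j" if "j \<in> S" for j
    using less[OF that] by (subst prod.insert[OF fin m]) auto
  have "(\<Sum>j\<in>insert m S. ?G (insert m S) j) = ?G (insert m S) m + (\<Sum>j\<in>S. ?G (insert m S) j)"
    by (rule sum.insert[OF fin m])
  also have "(\<Sum>j\<in>S. ?G (insert m S) j) = (\<Sum>j\<in>S. c m * ?G S j)"
    by (rule sum.cong[OF refl e2])
  finally have "(\<Sum>j\<in>insert m S. ?G (insert m S) j) = (a m - c m) * (\<Prod>k\<in>S. a k) + c m * ((\<Prod>k\<in>S. a k) - (\<Prod>k\<in>S. c k))"
    unfolding e1 insert.IH sum_distrib_left .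
  then show ?case using fin m by (simp add: algebra_simps)
qed simp

definition mix :: "('n::linorder \<Rightarrow> 'a \<Rightarrow> complex) \<Rightarrow> ('n \<Rightarrow> 'a \<Rightarrow> complex) \<Rightarrow> 'n \<Rightarrow> ('a \<Rightarrow> complex) \<Rightarrow> 'n \<Rightarrow> 'a \<Rightarrow> complex" where
  "mix A B j d k = (if k < j then A k else if k = j then d else B k)"

lemma wedge_det_expand:
  "wedge \<psi> X = (\<Sum>p\<in>{p. p permutes UNIV}. of_int (sign p) * (\<Prod>k\<in>UNIV. \<psi> k (X $ p k))) / complex_of_real (sqrt (fact CARD('n)))"
  for \<psi> :: "'n::finite \<Rightarrow> real \<times> real \<Rightarrow> complex"
  by (simp add: wedge_def det_def)

lemma wedge_upd_expand:
  fixes \<psi> :: "'n::finite \<Rightarrow> real \<times> real \<Rightarrow> complex"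
  shows "wedge (\<psi>(j := d)) X = (\<Sum>p\<in>{p. p permutes UNIV}. of_int (sign p) * (d (X $ p j) * (\<Prod>k\<in>UNIV - {j}. \<psi> k (X $ p k))))
    / complex_of_real (sqrt (fact CARD('n)))"
proof -
  have "(\<Prod>k\<in>UNIV. (\<psi>(j := d)) k (X $ p k)) = d (X $ p j) * (\<Prod>k\<in>UNIV - {j}. \<psi> k (X $ p k))" for p
  proof -
    have "(\<Prod>k\<in>UNIV. (\<psi>(j := d)) k (X $ p k)) = (\<psi>(j := d)) j (X $ p j) * (\<Prod>k\<in>UNIV - {j}. (\<psi>(j := d)) k (X $ p k))"
      by (rule prod.remove) auto
    also have "(\<Prod>k\<in>UNIV - {j}. (\<psi>(j := d)) k (X $ p k)) = (\<Prod>k\<in>UNIV - {j}. \<psi> k (X $ p k))"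
      by (rule prod.cong) auto
    finally show ?thesis by simp
  qed
  then show ?thesis unfolding wedge_det_expand by simp
qed

lemma wedge_upd_zero: "wedge (\<psi>(j := (\<lambda>x. 0))) X = 0"
  unfolding wedge_upd_expand by simp

lemma wedge_upd_diff: "wedge (\<psi>(j := (\<lambda>x. c * f x - g x))) X = c * wedge (\<psi>(j := f)) X - wedge (\<psi>(j := g)) X"
  unfolding wedge_upd_expand
  by (simp add: sum_distrib_left diff_divide_distrib[symmetric] sum_subtractf[symmetric] left_diff_distrib right_diff_distrib mult_ac)

lemma wedge_diff_telescope:
  fixes A B :: "'n::{finite,linorder} \<Rightarrow> real \<times> real \<Rightarrow> complex"
  shows "wedge A X - wedge B X = (\<Sum>j\<in>UNIV. wedge (mix A B j (\<lambda>x. A j x - B j x)) X)"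
proof -
  let ?c = "complex_of_real (sqrt (fact CARD('n)))" and ?S = "{p. p permutes (UNIV::'n set)}"
  have "wedge A X - wedge B X = (\<Sum>p\<in>?S. of_int (sign p) * ((\<Prod>k\<in>UNIV. A k (X $ p k)) - (\<Prod>k\<in>UNIV. B k (X $ p k)))) / ?c"
    unfolding wedge_det_expand by (simp add: diff_divide_distrib[symmetric] sum_subtractf[symmetric] right_diff_distrib)
  also have "\<dots> = (\<Sum>p\<in>?S. of_int (sign p) * (\<Sum>j\<in>UNIV. \<Prod>k\<in>UNIV. mix A B j (\<lambda>x. A j x - B j x) k (X $ p k))) / ?c"
    by (simp add: prod_diff_telescope mix_def if_distribR cong: if_cong)
  also have "\<dots> = (\<Sum>j\<in>UNIV. wedge (mix A B j (\<lambda>x. A j x - B j x)) X)"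
    unfolding wedge_det_expand sum_divide_distrib[symmetric] sum_distrib_left by (subst sum.swap) simp
  finally show ?thesis .
qed

lemma wedge_slot_cmult:
  fixes A B :: "'n::{finite,linorder} \<Rightarrow> real \<times> real \<Rightarrow> complex"
  shows "wedge (mix A B j (\<lambda>x. c * d x)) X = c * wedge (mix A B j d) X"
proof -
  have mix: "mix A B j e = (mix A B j (\<lambda>x. 0))(j := e)" for e by (auto simp: mix_def fun_eq_iff)
  show ?thesis
    by (subst (1 2) mix) (simp add: wedge_upd_expand sum_distrib_left mult_ac)
qed

lemma norm_on_triangle:
  assumes "S \<in> sets lebesgue" "L2on S f" "L2on S g"
  shows "norm_on S (\<lambda>x. f x + g x) \<le> norm_on S f + norm_on S g"
  using assms nrm_triangle by (auto simp: L2on_iff_sq_int norm_on_eq_nrm)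

lemma L2on_algebra:
  assumes "S \<in> sets lebesgue"
  shows "L2on S f \<Longrightarrow> L2on S g \<Longrightarrow> L2on S (\<lambda>x. f x + g x)" "L2on S f \<Longrightarrow> L2on S g \<Longrightarrow> L2on S (\<lambda>x. f x - g x)"
    "L2on S f \<Longrightarrow> L2on S (\<lambda>x. c * f x)" "L2on S f \<Longrightarrow> L2on S (\<lambda>x. f x / c)" "L2on S (\<lambda>x. 0)"
    "(\<And>i. i \<in> I \<Longrightarrow> L2on S (F i)) \<Longrightarrow> L2on S (\<lambda>x. \<Sum>i\<in>I. F i x)"
  using assms by (auto simp: L2on_iff_sq_int sq_int_add sq_int_diff sq_int_cmult sq_int_divide sq_int_sum)

lemma norm_on_nonneg: "S \<in> sets lebesgue \<Longrightarrow> norm_on S f \<ge> 0"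
  by (simp add: norm_on_eq_nrm)

lemma norm_on_tendsto:
  assumes S: "S \<in> sets lebesgue" and ev: "eventually (\<lambda>s. L2on S (f s)) F" and g: "L2on S g"
    and lim: "((\<lambda>s. norm_on S (\<lambda>x. f s x - g x)) \<longlongrightarrow> 0) F"
  shows "((\<lambda>s. norm_on S (f s)) \<longlongrightarrow> norm_on S g) F"
proof (rule LIM_zero_cancel, rule Lim_null_comparison[OF _ lim])
  show "eventually (\<lambda>s. norm (norm_on S (f s) - norm_on S g) \<le> norm_on S (\<lambda>x. f s x - g x)) F"
    using ev
  proof eventually_elim
    case (elim s)
    have "norm_on S (f s) \<le> norm_on S g + norm_on S (\<lambda>x. f s x - g x)"
      using nrm_triangle_diff[of "lebesgue_on S" "f s" g] elim g S by (simp add: L2on_iff_sq_int norm_on_eq_nrm)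
    moreover have "norm_on S g \<le> norm_on S (f s) + norm_on S (\<lambda>x. f s x - g x)"
      using nrm_triangle_diff[of "lebesgue_on S" g "f s"] elim g S
      by (simp add: L2on_iff_sq_int norm_on_eq_nrm nrm_minus_commute[of _ g "f s"])
    ultimately show ?case by simp
  qed
qed

text \<open>In every telescoped determinant one slot tends to zero while the norms of the others
  converge, so the product of the norms tends to zero.\<close>

lemma norm_on_wedge_tendsto:
  fixes A :: "real \<Rightarrow> 'n::{finite,linorder} \<Rightarrow> real \<times> real \<Rightarrow> complex"
  assumes ev: "\<And>k. eventually (\<lambda>s. L2on (box_Lambda L1 L2) (A s k)) F" and B: "\<And>k. L2on (box_Lambda L1 L2) (B k)"
    and lim: "\<And>k. ((\<lambda>s. norm_on (box_Lambda L1 L2) (\<lambda>x. A s k x - B k x)) \<longlongrightarrow> 0) F"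
  shows "((\<lambda>s. norm_on (box_LambdaN L1 L2) (\<lambda>X. wedge (A s) X - wedge B X)) \<longlongrightarrow> 0) F"
proof -
  let ?\<Lambda> = "box_Lambda L1 L2"
  let ?m = "\<lambda>s j. mix (A s) B j (\<lambda>x. A s j x - B j x)"
  have evall: "eventually (\<lambda>s. \<forall>k. L2on ?\<Lambda> (A s k)) F" using ev by (simp add: eventually_all_finite)
  have "((\<lambda>s. sqrt (fact CARD('n)) * (\<Sum>j\<in>UNIV. \<Prod>k\<in>UNIV. norm_on ?\<Lambda> (?m s j k))) \<longlongrightarrow>
      sqrt (fact CARD('n)) * (\<Sum>j\<in>(UNIV::'n set). 0)) F"
  proof (intro tendsto_mult tendsto_const tendsto_sum)
    fix j :: 'n
    have "((\<lambda>s. \<Prod>k\<in>UNIV. norm_on ?\<Lambda> (?m s j k)) \<longlongrightarrow> (\<Prod>k\<in>UNIV. if k = j then 0 else norm_on ?\<Lambda> (B k))) F"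
    proof (rule tendsto_prod)
      fix k :: 'n
      show "((\<lambda>s. norm_on ?\<Lambda> (?m s j k)) \<longlongrightarrow> (if k = j then 0 else norm_on ?\<Lambda> (B k))) F"
        using lim[of j] norm_on_tendsto[OF _ ev B lim, of k] by (cases "k < j"; cases "k = j") (auto simp: mix_def)
    qed
    moreover have "(\<Prod>k\<in>UNIV. if k = j then 0 else norm_on ?\<Lambda> (B k)) = 0" by (rule prod_zero) auto
    ultimately show "((\<lambda>s. \<Prod>k\<in>UNIV. norm_on ?\<Lambda> (?m s j k)) \<longlongrightarrow> 0) F" by simp
  qed
  then have up: "((\<lambda>s. sqrt (fact CARD('n)) * (\<Sum>j\<in>UNIV. \<Prod>k\<in>UNIV. norm_on ?\<Lambda> (?m s j k))) \<longlongrightarrow> 0) F" by simp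
  show ?thesis
  proof (rule Lim_null_comparison[OF _ up])
    show "eventually (\<lambda>s. norm (norm_on (box_LambdaN L1 L2) (\<lambda>X. wedge (A s) X - wedge B X)) \<le>
       sqrt (fact CARD('n)) * (\<Sum>j\<in>UNIV. \<Prod>k\<in>UNIV. norm_on ?\<Lambda> (?m s j k))) F"
      using evall
    proof eventually_elim
      case (elim s)
      have m: "L2on ?\<Lambda> (?m s j k)" for j k using elim B by (auto simp: mix_def intro!: L2on_algebra)
      have "norm_on (box_LambdaN L1 L2) (\<lambda>X. wedge (A s) X - wedge B X) = nrm (lebesgue_on (box_LambdaN L1 L2)) (\<lambda>X. \<Sum>j\<in>UNIV. wedge (?m s j) X)"
        by (simp add: wedge_diff_telescope norm_on_eq_nrm)
      also have "\<dots> \<le> (\<Sum>j\<in>UNIV. nrm (lebesgue_on (box_LambdaN L1 L2)) (wedge (?m s j)))"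
        by (rule nrm_triangle_sum) (use L2on_wedge(1)[OF m] in \<open>simp add: L2on_iff_sq_int\<close>)
      also have "\<dots> \<le> (\<Sum>j\<in>UNIV. sqrt (fact CARD('n)) * (\<Prod>k\<in>UNIV. norm_on ?\<Lambda> (?m s j k)))"
        by (rule sum_mono) (use L2on_wedge(2)[OF m] in \<open>simp add: norm_on_eq_nrm\<close>)
      finally show ?case by (simp add: norm_on_eq_nrm sum_distrib_left)
    qed
  qed
qed

text \<open>The difference quotient telescopes into mixed determinants: slot \<open>j\<close> holds
  a difference quotient, slots below it the orbitals at time \<open>s\<close>, slots above it those
  at time \<open>t\<close>. Each converges to the determinant with slot \<open>j\<close>
  differentiated.\<close>

lemma has_L2_derivative_wedge:
  fixes \<phi> :: "real \<Rightarrow> 'n::{finite,linorder} \<Rightarrow> real \<times> real \<Rightarrow> complex"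
  assumes t: "t \<in> T" and L2: "\<And>s k. s \<in> T \<Longrightarrow> L2on (box_Lambda L1 L2) (\<phi> s k)"
    and cont: "\<And>k. ((\<lambda>s. norm_on (box_Lambda L1 L2) (\<lambda>x. \<phi> s k x - \<phi> t k x)) \<longlongrightarrow> 0) (at t within T)"
    and d: "\<And>k. has_L2_derivative (box_Lambda L1 L2) (\<lambda>s. \<phi> s k) (\<phi>' k) t T"
  shows "has_L2_derivative (box_LambdaN L1 L2) (\<lambda>s. wedge (\<phi> s)) (\<lambda>X. \<Sum>j\<in>UNIV. wedge ((\<phi> t)(j := \<phi>' j)) X) t T"
  unfolding has_L2_derivative_def
proof
  let ?\<Lambda> = "box_Lambda L1 L2" and ?N = "box_LambdaN L1 L2 :: ((real \<times> real)^('n::{finite,linorder})) set"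
  have \<phi>': "L2on ?\<Lambda> (\<phi>' k)" and d': "((\<lambda>s. norm_on ?\<Lambda> (\<lambda>x. (\<phi> s k x - \<phi> t k x) / complex_of_real (s - t) - \<phi>' k x)) \<longlongrightarrow> 0) (at t within T)" for k
    using d[of k] by (auto simp: has_L2_derivative_def)
  have Lt: "L2on ?\<Lambda> (((\<phi> t)(j := \<phi>' j)) k)" for j k using L2[OF t] \<phi>' by simp
  show "L2on ?N (\<lambda>X. \<Sum>j\<in>UNIV. wedge ((\<phi> t)(j := \<phi>' j)) X)"
    by (intro L2on_algebra(6) L2on_wedge(1) Lt) simp
  define \<delta> where "\<delta> s j x = (\<phi> s j x - \<phi> t j x) / complex_of_real (s - t)" for s j x
  define m where "m s j = mix (\<phi> s) (\<phi> t) j (\<delta> s j)" for s j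
  have evT: "eventually (\<lambda>s. s \<in> T) (at t within T)" by (simp add: eventually_at_filter)
  have m_L2: "L2on ?\<Lambda> (m s j k)" if "s \<in> T" for s j k
    unfolding m_def mix_def \<delta>_def[abs_def] using L2[OF that] L2[OF t] by (auto intro!: L2on_algebra)
  have "((\<lambda>s. norm_on ?N (\<lambda>X. wedge (m s j) X - wedge ((\<phi> t)(j := \<phi>' j)) X)) \<longlongrightarrow> 0) (at t within T)" for j
  proof (rule norm_on_wedge_tendsto)
    fix k
    show "eventually (\<lambda>s. L2on ?\<Lambda> (m s j k)) (at t within T)" using evT by eventually_elim (rule m_L2)
    show "L2on ?\<Lambda> (((\<phi> t)(j := \<phi>' j)) k)" by (rule Lt)
    show "((\<lambda>s. norm_on ?\<Lambda> (\<lambda>x. m s j k x - ((\<phi> t)(j := \<phi>' j)) k x)) \<longlongrightarrow> 0) (at t within T)"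
      using cont[of k] d'[of j] by (cases "k < j"; cases "k = j") (auto simp: m_def mix_def \<delta>_def[abs_def] norm_on_def)
  qed
  then have "((\<lambda>s. \<Sum>j\<in>UNIV. norm_on ?N (\<lambda>X. wedge (m s j) X - wedge ((\<phi> t)(j := \<phi>' j)) X)) \<longlongrightarrow> (\<Sum>j\<in>(UNIV::'n set). 0)) (at t within T)"
    by (intro tendsto_sum)
  then have up: "((\<lambda>s. \<Sum>j\<in>UNIV. norm_on ?N (\<lambda>X. wedge (m s j) X - wedge ((\<phi> t)(j := \<phi>' j)) X)) \<longlongrightarrow> 0) (at t within T)" by simp
  show "((\<lambda>s. norm_on ?N (\<lambda>X. (wedge (\<phi> s) X - wedge (\<phi> t) X) / complex_of_real (s - t) - (\<Sum>j\<in>UNIV. wedge ((\<phi> t)(j := \<phi>' j)) X))) \<longlongrightarrow> 0) (at t within T)"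
  proof (rule Lim_null_comparison[OF _ up])
    show "eventually (\<lambda>s. norm (norm_on ?N (\<lambda>X. (wedge (\<phi> s) X - wedge (\<phi> t) X) / complex_of_real (s - t) - (\<Sum>j\<in>UNIV. wedge ((\<phi> t)(j := \<phi>' j)) X)))
       \<le> (\<Sum>j\<in>UNIV. norm_on ?N (\<lambda>X. wedge (m s j) X - wedge ((\<phi> t)(j := \<phi>' j)) X))) (at t within T)"
      using evT
    proof eventually_elim
      case (elim s)
      have e: "wedge (m s j) X = wedge (mix (\<phi> s) (\<phi> t) j (\<lambda>x. \<phi> s j x - \<phi> t j x)) X / complex_of_real (s - t)" for j X
      proof -
        have "\<delta> s j = (\<lambda>x. inverse (complex_of_real (s - t)) * (\<phi> s j x - \<phi> t j x))"
          by (simp add: \<delta>_def fun_eq_iff divide_inverse mult.commute)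
        then show ?thesis by (simp only: m_def wedge_slot_cmult) (simp add: divide_inverse mult.commute)
      qed
      have "(wedge (\<phi> s) X - wedge (\<phi> t) X) / complex_of_real (s - t) = (\<Sum>j\<in>UNIV. wedge (m s j) X)" for X
        by (simp only: e wedge_diff_telescope sum_divide_distrib)
      then have "norm_on ?N (\<lambda>X. (wedge (\<phi> s) X - wedge (\<phi> t) X) / complex_of_real (s - t) - (\<Sum>j\<in>UNIV. wedge ((\<phi> t)(j := \<phi>' j)) X))
         = nrm (lebesgue_on ?N) (\<lambda>X. \<Sum>j\<in>UNIV. wedge (m s j) X - wedge ((\<phi> t)(j := \<phi>' j)) X)"
        by (simp add: norm_on_eq_nrm sum_subtractf)
      also have "\<dots> \<le> (\<Sum>j\<in>UNIV. nrm (lebesgue_on ?N) (\<lambda>X. wedge (m s j) X - wedge ((\<phi> t)(j := \<phi>' j)) X))"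
      proof (rule nrm_triangle_sum)
        fix j
        have "L2on ?N (\<lambda>X. wedge (m s j) X - wedge ((\<phi> t)(j := \<phi>' j)) X)"
          by (intro L2on_algebra(2) L2on_wedge(1) Lt m_L2[OF elim]) simp
        then show "sq_int (lebesgue_on ?N) (\<lambda>X. wedge (m s j) X - wedge ((\<phi> t)(j := \<phi>' j)) X)" by (simp add: L2on_iff_sq_int)
      qed
      finally show ?case by (simp add: norm_on_eq_nrm)
    qed
  qed
qed

lemma has_L2_derivative_scale:
  assumes S: "S \<in> sets lebesgue" and t: "t \<in> T" and L2: "\<And>s. s \<in> T \<Longrightarrow> L2on S (f s)"
    and cont: "((\<lambda>s. norm_on S (\<lambda>x. f s x - f t x)) \<longlongrightarrow> 0) (at t within T)"
    and f: "has_L2_derivative S f f' t T" and a: "(a has_vector_derivative a') (at t within T)"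
  shows "has_L2_derivative S (\<lambda>s x. a s * f s x) (\<lambda>x. a' * f t x + a t * f' x) t T"
  unfolding has_L2_derivative_def
proof
  let ?n = "nrm (lebesgue_on S)"
  have f': "L2on S f'" and lim: "((\<lambda>s. norm_on S (\<lambda>x. (f s x - f t x) / complex_of_real (s - t) - f' x)) \<longlongrightarrow> 0) (at t within T)"
    using f by (auto simp: has_L2_derivative_def)
  show "L2on S (\<lambda>x. a' * f t x + a t * f' x)" by (intro L2on_algebra S L2 t f')
  have evT: "eventually (\<lambda>s. s \<in> T) (at t within T)" by (simp add: eventually_at_filter)
  have "((\<lambda>s. norm ((a s - a t) / complex_of_real (s - t) - a')) \<longlongrightarrow> 0) (at t within T)"
  proof -
    have "((\<lambda>s. (1 / norm (s - t)) *\<^sub>R (a s - (a t + (s - t) *\<^sub>R a'))) \<longlongrightarrow> 0) (at t within T)"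
      using a unfolding has_vector_derivative_def has_derivative_within by blast
    then have "((\<lambda>s. norm ((1 / norm (s - t)) *\<^sub>R (a s - (a t + (s - t) *\<^sub>R a')))) \<longlongrightarrow> 0) (at t within T)"
      by (rule tendsto_norm_zero)
    moreover have "eventually (\<lambda>s. norm ((1 / norm (s - t)) *\<^sub>R (a s - (a t + (s - t) *\<^sub>R a'))) = norm ((a s - a t) / complex_of_real (s - t) - a')) (at t within T)"
      unfolding eventually_at_filter
    proof (intro always_eventually allI impI)
      fix s assume "s \<noteq> t"
      then have "(a s - a t) / complex_of_real (s - t) - a' = (a s - (a t + (s - t) *\<^sub>R a')) / complex_of_real (s - t)"
        by (simp add: field_simps scaleR_conv_of_real)
      then show "norm ((1 / norm (s - t)) *\<^sub>R (a s - (a t + (s - t) *\<^sub>R a'))) = norm ((a s - a t) / complex_of_real (s - t) - a')"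
        by (simp add: norm_divide del: of_real_diff)
    qed
    ultimately show ?thesis by (rule Lim_transform_eventually)
  qed
  moreover have "((\<lambda>s. norm_on S (f s)) \<longlongrightarrow> norm_on S (f t)) (at t within T)"
    by (rule norm_on_tendsto[OF S _ L2[OF t] cont]) (use evT L2 in \<open>auto elim: eventually_mono\<close>)
  ultimately have up: "((\<lambda>s. norm ((a s - a t) / complex_of_real (s - t) - a') * norm_on S (f s) + norm a' * norm_on S (\<lambda>x. f s x - f t x)
      + norm (a t) * norm_on S (\<lambda>x. (f s x - f t x) / complex_of_real (s - t) - f' x)) \<longlongrightarrow> 0 * norm_on S (f t) + norm a' * 0 + norm (a t) * 0) (at t within T)"
    by (intro tendsto_intros cont lim)
  then have up: "((\<lambda>s. norm ((a s - a t) / complex_of_real (s - t) - a') * norm_on S (f s) + norm a' * norm_on S (\<lambda>x. f s x - f t x)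
      + norm (a t) * norm_on S (\<lambda>x. (f s x - f t x) / complex_of_real (s - t) - f' x)) \<longlongrightarrow> 0) (at t within T)" by simp
  show "((\<lambda>s. norm_on S (\<lambda>x. (a s * f s x - a t * f t x) / complex_of_real (s - t) - (a' * f t x + a t * f' x))) \<longlongrightarrow> 0) (at t within T)"
  proof (rule Lim_null_comparison[OF _ up])
    show "eventually (\<lambda>s. norm (norm_on S (\<lambda>x. (a s * f s x - a t * f t x) / complex_of_real (s - t) - (a' * f t x + a t * f' x))) \<le>
      norm ((a s - a t) / complex_of_real (s - t) - a') * norm_on S (f s) + norm a' * norm_on S (\<lambda>x. f s x - f t x)
      + norm (a t) * norm_on S (\<lambda>x. (f s x - f t x) / complex_of_real (s - t) - f' x)) (at t within T)"
      using evT
    proof eventually_elim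
      case (elim s)
      let ?q = "(a s - a t) / complex_of_real (s - t) - a'"
      let ?e = "\<lambda>x. (f s x - f t x) / complex_of_real (s - t) - f' x"
      have sq: "sq_int (lebesgue_on S) (f s)" "sq_int (lebesgue_on S) (f t)" "sq_int (lebesgue_on S) f'"
        using L2[OF elim] L2[OF t] f' S by (auto simp: L2on_iff_sq_int)
      have e: "sq_int (lebesgue_on S) ?e" "sq_int (lebesgue_on S) (\<lambda>x. f s x - f t x)" by (intro sq_int_diff sq_int_divide sq)+
      \<comment> \<open>Three small parts: the error of the scalar quotient times
        \<open>f s\<close>, then \<open>a'\<close> times the increment of \<open>f\<close>, then
        \<open>a t\<close> times the error of the quotient of \<open>f\<close>.\<close>
      have "(a s * f s x - a t * f t x) / complex_of_real (s - t) - (a' * f t x + a t * f' x) = (?q * f s x + a' * (f s x - f t x)) + a t * ?e x" for x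
        by (simp add: field_simps diff_divide_distrib add_divide_distrib)
      then have "norm_on S (\<lambda>x. (a s * f s x - a t * f t x) / complex_of_real (s - t) - (a' * f t x + a t * f' x)) =
         ?n (\<lambda>x. (?q * f s x + a' * (f s x - f t x)) + a t * ?e x)" using S by (simp add: norm_on_eq_nrm)
      also have "\<dots> \<le> ?n (\<lambda>x. ?q * f s x + a' * (f s x - f t x)) + ?n (\<lambda>x. a t * ?e x)"
        by (rule nrm_triangle) (intro sq_int_add sq_int_cmult sq e)+
      also have "?n (\<lambda>x. ?q * f s x + a' * (f s x - f t x)) \<le> ?n (\<lambda>x. ?q * f s x) + ?n (\<lambda>x. a' * (f s x - f t x))"
        by (rule nrm_triangle) (intro sq_int_add sq_int_cmult sq e)+
      finally show ?case using S by (simp add: norm_on_eq_nrm nrm_cmult)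
    qed
  qed
qed

lemma norm_on_zero_AE:
  assumes S: "S \<in> sets lebesgue" and f: "L2on S f" "norm_on S f = 0"
  shows "AE X in lborel. X \<in> S \<longrightarrow> f X = 0"
proof -
  have "AE X in lebesgue_on S. f X = 0"
    using f S nrm_eq_0_AE[of "lebesgue_on S" f] by (simp add: L2on_iff_sq_int norm_on_eq_nrm)
  then have "AE X in lebesgue. X \<in> S \<longrightarrow> f X = 0" using S by (simp add: AE_restrict_space_iff)
  then show ?thesis by (simp add: AE_completion_iff)
qed

lemma inner_on_add_right:
  assumes "S \<in> sets lebesgue" "L2on S f" "L2on S g" "L2on S h"
  shows "inner_on S f (\<lambda>x. g x + h x) = inner_on S f g + inner_on S f h"
  using assms by (simp add: L2on_iff_sq_int inner_on_eq_ip ip_add_right)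

lemma inner_on_cmult_right: "S \<in> sets lebesgue \<Longrightarrow> inner_on S f (\<lambda>x. c * g x) = c * inner_on S f g"
  by (simp add: inner_on_eq_ip ip_cmult_right)

lemma inner_on_cong_AE_right:
  assumes S: "S \<in> sets lebesgue" and L: "L2on S f" "L2on S g" "L2on S h" and eq: "AE X in lborel. X \<in> S \<longrightarrow> g X = h X"
  shows "inner_on S f g = inner_on S f h"
proof -
  have "AE X in lebesgue. X \<in> S \<longrightarrow> g X = h X" by (rule AE_completion[OF eq])
  then have "AE X in lebesgue_on S. g X = h X" using S by (simp add: AE_restrict_space_iff)
  then show ?thesis
    using L S unfolding inner_on_eq_ip[OF S] by (intro ip_cong_AE) (auto simp: L2on_iff_sq_int sq_int_def)
qed

text \<open>Expand the square norm of \<open>f s = f t + (s - t) (f' + E s)\<close>: the error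
  \<open>E s\<close> tends to zero in norm, and the quadratic term keeps a spare factor
  \<open>s - t\<close>.\<close>

lemma has_real_derivative_norm_on_sq:
  assumes S: "S \<in> sets lebesgue" and t: "t \<in> T" and L2: "\<And>s. s \<in> T \<Longrightarrow> L2on S (f s)" and d: "has_L2_derivative S f f' t T"
  shows "((\<lambda>s. (norm_on S (f s))\<^sup>2) has_real_derivative 2 * Re (inner_on S (f t) f')) (at t within T)"
  unfolding has_field_derivative_iff
proof -
  let ?M = "lebesgue_on S"
  have f': "sq_int ?M f'" and lim: "((\<lambda>s. nrm ?M (\<lambda>x. (f s x - f t x) / complex_of_real (s - t) - f' x)) \<longlongrightarrow> 0) (at t within T)"
    using d S by (auto simp: has_L2_derivative_def L2on_iff_sq_int norm_on_eq_nrm)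
  have sq: "sq_int ?M (f s)" if "s \<in> T" for s using L2[OF that] S by (simp add: L2on_iff_sq_int)
  define E where "E s x = (f s x - f t x) / complex_of_real (s - t) - f' x" for s x
  have E: "sq_int ?M (E s)" if "s \<in> T" for s
    unfolding E_def by (intro sq_int_diff sq_int_divide sq that t f')
  have Elim: "((\<lambda>s. nrm ?M (E s)) \<longlongrightarrow> 0) (at t within T)" using lim by (simp add: E_def[abs_def])
  have evT: "eventually (\<lambda>s. s \<in> T \<and> s \<noteq> t) (at t within T)" by (simp add: eventually_at_filter)
  have eq: "((nrm ?M (f s))\<^sup>2 - (nrm ?M (f t))\<^sup>2) / (s - t) =
      2 * Re (ip ?M (f t) f') + 2 * Re (ip ?M (f t) (E s)) + (s - t) * (nrm ?M (\<lambda>x. f' x + E s x))\<^sup>2" if s: "s \<in> T" "s \<noteq> t" for s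
  proof -
    let ?g = "\<lambda>x. f' x + E s x"
    have g: "sq_int ?M ?g" by (intro sq_int_add f' E s)
    have "f s x = f t x + complex_of_real (s - t) * ?g x" for x
      using s(2) by (simp add: E_def)
    then have "nrm ?M (f s) = nrm ?M (\<lambda>x. f t x + complex_of_real (s - t) * ?g x)" by presburger
    then have "(nrm ?M (f s))\<^sup>2 = (nrm ?M (f t))\<^sup>2 + 2 * Re (complex_of_real (s - t) * ip ?M (f t) ?g) + (\<bar>s - t\<bar> * nrm ?M ?g)\<^sup>2"
      using nrm_add_sq[OF sq[OF t] sq_int_cmult[OF g, of "complex_of_real (s - t)"]]
      by (simp only: ip_cmult_right nrm_cmult norm_of_real)
    also have "ip ?M (f t) ?g = ip ?M (f t) f' + ip ?M (f t) (E s)" by (rule ip_add_right[OF sq[OF t] f' E[OF s(1)]])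
    also have "(\<bar>s - t\<bar> * nrm ?M ?g)\<^sup>2 = (s - t) * ((s - t) * (nrm ?M ?g)\<^sup>2)"
      by (simp add: power_mult_distrib power2_eq_square[of "s - t"])
    finally have "(nrm ?M (f s))\<^sup>2 - (nrm ?M (f t))\<^sup>2 = (s - t) * (2 * Re (ip ?M (f t) f') + 2 * Re (ip ?M (f t) (E s)) + (s - t) * (nrm ?M ?g)\<^sup>2)"
      by (simp add: algebra_simps)
    then show ?thesis using s(2) by simp
  qed
  have l1: "((\<lambda>s. Re (ip ?M (f t) (E s))) \<longlongrightarrow> 0) (at t within T)"
  proof (rule Lim_null_comparison[of _ "\<lambda>s. nrm ?M (f t) * nrm ?M (E s)"])
    show "eventually (\<lambda>s. norm (Re (ip ?M (f t) (E s))) \<le> nrm ?M (f t) * nrm ?M (E s)) (at t within T)"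
      using evT
    proof eventually_elim
      case (elim s)
      have "norm (Re (ip ?M (f t) (E s))) \<le> norm (ip ?M (f t) (E s))" by (simp add: abs_Re_le_cmod)
      also have "\<dots> \<le> nrm ?M (f t) * nrm ?M (E s)" using elim by (intro ip_Cauchy_Schwarz sq E t) auto
      finally show ?case .
    qed
    show "((\<lambda>s. nrm ?M (f t) * nrm ?M (E s)) \<longlongrightarrow> 0) (at t within T)" using tendsto_mult[OF tendsto_const Elim] by simp
  qed
  have l2: "((\<lambda>s. (s - t) * (nrm ?M (\<lambda>x. f' x + E s x))\<^sup>2) \<longlongrightarrow> 0) (at t within T)"
  proof (rule Lim_null_comparison[of _ "\<lambda>s. \<bar>s - t\<bar> * (nrm ?M f' + nrm ?M (E s))\<^sup>2"])
    show "eventually (\<lambda>s. norm ((s - t) * (nrm ?M (\<lambda>x. f' x + E s x))\<^sup>2) \<le> \<bar>s - t\<bar> * (nrm ?M f' + nrm ?M (E s))\<^sup>2) (at t within T)"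
      using evT
    proof eventually_elim
      case (elim s)
      have "(nrm ?M (\<lambda>x. f' x + E s x))\<^sup>2 \<le> (nrm ?M f' + nrm ?M (E s))\<^sup>2"
        using elim by (intro power_mono nrm_triangle f' E) auto
      then show ?case by (simp add: abs_mult mult_left_mono)
    qed
    have "((\<lambda>s. \<bar>s - t\<bar> * (nrm ?M f' + nrm ?M (E s))\<^sup>2) \<longlongrightarrow> \<bar>t - t\<bar> * (nrm ?M f' + 0)\<^sup>2) (at t within T)"
      by (intro tendsto_intros Elim)
    then show "((\<lambda>s. \<bar>s - t\<bar> * (nrm ?M f' + nrm ?M (E s))\<^sup>2) \<longlongrightarrow> 0) (at t within T)" by simp
  qed
  have "((\<lambda>s. 2 * Re (ip ?M (f t) f') + 2 * Re (ip ?M (f t) (E s)) + (s - t) * (nrm ?M (\<lambda>x. f' x + E s x))\<^sup>2) \<longlongrightarrow> 2 * Re (ip ?M (f t) f') + 2 * 0 + 0) (at t within T)"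
    by (intro tendsto_intros l1 l2)
  moreover have "eventually (\<lambda>s. 2 * Re (ip ?M (f t) f') + 2 * Re (ip ?M (f t) (E s)) + (s - t) * (nrm ?M (\<lambda>x. f' x + E s x))\<^sup>2 =
     ((nrm ?M (f s))\<^sup>2 - (nrm ?M (f t))\<^sup>2) / (s - t)) (at t within T)"
    using evT by eventually_elim (simp add: eq)
  ultimately have "((\<lambda>s. ((nrm ?M (f s))\<^sup>2 - (nrm ?M (f t))\<^sup>2) / (s - t)) \<longlongrightarrow> 2 * Re (ip ?M (f t) f') + 2 * 0 + 0) (at t within T)"
    by (rule Lim_transform_eventually)
  then show "((\<lambda>s. ((norm_on S (f s))\<^sup>2 - (norm_on S (f t))\<^sup>2) / (s - t)) \<longlongrightarrow> 2 * Re (inner_on S (f t) f')) (at t within T)"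
    using S by (simp add: norm_on_eq_nrm inner_on_eq_ip)
qed

text \<open>Regularising the square root avoids dividing by \<open>n\<close>, which vanishes at \<open>0\<close>.\<close>

lemma linear_growth:
  fixes n g' :: "real \<Rightarrow> real"
  assumes d: "\<And>s. s \<in> {0..T} \<Longrightarrow> ((\<lambda>s. (n s)\<^sup>2) has_real_derivative g' s) (at s within {0..T})"
    and le: "\<And>s. s \<in> {0..T} \<Longrightarrow> g' s \<le> 2 * K * n s" and n: "\<And>s. n s \<ge> 0" and n0: "n 0 = 0" and K: "K \<ge> 0" and t: "t \<in> {0..T}"
  shows "n t \<le> K * t"
proof (rule field_le_epsilon)
  fix e :: real assume e: "e > 0"
  let ?h = "\<lambda>s. sqrt ((n s)\<^sup>2 + e\<^sup>2)"
  have pos: "(n s)\<^sup>2 + e\<^sup>2 > 0" for s using e by (simp add: add_nonneg_pos)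
  have dh: "(?h has_real_derivative g' s / (2 * ?h s)) (at s within {0..t})" if "s \<in> {0..t}" for s
  proof -
    have s: "s \<in> {0..T}" using that t by auto
    have "((\<lambda>s. (n s)\<^sup>2) has_real_derivative g' s) (at s within {0..t})"
      by (rule DERIV_subset[OF d[OF s]]) (use t in auto)
    then have "((\<lambda>s. (n s)\<^sup>2 + e\<^sup>2) has_real_derivative g' s) (at s within {0..t})"
      using DERIV_add[OF _ DERIV_const] by fastforce
    from DERIV_chain2[OF DERIV_real_sqrt[OF pos[of s]] this]
    show ?thesis by (simp add: field_simps)
  qed
  have bound: "g' s / (2 * ?h s) \<le> K" if "s \<in> {0..t}" for s
  proof -
    have s: "s \<in> {0..T}" using that t by auto
    have "n s \<le> ?h s" using n[of s] by (intro real_le_rsqrt) auto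
    then have "g' s \<le> 2 * K * ?h s" using le[OF s] mult_left_mono[of "n s" "?h s" "2 * K"] K by linarith
    then show ?thesis using pos[of s] by (simp add: divide_le_eq mult_ac)
  qed
  \<comment> \<open>Mean value theorem for the regularised norm, whose derivative is at most
    \<open>K\<close> also where \<open>n\<close> vanishes.\<close>
  have "\<exists>s\<in>{0..t}. ?h t - ?h 0 = (g' s / (2 * ?h s)) * (t - 0)"
  proof -
    have "(?h has_derivative (*) (g' s / (2 * ?h s))) (at s within {0..t})" if "0 \<le> s" "s \<le> t" for s
      using dh[of s] that by (simp only: has_field_derivative_def atLeastAtMost_iff)
    then show ?thesis
      by (intro mvt_very_simple[of 0 t ?h "\<lambda>s. (*) (g' s / (2 * ?h s))"]) (use t in auto)
  qed
  then obtain s where s: "s \<in> {0..t}" "?h t - ?h 0 = (g' s / (2 * ?h s)) * t" by auto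
  have "?h t \<le> K * t + ?h 0" using s(2) mult_right_mono[OF bound[OF s(1)], of t] t by auto
  moreover have "?h 0 = e" using n0 e by simp
  moreover have "n t \<le> ?h t" using n[of t] by (intro real_le_rsqrt) auto
  ultimately show "n t \<le> K * t + e" by linarith
qed

text \<open>A Borel version of a symmetric function need not be symmetric, and an essential bound
  holds only almost everywhere. Averaging over the swap and clipping at \<open>C\<close> repairs
  both for all arguments, without changing the pair sum at almost every configuration in the
  box.\<close>

lemma pair_potential_borel:
  fixes V :: "real \<times> real \<Rightarrow> real \<times> real \<Rightarrow> real"
  assumes V_meas: "set_borel_measurable lebesgue (box_Lambda L1 L2 \<times> box_Lambda L1 L2) (\<lambda>z. V (fst z) (snd z))"
    and V_sym: "\<And>x y. V x y = V y x" and C: "C \<ge> 0"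
    and V_bdd: "AE z in lebesgue. z \<in> box_Lambda L1 L2 \<times> box_Lambda L1 L2 \<longrightarrow> \<bar>V (fst z) (snd z)\<bar> \<le> C"
  shows "\<exists>v. (\<lambda>(x, y). v x y) \<in> borel_measurable (lborel \<Otimes>\<^sub>M lborel) \<and> (\<forall>x y. v x y = v y x) \<and> (\<forall>x y. \<bar>v x y\<bar> \<le> C) \<and>
    (AE X in (lborel :: ((real \<times> real) ^ ('n::{finite,linorder})) measure). X \<in> box_LambdaN L1 L2 \<longrightarrow>
       pair_pot V X = (\<Sum>(i, j)\<in>{(i, j). i < j}. v (X $ i) (X $ j)))"
proof -
  let ?S = "box_Lambda L1 L2 \<times> box_Lambda L1 L2"
  obtain g where g: "g \<in> borel_measurable lborel" "AE z in lborel. indicat_real ?S z *\<^sub>R V (fst z) (snd z) = g z"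
    using completion_ex_borel_measurable_real[OF V_meas[unfolded set_borel_measurable_def]] by blast
  define v where "v x y = max (- C) (min C ((g (x, y) + g (y, x)) / 2))" for x y
  have [measurable]: "g \<in> borel_measurable (lborel \<Otimes>\<^sub>M lborel)" using g(1) by (simp add: lborel_prod)
  have "(\<lambda>(x, y). v x y) \<in> borel_measurable (lborel \<Otimes>\<^sub>M lborel)" unfolding v_def by measurable
  moreover have "v x y = v y x" for x y by (simp add: v_def add.commute)
  moreover have "\<bar>v x y\<bar> \<le> C" for x y using C by (auto simp: v_def)
  moreover have "AE X in (lborel :: ((real \<times> real) ^ ('n::{finite,linorder})) measure). X \<in> box_LambdaN L1 L2 \<longrightarrow>
       pair_pot V X = (\<Sum>(i, j)\<in>{(i, j). i < j}. v (X $ i) (X $ j))"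
  proof -
    have b: "AE z in lborel. z \<in> ?S \<longrightarrow> \<bar>V (fst z) (snd z)\<bar> \<le> C" using V_bdd by (simp add: AE_completion_iff)
    have "AE z in lborel. z \<in> ?S \<longrightarrow> V (fst z) (snd z) = g z \<and> \<bar>V (fst z) (snd z)\<bar> \<le> C"
      using g(2) b by eventually_elim auto
    note ae = AE_lborel_pair_coordinates[OF _ this]
    have "AE X in (lborel :: ((real \<times> real) ^ ('n::{finite,linorder})) measure). \<forall>i j. i \<noteq> j \<longrightarrow> (X $ i, X $ j) \<in> ?S \<longrightarrow> V (X $ i) (X $ j) = g (X $ i, X $ j) \<and> \<bar>V (X $ i) (X $ j)\<bar> \<le> C"
      unfolding AE_all_countable
    proof (intro allI)
      fix i j :: 'n
      show "AE X in (lborel :: ((real \<times> real) ^ ('n::{finite,linorder})) measure). i \<noteq> j \<longrightarrow> (X $ i, X $ j) \<in> ?S \<longrightarrow> V (X $ i) (X $ j) = g (X $ i, X $ j) \<and> \<bar>V (X $ i) (X $ j)\<bar> \<le> C"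
        using ae[of i j] by (cases "i = j") auto
    qed
    then show ?thesis
    proof eventually_elim
      case (elim X)
      show ?case
      proof
        assume X: "X \<in> box_LambdaN L1 L2"
        have "V (X $ i) (X $ j) = v (X $ i) (X $ j)" if "i < j" for i j
        proof -
          have mem: "(X $ i, X $ j) \<in> ?S" "(X $ j, X $ i) \<in> ?S" using X by (simp_all add: box_LambdaN_def)
          have ne: "i \<noteq> j" "j \<noteq> i" using that by auto
          have 1: "V (X $ i) (X $ j) = g (X $ i, X $ j)" "\<bar>V (X $ i) (X $ j)\<bar> \<le> C" "V (X $ j) (X $ i) = g (X $ j, X $ i)"
            using elim[rule_format, OF ne(1) mem(1)] elim[rule_format, OF ne(2) mem(2)] by blast+
          then have "(g (X $ i, X $ j) + g (X $ j, X $ i)) / 2 = V (X $ i) (X $ j)" using V_sym[of "X $ i" "X $ j"] by simp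
          then show ?thesis using 1(2) by (simp add: v_def)
        qed
        then show "pair_pot V X = (\<Sum>(i, j)\<in>{(i, j). i < j}. v (X $ i) (X $ j))"
          unfolding pair_pot_def by (intro sum.cong) auto
      qed
    qed
  qed
  ultimately show ?thesis by blast
qed

text \<open>Twice the sum over increasing pairs is the sum over all pairs of distinct labels, which
  a permutation merely rearranges. It makes the interaction invariant, hence the residual
  antisymmetric.\<close>

lemma sum_less_pairs_permute:
  fixes F :: "'n::{finite,linorder} \<Rightarrow> 'n \<Rightarrow> real" and p :: "'n \<Rightarrow> 'n"
  assumes sym: "\<And>i j. F i j = F j i" and p: "bij p"
  shows "(\<Sum>(i, j)\<in>{(i, j). i < j}. F (p i) (p j)) = (\<Sum>(i, j)\<in>{(i, j). i < j}. F i j)"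
proof -
  have half: "2 * (\<Sum>(i, j)\<in>{(i, j). i < j}. G i j) = (\<Sum>(i, j)\<in>{(i, j). i \<noteq> j}. G i j)"
    if s: "\<And>i j. G i j = G j i" for G :: "'n \<Rightarrow> 'n \<Rightarrow> real"
  proof -
    have "{(i, j). i \<noteq> j} = {(i::'n, j). i < j} \<union> {(i, j). j < i}" by auto
    then have "(\<Sum>(i, j)\<in>{(i, j). i \<noteq> j}. G i j) = (\<Sum>(i, j)\<in>{(i, j). i < j}. G i j) + (\<Sum>(i, j)\<in>{(i, j). j < i}. G i j)"
      by (subst sum.union_disjoint[symmetric]) auto
    also have "(\<Sum>(i, j)\<in>{(i, j). j < i}. G i j) = (\<Sum>(i, j)\<in>{(i, j). i < j}. G i j)"
      by (rule sum.reindex_bij_witness[of _ prod.swap prod.swap]) (auto simp: s)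
    finally show ?thesis by simp
  qed
  have "(\<Sum>(i, j)\<in>{(i, j). i \<noteq> j}. F (p i) (p j)) = (\<Sum>(i, j)\<in>{(i, j). i \<noteq> j}. F i j)"
    by (rule sum.reindex_bij_witness[of _ "map_prod (inv p) (inv p)" "map_prod p p"])
       (use p in \<open>auto simp: bij_is_inj bij_is_surj inv_f_f surj_f_inv_f inj_eq inj_eq[OF bij_is_inj[OF bij_imp_bij_inv[OF p]]]\<close>)
  then show ?thesis using half[of F] half[of "\<lambda>i j. F (p i) (p j)"] sym by simp
qed

text \<open>By antisymmetry one factor of the inner product may be replaced by a product state;
  orthonormality then leaves the identity permutation alone, and \<open>N!\<close> cancels against
  the normalisation.\<close>

lemma norm_on_wedge_orthonormal:
  fixes \<phi> :: "'n::finite \<Rightarrow> real \<times> real \<Rightarrow> complex"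
  assumes \<phi>: "\<And>k. L2on (box_Lambda L1 L2) (\<phi> k)"
    and orth: "\<And>i j. inner_on (box_Lambda L1 L2) (\<phi> i) (\<phi> j) = (if i = j then 1 else 0)"
  shows "norm_on (box_LambdaN L1 L2) (wedge \<phi>) = 1"
proof -
  have "\<forall>k. \<exists>g. borel_rep (box_Lambda L1 L2) (\<phi> k) g"
    using \<phi> by (auto intro!: borel_rep_exists simp: L2on_def)
  then obtain \<phi>' where \<phi>': "\<And>k. borel_rep (box_Lambda L1 L2) (\<phi> k) (\<phi>' k)" by metis
  have sq: "sq_int lborel (\<phi>' k)" for k using borel_rep_sq_int[OF \<phi>'] \<phi> by blast
  have o: "ip lborel (\<phi>' i) (\<phi>' j) = (if i = j then 1 else 0)" for i j
    using borel_rep_inner_on[OF \<phi>' \<phi>'] orth by simp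
  have rep: "borel_rep (box_LambdaN L1 L2) (wedge \<phi>) (wedge \<phi>')" by (rule borel_rep_wedge[OF \<phi>'])
  have m: "wedge \<phi>' \<in> borel_measurable borel" by (rule borel_repD(1)[OF rep])
  note sl = sq_int_slater[OF sigma_finite_lborel, of \<phi>', OF sq]
  have "ip (PiU lborel) (slater \<phi>') (slater \<phi>') = fact CARD('n) * ip (PiU lborel) (tensor \<phi>') (slater \<phi>')"
    by (rule ip_slater_antisymmetric[OF sigma_finite_lborel sq sl antisymmetric_slater])
  also have "ip (PiU lborel) (tensor \<phi>') (slater \<phi>') = (\<Sum>p\<in>{p. p permutes UNIV}. of_int (sign p) * ip (PiU lborel) (tensor \<phi>') (tensor (\<phi>' \<circ> p)))"
    unfolding slater_def
    by (subst ip_sum_right) (auto simp: ip_cmult_right sq intro!: sq_int_cmult sq_int_tensor[OF sigma_finite_lborel])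
  also have "\<dots> = (\<Sum>p\<in>{p. p permutes (UNIV :: 'n set)}. if p = id then 1 else 0)"
  proof (rule sum.cong[OF refl])
    fix p :: "'n \<Rightarrow> 'n" assume "p \<in> {p. p permutes UNIV}"
    have "ip (PiU lborel) (tensor \<phi>') (tensor (\<phi>' \<circ> p)) = (\<Prod>k\<in>UNIV. if k = p k then 1 else 0)"
      using ip_tensor[OF sigma_finite_lborel, of \<phi>' "\<phi>' \<circ> p"] sq by (simp add: o)
    also have "\<dots> = (if p = id then 1 else 0)"
    proof (cases "p = id")
      case False
      then obtain k where "p k \<noteq> k" by (auto simp: fun_eq_iff)
      then show ?thesis using False by (simp, intro exI[of _ k]) auto
    qed simp
    finally show "of_int (sign p) * ip (PiU lborel) (tensor \<phi>') (tensor (\<phi>' \<circ> p)) = (if p = id then 1 else 0)"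
      by (simp add: sign_id)
  qed
  also have "\<dots> = 1" by (simp add: permutes_id finite_permutations)
  finally have "complex_of_real ((nrm (PiU lborel) (slater \<phi>'))\<^sup>2) = of_real (fact CARD('n))"
    unfolding ip_self by simp
  then have n: "(nrm (PiU lborel) (slater \<phi>'))\<^sup>2 = fact CARD('n)" by (simp only: of_real_eq_iff)
  have w: "(\<lambda>X. wedge \<phi>' (vec_lambda X)) = (\<lambda>X. inverse (complex_of_real (sqrt (fact CARD('n)))) * slater \<phi>' X)"
    by (auto simp: wedge_eq_slater vec_lambda_inverse field_simps)
  have "(norm_on (box_LambdaN L1 L2) (wedge \<phi>))\<^sup>2 = 1\<^sup>2"
    unfolding borel_rep_norm_on[OF rep] nrm_lborel_vec[OF m] w nrm_cmult
    by (simp add: power_mult_distrib n norm_inverse power_inverse)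
  then show ?thesis by (rule power2_eq_imp_eq) (auto simp: norm_on_nonneg)
qed

section \<open>The residual of a variational approximation\<close>

lemma L2on_pair_pot:
  fixes V :: "real \<times> real \<Rightarrow> real \<times> real \<Rightarrow> real" and f :: "(real \<times> real) ^ ('n::{finite,linorder}) \<Rightarrow> complex"
  assumes V_meas: "set_borel_measurable lebesgue (box_Lambda L1 L2 \<times> box_Lambda L1 L2) (\<lambda>z. V (fst z) (snd z))"
    and V_sym: "\<And>x y. V x y = V y x" and C: "C \<ge> 0"
    and V_bdd: "AE z in lebesgue. z \<in> box_Lambda L1 L2 \<times> box_Lambda L1 L2 \<longrightarrow> \<bar>V (fst z) (snd z)\<bar> \<le> C"
    and f: "L2on (box_LambdaN L1 L2) f"
  shows "L2on (box_LambdaN L1 L2) (\<lambda>X. of_real (pair_pot V X) * f X)"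
proof -
  let ?P = "{(i::'n, j). i < j}"
  obtain v where v: "(\<lambda>(x, y). v x y) \<in> borel_measurable (lborel \<Otimes>\<^sub>M lborel)" "\<And>x y. \<bar>v x y\<bar> \<le> C"
    "AE X in (lborel :: ((real \<times> real) ^ ('n::{finite,linorder})) measure). X \<in> box_LambdaN L1 L2 \<longrightarrow> pair_pot V X = (\<Sum>(i, j)\<in>?P. v (X $ i) (X $ j))"
    using pair_potential_borel[OF V_meas V_sym C V_bdd] by blast
  obtain f' where f': "borel_rep (box_LambdaN L1 L2) f f'"
    using borel_rep_exists[of "box_LambdaN L1 L2" f] f by (auto simp: L2on_def)
  have f'sq: "sq_int lborel f'" using borel_rep_sq_int[OF f'] f by blast
  have vm: "(\<lambda>X :: (real \<times> real) ^ ('n::{finite,linorder}). v (X $ i) (X $ j)) \<in> borel_measurable borel" for i j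
  proof -
    have "(\<lambda>X :: (real \<times> real) ^ ('n::{finite,linorder}). (X $ i, X $ j)) \<in> measurable borel (lborel \<Otimes>\<^sub>M lborel)"
      by (simp add: lborel_prod)
    from measurable_compose[OF this v(1)] show ?thesis by simp
  qed
  let ?W = "\<lambda>X. \<Sum>(i, j)\<in>?P. v (X $ i) (X $ j)"
  have Wm: "(\<lambda>X :: (real \<times> real) ^ ('n::{finite,linorder}). complex_of_real (?W X)) \<in> borel_measurable borel"
    unfolding case_prod_unfold of_real_sum by (intro borel_measurable_sum measurable_compose[OF vm borel_measurable_of_real])
  have Wle: "norm (complex_of_real (?W X)) \<le> real (card ?P) * C" for X
  proof -
    have "\<bar>?W X\<bar> \<le> (\<Sum>z\<in>?P. C)" unfolding case_prod_unfold by (rule order_trans[OF sum_abs]) (intro sum_mono v(2))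
    then show ?thesis by (simp only: norm_of_real sum_constant)
  qed
  have sq: "sq_int lborel (\<lambda>X. complex_of_real (?W X) * f' X)"
    by (rule sq_int_mult_bounded[OF _ f'sq, where C="real (card ?P) * C"]) (use Wm Wle in auto)
  have "borel_rep (box_LambdaN L1 L2) (\<lambda>X. of_real (pair_pot V X) * f X) (\<lambda>X. complex_of_real (?W X) * f' X)"
    unfolding borel_rep_def
  proof (intro conjI allI impI)
    show "AE X in lborel. X \<in> box_LambdaN L1 L2 \<longrightarrow> of_real (pair_pot V X) * f X = complex_of_real (?W X) * f' X"
      using v(3) borel_repD(3)[OF f'] by eventually_elim auto
    show "(\<lambda>X. complex_of_real (?W X) * f' X) \<in> borel_measurable borel"
      by (intro borel_measurable_times Wm borel_repD(1)[OF f'])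
  qed (simp add: borel_repD(2)[OF f'])
  from borel_rep_sq_int[OF this] sq show ?thesis by blast
qed

lemma inner_on_real_mult: "Im (inner_on S f (\<lambda>x. of_real (w x) * f x)) = 0"
proof -
  have e: "cnj (f x) * (of_real (w x) * f x) = complex_of_real (w x * (cmod (f x))\<^sup>2)" for x
  proof -
    have "cnj (f x) * (of_real (w x) * f x) = of_real (w x) * (cnj (f x) * f x)" by (simp only: mult_ac)
    also have "\<dots> = complex_of_real (w x * (cmod (f x))\<^sup>2)" by (simp only: cnj_mult_self of_real_mult)
    finally show ?thesis .
  qed
  have s: "indicat_real S x *\<^sub>R complex_of_real r = complex_of_real (indicat_real S x * r)" for x r
    by (simp add: scaleR_conv_of_real)
  show ?thesis unfolding inner_on_def set_lebesgue_integral_def e s integral_complex_of_real by simp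
qed

text \<open>Kinetic energy and time derivative enter through the tangent vector given by
  \<open>c\<close> and \<open>\<eta>\<close> alone; as \<open>r\<close> is orthogonal to it, the
  interaction is the sole source of the residual.\<close>

lemma residual_bound:
  fixes V :: "real \<times> real \<Rightarrow> real \<times> real \<Rightarrow> real" and \<phi> \<eta> :: "'n::{finite,linorder} \<Rightarrow> real \<times> real \<Rightarrow> complex"
    and r :: "(real \<times> real) ^ ('n::{finite,linorder}) \<Rightarrow> complex"
  assumes V_meas: "set_borel_measurable lebesgue (box_Lambda L1 L2 \<times> box_Lambda L1 L2) (\<lambda>z. V (fst z) (snd z))"
    and V_sym: "\<And>x y. V x y = V y x" and C: "C \<ge> 0"
    and V_bdd: "AE z in lebesgue. z \<in> box_Lambda L1 L2 \<times> box_Lambda L1 L2 \<longrightarrow> \<bar>V (fst z) (snd z)\<bar> \<le> C"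
    and \<phi>: "\<And>k. L2on (box_Lambda L1 L2) (\<phi> k)" and \<eta>: "\<And>k. L2on (box_Lambda L1 L2) (\<eta> k)"
    and orth: "\<And>i j. inner_on (box_Lambda L1 L2) (\<phi> i) (\<phi> j) = (if i = j then 1 else 0)"
    and a: "norm a = 1"
    and r: "AE X in lborel. X \<in> box_LambdaN L1 L2 \<longrightarrow> r X = of_real (pair_pot V X) * (a * wedge \<phi> X) - tangent_vec a \<phi> c \<eta> X"
    and dirac: "\<And>adot \<phi>dot. (\<And>j. L2on (box_Lambda L1 L2) (\<phi>dot j)) \<Longrightarrow>
       inner_on (box_LambdaN L1 L2) (tangent_vec a \<phi> adot \<phi>dot) r = 0"
  shows "norm_on (box_LambdaN L1 L2) r \<le> C * sqrt (real (CARD('n) * (CARD('n) - 1)) / 2)"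
proof -
  let ?P = "{(i::'n, j). i < j}" and ?\<Lambda> = "box_Lambda L1 L2" and ?S = "box_LambdaN L1 L2 :: ((real \<times> real) ^ ('n::{finite,linorder})) set"
  let ?PM = "PiU lborel :: ('n \<Rightarrow> real \<times> real) measure"
  let ?c = "complex_of_real (sqrt (fact CARD('n)))"
  note sf = sigma_finite_lborel
  obtain v where v: "(\<lambda>(x, y). v x y) \<in> borel_measurable (lborel \<Otimes>\<^sub>M lborel)" "\<And>x y. v x y = v y x" "\<And>x y. \<bar>v x y\<bar> \<le> C"
    "AE X in (lborel :: ((real \<times> real) ^ ('n::{finite,linorder})) measure). X \<in> ?S \<longrightarrow> pair_pot V X = (\<Sum>(i, j)\<in>?P. v (X $ i) (X $ j))"
    using pair_potential_borel[OF V_meas V_sym C V_bdd] by blast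
  have "\<forall>k. \<exists>g. borel_rep ?\<Lambda> (\<phi> k) g" using \<phi> by (auto intro!: borel_rep_exists simp: L2on_def)
  then obtain \<phi>' where \<phi>': "\<And>k. borel_rep ?\<Lambda> (\<phi> k) (\<phi>' k)" by metis
  have "\<forall>k. \<exists>g. borel_rep ?\<Lambda> (\<eta> k) g" using \<eta> by (auto intro!: borel_rep_exists simp: L2on_def)
  then obtain \<eta>' where \<eta>': "\<And>k. borel_rep ?\<Lambda> (\<eta> k) (\<eta>' k)" by metis
  have \<phi>sq: "sq_int lborel (\<phi>' k)" and \<eta>sq: "sq_int lborel (\<eta>' k)" for k
    using borel_rep_sq_int[OF \<phi>'] \<phi> borel_rep_sq_int[OF \<eta>'] \<eta> by blast+
  have o: "ip lborel (\<phi>' i) (\<phi>' j) = (if i = j then 1 else 0)" for i j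
    using borel_rep_inner_on[OF \<phi>' \<phi>'] orth by simp
  let ?W = "\<lambda>X. \<Sum>(i, j)\<in>?P. v (X $ i) (X $ j)"
  define r' where "r' X = of_real (?W X) * (a * wedge \<phi>' X) - tangent_vec a \<phi>' c \<eta>' X" for X
  have vm: "(\<lambda>X :: (real \<times> real) ^ ('n::{finite,linorder}). v (X $ i) (X $ j)) \<in> borel_measurable borel" for i j
  proof -
    have "(\<lambda>X :: (real \<times> real) ^ ('n::{finite,linorder}). (X $ i, X $ j)) \<in> measurable borel (lborel \<Otimes>\<^sub>M lborel)"
      by (simp add: lborel_prod)
    from measurable_compose[OF this v(1)] show ?thesis by simp
  qed
  have Wm: "(\<lambda>X :: (real \<times> real) ^ ('n::{finite,linorder}). complex_of_real (?W X)) \<in> borel_measurable borel"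
    unfolding case_prod_unfold of_real_sum by (intro borel_measurable_sum measurable_compose[OF vm borel_measurable_of_real])
  note rep_w = borel_rep_wedge[of _ _ \<phi> \<phi>', OF \<phi>'] and rep_t = borel_rep_tangent_vec[of _ _ \<phi> \<phi>' \<eta> \<eta>' a c, OF \<phi>' \<eta>']
  have rep_r: "borel_rep ?S r r'"
    unfolding borel_rep_def
  proof (intro conjI allI impI)
    show "AE X in lborel. X \<in> ?S \<longrightarrow> r X = r' X"
      using r v(4) borel_repD(3)[OF rep_w] borel_repD(3)[OF rep_t]
      by eventually_elim (auto simp: r'_def)
    show "r' \<in> borel_measurable borel"
      unfolding r'_def[abs_def]
      by (intro borel_measurable_diff borel_measurable_times borel_measurable_const Wm borel_repD(1)[OF rep_w] borel_repD(1)[OF rep_t])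
    show "r' X = 0" if "X \<notin> ?S" for X
      by (simp add: r'_def borel_repD(2)[OF rep_w that] borel_repD(2)[OF rep_t that])
  qed
  have r'm: "r' \<in> borel_measurable borel" by (rule borel_repD(1)[OF rep_r])
  define R where "R X = r' (vec_lambda X)" for X :: "'n \<Rightarrow> real \<times> real"
  define U where "U X = (a / ?c) * slater \<phi>' X" for X :: "'n \<Rightarrow> real \<times> real"
  define T where "T X = (c / ?c) * slater \<phi>' X + (\<Sum>j\<in>UNIV. (a / ?c) * slater (\<phi>'(j := \<eta>' j)) X)" for X :: "'n \<Rightarrow> real \<times> real"
  let ?WP = "\<lambda>X :: 'n \<Rightarrow> real \<times> real. \<Sum>(i, j)\<in>?P. v (X i) (X j)"
  have T: "tangent_vec a \<phi>' c \<eta>' (vec_lambda X) = T X" for X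
    by (simp add: tangent_vec_def T_def wedge_eq_slater vec_lambda_inverse sum_distrib_left)
  have RX: "R X = of_real (?WP X) * U X - T X" for X
    unfolding R_def r'_def T by (simp add: U_def wedge_eq_slater vec_lambda_inverse)
  have upd_sq: "sq_int lborel ((\<phi>'(j := \<eta>' j)) k)" for j k using \<phi>sq \<eta>sq by simp
  have slU: "sq_int ?PM (slater \<phi>')" by (rule sq_int_slater[OF sf \<phi>sq])
  have Usq: "sq_int ?PM U" unfolding U_def by (rule sq_int_cmult[OF slU])
  have Tsq: "sq_int ?PM T" unfolding T_def
    by (intro sq_int_add sq_int_sum sq_int_cmult slU sq_int_slater[OF sf upd_sq])
  have WPm: "(\<lambda>X. complex_of_real (?WP X)) \<in> borel_measurable ?PM"
    using measurable_compose[OF measurable_vec_lambda_lborel Wm] by (simp add: vec_lambda_inverse)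
  have WPle: "norm (complex_of_real (?WP X)) \<le> real (card ?P) * C" for X
  proof -
    have "\<bar>?WP X\<bar> \<le> (\<Sum>z\<in>?P. C)" unfolding case_prod_unfold by (rule order_trans[OF sum_abs]) (intro sum_mono v(3))
    then show ?thesis by (simp only: norm_of_real sum_constant)
  qed
  have WUsq: "sq_int ?PM (\<lambda>X. of_real (?WP X) * U X)"
    by (rule sq_int_mult_bounded[OF WPm Usq, where C="real (card ?P) * C"]) (use WPle in auto)
  have Req: "R = (\<lambda>X. of_real (?WP X) * U X - T X)" using RX by blast
  have Rsq: "sq_int ?PM R" unfolding Req by (rule sq_int_diff[OF WUsq Tsq])
  \<comment> \<open>The sign factors out of both parts: the interaction is invariant and all
    determinants are antisymmetric.\<close>
  have anti: "antisymmetric R"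
    unfolding antisymmetric_def
  proof (intro allI impI)
    fix p :: "'n \<Rightarrow> 'n" and X :: "'n \<Rightarrow> real \<times> real" assume p: "p permutes UNIV"
    have sl: "slater f (X \<circ> p) = of_int (sign p) * slater f X" for f :: "'n \<Rightarrow> real \<times> real \<Rightarrow> complex"
      using antisymmetric_slater[of f] p unfolding antisymmetric_def by blast
    have scale: "of_real w * (a / ?c * (s * x)) - (c / ?c * (s * y) + (\<Sum>j\<in>UNIV. a / ?c * (s * z j))) =
        s * (of_real w * (a / ?c * x) - (c / ?c * y + (\<Sum>j\<in>UNIV. a / ?c * z j)))" for w :: real and s x y and z :: "'n \<Rightarrow> complex"
      by (simp add: algebra_simps sum_distrib_left)
    have "?WP (X \<circ> p) = ?WP X"
      using sum_less_pairs_permute[of "\<lambda>i j. v (X i) (X j)" p] v(2) permutes_imp_bij[OF p] by (simp add: comp_def)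
    then show "R (X \<circ> p) = of_int (sign p) * R X"
      unfolding RX U_def T_def sl by (simp only: scale)
  qed
  have inner_tangent: "ip ?PM (\<lambda>X. tangent_vec a \<phi>' adot \<xi>' (vec_lambda X)) R = 0"
    if \<xi>: "\<And>k. L2on ?\<Lambda> (\<xi> k)" "\<And>k. borel_rep ?\<Lambda> (\<xi> k) (\<xi>' k)" for adot \<xi> \<xi>'
  proof -
    note rep = borel_rep_tangent_vec[of _ _ \<phi> \<phi>' \<xi> \<xi>' a adot, OF \<phi>' \<xi>(2)]
    have "ip lborel (tangent_vec a \<phi>' adot \<xi>') r' = 0"
      using borel_rep_inner_on[OF rep rep_r] dirac[OF \<xi>(1)] by simp
    then show ?thesis unfolding R_def ip_lborel_vec[OF borel_repD(1)[OF rep] r'm] .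
  qed
  \<comment> \<open>The Dirac-Frenkel condition speaks of directions on the box, while
    \<open>\<psi>\<close> lives on the whole plane. Cutting \<open>\<psi>\<close> off is harmless
    because \<open>R\<close> vanishes outside the box, and zero in the other directions isolates the
    summand \<open>i\<close>.\<close>
  have perp: "ip ?PM (slater (\<phi>'(i := \<psi>))) R = 0" if \<psi>: "sq_int lborel \<psi>" for i \<psi>
  proof -
    define \<psi>1 where "\<psi>1 x = indicat_real ?\<Lambda> x *\<^sub>R \<psi> x" for x
    define \<xi> where "\<xi> = (\<lambda>k. if k = i then \<psi>1 else (\<lambda>x. 0))"
    have \<psi>m: "\<psi> \<in> borel_measurable borel" using sq_int_measurable[OF \<psi>] by simp
    have rep1: "borel_rep ?\<Lambda> \<psi>1 \<psi>1"
      unfolding borel_rep_def \<psi>1_def using \<psi>m by auto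
    have sq1: "sq_int lborel \<psi>1"
      by (rule sq_int_bound[OF _ \<psi>, where C=1]) (use borel_repD(1)[OF rep1] in \<open>auto simp: \<psi>1_def indicator_def\<close>)
    have rep: "borel_rep ?\<Lambda> (\<xi> k) (\<xi> k)" for k using rep1 by (auto simp: \<xi>_def borel_rep_def)
    have L: "L2on ?\<Lambda> (\<xi> k)" for k
      using borel_rep_sq_int[OF rep] sq1 by (auto simp: \<xi>_def)
    have z: "slater (\<phi>'(j := \<xi> j)) X = (if j = i then slater (\<phi>'(i := \<psi>1)) X else 0)" for j X
    proof (cases "j = i")
      case False
      have "tensor (\<phi>'(j := \<xi> j) \<circ> p) X = 0" if p: "p permutes UNIV" for p
      proof -
        obtain k where "p k = j" using permutes_surj[OF p] by (metis surjD)
        then show ?thesis using False unfolding tensor_def by (intro prod_zero) (auto simp: \<xi>_def intro!: bexI[of _ k])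
      qed
      then show ?thesis using False by (simp add: slater_def)
    qed (simp add: \<xi>_def)
    have "ip ?PM (\<lambda>X. (a / ?c) * slater (\<phi>'(i := \<psi>1)) X) R = 0"
      using inner_tangent[where \<xi>=\<xi> and \<xi>'=\<xi> and adot=0, OF L rep] by (simp add: tangent_vec_def wedge_eq_slater vec_lambda_inverse z if_distrib[of "\<lambda>x. x / _"] cong: if_cong)
    moreover have "a / ?c \<noteq> 0" using a by auto
    ultimately have 0: "ip ?PM (slater (\<phi>'(i := \<psi>1))) R = 0" unfolding ip_cmult_left by (metis complex_cnj_zero_iff mult_eq_0_iff)
    have "cnj (slater (\<phi>'(i := \<psi>)) X) * R X = cnj (slater (\<phi>'(i := \<psi>1)) X) * R X" for X
    proof (cases "vec_lambda X \<in> ?S")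
      case True
      then have "X k \<in> ?\<Lambda>" for k by (simp add: box_LambdaN_def)
      then have "slater (\<phi>'(i := \<psi>)) X = slater (\<phi>'(i := \<psi>1)) X"
        unfolding slater_det by (intro arg_cong[where f=det]) (auto simp: vec_eq_iff \<psi>1_def)
      then show ?thesis by simp
    next
      case False
      then show ?thesis unfolding R_def by (simp add: borel_repD(2)[OF rep_r])
    qed
    then show ?thesis using 0 unfolding ip_def by (simp only:)
  qed
  have main: "norm (ip ?PM R (\<lambda>X. of_real (?WP X) * slater \<phi>' X)) \<le> nrm ?PM R * (C * sqrt (real (CARD('n) * (CARD('n) - 1)) / 2) * nrm ?PM (slater \<phi>'))"
    by (rule pair_potential_bound[OF sf \<phi>sq o Rsq anti perp v(1,3)])
  have ipT: "ip ?PM R T = 0"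
  proof -
    have "ip ?PM T R = 0" using inner_tangent[where \<xi>=\<eta> and \<xi>'=\<eta>' and adot=c, OF \<eta> \<eta>'] by (simp add: T)
    then show ?thesis by (metis cnj_ip complex_cnj_zero)
  qed
  have "complex_of_real ((nrm ?PM R)\<^sup>2) = ip ?PM R (\<lambda>X. of_real (?WP X) * U X) - ip ?PM R T"
    unfolding ip_self[symmetric] using ip_diff_right[OF Rsq WUsq Tsq] by (simp only: Req)
  also have "\<dots> = (a / ?c) * ip ?PM R (\<lambda>X. of_real (?WP X) * slater \<phi>' X)"
    unfolding ipT ip_cmult_right[symmetric] U_def by (simp add: mult_ac)
  finally have "norm (complex_of_real ((nrm ?PM R)\<^sup>2)) = norm (a / ?c) * norm (ip ?PM R (\<lambda>X. of_real (?WP X) * slater \<phi>' X))"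
    by (simp only: norm_mult)
  then have "(nrm ?PM R)\<^sup>2 \<le> norm (a / ?c) * (nrm ?PM R * (C * sqrt (real (CARD('n) * (CARD('n) - 1)) / 2) * nrm ?PM (slater \<phi>')))"
    using mult_left_mono[OF main, of "norm (a / ?c)"] by (simp only: norm_of_real abs_power2 norm_ge_zero)
  also have "\<dots> = nrm ?PM R * (C * sqrt (real (CARD('n) * (CARD('n) - 1)) / 2) * nrm ?PM U)"
    unfolding U_def nrm_cmult by (simp only: mult_ac)
  also have "nrm ?PM U = 1"
  proof -
    have "nrm ?PM U = norm a * norm_on ?S (wedge \<phi>)"
      unfolding borel_rep_norm_on[OF rep_w] nrm_lborel_vec[OF borel_repD(1)[OF rep_w]] nrm_cmult[symmetric]
      by (simp add: U_def[abs_def] wedge_eq_slater vec_lambda_inverse)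
    then show ?thesis using a norm_on_wedge_orthonormal[OF \<phi> orth] by simp
  qed
  finally have "(nrm ?PM R)\<^sup>2 \<le> nrm ?PM R * (C * sqrt (real (CARD('n) * (CARD('n) - 1)) / 2))" by simp
  moreover have "C * sqrt (real (CARD('n) * (CARD('n) - 1)) / 2) \<ge> 0" using C by simp
  \<comment> \<open>One factor of the norm is cancelled; if the norm is zero, the bound holds since
    its right-hand side is nonnegative.\<close>
  ultimately have "nrm ?PM R \<le> C * sqrt (real (CARD('n) * (CARD('n) - 1)) / 2)"
    using nrm_nonneg[of ?PM R] by (cases "nrm ?PM R = 0") (auto simp: power2_eq_square)
  moreover have "norm_on ?S r = nrm ?PM R"
    unfolding borel_rep_norm_on[OF rep_r] nrm_lborel_vec[OF r'm] R_def ..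
  ultimately show ?thesis by simp
qed

section \<open>The error of the variational approximation\<close>

lemma inner_on_diff_right:
  assumes "S \<in> sets lebesgue" "L2on S f" "L2on S g" "L2on S h"
  shows "inner_on S f (\<lambda>x. g x - h x) = inner_on S f g - inner_on S f h"
  using assms by (simp add: L2on_iff_sq_int inner_on_eq_ip ip_diff_right)

lemma inner_on_Cauchy_Schwarz:
  assumes "S \<in> sets lebesgue" "L2on S f" "L2on S g"
  shows "norm (inner_on S f g) \<le> norm_on S f * norm_on S g"
  using assms by (simp add: L2on_iff_sq_int inner_on_eq_ip norm_on_eq_nrm ip_Cauchy_Schwarz)

lemma norm_on_cmult: "S \<in> sets lebesgue \<Longrightarrow> norm_on S (\<lambda>x. c * f x) = norm c * norm_on S f"
  by (simp add: norm_on_eq_nrm nrm_cmult)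

lemma has_L2_derivative_diff:
  assumes S: "S \<in> sets lebesgue" and t: "t \<in> T" and L2: "\<And>s. s \<in> T \<Longrightarrow> L2on S (f s)" "\<And>s. s \<in> T \<Longrightarrow> L2on S (g s)"
    and f: "has_L2_derivative S f f' t T" and g: "has_L2_derivative S g g' t T"
  shows "has_L2_derivative S (\<lambda>s x. f s x - g s x) (\<lambda>x. f' x - g' x) t T"
  unfolding has_L2_derivative_def
proof
  have L': "L2on S f'" "L2on S g'" using f g by (auto simp: has_L2_derivative_def)
  then show "L2on S (\<lambda>x. f' x - g' x)" by (rule L2on_algebra(2)[OF S])
  let ?F = "\<lambda>s x. (f s x - f t x) / complex_of_real (s - t) - f' x" and ?G = "\<lambda>s x. (g s x - g t x) / complex_of_real (s - t) - g' x"
  have lim: "((\<lambda>s. norm_on S (?F s) + norm_on S (?G s)) \<longlongrightarrow> 0) (at t within T)"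
    using tendsto_add[of "\<lambda>s. norm_on S (?F s)" 0 _ "\<lambda>s. norm_on S (?G s)" 0] f g unfolding has_L2_derivative_def by simp
  have "eventually (\<lambda>s. s \<in> T) (at t within T)" by (simp add: eventually_at_filter)
  then have ev: "eventually (\<lambda>s. norm (norm_on S (\<lambda>x. (f s x - g s x - (f t x - g t x)) / complex_of_real (s - t) - (f' x - g' x)))
      \<le> norm_on S (?F s) + norm_on S (?G s)) (at t within T)"
  proof eventually_elim
    case (elim s)
    have LF: "L2on S (?F s)" by (intro L2on_algebra[OF S] L2 elim t L')
    have LG: "L2on S (?G s)" by (intro L2on_algebra[OF S] L2 elim t L')
    have eq: "(\<lambda>x. (f s x - g s x - (f t x - g t x)) / complex_of_real (s - t) - (f' x - g' x)) = (\<lambda>x. ?F s x + (- 1) * ?G s x)"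
      by (simp add: fun_eq_iff diff_divide_distrib)
    have "norm_on S (\<lambda>x. ?F s x + (- 1) * ?G s x) \<le> norm_on S (?F s) + norm_on S (\<lambda>x. (- 1) * ?G s x)"
      by (rule norm_on_triangle[OF S LF L2on_algebra(3)[OF S LG]])
    also have "norm_on S (\<lambda>x. (- 1) * ?G s x) = norm_on S (?G s)" unfolding norm_on_cmult[OF S] by simp
    finally show ?case unfolding eq using norm_on_nonneg[OF S] by simp
  qed
  show "((\<lambda>s. norm_on S (\<lambda>x. (f s x - g s x - (f t x - g t x)) / complex_of_real (s - t) - (f' x - g' x))) \<longlongrightarrow> 0) (at t within T)"
    by (rule Lim_null_comparison[OF ev lim])
qed

text \<open>\<open>C\<close> is an arbitrary essential bound of the potential; passing to the
  smallest one is postponed to the end.\<close>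

locale interacting_box = magnetic_box +
  fixes V :: "real \<times> real \<Rightarrow> real \<times> real \<Rightarrow> real" and C hbar m0 :: real
  assumes V_meas: "set_borel_measurable lebesgue (box_Lambda L1 L2 \<times> box_Lambda L1 L2) (\<lambda>z. V (fst z) (snd z))"
    and V_sym: "\<And>x y. V x y = V y x" and C: "C \<ge> 0"
    and V_bdd: "AE z in lebesgue. z \<in> box_Lambda L1 L2 \<times> box_Lambda L1 L2 \<longrightarrow> \<bar>V (fst z) (snd z)\<bar> \<le> C"
begin

abbreviation "\<Lambda> \<equiv> box_Lambda L1 L2"
abbreviation "\<Lambda>N \<equiv> box_LambdaN L1 L2"
abbreviation "H \<equiv> HN L1 L2 M hbar m0 b V"
abbreviation "h \<equiv> H1 L1 L2 M hbar m0 b"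
abbreviation "dom_H \<equiv> in_domHN L1 L2 M hbar m0 b"

lemma domHN_kinetic:
  fixes \<Psi> :: "(real \<times> real) ^ ('n::{finite,linorder}) \<Rightarrow> complex"
  assumes "dom_H \<Psi>"
  shows "\<exists>G. L2on \<Lambda>N G \<and> mag_perN L1 L2 M G \<and> weak_kin hbar m0 b \<Psi> G \<and> H \<Psi> = (\<lambda>X. G X + of_real (pair_pot V X) * \<Psi> X)"
proof -
  let ?P = "\<lambda>G. L2on \<Lambda>N G \<and> mag_perN L1 L2 M G \<and> weak_kin hbar m0 b \<Psi> G"
  have "?P (SOME G. ?P G)" by (rule someI_ex[of ?P]) (use assms in \<open>simp add: in_domHN_def\<close>)
  then show ?thesis by (intro exI[of _ "SOME G. ?P G"]) (auto simp: HN_def fun_eq_iff)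
qed

lemma domHN_D: "dom_H \<Psi> \<Longrightarrow> L2on \<Lambda>N \<Psi>" "dom_H \<Psi> \<Longrightarrow> mag_perN L1 L2 M \<Psi>"
  by (simp_all add: in_domHN_def)

lemma L2on_HN:
  fixes \<Psi> :: "(real \<times> real) ^ ('n::{finite,linorder}) \<Rightarrow> complex"
  assumes "dom_H \<Psi>" shows "L2on \<Lambda>N (H \<Psi>)"
proof -
  obtain G where G: "L2on \<Lambda>N G" "H \<Psi> = (\<lambda>X. G X + of_real (pair_pot V X) * \<Psi> X)"
    using domHN_kinetic[OF assms] by blast
  show ?thesis unfolding G(2)
    by (rule L2on_algebra(1)[OF box_LambdaN_sets(2) G(1) L2on_pair_pot[OF V_meas V_sym C V_bdd domHN_D(1)[OF assms]]])
qed

text \<open>Stated for differences because \<open>HN\<close> is defined by choice and need not be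
  pointwise linear: the chosen kinetic energies are subtracted instead, and form a weak kinetic
  energy of the difference.\<close>

lemma HN_diff_symmetric:
  fixes \<Psi> \<Xi> :: "(real \<times> real) ^ ('n::{finite,linorder}) \<Rightarrow> complex"
  assumes \<Psi>: "dom_H \<Psi>" and \<Xi>: "dom_H \<Xi>"
  shows "Im (inner_on \<Lambda>N (\<lambda>X. \<Psi> X - \<Xi> X) (\<lambda>X. H \<Psi> X - H \<Xi> X)) = 0"
proof -
  let ?D = "\<lambda>X. \<Psi> X - \<Xi> X"
  obtain G where G: "L2on \<Lambda>N G" "mag_perN L1 L2 M G" "weak_kin hbar m0 b \<Psi> G" "H \<Psi> = (\<lambda>X. G X + of_real (pair_pot V X) * \<Psi> X)"
    using domHN_kinetic[OF \<Psi>] by blast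
  obtain K where K: "L2on \<Lambda>N K" "mag_perN L1 L2 M K" "weak_kin hbar m0 b \<Xi> K" "H \<Xi> = (\<lambda>X. K X + of_real (pair_pot V X) * \<Xi> X)"
    using domHN_kinetic[OF \<Xi>] by blast
  note L = domHN_D(1)[OF \<Psi>] domHN_D(1)[OF \<Xi>] and p = domHN_D(2)[OF \<Psi>] domHN_D(2)[OF \<Xi>]
  have LD: "L2on \<Lambda>N ?D" by (rule L2on_diff[OF _ L]) simp
  have LG: "L2on \<Lambda>N (\<lambda>X. G X - K X)" by (rule L2on_diff[OF _ G(1) K(1)]) simp
  have eq: "(\<lambda>X. H \<Psi> X - H \<Xi> X) = (\<lambda>X. (G X - K X) + of_real (pair_pot V X) * ?D X)"
    unfolding G(4) K(4) by (simp add: fun_eq_iff algebra_simps)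
  have "weak_kin hbar m0 b ?D (\<lambda>X. G X - K X)"
    by (rule weak_kin_diff[OF G(3) K(3)]) (intro torus_fun_mag_perN p L G K)+
  then have "Im (inner_on \<Lambda>N ?D (\<lambda>X. G X - K X)) = 0"
    by (intro weak_kin_symmetric LD LG mag_perN_diff p G K)
  then show ?thesis
    unfolding eq by (subst inner_on_add_right[OF box_LambdaN_sets(2) LD LG L2on_pair_pot[OF V_meas V_sym C V_bdd LD]])
      (simp add: inner_on_real_mult)
qed

lemma HN_symmetric:
  fixes \<Psi> :: "(real \<times> real) ^ ('n::{finite,linorder}) \<Rightarrow> complex"
  assumes \<Psi>: "dom_H \<Psi>"
  shows "Im (inner_on \<Lambda>N \<Psi> (H \<Psi>)) = 0"
proof -
  obtain G where G: "L2on \<Lambda>N G" "mag_perN L1 L2 M G" "weak_kin hbar m0 b \<Psi> G" "H \<Psi> = (\<lambda>X. G X + of_real (pair_pot V X) * \<Psi> X)"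
    using domHN_kinetic[OF \<Psi>] by blast
  note L = domHN_D(1)[OF \<Psi>]
  have "Im (inner_on \<Lambda>N \<Psi> G) = 0" by (rule weak_kin_symmetric[OF L domHN_D(2)[OF \<Psi>] G(1,2,3)])
  then show ?thesis
    unfolding G(4) by (subst inner_on_add_right[OF box_LambdaN_sets(2) L G(1) L2on_pair_pot[OF V_meas V_sym C V_bdd L]])
      (simp add: inner_on_real_mult)
qed

lemma H1_spec:
  assumes "in_H2A L1 L2 M hbar m0 b \<psi>"
  shows "L2on \<Lambda> \<psi>" "mag_per L1 L2 M \<psi>" "L2on \<Lambda> (h \<psi>)" "mag_per L1 L2 M (h \<psi>)" "weak_H1 hbar m0 b \<psi> (h \<psi>)"
proof -
  let ?P = "\<lambda>g. L2on \<Lambda> g \<and> mag_per L1 L2 M g \<and> weak_H1 hbar m0 b \<psi> g"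
  have "?P (SOME g. ?P g)" by (rule someI_ex[of ?P]) (use assms in \<open>simp add: in_H2A_def\<close>)
  then show "L2on \<Lambda> (h \<psi>)" "mag_per L1 L2 M (h \<psi>)" "weak_H1 hbar m0 b \<psi> (h \<psi>)" by (simp_all add: H1_def)
qed (use assms in \<open>simp_all add: in_H2A_def\<close>)

text \<open>The Leibniz sum is one admissible weak kinetic energy, so by uniqueness the chosen one
  agrees with it almost everywhere on the box.\<close>

lemma HN_slater:
  fixes \<phi> :: "'n::{finite,linorder} \<Rightarrow> real \<times> real \<Rightarrow> complex"
  assumes \<phi>: "\<And>k. in_H2A L1 L2 M hbar m0 b (\<phi> k)"
  shows "dom_H (\<lambda>X. a * wedge \<phi> X)"
    and "AE X in lborel. X \<in> \<Lambda>N \<longrightarrow> H (\<lambda>X. a * wedge \<phi> X) X =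
      a * (\<Sum>j\<in>UNIV. wedge (\<phi>(j := h (\<phi> j))) X) + of_real (pair_pot V X) * (a * wedge \<phi> X)"
proof -
  let ?u = "\<lambda>X. a * wedge \<phi> X" and ?K = "\<lambda>X. a * (\<Sum>j\<in>UNIV. wedge (\<phi>(j := h (\<phi> j))) X)"
  note spec = H1_spec[OF \<phi>]
  have upd: "L2on \<Lambda> ((\<phi>(j := h (\<phi> j))) k)" "mag_per L1 L2 M ((\<phi>(j := h (\<phi> j))) k)" for j k
    using spec by auto
  have wedge_K: "weak_kin hbar m0 b (wedge \<phi>) (\<lambda>X. \<Sum>j\<in>UNIV. wedge (\<phi>(j := h (\<phi> j))) X)"
    by (intro weak_kin_wedge torus_fun_mag_per spec)
  have uK: "weak_kin hbar m0 b ?u ?K"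
    using wedge_K unfolding weak_kin_def by (auto simp: mult.left_commute[of _ a])
  have u: "L2on \<Lambda>N ?u" by (intro L2on_algebra(3)[OF box_LambdaN_sets(2)] L2on_wedge spec)
  have K: "L2on \<Lambda>N ?K"
    by (intro L2on_algebra(3,6)[OF box_LambdaN_sets(2)] L2on_wedge upd)
  have up: "mag_perN L1 L2 M ?u" using mag_perN_wedge[of \<phi>, OF spec(2)] by (simp add: mag_perN_def)
  have Kp: "mag_perN L1 L2 M ?K"
    using mag_perN_wedge[of "\<phi>(j := h (\<phi> j))" for j, OF upd(2)] by (simp add: mag_perN_def sum_distrib_left sum_distrib_right mult_ac)
  show dom: "dom_H ?u" unfolding in_domHN_def using u up K Kp uK by blast
  obtain G where G: "L2on \<Lambda>N G" "mag_perN L1 L2 M G" "weak_kin hbar m0 b ?u G" "H ?u = (\<lambda>X. G X + of_real (pair_pot V X) * ?u X)"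
    using domHN_kinetic[OF dom] by blast
  have "norm_on \<Lambda>N (\<lambda>X. G X - ?K X) = 0" by (rule weak_kin_unique[OF u up G(1,2) K Kp G(3) uK])
  then have "AE X in lborel. X \<in> \<Lambda>N \<longrightarrow> G X - ?K X = 0"
    by (rule norm_on_zero_AE[OF box_LambdaN_sets(2) L2on_diff[OF box_LambdaN_sets(2) G(1) K]])
  then show "AE X in lborel. X \<in> \<Lambda>N \<longrightarrow> H ?u X = ?K X + of_real (pair_pot V X) * ?u X"
    unfolding G(4) by eventually_elim auto
qed

text \<open>The kinetic part of \<open>HN u\<close> and the time derivative merge into one tangent
  vector, with directions \<open>i hbar \<phi>' j - h (\<phi> j)\<close> and scalar variation
  \<open>i hbar a'\<close>. The interaction is left over.\<close>

lemma slater_residual_bound: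
  fixes \<phi> \<phi>' :: "'n::{finite,linorder} \<Rightarrow> real \<times> real \<Rightarrow> complex"
  assumes \<phi>: "\<And>k. in_H2A L1 L2 M hbar m0 b (\<phi> k)" and \<phi>': "\<And>k. L2on \<Lambda> (\<phi>' k)"
    and orth: "\<And>i j. inner_on \<Lambda> (\<phi> i) (\<phi> j) = (if i = j then 1 else 0)" and a: "norm a = 1"
    and dirac: "\<And>adot \<phi>dot. (\<And>j. L2on \<Lambda> (\<phi>dot j)) \<Longrightarrow> inner_on \<Lambda>N (tangent_vec a \<phi> adot \<phi>dot)
       (\<lambda>X. \<i> * complex_of_real hbar * tangent_vec a \<phi> a' \<phi>' X - H (\<lambda>X. a * wedge \<phi> X) X) = 0"
  shows "norm_on \<Lambda>N (\<lambda>X. H (\<lambda>X. a * wedge \<phi> X) X - \<i> * complex_of_real hbar * tangent_vec a \<phi> a' \<phi>' X)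
    \<le> C * sqrt (real (CARD('n) * (CARD('n) - 1)) / 2)"
proof -
  let ?c = "\<i> * complex_of_real hbar"
  let ?r = "\<lambda>X. H (\<lambda>X. a * wedge \<phi> X) X - ?c * tangent_vec a \<phi> a' \<phi>' X"
  let ?\<eta> = "\<lambda>j x. ?c * \<phi>' j x - h (\<phi> j) x"
  note spec = H1_spec[OF \<phi>]
  show ?thesis
  proof (rule residual_bound[OF V_meas V_sym C V_bdd spec(1) _ orth a, where \<eta>="?\<eta>" and c="?c * a'"])
    show "L2on \<Lambda> (?\<eta> k)" for k by (intro L2on_algebra[OF box_Lambda_sets(2)] \<phi>' spec)
    show "AE X in lborel. X \<in> \<Lambda>N \<longrightarrow> ?r X = of_real (pair_pot V X) * (a * wedge \<phi> X) - tangent_vec a \<phi> (?c * a') ?\<eta> X"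
      using HN_slater(2)[of \<phi> a, OF \<phi>]
      unfolding tangent_vec_def wedge_upd_diff sum_subtractf sum_distrib_left[symmetric]
      by eventually_elim (simp add: right_diff_distrib distrib_left)
    fix adot :: complex and \<phi>dot :: "'n \<Rightarrow> real \<times> real \<Rightarrow> complex" assume L: "\<And>j. L2on \<Lambda> (\<phi>dot j)"
    have "inner_on \<Lambda>N (tangent_vec a \<phi> adot \<phi>dot) (\<lambda>X. (- 1) * (?c * tangent_vec a \<phi> a' \<phi>' X - H (\<lambda>X. a * wedge \<phi> X) X)) = 0"
      unfolding inner_on_cmult_right[OF box_LambdaN_sets(2)] dirac[OF L] by simp
    then show "inner_on \<Lambda>N (tangent_vec a \<phi> adot \<phi>dot) ?r = 0" by simp
  qed
qed

lemma variational_error: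
  fixes \<phi> \<phi>' :: "real \<Rightarrow> 'n::{finite,linorder} \<Rightarrow> real \<times> real \<Rightarrow> complex"
    and \<Psi> \<Psi>' u :: "real \<Rightarrow> (real \<times> real) ^ ('n::{finite,linorder}) \<Rightarrow> complex"
  assumes hbar: "hbar > 0"
    and a_deriv: "\<And>t. t \<in> {0..tbar} \<Longrightarrow> (a has_vector_derivative a' t) (at t within {0..tbar})" and a0: "a 0 = 1"
    and phi_C1: "\<And>l. L2_C1_on \<Lambda> (\<lambda>t. \<phi> t l) (\<lambda>t. \<phi>' t l) {0..tbar}"
    and phi_H2A: "\<And>l t. t \<in> {0..tbar} \<Longrightarrow> in_H2A L1 L2 M hbar m0 b (\<phi> t l)"
    and orthonormal: "\<And>i j t. t \<in> {0..tbar} \<Longrightarrow> inner_on \<Lambda> (\<phi> t i) (\<phi> t j) = (if i = j then 1 else 0)"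
    and u_def: "\<And>t. u t = (\<lambda>X. a t * wedge (\<phi> t) X)"
    and dirac_frenkel: "\<And>t adot \<phi>dot. t \<in> {0..tbar} \<Longrightarrow> (\<forall>j. L2on \<Lambda> (\<phi>dot j)) \<Longrightarrow>
         inner_on \<Lambda>N (tangent_vec (a t) (\<phi> t) adot \<phi>dot)
           (\<lambda>X. \<i> * complex_of_real hbar * tangent_vec (a t) (\<phi> t) (a' t) (\<phi>' t) X - H (u t) X) = 0"
    and Psi_dom: "\<And>t. t \<in> {0..tbar} \<Longrightarrow> dom_H (\<Psi> t)"
    and Psi_deriv: "\<And>t. t \<in> {0..tbar} \<Longrightarrow> has_L2_derivative \<Lambda>N \<Psi> (\<Psi>' t) t {0..tbar}"
    and Psi_eq: "\<And>t. t \<in> {0..tbar} \<Longrightarrow> norm_on \<Lambda>N (\<lambda>X. \<i> * complex_of_real hbar * \<Psi>' t X - H (\<Psi> t) X) = 0"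
    and Psi0: "norm_on \<Lambda>N (\<lambda>X. \<Psi> 0 X - u 0 X) = 0"
    and t: "t \<in> {0..tbar}"
  shows "norm_on \<Lambda>N (\<lambda>X. \<Psi> t X - u t X) \<le> C * sqrt (real (CARD('n) * (CARD('n) - 1)) / 2) / hbar * t"
proof -
  let ?T = "{0..tbar}" and ?c = "\<i> * complex_of_real hbar" and ?B = "C * sqrt (real (CARD('n) * (CARD('n) - 1)) / 2)"
  note S = box_LambdaN_sets(2)[where 'n='n]
  define \<tau> where "\<tau> t = tangent_vec (a t) (\<phi> t) (a' t) (\<phi>' t)" for t
  have u_eq: "u = (\<lambda>s X. a s * wedge (\<phi> s) X)" by (rule ext) (rule u_def)
  have C1: "L2on \<Lambda> (\<phi> s k)" "L2on \<Lambda> (\<phi>' s k)"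
    "((\<lambda>r. norm_on \<Lambda> (\<lambda>x. \<phi> r k x - \<phi> s k x)) \<longlongrightarrow> 0) (at s within ?T)"
    "has_L2_derivative \<Lambda> (\<lambda>r. \<phi> r k) (\<phi>' s k) s ?T" if "s \<in> ?T" for s k
    using phi_C1[of k] that by (auto simp: L2_C1_on_def L2_continuous_on_def)
  have dom_u: "dom_H (u s)" if "s \<in> ?T" for s
    unfolding u_def by (rule HN_slater(1)) (rule phi_H2A[OF that])
  note Lu = domHN_D(1)[OF dom_u] and LP = domHN_D(1)[OF Psi_dom]
  have u_deriv: "has_L2_derivative \<Lambda>N u (\<tau> s) s ?T" if s: "s \<in> ?T" for s
  proof -
    have evT: "eventually (\<lambda>r. r \<in> ?T) (at s within ?T)" by (simp add: eventually_at_filter)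
    have "((\<lambda>r. norm_on \<Lambda>N (\<lambda>X. wedge (\<phi> r) X - wedge (\<phi> s) X)) \<longlongrightarrow> 0) (at s within ?T)"
      by (rule norm_on_wedge_tendsto) (use evT C1[OF s] in \<open>auto elim!: eventually_mono intro: C1\<close>)
    then have "has_L2_derivative \<Lambda>N (\<lambda>s x. a s * wedge (\<phi> s) x)
        (\<lambda>x. a' s * wedge (\<phi> s) x + a s * (\<Sum>j\<in>UNIV. wedge ((\<phi> s)(j := \<phi>' s j)) x)) s ?T"
      by (intro has_L2_derivative_scale[OF S s] L2on_wedge has_L2_derivative_wedge a_deriv C1 s)
    then show ?thesis unfolding u_eq \<tau>_def tangent_vec_def[abs_def] .
  qed
  then have L\<tau>: "L2on \<Lambda>N (\<tau> s)" if "s \<in> ?T" for s using that by (auto simp: has_L2_derivative_def)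
  have norm_u: "norm_on \<Lambda>N (u s) = norm (a s)" if s: "s \<in> ?T" for s
    unfolding u_def norm_on_cmult[OF S] using norm_on_wedge_orthonormal[OF C1(1)[OF s] orthonormal[OF s]] by simp
  have a1: "norm (a s) = 1" if s: "s \<in> ?T" for s
  proof -
    have "((\<lambda>s. (norm_on \<Lambda>N (u s))\<^sup>2) has_field_derivative 0) (at s within ?T)" if s: "s \<in> ?T" for s
    proof -
      \<comment> \<open>The vector \<open>u\<close> itself is tangent: take \<open>a\<close> as the
        scalar variation and leave the orbitals fixed.\<close>
      have tv: "tangent_vec (a s) (\<phi> s) (a s) (\<lambda>j x. 0) = u s"
        by (simp add: fun_eq_iff tangent_vec_def wedge_upd_zero u_def)
      have "inner_on \<Lambda>N (u s) (\<lambda>X. ?c * \<tau> s X - H (u s) X) = 0"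
        using dirac_frenkel[OF s, of "\<lambda>j x. 0" "a s"] unfolding tv \<tau>_def by (simp add: L2on_algebra(5))
      then have "?c * inner_on \<Lambda>N (u s) (\<tau> s) = inner_on \<Lambda>N (u s) (H (u s))"
        by (simp add: inner_on_diff_right[OF S Lu[OF s] L2on_algebra(3)[OF S L\<tau>[OF s]] L2on_HN[OF dom_u[OF s]]] inner_on_cmult_right[OF S])
      then have "Im (?c * inner_on \<Lambda>N (u s) (\<tau> s)) = 0" using HN_symmetric[OF dom_u[OF s]] by simp
      then have "Re (inner_on \<Lambda>N (u s) (\<tau> s)) = 0" using hbar by simp
      then show ?thesis
        using has_real_derivative_norm_on_sq[OF S s Lu u_deriv[OF s]] by simp
    qed
    then obtain c where c: "\<And>s. s \<in> ?T \<Longrightarrow> (norm_on \<Lambda>N (u s))\<^sup>2 = c"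
      using has_field_derivative_zero_constant[of ?T "\<lambda>s. (norm_on \<Lambda>N (u s))\<^sup>2"] by auto
    have "0 \<in> ?T" using s by auto
    from c[OF this] c[OF s] have "(norm (a s))\<^sup>2 = 1" using norm_u[OF s] norm_u[OF \<open>0 \<in> ?T\<close>] a0 by simp
    then show ?thesis by (simp add: power2_eq_1_iff) (use norm_ge_zero[of "a s"] in linarith)
  qed
  define D where "D s X = \<Psi> s X - u s X" for s X
  have LD: "L2on \<Lambda>N (D s)" if "s \<in> ?T" for s
    unfolding D_def[abs_def] by (rule L2on_diff[OF S LP[OF that] Lu[OF that]])
  have LP': "L2on \<Lambda>N (\<Psi>' s)" if "s \<in> ?T" for s using Psi_deriv[OF that] by (simp add: has_L2_derivative_def)
  have D_deriv: "has_L2_derivative \<Lambda>N D (\<lambda>X. \<Psi>' s X - \<tau> s X) s ?T" if s: "s \<in> ?T" for s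
    unfolding D_def[abs_def] by (rule has_L2_derivative_diff[OF S s LP Lu Psi_deriv[OF s] u_deriv[OF s]])
  have energy: "Re (inner_on \<Lambda>N (D s) (\<lambda>X. \<Psi>' s X - \<tau> s X)) \<le> ?B / hbar * norm_on \<Lambda>N (D s)" if s: "s \<in> ?T" for s
  proof -
    let ?r = "\<lambda>X. H (u s) X - ?c * \<tau> s X"
    have r: "norm_on \<Lambda>N ?r \<le> ?B"
      unfolding \<tau>_def u_def
      by (rule slater_residual_bound[OF phi_H2A[OF s] C1(2)[OF s] orthonormal[OF s] a1[OF s]])
        (use dirac_frenkel[OF s] in \<open>simp add: u_def\<close>)
    have Lr: "L2on \<Lambda>N ?r" by (intro L2on_diff[OF S] L2on_HN dom_u s L2on_algebra(3)[OF S] L\<tau>)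
    have LHd: "L2on \<Lambda>N (\<lambda>X. H (\<Psi> s) X - H (u s) X)" by (intro L2on_diff[OF S] L2on_HN dom_u Psi_dom s)
    \<comment> \<open>The Schroedinger equation is assumed in norm; off a null set it may be
      inserted pointwise.\<close>
    have "AE X in lborel. X \<in> \<Lambda>N \<longrightarrow> ?c * \<Psi>' s X - H (\<Psi> s) X = 0"
      by (rule norm_on_zero_AE[OF S _ Psi_eq[OF s]]) (intro L2on_diff[OF S] L2on_HN Psi_dom s L2on_algebra(3)[OF S] LP')
    then have ae: "AE X in lborel. X \<in> \<Lambda>N \<longrightarrow> ?c * (\<Psi>' s X - \<tau> s X) = (H (\<Psi> s) X - H (u s) X) + ?r X"
      by eventually_elim (simp add: right_diff_distrib)
    have "?c * inner_on \<Lambda>N (D s) (\<lambda>X. \<Psi>' s X - \<tau> s X) = inner_on \<Lambda>N (D s) (\<lambda>X. ?c * (\<Psi>' s X - \<tau> s X))"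
      by (rule inner_on_cmult_right[OF S, symmetric])
    also have "\<dots> = inner_on \<Lambda>N (D s) (\<lambda>X. (H (\<Psi> s) X - H (u s) X) + ?r X)"
      by (rule inner_on_cong_AE_right[OF S LD[OF s] _ _ ae])
        (intro L2on_algebra(3)[OF S] L2on_diff[OF S] LP' L\<tau> s, intro L2on_algebra(1)[OF S] LHd Lr)
    also have "\<dots> = inner_on \<Lambda>N (D s) (\<lambda>X. H (\<Psi> s) X - H (u s) X) + inner_on \<Lambda>N (D s) ?r"
      by (rule inner_on_add_right[OF S LD[OF s] LHd Lr])
    finally have "Im (?c * inner_on \<Lambda>N (D s) (\<lambda>X. \<Psi>' s X - \<tau> s X)) = Im (inner_on \<Lambda>N (D s) ?r)"
      using HN_diff_symmetric[OF Psi_dom[OF s] dom_u[OF s]] by (simp add: D_def[abs_def])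
    then have "hbar * Re (inner_on \<Lambda>N (D s) (\<lambda>X. \<Psi>' s X - \<tau> s X)) = Im (inner_on \<Lambda>N (D s) ?r)" by simp
    also have "\<dots> \<le> norm_on \<Lambda>N (D s) * norm_on \<Lambda>N ?r"
      using inner_on_Cauchy_Schwarz[OF S LD[OF s] Lr] abs_Im_le_cmod[of "inner_on \<Lambda>N (D s) ?r"] by linarith
    also have "\<dots> \<le> norm_on \<Lambda>N (D s) * ?B" by (rule mult_left_mono[OF r norm_on_nonneg[OF S]])
    finally show ?thesis using hbar by (simp add: field_simps)
  qed
  have "norm_on \<Lambda>N (D t) \<le> ?B / hbar * t"
  proof (rule linear_growth[OF _ _ _ _ _ t])
    show "((\<lambda>s. (norm_on \<Lambda>N (D s))\<^sup>2) has_real_derivative 2 * Re (inner_on \<Lambda>N (D s) (\<lambda>X. \<Psi>' s X - \<tau> s X))) (at s within ?T)"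
      if "s \<in> ?T" for s by (rule has_real_derivative_norm_on_sq[OF S that LD D_deriv[OF that]])
    show "2 * Re (inner_on \<Lambda>N (D s) (\<lambda>X. \<Psi>' s X - \<tau> s X)) \<le> 2 * (?B / hbar) * norm_on \<Lambda>N (D s)" if "s \<in> ?T" for s
      using energy[OF that] by linarith
    show "norm_on \<Lambda>N (D 0) = 0" using Psi0 by (simp add: D_def[abs_def])
    show "?B / hbar \<ge> 0" using C hbar by (intro divide_nonneg_pos mult_nonneg_nonneg) auto
  qed (rule norm_on_nonneg[OF S])
  then show ?thesis by (simp add: D_def[abs_def])
qed

end

theorem theorem5p1:
  fixes L1 L2 b hbar m0 tbar :: real
    and M :: nat
    and V :: "real \<times> real \<Rightarrow> real \<times> real \<Rightarrow> real"
    and a a' :: "real \<Rightarrow> complex"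
    and \<phi> \<phi>' :: "real \<Rightarrow> 'n::{finite,linorder} \<Rightarrow> real \<times> real \<Rightarrow> complex"
    and \<Psi> \<Psi>' :: "real \<Rightarrow> (real \<times> real)^('n::{finite,linorder}) \<Rightarrow> complex"
    and u :: "real \<Rightarrow> (real \<times> real)^('n::{finite,linorder}) \<Rightarrow> complex"
  assumes L1: "L1 > 0" and L2: "L2 > 0" and b: "b > 0" and hbar: "hbar > 0" and m0: "m0 > 0"
    and M: "M > 0" and flux: "b * L1 * L2 = 2 * pi * real M"
    (* V in L^infinity(Lambda x Lambda), real-valued and symmetric *)
    and V_meas: "set_borel_measurable lebesgue (box_Lambda L1 L2 \<times> box_Lambda L1 L2)
                   (\<lambda>z. V (fst z) (snd z))"
    and V_bdd: "\<exists>C. AE z in lebesgue. z \<in> box_Lambda L1 L2 \<times> box_Lambda L1 L2 \<longrightarrow>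
                   \<bar>V (fst z) (snd z)\<bar> \<le> C"
    and V_sym: "\<And>x y. V x y = V y x"
    and tbar: "tbar > 0"
    (* a in C^1([0,tbar]) *)
    and a_deriv: "\<And>t. t \<in> {0..tbar} \<Longrightarrow> (a has_vector_derivative a' t) (at t within {0..tbar})"
    and a'_cont: "continuous_on {0..tbar} a'"
    and a0: "a 0 = 1"
    (* orbitals in C^1([0,tbar]; L2) and in C([0,tbar]; H^2_A) *)
    and phi_C1: "\<And>l. L2_C1_on (box_Lambda L1 L2) (\<lambda>t. \<phi> t l) (\<lambda>t. \<phi>' t l) {0..tbar}"
    and phi_H2A: "\<And>l t. t \<in> {0..tbar} \<Longrightarrow> in_H2A L1 L2 M hbar m0 b (\<phi> t l)"
    and phi_H2A_cont: "\<And>l. L2_continuous_on (box_Lambda L1 L2)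
                          (\<lambda>t. H1 L1 L2 M hbar m0 b (\<phi> t l)) {0..tbar}"
    (* orthonormality and gauge condition *)
    and orthonormal: "\<And>i j t. t \<in> {0..tbar} \<Longrightarrow>
                        inner_on (box_Lambda L1 L2) (\<phi> t i) (\<phi> t j) = (if i = j then 1 else 0)"
    and gauge: "\<And>i j t. t \<in> {0..tbar} \<Longrightarrow> inner_on (box_Lambda L1 L2) (\<phi> t i) (\<phi>' t j) = 0"
    (* u(t) = a(t) phi_1(t) ^ ... ^ phi_N(t) *)
    and u_def: "\<And>t. u t = (\<lambda>X. a t * wedge (\<phi> t) X)"
    (* Dirac-Frenkel condition, with udot given by the product rule *)
    and dirac_frenkel: "\<And>t adot \<phi>dot. t \<in> {0..tbar} \<Longrightarrow>
         (\<forall>j. L2on (box_Lambda L1 L2) (\<phi>dot j)) \<Longrightarrow>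
         inner_on (box_LambdaN L1 L2) (tangent_vec (a t) (\<phi> t) adot \<phi>dot)
           (\<lambda>X. \<i> * complex_of_real hbar * tangent_vec (a t) (\<phi> t) (a' t) (\<phi>' t) X
                 - HN L1 L2 M hbar m0 b V (u t) X) = 0"
    (* Psi(t) = exp(-i H_N t / hbar) u(0): the strong solution of i hbar Psi' = H_N Psi, Psi(0) = u(0) *)
    and Psi_dom: "\<And>t. t \<in> {0..tbar} \<Longrightarrow> in_domHN L1 L2 M hbar m0 b (\<Psi> t)"
    and Psi_deriv: "\<And>t. t \<in> {0..tbar} \<Longrightarrow> has_L2_derivative (box_LambdaN L1 L2) \<Psi> (\<Psi>' t) t {0..tbar}"
    and Psi_eq: "\<And>t. t \<in> {0..tbar} \<Longrightarrow>
         norm_on (box_LambdaN L1 L2)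
           (\<lambda>X. \<i> * complex_of_real hbar * \<Psi>' t X - HN L1 L2 M hbar m0 b V (\<Psi> t) X) = 0"
    and Psi0: "norm_on (box_LambdaN L1 L2) (\<lambda>X. \<Psi> 0 X - u 0 X) = 0"
  shows "\<forall>t\<in>{0..tbar}. norm_on (box_LambdaN L1 L2) (\<lambda>X. \<Psi> t X - u t X)
           \<le> (1 / hbar) * sqrt (real (CARD('n) * (CARD('n) - 1))) * Linf_norm_V L1 L2 V * t"
proof
  fix t assume t: "t \<in> {0..tbar}"
  let ?A = "{C. 0 \<le> C \<and> (AE z in lebesgue. z \<in> box_Lambda L1 L2 \<times> box_Lambda L1 L2 \<longrightarrow> \<bar>V (fst z) (snd z)\<bar> \<le> C)}"
  let ?d = "norm_on (box_LambdaN L1 L2) (\<lambda>X. \<Psi> t X - u t X)"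
  define N where "N = real (CARD('n) * (CARD('n) - 1))"
  have N: "N \<ge> 0" by (simp add: N_def)
  have bound: "?d \<le> (1 / hbar) * sqrt N * C * t" if C: "C \<in> ?A" for C
  proof -
    interpret interacting_box L1 L2 b M V C hbar m0
      by unfold_locales (use L1 L2 flux V_meas V_sym C in auto)
    have "?d \<le> C * sqrt (N / 2) / hbar * t"
      unfolding N_def
      by (rule variational_error[OF hbar a_deriv a0 phi_C1 phi_H2A orthonormal u_def dirac_frenkel Psi_dom Psi_deriv Psi_eq Psi0 t])
    \<comment> \<open>The factor \<open>sqrt 2\<close> gained by the projection argument is given
      away here.\<close>
    also have "\<dots> \<le> C * sqrt N / hbar * t"
      using C N hbar t by (intro mult_right_mono divide_right_mono mult_left_mono) auto
    finally show ?thesis by (simp add: mult_ac)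
  qed
  obtain C0 where C0: "AE z in lebesgue. z \<in> box_Lambda L1 L2 \<times> box_Lambda L1 L2 \<longrightarrow> \<bar>V (fst z) (snd z)\<bar> \<le> C0"
    using V_bdd by blast
  \<comment> \<open>The maximum with 0 makes the bound admissible for the infimum, which runs over
    nonnegative numbers.\<close>
  have "max C0 0 \<in> ?A" using C0 by (auto elim: eventually_mono)
  then have ne: "?A \<noteq> {}" by blast
  define k where "k = (1 / hbar) * sqrt N * t"
  have k: "k \<ge> 0" using hbar t N by (simp add: k_def)
  have bk: "?d \<le> k * C" if "C \<in> ?A" for C using bound[OF that] by (simp add: k_def mult_ac)
  have "?d \<le> k * Linf_norm_V L1 L2 V"
  proof (cases "k = 0")
    \<comment> \<open>One particle or time zero: the prefactor cannot be divided by, but any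
      admissible bound already makes the right-hand side zero.\<close>
    case True
    then show ?thesis using bk[OF \<open>max C0 0 \<in> ?A\<close>] by simp
  next
    case False
    then have "?d / k \<le> C" if "C \<in> ?A" for C using bk[OF that] k by (simp add: field_simps)
    then have "?d / k \<le> Inf ?A" by (rule cInf_greatest[OF ne])
    then show ?thesis using False k by (simp add: Linf_norm_V_def field_simps)
  qed
  then show "?d \<le> (1 / hbar) * sqrt (real (CARD('n) * (CARD('n) - 1))) * Linf_norm_V L1 L2 V * t"
    by (simp add: k_def N_def mult_ac)
qed

end
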